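(* Let $n\ge i\ge 1$, $r-1\ge1$, fix a sign $\pm1$, and let $s\in\mathcal{A}$ be an irreducible factor of $t^{n-i}q^{r-1}a^*(b^* )^{\pm1}-1$. Then the space $$V=\mathrm{span}_{\mathbb{K}_s}\{E_\lambda|_{s=0};\ \lambda\in\mathbb{Z}^n,\ \lambda_i^+>r-1,\ \text{or } \lambda_i^+=r-1 \text{ and } \sigma(\lambda)_{|w_\lambda^+(i)|}=+1\}$$ is the unique irreducible subrepresentation of the polynomial representation $P_n^s$.
   Context: $n\ge 2$; $\mathcal{A}=\mathbb{C}[q^{\pm1/2},t^{\pm1/2},t_n^{\pm1/2},t_0^{\pm1/2},u_n^{\pm1/2},u_0^{\pm1/2}]$, $\mathbb{K}=\mathrm{Frac}(\mathcal{A})$, $P_n=\mathbb{K}[x_1^{\pm1},\dots,x_n^{\pm1}]$. Put $a=t_n^{1/2}u_n^{1/2}$, $b=-t_n^{1/2}u_n^{-1/2}$, $c=q^{1/2}t_0^{1/2}u_0^{1/2}$, $d=-q^{1/2}t_0^{1/2}u_0^{-1/2}$, $a^*=t_n^{1/2}t_0^{1/2}$, $b^*=-t_n^{1/2}t_0^{-1/2}$. On Laurent polynomials, $s_i$ ($1\le i\le n-1$) exchanges $x_i,x_{i+1}$, $s_n$ sends $x_n\mapsto x_n^{-1}$, $s_0$ sends $x_1\mapsto qx_1^{-1}$. Define $\widehat T_0=t_0^{1/2}+t_0^{-1/2}\frac{(1-cx_1^{-1})(1-dx_1^{-1})}{1-qx_1^{-2}}(s_0-1)$, $\widehat T_i=t^{1/2}+t^{-1/2}\frac{1-tx_ix_{i+1}^{-1}}{1-x_ix_{i+1}^{-1}}(s_i-1)$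 ($1\le i\le n-1$), $\widehat T_n=t_n^{1/2}+t_n^{-1/2}\frac{(1-ax_n)(1-bx_n)}{1-x_n^2}(s_n-1)$. The double affine Hecke algebra (DAHA) of type $(C_n^\vee,C_n)$, generated by $T_0,\dots,T_n,X_j^{\pm1}$, acts on $P_n$ by $T_i\mapsto\widehat T_i$, $X_j\mapsto x_j$ (polynomial representation); a subrepresentation is a subspace stable under all $\widehat T_i$ and $x_j^{\pm1}$. Put $\widehat Y_i=\widehat T_i\cdots\widehat T_{n-1}\widehat T_n\widehat T_{n-1}\cdots\widehat T_1\widehat T_0\widehat T_1^{-1}\cdots\widehat T_{i-1}^{-1}$ (mutually commuting). $W_0$ is the group of signed permutations acting on $\mathbb{Z}^n$; for $w\in W_0$ write $w\epsilon_i=\pm\epsilon_{|w(i)|}$. For $\lambda\in\mathbb{Z}^n$, $\lambda^+$ is the dominant element of $W_0\lambda$ (a partition), $w_\lambda^+\in W_0$ the shortest element with $w_\lambda^+\lambda^+=\lambda$, $\rho(\lambda)=w_\lambda^+(n-1,\dots,1,0)$, $\sigma(\lambda)_i=\mathrm{sgn}(\lambda_i)$ with $\mathrm{sgn}(0)=+1$. $\lambda\ge\mu$ means $\lambda-\mu$ is a $\mathbb{Z}_{\ge0}$-combination of $\epsilon_1-\epsilon_2,\dots,\epsilon_{n-1}-\epsilon_n,\epsilon_n$; $\lambda\succeq\mu$ means $\lambda^+>\mu^+$, or $\lambda^+=\mu^+$ and $\lambda\ge\mu$. $y(\lambda)_i=q^{\lambda_i}t^{\rho(\lambda)_i}(a^*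 )^{\sigma(\lambda)_i}$. The non-symmetric Koornwinder polynomial $E_\lambda\in P_n$ is the unique element with $\widehat Y_iE_\lambda=y(\lambda)_iE_\lambda$ for all $i$ and $E_\lambda\in x^\lambda+\sum_{\mu\prec\lambda}\mathbb{K}x^\mu$. For an irreducible $s\in\mathcal{A}$, $\mathbb{K}_s=\mathrm{Frac}(\mathcal{A}/s\mathcal{A})$, and $|_{s=0}$ denotes coefficientwise reduction to $\mathbb{K}_s$ of Laurent polynomials whose coefficients have non-negative $s$-adic valuation (for the present $s$, every $E_\lambda$ has this property). $P_n^s=\mathbb{K}_s[x_1^{\pm1},\dots,x_n^{\pm1}]$ is the polynomial representation over $\mathbb{K}_s$, given by the same formulas with the parameters replaced by their images in $\mathbb{K}_s$. *)

theory Defs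
  imports
    Complex_Main
    "HOL-Library.Poly_Mapping"
    "HOL-Combinatorics.Permutations"
    "HOL-Computational_Algebra.Computational_Algebra"
begin

section \<open>The ring of parameters\<close>

datatype param = Pq | Pt | Ptn | Pt0 | Pun | Pu0

text \<open>The linear order on \<open>param\<close> is arbitrary; it only serves to obtain the
  \<open>idom\<close> instance for the ring of parameters from the library.\<close>

primrec param_index :: "param \<Rightarrow> nat" where
  "param_index Pq = 0"
| "param_index Pt = 1"
| "param_index Ptn = 2"
| "param_index Pt0 = 3"
| "param_index Pun = 4"
| "param_index Pu0 = 5"

instantiation param :: linorder
begin

definition "x \<le> y \<longleftrightarrow> param_index x \<le> param_index y"

definition "x < y \<longleftrightarrow> param_index x < param_index y"

instance
proof
  fix x y :: param
  assume "x \<le> y" "y \<le> x"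
  then show "x = y"
    by (cases x; cases y) (simp_all add: less_eq_param_def)
qed (auto simp: less_eq_param_def less_param_def)

end

text \<open>The group algebra over the complex numbers of the free abelian group on the formal
  square roots of the six parameters, i.e. the ring of Laurent polynomials in
  \<open>q\<^sup>1\<^sup>/\<^sup>2\<close>, \<open>t\<^sup>1\<^sup>/\<^sup>2\<close>, and so on. The exponent of \<open>Pq\<close> counts powers of
  \<open>q\<^sup>1\<^sup>/\<^sup>2\<close>, and similarly for the others.\<close>

type_synonym param_ring = "(param \<Rightarrow>\<^sub>0 int) \<Rightarrow>\<^sub>0 complex"

text \<open>\<open>half_pow p k\<close> is \<open>p\<close> to the power \<open>k/2\<close>.\<close>

definition half_pow :: "param \<Rightarrow> int \<Rightarrow> param_ring" where
  "half_pow p k = Poly_Mapping.single (Poly_Mapping.single p k) 1"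

definition par_a :: param_ring where
  "par_a = half_pow Ptn 1 * half_pow Pun 1"

definition par_b :: param_ring where
  "par_b = - (half_pow Ptn 1 * half_pow Pun (-1))"

definition par_c :: param_ring where
  "par_c = half_pow Pq 1 * half_pow Pt0 1 * half_pow Pu0 1"

definition par_d :: param_ring where
  "par_d = - (half_pow Pq 1 * half_pow Pt0 1 * half_pow Pu0 (-1))"

definition par_a_star :: param_ring where
  "par_a_star = half_pow Ptn 1 * half_pow Pt0 1"

definition par_b_star :: param_ring where
  "par_b_star = - (half_pow Ptn 1 * half_pow Pt0 (-1))"

text \<open>The fraction field of the quotient by the ideal generated by \<open>s\<close>, given by its
  universal description: a field \<open>'k\<close> with a ring homomorphism \<open>\<phi>\<close> from the ring of
  parameters whose kernel is that ideal and such that every element of the field is a quotient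
  of two elements of the image.\<close>

definition is_residue_field :: "param_ring \<Rightarrow> (param_ring \<Rightarrow> 'k::field) \<Rightarrow> bool" where
  "is_residue_field s \<phi> \<longleftrightarrow>
     \<phi> 1 = 1 \<and> (\<forall>x y. \<phi> (x + y) = \<phi> x + \<phi> y) \<and> (\<forall>x y. \<phi> (x * y) = \<phi> x * \<phi> y) \<and>
     (\<forall>x. \<phi> x = 0 \<longleftrightarrow> s dvd x) \<and>
     (\<forall>z. \<exists>x y. \<phi> y \<noteq> 0 \<and> z = \<phi> x / \<phi> y)"


section \<open>Laurent polynomials and the polynomial representation\<close>

text \<open>Exponent vectors are finitely supported functions on all of \<open>nat\<close>; those in
  \<open>weights n\<close>, supported on the positions \<open>1, \<dots>, n\<close>, are the elements of the lattice.\<close>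

type_synonym 'k laurent = "(nat \<Rightarrow>\<^sub>0 int) \<Rightarrow>\<^sub>0 'k"

definition weights :: "nat \<Rightarrow> (nat \<Rightarrow>\<^sub>0 int) set" where
  "weights n = {\<mu>. Poly_Mapping.keys \<mu> \<subseteq> {1..n}}"

definition laurent_polys :: "nat \<Rightarrow> 'k::zero laurent set" where
  "laurent_polys n = {f. Poly_Mapping.keys f \<subseteq> weights n}"

definition monom_x :: "(nat \<Rightarrow>\<^sub>0 int) \<Rightarrow> 'k::zero_neq_one laurent" where
  "monom_x \<mu> = Poly_Mapping.single \<mu> 1"

definition xpow :: "nat \<Rightarrow> int \<Rightarrow> 'k::zero_neq_one laurent" where
  "xpow j k = monom_x (Poly_Mapping.single j k)"

definition lscale :: "'k \<Rightarrow> 'k laurent \<Rightarrow> 'k::field laurent" where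
  "lscale c f = Poly_Mapping.single 0 c * f"

interpretation laurent: vector_space "lscale :: 'k \<Rightarrow> 'k laurent \<Rightarrow> 'k::field laurent"
proof
  fix a b :: 'k and x y :: "'k laurent"
  show "lscale a (x + y) = lscale a x + lscale a y"
    by (simp add: lscale_def distrib_left)
  show "lscale (a + b) x = lscale a x + lscale b x"
    by (simp add: lscale_def single_add distrib_right)
  show "lscale a (lscale b x) = lscale (a * b) x"
    by (simp add: lscale_def mult.assoc [symmetric] mult_single)
  show "lscale 1 x = x"
    by (simp add: lscale_def)
qed

text \<open>The operators \<open>s\<^sub>0, \<dots>, s\<^sub>n\<close>: values on monomials, extended linearly. Here and below,
  \<open>\<phi>\<close> maps the parameters to the ground field.\<close>

definition refl_monom :: "(param_ring \<Rightarrow> 'k::field) \<Rightarrow> nat \<Rightarrow> nat \<Rightarrow> (nat \<Rightarrow>\<^sub>0 int) \<Rightarrow> 'k laurent"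
  where
  "refl_monom \<phi> n i \<mu> =
     (if i = 0 then
        lscale (\<phi> (half_pow Pq 2) powi Poly_Mapping.lookup \<mu> 1)
          (monom_x (Poly_Mapping.update 1 (- Poly_Mapping.lookup \<mu> 1) \<mu>))
      else if i < n then
        monom_x (Poly_Mapping.update i (Poly_Mapping.lookup \<mu> (i + 1))
          (Poly_Mapping.update (i + 1) (Poly_Mapping.lookup \<mu> i) \<mu>))
      else
        monom_x (Poly_Mapping.update n (- Poly_Mapping.lookup \<mu> n) \<mu>))"

definition refl :: "(param_ring \<Rightarrow> 'k::field) \<Rightarrow> nat \<Rightarrow> nat \<Rightarrow> 'k laurent \<Rightarrow> 'k laurent" where
  "refl \<phi> n i f =
     (\<Sum>\<mu>\<in>Poly_Mapping.keys f. lscale (Poly_Mapping.lookup f \<mu>) (refl_monom \<phi> n i \<mu>))"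

text \<open>Exact division in the integral domain of Laurent polynomials.\<close>

definition lquot :: "'k::field laurent \<Rightarrow> 'k laurent \<Rightarrow> 'k laurent" where
  "lquot g h = (THE u. u * h = g)"

definition T_hat :: "(param_ring \<Rightarrow> 'k::field) \<Rightarrow> nat \<Rightarrow> nat \<Rightarrow> 'k laurent \<Rightarrow> 'k laurent" where
  "T_hat \<phi> n i f =
     (if i = 0 then
        lscale (\<phi> (half_pow Pt0 1)) f + lscale (\<phi> (half_pow Pt0 (-1)))
          (lquot ((1 - lscale (\<phi> par_c) (xpow 1 (-1))) * (1 - lscale (\<phi> par_d) (xpow 1 (-1)))
                    * (refl \<phi> n 0 f - f))
                 (1 - lscale (\<phi> (half_pow Pq 2)) (xpow 1 (-2))))
      else if i < n then
        lscale (\<phi> (half_pow Pt 1)) f + lscale (\<phi> (half_pow Pt (-1)))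
          (lquot ((1 - lscale (\<phi> (half_pow Pt 2)) (xpow i 1 * xpow (i + 1) (-1)))
                    * (refl \<phi> n i f - f))
                 (1 - xpow i 1 * xpow (i + 1) (-1)))
      else
        lscale (\<phi> (half_pow Ptn 1)) f + lscale (\<phi> (half_pow Ptn (-1)))
          (lquot ((1 - lscale (\<phi> par_a) (xpow n 1)) * (1 - lscale (\<phi> par_b) (xpow n 1))
                    * (refl \<phi> n n f - f))
                 (1 - xpow n 2)))"

definition T_hat_inv :: "(param_ring \<Rightarrow> 'k::field) \<Rightarrow> nat \<Rightarrow> nat \<Rightarrow> 'k laurent \<Rightarrow> 'k laurent" where
  "T_hat_inv \<phi> n i = inv_into (laurent_polys n) (T_hat \<phi> n i)"

definition compose_list :: "('a \<Rightarrow> 'a) list \<Rightarrow> 'a \<Rightarrow> 'a" where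
  "compose_list fs = foldr (\<circ>) fs id"

definition Y_hat :: "(param_ring \<Rightarrow> 'k::field) \<Rightarrow> nat \<Rightarrow> nat \<Rightarrow> 'k laurent \<Rightarrow> 'k laurent" where
  "Y_hat \<phi> n i =
     compose_list
       (map (T_hat \<phi> n) ([i..<n] @ [n] @ rev [1..<n] @ [0]) @ map (T_hat_inv \<phi> n) [1..<i])"

definition is_subrep :: "(param_ring \<Rightarrow> 'k::field) \<Rightarrow> nat \<Rightarrow> 'k laurent set \<Rightarrow> bool" where
  "is_subrep \<phi> n W \<longleftrightarrow>
     W \<subseteq> laurent_polys n \<and> laurent.subspace W \<and>
     (\<forall>i\<le>n. \<forall>f\<in>W. T_hat \<phi> n i f \<in> W) \<and>
     (\<forall>j\<in>{1..n}. \<forall>f\<in>W. xpow j 1 * f \<in> W \<and> xpow j (-1) * f \<in> W)"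

definition is_irreducible_subrep ::
    "(param_ring \<Rightarrow> 'k::field) \<Rightarrow> nat \<Rightarrow> 'k laurent set \<Rightarrow> bool" where
  "is_irreducible_subrep \<phi> n W \<longleftrightarrow>
     is_subrep \<phi> n W \<and> W \<noteq> {0} \<and> (\<forall>U. is_subrep \<phi> n U \<and> U \<subseteq> W \<longrightarrow> U = {0} \<or> U = W)"


section \<open>Signed permutations and weights\<close>

text \<open>A signed permutation is a permutation \<open>w\<close> of \<open>\<plusminus>1, \<dots>, \<plusminus>n\<close> with \<open>w(-j) = -w(j)\<close>;
  a negative value \<open>w(i)\<close> means that \<open>w\<close> sends the basis vector \<open>\<epsilon>\<^sub>i\<close> to the negative of
  the basis vector with index \<open>\<bar>w(i)\<bar>\<close>.\<close>

definition signed_perms :: "nat \<Rightarrow> (int \<Rightarrow> int) set" where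
  "signed_perms n = {w. w permutes ({- int n..int n} - {0}) \<and> (\<forall>j. w (- j) = - w j)}"

definition act :: "(int \<Rightarrow> int) \<Rightarrow> (nat \<Rightarrow>\<^sub>0 int) \<Rightarrow> (nat \<Rightarrow>\<^sub>0 int)" where
  "act w \<mu> = (\<Sum>i\<in>Poly_Mapping.keys \<mu>.
     Poly_Mapping.single (nat \<bar>w (int i)\<bar>) (sgn (w (int i)) * Poly_Mapping.lookup \<mu> i))"

definition simple_refl :: "nat \<Rightarrow> nat \<Rightarrow> int \<Rightarrow> int" where
  "simple_refl n i =
     (if i < n then transpose (int i) (int i + 1) \<circ> transpose (- int i) (- (int i + 1))
      else transpose (int n) (- int n))"

definition refl_length :: "nat \<Rightarrow> (int \<Rightarrow> int) \<Rightarrow> nat" where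
  "refl_length n w =
     (LEAST k. \<exists>is. length is = k \<and> set is \<subseteq> {1..n} \<and> w = compose_list (map (simple_refl n) is))"

definition dominant :: "nat \<Rightarrow> (nat \<Rightarrow>\<^sub>0 int) \<Rightarrow> bool" where
  "dominant n \<mu> \<longleftrightarrow> \<mu> \<in> weights n \<and>
     (\<forall>i\<in>{1..<n}. Poly_Mapping.lookup \<mu> i \<ge> Poly_Mapping.lookup \<mu> (i + 1)) \<and>
     Poly_Mapping.lookup \<mu> n \<ge> 0"

definition dom_wt :: "nat \<Rightarrow> (nat \<Rightarrow>\<^sub>0 int) \<Rightarrow> (nat \<Rightarrow>\<^sub>0 int)" where
  "dom_wt n \<mu> = (THE \<nu>. dominant n \<nu> \<and> (\<exists>w\<in>signed_perms n. \<nu> = act w \<mu>))"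

definition w_plus :: "nat \<Rightarrow> (nat \<Rightarrow>\<^sub>0 int) \<Rightarrow> int \<Rightarrow> int" where
  "w_plus n \<mu> = (THE w. w \<in> signed_perms n \<and> act w (dom_wt n \<mu>) = \<mu> \<and>
     (\<forall>v\<in>signed_perms n. act v (dom_wt n \<mu>) = \<mu> \<longrightarrow> refl_length n w \<le> refl_length n v))"

definition rho :: "nat \<Rightarrow> (nat \<Rightarrow>\<^sub>0 int) \<Rightarrow> (nat \<Rightarrow>\<^sub>0 int)" where
  "rho n \<mu> = act (w_plus n \<mu>) (\<Sum>i\<in>{1..n}. Poly_Mapping.single i (int (n - i)))"

definition sigma :: "(nat \<Rightarrow>\<^sub>0 int) \<Rightarrow> nat \<Rightarrow> int" where
  "sigma \<mu> i = (if Poly_Mapping.lookup \<mu> i \<ge> 0 then 1 else -1)"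

definition dominates :: "nat \<Rightarrow> (nat \<Rightarrow>\<^sub>0 int) \<Rightarrow> (nat \<Rightarrow>\<^sub>0 int) \<Rightarrow> bool" where
  "dominates n \<mu> \<nu> \<longleftrightarrow> (\<exists>c :: nat \<Rightarrow> nat.
     \<mu> - \<nu> = (\<Sum>i\<in>{1..<n}. Poly_Mapping.single i (int (c i)) - Poly_Mapping.single (i + 1) (int (c i)))
             + Poly_Mapping.single n (int (c n)))"

definition succ_eq :: "nat \<Rightarrow> (nat \<Rightarrow>\<^sub>0 int) \<Rightarrow> (nat \<Rightarrow>\<^sub>0 int) \<Rightarrow> bool" where
  "succ_eq n \<mu> \<nu> \<longleftrightarrow>
     (dominates n (dom_wt n \<mu>) (dom_wt n \<nu>) \<and> dom_wt n \<mu> \<noteq> dom_wt n \<nu>) \<or>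
     (dom_wt n \<mu> = dom_wt n \<nu> \<and> dominates n \<mu> \<nu>)"


section \<open>Non-symmetric Koornwinder polynomials\<close>

definition generic :: "param_ring \<Rightarrow> param_ring fract" where
  "generic x = Fract x 1"

definition y_eigenvalue :: "nat \<Rightarrow> (nat \<Rightarrow>\<^sub>0 int) \<Rightarrow> nat \<Rightarrow> param_ring fract" where
  "y_eigenvalue n \<mu> i =
     generic (half_pow Pq 2) powi Poly_Mapping.lookup \<mu> i
     * generic (half_pow Pt 2) powi Poly_Mapping.lookup (rho n \<mu>) i
     * generic par_a_star powi sigma \<mu> i"

definition koornwinder_E :: "nat \<Rightarrow> (nat \<Rightarrow>\<^sub>0 int) \<Rightarrow> param_ring fract laurent" where
  "koornwinder_E n \<mu> = (THE E. E \<in> laurent_polys n \<and>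
     (\<forall>i\<in>{1..n}. Y_hat generic n i E = lscale (y_eigenvalue n \<mu> i) E) \<and>
     E - monom_x \<mu> \<in> laurent.span {monom_x \<nu> |\<nu>. \<nu> \<in> weights n \<and> succ_eq n \<mu> \<nu> \<and> \<nu> \<noteq> \<mu>})"

text \<open>If \<open>\<phi>\<close> is as in \<open>is_residue_field s \<phi>\<close>, then the fractions of non-negative \<open>s\<close>-adic
  valuation are those having a denominator \<open>b\<close> not divisible by \<open>s\<close>, i.e. with \<open>\<phi> b \<noteq> 0\<close>.
  On all other fractions the value of \<open>reduce_coeff \<phi>\<close> is unspecified.\<close>

definition reduce_coeff :: "(param_ring \<Rightarrow> 'k::field) \<Rightarrow> param_ring fract \<Rightarrow> 'k" where
  "reduce_coeff \<phi> z = (THE r. \<exists>a b. \<phi> b \<noteq> 0 \<and> z = Fract a b \<and> r = \<phi> a / \<phi> b)"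

definition reduce :: "(param_ring \<Rightarrow> 'k::field) \<Rightarrow> param_ring fract laurent \<Rightarrow> 'k laurent" where
  "reduce \<phi> f = Poly_Mapping.map (reduce_coeff \<phi>) f"

end

theory Submission
  imports Defs
begin

text \<open>The operators \<open>Y\<^sub>1, \<dots>, Y\<^sub>n\<close> are triangular with respect to a partial order on the weights that is
  contained in the order \<open>\<succeq>\<close>, with diagonal entries \<open>y(\<mu>)\<close>. At a generic zero of \<open>s\<close> the spectrum remains
  simple: if a monomial in the parameters becomes constant modulo an irreducible factor of
  \<open>t\<^sup>n\<^sup>-\<^sup>i q\<^sup>r\<^sup>-\<^sup>1 a\<^sup>* (b\<^sup>*)\<^sup>\<plusminus>\<^sup>1 - 1\<close>, then its exponent is proportional to that of the binomial, as one sees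
  by comparing the widths of the supports in all directions.

  Starting from the constant polynomial, intertwining elements \<open>T\<^sub>j + g\<close> and \<open>U + g\<close> with
  \<open>U = q\<^sup>-\<^sup>1\<^sup>/\<^sup>2 T\<^sub>0\<^sup>-\<^sup>1 x\<^sub>1\<close> produce a joint eigenvector for every weight, over the generic and over the residue
  field simultaneously, so every \<open>E\<^sub>\<mu>\<close> reduces to an eigenvector. The coordinates of a weight move along the
  chain \<open>0, -1, 1, -2, 2, \<dots>\<close>. An intertwiner that would change the weight vanishes only for the sign change
  \<open>r - 1 \<mapsto> - (r - 1)\<close> of the last coordinate when exactly \<open>i\<close> coordinates are at or above \<open>r - 1\<close> in the
  chain. Hence the weights with at least \<open>i\<close> such coordinates span a subrepresentation, and every nonzero
  subrepresentation, which contains some eigenvector, reaches all of these weights.\<close>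

text \<open>Each intertwiner satisfies (F + g')(F + g) = 1 + g g', so everything hinges on the zeros
  of 1 + g g'. For \<open>T_n\<close> this becomes a quadratic equation in y + 1/y with y =
  y(\<mu>)_n. Its solutions are y = \<open>par_a_star\<close>, y = \<open>par_b_star\<close> and
  their inverses. The first pair would force \<mu>_n = 0; the hypothesis on s says that t^(n-i)
  q^(r-1) \<open>par_a_star\<close> is one of the second pair. At such a zero the composite of the
  two sign changes is 0. The upward one is nonzero, because its leading coefficient survives, hence
  the downward one must vanish. For this reason eigenvectors are built by upward moves only: these
  stay nonzero modulo s and their constants have denominators prime to s, which also shows that
  E_\<mu> has a reduction. The definite descriptions in \<open>dom_wt\<close>, \<open>w_plus\<close>
  and \<open>koornwinder_E\<close> shape the combinatorial half: the exchange condition is proved in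
  order to identify the shortest element, and with it \<open>rho\<close>, by explicit counts of
  coordinates.\<close>

abbreviation lookup :: "('a \<Rightarrow>\<^sub>0 'b::zero) \<Rightarrow> 'a \<Rightarrow> 'b" where "lookup \<equiv> Poly_Mapping.lookup"
abbreviation keys :: "('a \<Rightarrow>\<^sub>0 'b::zero) \<Rightarrow> 'a set" where "keys \<equiv> Poly_Mapping.keys"
abbreviation single :: "'a \<Rightarrow> 'b \<Rightarrow> ('a \<Rightarrow>\<^sub>0 'b::zero)" where "single \<equiv> Poly_Mapping.single"

section \<open>Linear operators on Laurent polynomials\<close>

lemma poly_mapping_sum_single: "f = (\<Sum>\<mu>\<in>keys f. single \<mu> (lookup f \<mu>))"
  by (rule poly_mapping_eqI)
    (auto simp: lookup_sum lookup_single when_def sum.delta not_in_keys_iff_lookup_eq_zero)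

lemma lookup_single_mult:
  fixes f :: "('a::ab_group_add) \<Rightarrow>\<^sub>0 'b::comm_semiring_1"
  shows "lookup (single \<kappa> c * f) \<mu> = c * lookup f (\<mu> - \<kappa>)"
proof -
  have "single \<kappa> c * f = (\<Sum>\<nu>\<in>keys f. single (\<kappa> + \<nu>) (c * lookup f \<nu>))"
    by (subst poly_mapping_sum_single[of f]) (simp add: sum_distrib_left mult_single)
  then have "lookup (single \<kappa> c * f) \<mu> = (\<Sum>\<nu>\<in>keys f. if \<nu> = \<mu> - \<kappa> then c * lookup f \<nu> else 0)"
    by (auto simp: lookup_sum lookup_single when_def algebra_simps intro!: sum.cong)
  also have "\<dots> = c * lookup f (\<mu> - \<kappa>)"
    by (simp add: sum.delta not_in_keys_iff_lookup_eq_zero)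
  finally show ?thesis .
qed

lemma lookup_lscale [simp]: "lookup (lscale c f) \<mu> = c * lookup f \<mu>"
  by (simp add: lscale_def lookup_single_mult)

lemma lookup_monom_x: "lookup (monom_x \<mu>) \<nu> = (if \<nu> = \<mu> then 1 else 0)"
  by (simp add: monom_x_def lookup_single when_def)

lemma keys_monom_x [simp]: "keys (monom_x \<mu> :: 'k::zero_neq_one laurent) = {\<mu>}"
  by (simp add: monom_x_def)

lemma monom_x_mult: "monom_x (\<mu> + \<nu>) = (monom_x \<mu> * monom_x \<nu> :: 'k::comm_semiring_1 laurent)"
  by (simp add: monom_x_def mult_single)

lemma monom_x_0 [simp]: "monom_x 0 = (1 :: 'k::comm_semiring_1 laurent)"
  by (simp add: monom_x_def)

lemma keys_lscale: "keys (lscale c f) \<subseteq> keys f"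
  by (auto simp: in_keys_iff)

lemma keys_lscale_nonzero [simp]: "c \<noteq> 0 \<Longrightarrow> keys (lscale c f) = keys f"
  by (auto simp: in_keys_iff)

lemma lscale_eq_0_iff [simp]: "lscale c f = 0 \<longleftrightarrow> c = 0 \<or> f = 0"
  by (simp add: laurent.scale_eq_0_iff)

lemma lscale_mult_left: "lscale c f * g = lscale c (f * g)"
  by (simp add: lscale_def mult.assoc)

lemma lscale_mult_right: "f * lscale c g = lscale c (f * g)"
  by (simp add: lscale_def algebra_simps)

lemma laurent_expand: "f = (\<Sum>\<mu>\<in>keys f. lscale (lookup f \<mu>) (monom_x \<mu>))"
  by (subst poly_mapping_sum_single) (simp add: lscale_def monom_x_def mult_single)

definition lin :: "('k::field laurent \<Rightarrow> 'k laurent) \<Rightarrow> bool" where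
  "lin F \<longleftrightarrow> (\<forall>f g. F (f + g) = F f + F g) \<and> (\<forall>c f. F (lscale c f) = lscale c (F f))"

lemma linI: "(\<And>f g. F (f + g) = F f + F g) \<Longrightarrow> (\<And>c f. F (lscale c f) = lscale c (F f)) \<Longrightarrow> lin F"
  by (simp add: lin_def)

lemma lin_add: "lin F \<Longrightarrow> F (f + g) = F f + F g"
  and lin_scale: "lin F \<Longrightarrow> F (lscale c f) = lscale c (F f)"
  by (simp_all add: lin_def)

lemma lin_zero: "lin F \<Longrightarrow> F 0 = 0"
  using lin_scale[of F 0 0] by simp

lemma lin_diff: "lin F \<Longrightarrow> F (f - g) = F f - F g"
  using lin_add[of F "f - g" g] by (simp add: algebra_simps)

lemma lin_uminus: "lin F \<Longrightarrow> F (- g) = - F g"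
  using lin_diff[of F 0 g] by (simp add: lin_zero)

lemma lin_sum: "lin F \<Longrightarrow> F (sum g A) = (\<Sum>a\<in>A. F (g a))"
  by (induction A rule: infinite_finite_induct) (simp_all add: lin_zero lin_add)

lemma lin_expand: "lin F \<Longrightarrow> F f = (\<Sum>\<mu>\<in>keys f. lscale (lookup f \<mu>) (F (monom_x \<mu>)))"
  using lin_sum[of F "\<lambda>\<mu>. lscale (lookup f \<mu>) (monom_x \<mu>)" "keys f"]
  by (simp add: laurent_expand[symmetric] lin_scale)

lemma lin_ext:
  assumes "lin F" "lin G" and "\<And>\<mu>. F (monom_x \<mu>) = G (monom_x \<mu>)"
  shows "F f = G f"
  using lin_expand[OF assms(1), of f] lin_expand[OF assms(2), of f] assms(3) by simp

lemma lin_keys: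
  assumes "lin F" shows "keys (F f) \<subseteq> (\<Union>\<mu>\<in>keys f. keys (F (monom_x \<mu>)))"
proof -
  have "keys (F f) \<subseteq> (\<Union>\<mu>\<in>keys f. keys (lscale (lookup f \<mu>) (F (monom_x \<mu>))))"
    by (subst lin_expand[OF assms]) (rule keys_sum)
  then show ?thesis using keys_lscale by blast
qed

lemma lin_comp: "lin F \<Longrightarrow> lin G \<Longrightarrow> lin (\<lambda>f. F (G f))"
  and lin_plus: "lin F \<Longrightarrow> lin G \<Longrightarrow> lin (\<lambda>f. F f + G f)"
  and lin_minus: "lin F \<Longrightarrow> lin G \<Longrightarrow> lin (\<lambda>f. F f - G f)"
  and lin_smult: "lin F \<Longrightarrow> lin (\<lambda>f. lscale c (F f))"
  and lin_mult: "lin F \<Longrightarrow> lin (\<lambda>f. h * F f)"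
  and lin_multr: "lin F \<Longrightarrow> lin (\<lambda>f. F f * h)"
  and lin_id: "lin (\<lambda>f. f)"
  by (auto simp: lin_def laurent.scale_right_distrib laurent.scale_right_diff_distrib algebra_simps
      lscale_mult_left lscale_mult_right laurent.scale_scale)

lemma lin_extension: "lin (\<lambda>f. \<Sum>\<mu>\<in>keys f. lscale (lookup f \<mu>) (h \<mu>))"
proof -
  \<comment> \<open>The sum may run over any finite set containing the support; this gives f, g and
    f + g a common index set.\<close>
  have *: "(\<Sum>\<mu>\<in>keys f. lscale (lookup f \<mu>) (h \<mu>)) = (\<Sum>\<mu>\<in>A. lscale (lookup f \<mu>) (h \<mu>))"
    if "keys f \<subseteq> A" "finite A" for A f
    using that by (intro sum.mono_neutral_left) (auto simp: not_in_keys_iff_lookup_eq_zero)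
  show ?thesis
  proof (rule linI)
    fix f g :: "'a laurent"
    let ?A = "keys f \<union> keys g"
    show "(\<Sum>\<mu>\<in>keys (f + g). lscale (lookup (f + g) \<mu>) (h \<mu>)) =
      (\<Sum>\<mu>\<in>keys f. lscale (lookup f \<mu>) (h \<mu>)) + (\<Sum>\<mu>\<in>keys g. lscale (lookup g \<mu>) (h \<mu>))"
      using keys_add[of f g]
      by (subst (1 2 3) *[of _ ?A]) (auto simp: sum.distrib lookup_add laurent.scale_left_distrib)
  next
    fix c and f :: "'a laurent"
    show "(\<Sum>\<mu>\<in>keys (lscale c f). lscale (lookup (lscale c f) \<mu>) (h \<mu>)) =
      lscale c (\<Sum>\<mu>\<in>keys f. lscale (lookup f \<mu>) (h \<mu>))"
      by (subst *[of _ "keys f"]) (auto simp: keys_lscale laurent.scale_sum_right intro: subsetD[OF keys_lscale])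
  qed
qed

lemma lin_extension_monom: "(\<Sum>\<mu>\<in>keys (monom_x \<nu>). lscale (lookup (monom_x \<nu>) \<mu>) (h \<mu>)) = (h \<nu> :: 'k::field laurent)"
  by (simp add: lookup_monom_x)

lemma lin_multiplicative:
  assumes F: "lin F" and "\<And>\<mu> \<nu>. F (monom_x (\<mu> + \<nu>)) = F (monom_x \<mu>) * F (monom_x \<nu>)"
  shows "F (f * g) = F f * F g"
proof -
  have 1: "F (monom_x \<mu> * g) = F (monom_x \<mu>) * F g" for \<mu> g
    by (rule lin_ext[OF lin_comp[OF F lin_mult[OF lin_id]] lin_mult[OF F]])
      (simp add: monom_x_mult[symmetric] assms)
  show ?thesis
    by (rule lin_ext[OF lin_comp[OF F lin_multr[OF lin_id]] lin_multr[OF F]]) (rule 1)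
qed

lemma lin_refl: "lin (refl \<phi> n i)"
  unfolding refl_def by (rule lin_extension)

lemma refl_monom_x: "refl \<phi> n i (monom_x \<mu>) = refl_monom \<phi> n i \<mu>"
  unfolding refl_def by (rule lin_extension_monom)

text \<open>The effect of \<open>s_i\<close> on exponents alone; the power of q that
  \<open>s_0\<close> produces is split off in \<open>refl_monom_eq\<close>.\<close>

definition rv :: "nat \<Rightarrow> nat \<Rightarrow> (nat \<Rightarrow>\<^sub>0 int) \<Rightarrow> (nat \<Rightarrow>\<^sub>0 int)" where
  "rv n i \<mu> = (if i = 0 then Poly_Mapping.update 1 (- lookup \<mu> 1) \<mu>
     else if i < n then Poly_Mapping.update i (lookup \<mu> (i + 1)) (Poly_Mapping.update (i + 1) (lookup \<mu> i) \<mu>)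
     else Poly_Mapping.update n (- lookup \<mu> n) \<mu>)"

lemma lookup_rv: "lookup (rv n i \<mu>) p = (if i = 0 then (if p = 1 then - lookup \<mu> 1 else lookup \<mu> p)
   else if i < n then (if p = i then lookup \<mu> (i+1) else if p = i + 1 then lookup \<mu> i else lookup \<mu> p)
   else (if p = n then - lookup \<mu> n else lookup \<mu> p))"
  by (auto simp: rv_def lookup_update)

lemma refl_monom_eq: "refl_monom \<phi> n i \<mu> =
    (if i = 0 then lscale (\<phi> (half_pow Pq 2) powi lookup \<mu> 1) (monom_x (rv n i \<mu>)) else monom_x (rv n i \<mu>))"
  by (auto simp: refl_monom_def rv_def)

lemma half_pow_mult: "half_pow p a * half_pow p b = half_pow p (a + b)"
  by (simp add: half_pow_def mult_single single_add)

lemma half_pow_0 [simp]: "half_pow p 0 = 1"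
  by (simp add: half_pow_def)

section \<open>Braid relations for Demazure--Lusztig operators\<close>

text \<open>Both braid relations are compared in the fraction field, coefficient by coefficient with
  respect to the elements of the dihedral group generated by the two reflections. In each case all
  coefficient identities are multiples of a single one.\<close>

lemma braid3_fract:
  fixes s r S R :: "'a::idom \<Rightarrow> 'a" and X Y Z H K K' :: 'a
  assumes hom: "\<And>f g. s (f + g) = s f + s g" "\<And>f g. s (f * g) = s f * s g" "\<And>f g. s (f - g) = s f - s g"
     "\<And>f g. r (f + g) = r f + r g" "\<And>f g. r (f * g) = r f * r g" "\<And>f g. r (f - g) = r f - r g"
    and inv: "\<And>f. s (s f) = f" "\<And>f. r (r f) = f" "\<And>f. s (r (s f)) = r (s (r f))"
    and c: "s H = H" "s K = K" "s K' = K'" "r H = H" "r K = K" "r K' = K'" "K * K' = 1" "H = K - K'"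
    and XY: "s X = Y" "s Y = X" "s Z = Z" "r X = X" "r Y = Z" "r Z = Y"
    and ne: "X \<noteq> Y" "Y \<noteq> Z" "X \<noteq> Z"
    and S: "\<And>f. (Y - X) * S f = H * Y * f + (K' * Y - K * X) * s f"
    and R: "\<And>f. (Z - Y) * R f = H * Z * f + (K' * Z - K * Y) * r f"
  shows "S (R (S f)) = R (S (R f))"
proof -
  define i where "i = (to_fract :: 'a \<Rightarrow> 'a fract)"
  have i: "i (f + g) = i f + i g" "i (f * g) = i f * i g" "i (f - g) = i f - i g" "i f = i g \<longleftrightarrow> f = g" "i 1 = 1" for f g
    by (simp_all add: i_def)
  \<comment> \<open>In the fraction field S becomes f \<mapsto> a f + b s(f), with coefficients
    depending on an ordered pair of variables; applying s or r to this equation only permutes the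
    variables.\<close>
  define a where "a = (\<lambda>U V. i H * i V / (i V - i U))"
  define b where "b = (\<lambda>U V. (i K' * i V - i K * i U) / (i V - i U))"
  have key: "i T = a U V * i F + b U V * i G"
    if "(V - U) * T = H * V * F + (K' * V - K * U) * G" "U \<noteq> V" for T F G U V
  proof -
    have "(i V - i U) * i T = i H * i V * i F + (i K' * i V - i K * i U) * i G"
      using arg_cong[OF that(1), of i] by (simp add: i)
    moreover have "i V - i U \<noteq> 0" using that(2) i(4) by auto
    ultimately have "i T = (i H * i V * i F + (i K' * i V - i K * i U) * i G) / (i V - i U)"
      by (metis nonzero_mult_div_cancel_left)
    then show ?thesis by (simp add: a_def b_def add_divide_distrib)
  qed
  have S0: "i (S f) = a X Y * i f + b X Y * i (s f)" for f
    using key[OF S ne(1)] .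
  have S1: "i (s (S f)) = a Y X * i (s f) + b Y X * i f" for f
    using key[OF _ ne(1)[symmetric], of "s (S f)" "s f" f] arg_cong[OF S[of f], of s] by (simp add: hom inv c XY)
  have S2: "i (r (S f)) = a X Z * i (r f) + b X Z * i (r (s f))" for f
    using key[OF _ ne(3), of "r (S f)" "r f" "r (s f)"] arg_cong[OF S[of f], of r] by (simp add: hom inv c XY)
  have S3: "i (s (r (S f))) = a Y Z * i (s (r f)) + b Y Z * i (r (s (r f)))" for f
    using key[OF _ ne(2), of "s (r (S f))" "s (r f)" "s (r (s f))"] arg_cong[OF S[of f], of "\<lambda>f. s (r f)"]
    by (simp add: hom inv c XY)
  have R0: "i (R f) = a Y Z * i f + b Y Z * i (r f)" for f
    using key[OF R ne(2)] .
  have R1: "i (r (R f)) = a Z Y * i (r f) + b Z Y * i f" for f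
    using key[OF _ ne(2)[symmetric], of "r (R f)" "r f" f] arg_cong[OF R[of f], of r] by (simp add: hom inv c XY)
  have R2: "i (s (R f)) = a X Z * i (s f) + b X Z * i (s (r f))" for f
    using key[OF _ ne(3), of "s (R f)" "s f" "s (r f)"] arg_cong[OF R[of f], of s] by (simp add: hom inv c XY)
  have R3: "i (r (s (R f))) = a X Y * i (r (s f)) + b X Y * i (r (s (r f)))" for f
    using key[OF _ ne(1), of "r (s (R f))" "r (s f)" "r (s (r f))"] arg_cong[OF R[of f], of "\<lambda>f. r (s f)"]
    by (simp add: hom inv c XY)
  have d: "i Y - i X \<noteq> 0" "i Z - i Y \<noteq> 0" "i Z - i X \<noteq> 0" using ne i(4) by auto
  have h: "i H = i K - i K'" and kk: "i K * i K' = 1" using c i(2,3,5) by metis+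
  have minus: "a V U = i H - a U V" and bb: "b U V * b V U = 1 + a U V * a V U" if "U \<noteq> V" for U V
  proof -
    have d: "i V - i U \<noteq> 0" "i U - i V \<noteq> 0" using that i(4) by auto
    show "a V U = i H - a U V" unfolding a_def using d by (simp add: field_simps)
    define j where "j = 1 / (i V - i U)"
    have j: "j * (i V - i U) = 1" using d by (simp add: j_def)
    have e: "x / (i V - i U) = x * j" "x / (i U - i V) = - x * j" for x
      using d by (simp_all add: j_def field_simps)
    show "b U V * b V U = 1 + a U V * a V U" unfolding a_def b_def e h using j kk by algebra
  qed
  \<comment> \<open>The one rational identity to which all coefficient comparisons reduce, once
    \<open>minus\<close> and \<open>bb\<close> have removed the reversed pairs.\<close>
  have J: "a X Y * a Y Z + a X Z * (i H - a X Y) = a Y Z * a X Z"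
    unfolding a_def using d by (simp add: divide_simps) (simp add: algebra_simps)
  have "i (S (R (S f))) = i (R (S (R f)))"
    unfolding S0 R0 S1 S2 R1 R2 S3 R3 
    using J bb[OF ne(1)] bb[OF ne(2)] unfolding minus[OF ne(1)] minus[OF ne(2)]
    by algebra
  then show ?thesis by (simp add: i)
qed

lemma braid4_fract:
  fixes s r S R :: "'a::idom \<Rightarrow> 'a" and X Y X' Y' H K K' H0 E K0 K0' :: 'a
  assumes hom: "\<And>f g. s (f + g) = s f + s g" "\<And>f g. s (f * g) = s f * s g" "\<And>f g. s (f - g) = s f - s g" "s 1 = 1"
     "\<And>f g. r (f + g) = r f + r g" "\<And>f g. r (f * g) = r f * r g" "\<And>f g. r (f - g) = r f - r g" "r 1 = 1"
    and inv: "\<And>f. s (s f) = f" "\<And>f. r (r f) = f" "\<And>f. s (r (s (r f))) = r (s (r (s f)))"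
    and c: "s H = H" "s K = K" "s K' = K'" "r H = H" "r K = K" "r K' = K'" "K * K' = 1" "H = K - K'"
     "s H0 = H0" "s K0 = K0" "s K0' = K0'" "r H0 = H0" "r K0 = K0" "r K0' = K0'" "K0 * K0' = 1" "H0 = K0 - K0'"
     "s E = E" "r E = E"
    and XY: "s X = Y" "s Y = X" "s X' = Y'" "s Y' = X'" "r X = X" "r Y = Y'" "r X' = X'" "r Y' = Y" "X * X' = 1" "Y * Y' = 1"
    and ne: "X \<noteq> Y" "X \<noteq> Y'" "X \<noteq> X'" "Y \<noteq> Y'"
    and S: "\<And>f. (Y - X) * S f = H * Y * f + (K' * Y - K * X) * s f"
    and R: "\<And>f. (1 - Y * Y) * R f = (H0 + E * Y) * f + (K0' - E * Y - K0 * (Y * Y)) * r f"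
  shows "S (R (S (R f))) = R (S (R (S f)))"
proof -
  define i where "i = (to_fract :: 'a \<Rightarrow> 'a fract)"
  have i: "i (f + g) = i f + i g" "i (f * g) = i f * i g" "i (f - g) = i f - i g" "i f = i g \<longleftrightarrow> f = g" "i 1 = 1" for f g
    by (simp_all add: i_def)
  define a where "a = (\<lambda>U V. i H * i V / (i V - i U))"
  define b where "b = (\<lambda>U V. (i K' * i V - i K * i U) / (i V - i U))"
  define p where "p = (\<lambda>U. (i H0 + i E * i U) / (1 - i U * i U))"
  define q where "q = (\<lambda>U. (i K0' - i E * i U - i K0 * (i U * i U)) / (1 - i U * i U))"
  have key: "i T = a U V * i F + b U V * i G"
    if "(V - U) * T = H * V * F + (K' * V - K * U) * G" "U \<noteq> V" for T F G U V
  proof -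
    have "(i V - i U) * i T = i H * i V * i F + (i K' * i V - i K * i U) * i G"
      using arg_cong[OF that(1), of i] by (simp add: i)
    moreover have "i V - i U \<noteq> 0" using that(2) i(4) by auto
    ultimately have "i T = (i H * i V * i F + (i K' * i V - i K * i U) * i G) / (i V - i U)"
      by (metis nonzero_mult_div_cancel_left)
    then show ?thesis by (simp add: a_def b_def add_divide_distrib)
  qed
  have key': "i T = p U * i F + q U * i G"
    if "(1 - U * U) * T = (H0 + E * U) * F + (K0' - E * U - K0 * (U * U)) * G" "U * U \<noteq> 1" for T F G U
  proof -
    have "(1 - i U * i U) * i T = (i H0 + i E * i U) * i F + (i K0' - i E * i U - i K0 * (i U * i U)) * i G"
      using arg_cong[OF that(1), of i] by (simp add: i)
    moreover have "1 - i U * i U \<noteq> 0" using that(2) i by (metis eq_iff_diff_eq_0)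
    ultimately have "i T = ((i H0 + i E * i U) * i F + (i K0' - i E * i U - i K0 * (i U * i U)) * i G) / (1 - i U * i U)"
      by (metis nonzero_mult_div_cancel_left)
    then show ?thesis by (subst (asm) add_divide_distrib) (simp add: p_def q_def)
  qed
  have ne': "Y' \<noteq> X'" "X' \<noteq> Y" "Y \<noteq> X'"
    using ne XY by (metis mult.commute mult.left_neutral mult.assoc)+
  have sq: "X * X \<noteq> 1" "Y * Y \<noteq> 1" "X' * X' \<noteq> 1" "Y' * Y' \<noteq> 1"
    using ne XY by (metis mult.commute mult.left_neutral mult.assoc)+
  have nz: "i X \<noteq> 0" "i Y \<noteq> 0" using XY i by (metis mult_zero_left zero_neq_one i_def to_fract_0)+
  have iv: "i X' = 1 / i X" "i Y' = 1 / i Y" 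
    using arg_cong[OF XY(9), of i] arg_cong[OF XY(10), of i] nz by (simp_all add: i field_simps)
  have d: "i Y - i X \<noteq> 0" "1 - i X * i Y \<noteq> 0" "1 - i X * i X \<noteq> 0" "1 - i Y * i Y \<noteq> 0"
  proof -
    have "X * Y \<noteq> 1" using ne XY by (metis mult.commute mult.left_neutral mult.assoc)
    then have "i X * i Y \<noteq> 1" "i X * i X \<noteq> 1" "i Y * i Y \<noteq> 1" using sq i by metis+
    then show "i Y - i X \<noteq> 0" "1 - i X * i Y \<noteq> 0" "1 - i X * i X \<noteq> 0" "1 - i Y * i Y \<noteq> 0"
      using ne i(4) by auto
  qed
  \<comment> \<open>The coefficients a and b at the pairs involving an inverse variable, with 1/X
    and 1/Y cleared; \<open>ag\<close> identifies them.\<close>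
  define g where "g = i H / (1 - i X * i Y)"
  define g' where "g' = (i K' - i K * (i X * i Y)) / (1 - i X * i Y)"
  define g'' where "g'' = (i K - i K' * (i X * i Y)) / (1 - i X * i Y)"
  have h: "i H = i K - i K'" and kk: "i K * i K' = 1" and h0: "i H0 = i K0 - i K0'" and kk0: "i K0 * i K0' = 1"
    using c i(2,3,5) by metis+
  have ag: "a X Y' = g" "a Y X' = g" "b X Y' = g'" "b Y X' = g'" "a Y' X = i H - g" "a X' Y = i H - g"  "b Y' X = g''" "b X' Y = g''"
    using d nz by (auto simp: a_def b_def g_def g'_def g''_def iv divide_simps) (auto simp: algebra_simps)
  have gg: "g' * g'' = 1 + g * (i H - g)"
  proof -
    define j where "j = 1 / (1 - i X * i Y)"
    have j: "j * (1 - i X * i Y) = 1" using d by (simp add: j_def)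
    have e: "x / (1 - i X * i Y) = x * j" for x
      using d by (simp_all add: j_def field_simps)
    show ?thesis unfolding g_def g'_def g''_def e h using j kk by algebra
  qed
  have minus: "a Y X = i H - a X Y" and bb: "b X Y * b Y X = 1 + a X Y * (i H - a X Y)"
  proof -
    have d: "i Y - i X \<noteq> 0" "i X - i Y \<noteq> 0" using ne i(4) by auto
    show "a Y X = i H - a X Y" unfolding a_def using d by (simp add: field_simps)
    define j where "j = 1 / (i Y - i X)"
    have j: "j * (i Y - i X) = 1" using d by (simp add: j_def)
    have e: "x / (i Y - i X) = x * j" "x / (i X - i Y) = - x * j" for x
      using d by (simp_all add: j_def field_simps)
    show "b X Y * b Y X = 1 + a X Y * (i H - a X Y)" unfolding a_def b_def e h using j kk by algebra
  qed
  have pm: "p V = i H0 - p U" and qq: "q U * q V = 1 + p U * (i H0 - p U)"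
    if "i V = 1 / i U" "i U \<noteq> 0" "1 - i U * i U \<noteq> 0" for U V
  proof -
    define j where "j = 1 / (1 - i U * i U)"
    have j: "j * (1 - i U * i U) = 1" using that by (simp add: j_def)
    have e: "x / (1 - i U * i U) = x * j" for x by (simp_all add: j_def field_simps)
    have e2: "p V = - (i H0 * (i U * i U) + i E * i U) / (1 - i U * i U)"
       "q V = (i K0 - (i K0' * (i U * i U) - i E * i U)) / (1 - i U * i U)"
    proof -
      define x where "x = i U"
      have x: "i V = 1 / x" "x \<noteq> 0" "1 - x * x \<noteq> 0" using that by (simp_all add: x_def)
      then have n: "1 - 1 / x * (1 / x) \<noteq> 0" by (auto simp: field_simps)
      show "p V = - (i H0 * (i U * i U) + i E * i U) / (1 - i U * i U)"
        unfolding p_def x(1) x_def[symmetric] using x(2) by (subst frac_eq_eq[OF n x(3)]) (simp add: field_simps)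
      show "q V = (i K0 - (i K0' * (i U * i U) - i E * i U)) / (1 - i U * i U)"
        unfolding q_def x(1) x_def[symmetric] using x(2) by (subst frac_eq_eq[OF n x(3)]) (simp add: field_simps)
    qed
    show "p V = i H0 - p U" unfolding e2 unfolding p_def e using j by algebra
    show "q U * q V = 1 + p U * (i H0 - p U)" unfolding e2 unfolding p_def q_def e h0 using j kk0 by algebra
  qed
  have S0: "i (S f) = a X Y * i f + b X Y * i (s f)" for f
    using key[OF S ne(1)] .
  have S1: "i (s (S f)) = (i H - a X Y) * i (s f) + b Y X * i f" for f
    using key[OF _ ne(1)[symmetric], of "s (S f)" "s f" f] arg_cong[OF S[of f], of s] by (simp add: hom inv c XY minus)
  have S2: "i (r (S f)) = g * i (r f) + g' * i (r (s f))" for f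
    using key[OF _ ne(2), of "r (S f)" "r f" "r (s f)"] arg_cong[OF S[of f], of r] by (simp add: hom inv c XY ag)
  have S3: "i (s (r (S f))) = g * i (s (r f)) + g' * i (s (r (s f)))" for f
    using key[OF _ ne'(3), of "s (r (S f))" "s (r f)" "s (r (s f))"] arg_cong[OF S[of f], of "\<lambda>f. s (r f)"]
    by (simp add: hom inv c XY ag)
  have S4: "i (r (s (S f))) = (i H - g) * i (r (s f)) + g'' * i (r f)" for f
    using key[OF _ ne(2)[symmetric], of "r (s (S f))" "r (s f)" "r f"] arg_cong[OF S[of f], of "\<lambda>f. r (s f)"]
    by (simp add: hom inv c XY ag)
  \<comment> \<open>Here r s r turns X, Y into their inverses; multiplication by X Y leads back to
    the pair X, Y.\<close>
  have S5: "i (r (s (r (S f)))) = a X Y * i (r (s (r f))) + b X Y * i (r (s (r (s f))))" for f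
  proof -
    have "(X' - Y') * r (s (r (S f))) = H * X' * r (s (r f)) + (K' * X' - K * Y') * r (s (r (s f)))"
      using arg_cong[OF S[of f], of "\<lambda>f. r (s (r f))"] by (simp add: hom inv c XY)
    from arg_cong[OF this, of "\<lambda>f. X * Y * f"]
    have "X * Y * ((X' - Y') * r (s (r (S f)))) = X * Y * (H * X' * r (s (r f)) + (K' * X' - K * Y') * r (s (r (s f))))" .
    then have "(Y - X) * r (s (r (S f))) = H * Y * r (s (r f)) + (K' * Y - K * X) * r (s (r (s f)))"
      using XY(9,10) by algebra
    from key[OF this ne(1)] show ?thesis .
  qed
  have R0: "i (R f) = p Y * i f + q Y * i (r f)" for f
    using key'[OF R sq(2)] .
  have R1: "i (r (R f)) = (i H0 - p Y) * i (r f) + q Y' * i f" for f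
    using key'[OF _ sq(4), of "r (R f)" "r f" f] arg_cong[OF R[of f], of r] pm[OF iv(2) nz(2) d(4)] by (simp add: hom inv c XY)
  have R2: "i (s (R f)) = p X * i (s f) + q X * i (s (r f))" for f
    using key'[OF _ sq(1), of "s (R f)" "s f" "s (r f)"] arg_cong[OF R[of f], of s] by (simp add: hom inv c XY)
  have R3: "i (r (s (R f))) = p X * i (r (s f)) + q X * i (r (s (r f)))" for f
    using key'[OF _ sq(1), of "r (s (R f))" "r (s f)" "r (s (r f))"] arg_cong[OF R[of f], of "\<lambda>f. r (s f)"]
    by (simp add: hom inv c XY)
  have R4: "i (s (r (R f))) = (i H0 - p X) * i (s (r f)) + q X' * i (s f)" for f
    using key'[OF _ sq(3), of "s (r (R f))" "s (r f)" "s f"] arg_cong[OF R[of f], of "\<lambda>f. s (r f)"] pm[OF iv(1) nz(1) d(3)]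
    by (simp add: hom inv c XY)
  have R5: "i (s (r (s (R f)))) = p Y * i (s (r (s f))) + q Y * i (r (s (r (s f))))" for f
    using key'[OF _ sq(2), of "s (r (s (R f)))" "s (r (s f))" "s (r (s (r f)))"] arg_cong[OF R[of f], of "\<lambda>f. s (r (s f))"] inv(3)[of f]
    by (simp add: hom inv(1,2) c XY)
  have J: "a X Y * (p Y - p X) + i H * p X + g * (i H0 - p X - p Y) = 0"
  proof -
    define x y where "x = i X" "y = i Y"
    define j1 j2 j3 j4 where "j1 = 1 / (y - x)" "j2 = 1 / (1 - x * y)" "j3 = 1 / (1 - x * x)" "j4 = 1 / (1 - y * y)"
    have j: "j1 * (y - x) = 1" "j2 * (1 - x * y) = 1" "j3 * (1 - x * x) = 1" "j4 * (1 - y * y) = 1"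
      using d by (simp_all add: j1_j2_j3_j4_def x_y_def)
    have e: "a X Y = i H * y * j1" "g = i H * j2" "p X = (i H0 + i E * x) * j3" "p Y = (i H0 + i E * y) * j4"
      by (simp_all add: a_def g_def p_def j1_j2_j3_j4_def x_y_def)
    show ?thesis unfolding e using j by algebra
  qed
  define A B B' P Px Q Qm Qx Qxm where "A = a X Y" "B = b X Y" "B' = b Y X" "P = p Y" "Px = p X" "Q = q Y" "Qm = q Y'" "Qx = q X" "Qxm = q X'"
  note defs = this
  have rel: "A * (P - Px) + i H * Px + g * (i H0 - Px - P) = 0" "B * B' = 1 + A * (i H - A)" "g' * g'' = 1 + g * (i H - g)"
     "Q * Qm = 1 + P * (i H0 - P)" "Qx * Qxm = 1 + Px * (i H0 - Px)"
    using J bb gg qq[OF iv(2) nz(2) d(4)] qq[OF iv(1) nz(1) d(3)] by (simp_all add: defs)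
  \<comment> \<open>The comparisons that are not formal: each follows from the first equation of
    \<open>rel\<close> after the products of reversed coefficients are replaced.\<close>
  have c1: "A * P + Px * (i H - A) + g * (i H0 - Px) = P * g" using rel(1) by algebra
  have c2: "A * Px = P * A + g * (i H0 - P) + Px * (i H - g)" using rel(1) by algebra
  have c3: "A * P * Px + Px * Px * (i H - A) + Qx * Qxm * g = P * P * A + P * Px * (i H - A) + Q * Qm * g"
    using rel(1) unfolding rel(4,5) by algebra
  have c4: "A * A * P + A * g * (i H0 - P) + B * B' * Px = P * A * g + g * g * (i H0 - P) + g' * g'' * Px"
    using rel(1) unfolding rel(2,3) by algebra
  have "i (S (R (S (R f)))) = i (R (S (R (S f))))"
    unfolding S0 R0 S1 S2 R1 R2 S3 R3 S4 R4 S5 R5 inv(3) defs[symmetric]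
    using c1 c2 c3 c4 by algebra
  then show ?thesis by (simp add: i)
qed

section \<open>The operators of the polynomial representation\<close>

text \<open>Only a ring homomorphism to a field is fixed, so the theory applies both to
  \<open>generic\<close>, for the fraction field, and to the map onto the residue field.\<close>

locale daha =
  fixes \<phi> :: "param_ring \<Rightarrow> 'k::field" and n :: nat
  assumes phi_1: "\<phi> 1 = 1" and phi_add: "\<phi> (x + y) = \<phi> x + \<phi> y" and phi_mult: "\<phi> (x * y) = \<phi> x * \<phi> y"
    and n2: "n \<ge> 2"
begin

abbreviation hp :: "param \<Rightarrow> int \<Rightarrow> 'k" where "hp p a \<equiv> \<phi> (half_pow p a)"

declare phi_1 [simp]

lemma phi_0: "\<phi> 0 = 0"
  using phi_add[of 0 0] by (metis add.right_neutral add_left_cancel)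

lemma phi_uminus: "\<phi> (- x) = - \<phi> x"
  using phi_add[of x "- x"] phi_0 by (metis add.right_inverse add_eq_0_iff)

lemma phi_diff: "\<phi> (x - y) = \<phi> x - \<phi> y"
  using phi_add[of x "- y"] by (simp add: phi_uminus)

lemma hp_mult: "hp p a * hp p b = hp p (a + b)"
  by (simp add: half_pow_mult flip: phi_mult)

lemma hp_0 [simp]: "hp p 0 = 1"
  by (simp add: phi_1)

lemma hp_nonzero [simp]: "hp p a \<noteq> 0"
  using hp_mult[of p a "- a"] by auto

lemma hp_uminus: "hp p (- a) = inverse (hp p a)"
  using hp_mult[of p a "- a"] by (simp add: inverse_unique)

lemma hp_2: "hp p 2 = hp p 1 * hp p 1"
  by (simp add: hp_mult)

lemma hp_inv [simp]: "hp p 1 * hp p (- 1) = 1" "hp p (- 1) * hp p 1 = 1"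
  by (simp_all add: hp_mult)

abbreviation q :: 'k where "q \<equiv> hp Pq 2"

definition kp :: "nat \<Rightarrow> param" where
  "kp j = (if j = 0 then Pt0 else if j < n then Pt else Ptn)"

abbreviation kk :: "nat \<Rightarrow> 'k" where "kk j \<equiv> hp (kp j) 1"
abbreviation kk' :: "nat \<Rightarrow> 'k" where "kk' j \<equiv> hp (kp j) (- 1)"
abbreviation hh :: "nat \<Rightarrow> 'k" where "hh j \<equiv> kk j - kk' j"

abbreviation cst :: "'k \<Rightarrow> 'k laurent" where "cst c \<equiv> lscale c 1"

lemma lscale_cst: "lscale c f = cst c * f"
  by (simp add: lscale_mult_left)

lemma cst_mult: "cst (a * b) = cst a * cst b"
  by (simp add: lscale_mult_left laurent.scale_scale)

lemma cst_add: "cst (a + b) = cst a + cst b"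
  and cst_diff: "cst (a - b) = cst a - cst b"
  and cst_1: "cst 1 = 1"
  by (simp_all add: laurent.scale_left_distrib laurent.scale_left_diff_distrib)

abbreviation sr :: "nat \<Rightarrow> 'k laurent \<Rightarrow> 'k laurent" where "sr \<equiv> refl \<phi> n"
abbreviation TT :: "nat \<Rightarrow> 'k laurent \<Rightarrow> 'k laurent" where "TT \<equiv> T_hat \<phi> n"
text \<open>The inverse of \<open>TT j\<close>, read off from the quadratic relation
  \<open>T_quadratic\<close>.\<close>

definition TI :: "nat \<Rightarrow> 'k laurent \<Rightarrow> 'k laurent" where "TI j f = TT j f - lscale (hh j) f"

text \<open>Powers of the exponential of the j-th simple affine root: \<open>1 - zp j 1\<close> is
  the denominator in the definition of the j-th operator.\<close>

definition zp :: "nat \<Rightarrow> int \<Rightarrow> 'k laurent" where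
  "zp j l = (if j = 0 then lscale (q powi l) (monom_x (single 1 (- 2 * l)))
     else if j < n then monom_x (single j l + single (j + 1) (- l)) else monom_x (single n (2 * l)))"

lemma zp_add: "zp j (a + b) = zp j a * zp j b"
proof -
  have "q powi (a + b) = q powi b * q powi a" by (simp add: power_int_add)
  moreover have "single 1 (- 2 * (a + b)) = single (1::nat) (- 2 * a) + single 1 (- 2 * b)"
    "single n (2 * (a + b)) = single n (2 * a) + single n (2 * b)"
    "single j (a + b) + single (j + 1) (- (a + b)) = (single j a + single (j+1) (- a)) + (single j b + single (j+1) (- b))"
    by (rule poly_mapping_eqI; simp add: lookup_add lookup_single when_def)+
  ultimately show ?thesis
    by (auto simp only: zp_def monom_x_mult lscale_mult_left lscale_mult_right laurent.scale_scale split: if_split)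
qed

lemma zp_0 [simp]: "zp j 0 = 1"
  by (simp add: zp_def)

text \<open>The pairing of \<mu> with the j-th coroot, so that the reflection multiplies the
  monomial by \<open>zp j (- dd j \<mu>)\<close>.\<close>

definition dd :: "nat \<Rightarrow> (nat \<Rightarrow>\<^sub>0 int) \<Rightarrow> int" where
  "dd j \<mu> = (if j = 0 then - lookup \<mu> 1 else if j < n then lookup \<mu> j - lookup \<mu> (j + 1) else lookup \<mu> n)"

lemma refl_monom_zp:
  assumes "j \<le> n" shows "sr j (monom_x \<mu>) = monom_x \<mu> * zp j (- dd j \<mu>)"
proof -
  have "rv n 0 \<mu> = \<mu> + single 1 (- 2 * lookup \<mu> 1)"
    "j > 0 \<Longrightarrow> j < n \<Longrightarrow> rv n j \<mu> = \<mu> + (single j (- dd j \<mu>) + single (j + 1) (dd j \<mu>))"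
    "rv n n \<mu> = \<mu> + single n (2 * (- lookup \<mu> n))"
    using n2 by (auto intro!: poly_mapping_eqI simp: lookup_rv lookup_add lookup_single when_def dd_def)
  then show ?thesis using assms n2
    by (auto simp: refl_monom_x refl_monom_eq zp_def dd_def monom_x_mult lscale_mult_right)
qed

lemma refl_mult: "j \<le> n \<Longrightarrow> sr j (f * g) = sr j f * sr j g"
proof (rule lin_multiplicative[OF lin_refl])
  fix \<mu> \<nu> assume "j \<le> n"
  have "dd j (\<mu> + \<nu>) = dd j \<mu> + dd j \<nu>" by (simp add: dd_def lookup_add)
  then show "sr j (monom_x (\<mu> + \<nu>)) = sr j (monom_x \<mu>) * sr j (monom_x \<nu>)"
    using zp_add[of j "- dd j \<mu>" "- dd j \<nu>"]
    unfolding refl_monom_zp[OF \<open>j \<le> n\<close>] by (simp add: monom_x_mult algebra_simps)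
qed

lemma refl_simps:
  "sr j (f + g) = sr j f + sr j g" "sr j (f - g) = sr j f - sr j g" "sr j (lscale c f) = lscale c (sr j f)"
  "sr j (- f) = - sr j f"
  by (simp_all add: lin_add lin_diff lin_scale lin_uminus lin_refl)

lemma refl_1 [simp]: "sr j 1 = 1"
proof -
  have "rv n j 0 = 0" by (rule poly_mapping_eqI) (simp add: lookup_rv)
  then show ?thesis using refl_monom_x[of \<phi> n j 0] by (cases "j = 0") (simp_all add: refl_monom_eq)
qed

lemma rv_rv: "j \<le> n \<Longrightarrow> rv n j (rv n j \<mu>) = \<mu>"
  by (rule poly_mapping_eqI) (auto simp: lookup_rv)

lemma refl_refl: assumes "j \<le> n" shows "sr j (sr j f) = f"
proof (rule lin_ext[OF lin_comp[OF lin_refl lin_refl] lin_id])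
  fix \<mu> show "sr j (sr j (monom_x \<mu>)) = monom_x \<mu>"
    using assms by (simp add: refl_monom_x refl_monom_eq refl_simps rv_rv lookup_rv power_int_minus)
qed

text \<open>The divided difference of a monomial as a geometric sum. The explicit form resolves the
  \<open>THE\<close> in \<open>lquot\<close>, and it exhibits the exponents that matter for
  triangularity.\<close>

definition DDm :: "nat \<Rightarrow> (nat \<Rightarrow>\<^sub>0 int) \<Rightarrow> 'k laurent" where
  "DDm j \<mu> = (if dd j \<mu> \<ge> 0 then \<Sum>l<nat (dd j \<mu>). monom_x \<mu> * zp j (- 1 - int l)
     else - (\<Sum>l<nat (- dd j \<mu>). monom_x \<mu> * zp j (int l)))"

definition DD :: "nat \<Rightarrow> 'k laurent \<Rightarrow> 'k laurent" where
  "DD j f = (\<Sum>\<mu>\<in>keys f. lscale (lookup f \<mu>) (DDm j \<mu>))"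

lemma lin_DD: "lin (DD j)"
  unfolding DD_def by (rule lin_extension)

lemma DD_monom: "DD j (monom_x \<mu>) = DDm j \<mu>"
  unfolding DD_def by (rule lin_extension_monom)

lemma geometric:
  "(\<Sum>l<m. zp j (- 1 - int l)) * (1 - zp j 1) = zp j (- int m) - 1"
  "(\<Sum>l<m. zp j (int l)) * (1 - zp j 1) = 1 - zp j (int m)"
proof -
  have a: "zp j (- 1 - int m) * zp j 1 = zp j (- int m)" for m
    by (simp flip: zp_add)
  have b: "zp j (int m) * zp j 1 = zp j (1 + int m)" for m
    by (simp add: add.commute flip: zp_add)
  show "(\<Sum>l<m. zp j (- 1 - int l)) * (1 - zp j 1) = zp j (- int m) - 1"
  proof (induction m)
    case (Suc m)
    have "(\<Sum>l<Suc m. zp j (- 1 - int l)) * (1 - zp j 1)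
      = (\<Sum>l<m. zp j (- 1 - int l)) * (1 - zp j 1) + (zp j (- 1 - int m) - zp j (- 1 - int m) * zp j 1)"
      by (simp add: distrib_right right_diff_distrib)
    then show ?case unfolding Suc.IH a by simp
  qed simp
  show "(\<Sum>l<m. zp j (int l)) * (1 - zp j 1) = 1 - zp j (int m)"
  proof (induction m)
    case (Suc m)
    have "(\<Sum>l<Suc m. zp j (int l)) * (1 - zp j 1)
      = (\<Sum>l<m. zp j (int l)) * (1 - zp j 1) + (zp j (int m) - zp j (int m) * zp j 1)"
      by (simp add: distrib_right right_diff_distrib)
    then show ?case unfolding Suc.IH b by simp
  qed simp
qed

lemma DD_eq: assumes "j \<le> n" shows "DD j f * (1 - zp j 1) = sr j f - f"
proof (rule lin_ext[OF lin_multr[OF lin_DD] lin_minus[OF lin_refl lin_id]])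
  fix \<mu>
  show "DD j (monom_x \<mu>) * (1 - zp j 1) = sr j (monom_x \<mu>) - monom_x \<mu>"
  proof (cases "dd j \<mu> \<ge> 0")
    case True
    have "DD j (monom_x \<mu>) * (1 - zp j 1) = monom_x \<mu> * ((\<Sum>l<nat (dd j \<mu>). zp j (- 1 - int l)) * (1 - zp j 1))"
      using True by (simp add: DD_monom DDm_def sum_distrib_left mult.assoc)
    also have "\<dots> = monom_x \<mu> * (zp j (- dd j \<mu>) - 1)" using True by (simp only: geometric) simp
    finally show ?thesis using assms by (simp add: refl_monom_zp right_diff_distrib)
  next
    case False
    have "DD j (monom_x \<mu>) * (1 - zp j 1) = - monom_x \<mu> * ((\<Sum>l<nat (- dd j \<mu>). zp j (int l)) * (1 - zp j 1))"
      using False by (simp add: DD_monom DDm_def sum_distrib_left mult.assoc)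
    also have "\<dots> = - monom_x \<mu> * (1 - zp j (- dd j \<mu>))" using False by (simp only: geometric) simp
    finally show ?thesis using assms by (simp add: refl_monom_zp right_diff_distrib)
  qed
qed

lemma zp_ne_1: "j \<le> n \<Longrightarrow> zp j 1 \<noteq> 1"
proof
  assume "j \<le> n" "zp j 1 = 1"
  then have "keys (zp j 1) = {0}" by simp
  moreover have "0 \<notin> keys (zp j 1)" using n2
    by (auto simp: zp_def poly_mapping_eq_iff fun_eq_iff lookup_add lookup_single when_def split: if_splits)
  ultimately show False by blast
qed

definition pp :: "nat \<Rightarrow> 'k laurent" where
  "pp j = (if j = 0 then (1 - lscale (\<phi> par_c) (xpow 1 (-1))) * (1 - lscale (\<phi> par_d) (xpow 1 (-1)))
    else if j < n then 1 - lscale (hp Pt 2) (zp j 1)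
    else (1 - lscale (\<phi> par_a) (xpow n 1)) * (1 - lscale (\<phi> par_b) (xpow n 1)))"

lemma lquot_eq: "u * h = g \<Longrightarrow> h \<noteq> 0 \<Longrightarrow> lquot g h = u"
  unfolding lquot_def by (rule the_equality) auto

lemma T_eq: assumes "j \<le> n" shows "TT j f = lscale (kk j) f + lscale (kk' j) (pp j * DD j f)"
proof -
  have z: "1 - zp j 1 \<noteq> 0" using zp_ne_1[OF assms] by simp
  have d: "lquot (p * (sr j f - f)) (1 - zp j 1) = p * DD j f" for p
    using DD_eq[OF assms, of f] by (intro lquot_eq[OF _ z]) (simp add: mult.assoc)
  have "zp 0 1 = lscale q (xpow 1 (- 2))" "zp n 1 = xpow n 2" 
    "0 < j \<Longrightarrow> j < n \<Longrightarrow> zp j 1 = xpow j 1 * xpow (j + 1) (- 1)"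
    using n2 by (auto simp: zp_def xpow_def monom_x_mult)
  then show ?thesis using assms d n2
    unfolding T_hat_def pp_def kp_def by (cases "j = 0"; cases "j < n") simp_all
qed

lemma lin_T: "j \<le> n \<Longrightarrow> lin (TT j)"
proof -
  assume "j \<le> n"
  then have "TT j = (\<lambda>f. lscale (kk j) f + lscale (kk' j) (pp j * DD j f))" by (simp add: T_eq fun_eq_iff)
  then show ?thesis by (simp add: lin_plus lin_smult[OF lin_id] lin_smult[OF lin_mult[OF lin_DD]])
qed

text \<open>The form free of denominators in which all relations are checked;
  \<open>T_cancel\<close> removes the factor \<open>1 - zp j 1\<close> afterwards.\<close>

lemma T_char: 
  assumes "j \<le> n"
  shows "(1 - zp j 1) * TT j f = cst (kk j) * (1 - zp j 1) * f + cst (kk' j) * pp j * (sr j f - f)"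
  using DD_eq[OF assms, of f] unfolding T_eq[OF assms] lscale_cst[of _ f] lscale_cst[of _ "_ * _"] by algebra

lemma T_cancel:
  assumes "j \<le> n" "(1 - zp j 1) * f = (1 - zp j 1) * g" shows "f = g"
  using assms zp_ne_1[of j] by simp

text \<open>A square root of \<open>zp j 1\<close> at the two end nodes. In terms of it, nodes 0 and
  n obey the same formulas, with parameters \<open>kk j\<close> and \<open>uu j\<close>.\<close>

definition vv :: "nat \<Rightarrow> 'k laurent" where
  "vv j = (if j = 0 then lscale (hp Pq 1) (xpow 1 (-1)) else xpow n 1)"
definition vi :: "nat \<Rightarrow> 'k laurent" where
  "vi j = (if j = 0 then lscale (hp Pq (-1)) (xpow 1 1) else xpow n (-1))"
definition up :: "nat \<Rightarrow> param" where "up j = (if j = 0 then Pu0 else Pun)"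
abbreviation uu :: "nat \<Rightarrow> 'k" where "uu j \<equiv> hp (up j) 1 - hp (up j) (- 1)"

lemma xpow_mult: "xpow j a * xpow j b = (xpow j (a + b) :: 'k laurent)"
  by (simp add: xpow_def single_add monom_x_mult)

lemma xpow_0 [simp]: "xpow j 0 = (1 :: 'k laurent)"
  by (simp add: xpow_def)

lemma vv_simps:
  assumes "j = 0 \<or> j = n"
  shows "vv j * vi j = 1" "zp j 1 = vv j * vv j" "sr j (vv j) = vi j" "sr j (vi j) = vv j"
    "pp j = 1 - cst (kk j * uu j) * vv j - cst (kk j * kk j) * (vv j * vv j)"
proof -
  show 1: "vv j * vi j = 1"
    by (simp add: vv_def vi_def lscale_mult_left lscale_mult_right laurent.scale_scale xpow_mult)
  show 2: "zp j 1 = vv j * vv j" using n2 assms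
    by (auto simp: vv_def zp_def lscale_mult_left lscale_mult_right laurent.scale_scale xpow_mult hp_2)
      (auto simp: xpow_def)
  have "rv n j (single p m) = single p (- m)" if "p = 1 \<and> j = 0 \<or> j = n \<and> p = n" for p m
    using that n2 by (intro poly_mapping_eqI) (auto simp: lookup_rv lookup_single when_def)
  then show "sr j (vv j) = vi j" "sr j (vi j) = vv j"
    using assms n2
    by (auto simp: vv_def vi_def refl_simps refl_monom_x refl_monom_eq xpow_def lookup_single hp_uminus hp_2 power_int_minus
        laurent.scale_scale field_simps)
  show "pp j = 1 - cst (kk j * uu j) * vv j - cst (kk j * kk j) * (vv j * vv j)"
  proof (cases "j = 0")
    case True
    have "pp j = 1 - lscale (\<phi> par_c + \<phi> par_d) (xpow 1 (-1)) + lscale (\<phi> par_c * \<phi> par_d) (xpow 1 (-2))"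
      using True by (simp add: pp_def algebra_simps lscale_mult_left lscale_mult_right laurent.scale_scale xpow_mult laurent.scale_left_distrib)
    moreover have "\<phi> par_c + \<phi> par_d = kk j * uu j * hp Pq 1" "\<phi> par_c * \<phi> par_d = - (kk j * kk j * (hp Pq 1 * hp Pq 1))"
      using True by (simp_all add: par_c_def par_d_def phi_mult phi_uminus kp_def up_def algebra_simps)
    ultimately show ?thesis using True
      by (simp add: vv_def lscale_mult_left lscale_mult_right laurent.scale_scale xpow_mult mult_ac)
  next
    case False
    then have j: "j = n" "n > 0" using assms by auto
    have "pp j = 1 - lscale (\<phi> par_a + \<phi> par_b) (xpow n 1) + lscale (\<phi> par_a * \<phi> par_b) (xpow n 2)"
      using j by (simp add: pp_def algebra_simps lscale_mult_left lscale_mult_right laurent.scale_scale xpow_mult laurent.scale_left_distrib)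
    moreover have "\<phi> par_a + \<phi> par_b = kk j * uu j" "\<phi> par_a * \<phi> par_b = - (kk j * kk j)"
      using j by (simp_all add: par_a_def par_b_def phi_mult phi_uminus kp_def up_def algebra_simps)
    ultimately show ?thesis using j
      by (simp add: vv_def lscale_mult_left lscale_mult_right laurent.scale_scale xpow_mult mult.assoc)
  qed
qed

lemma kk_inv: "cst (kk j) * cst (kk' j) = 1"
  by (simp flip: cst_mult)

lemma refl_cst [simp]: "sr j (cst c) = cst c"
  by (simp add: refl_simps)

lemma zp_inv: "zp j 1 * zp j (- 1) = 1"
  by (simp flip: zp_add)

lemma refl_zp: assumes "j \<le> n" shows "sr j (zp j 1) = zp j (- 1)"
proof (cases "j = 0 \<or> j = n")
  case True
  have "sr j (zp j 1) = vi j * vi j"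
    unfolding vv_simps(2)[OF True] refl_mult[OF assms] vv_simps(3)[OF True] ..
  then have "sr j (zp j 1) * zp j 1 = 1"
    unfolding vv_simps(2)[OF True] using vv_simps(1)[OF True] by algebra
  then show ?thesis using zp_inv[of j] by algebra
next
  case False
  then have "rv n j (single j 1 + single (j + 1) (- 1)) = single j (-1) + single (j + 1) 1"
    using assms by (intro poly_mapping_eqI) (auto simp: lookup_rv lookup_add lookup_single when_def)
  then show ?thesis using False assms by (simp add: zp_def refl_monom_x refl_monom_eq)
qed

text \<open>The property of the numerators that is responsible for the quadratic relation.\<close>

lemma pp_refl: assumes "j \<le> n" shows "pp j - zp j 1 * sr j (pp j) = cst (1 + kk j * kk j) * (1 - zp j 1)"
proof (cases "j = 0 \<or> j = n")
  case True
  note v = vv_simps[OF True]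
  have "sr j (pp j) = 1 - cst (kk j * uu j) * vi j - cst (kk j * kk j) * (vi j * vi j)"
    unfolding v(5) using assms by (simp only: refl_simps refl_mult refl_cst refl_1 v(3))
  then show ?thesis unfolding v(5) v(2) cst_add cst_1 using v(1) by algebra
next
  case False
  then have j: "pp j = 1 - cst (kk j * kk j) * zp j 1" using assms 
    by (simp add: pp_def kp_def hp_2 lscale_cst[of _ "zp _ _"])
  have "sr j (pp j) = 1 - cst (kk j * kk j) * zp j (- 1)"
    unfolding j using assms by (simp only: refl_simps refl_mult refl_cst refl_1 refl_zp)
  then show ?thesis unfolding j cst_add cst_1 using zp_inv[of j] by algebra
qed

text \<open>The image of \<open>T\<^sub>j - k\<^sub>j\<close> is negated by \<open>T\<^sub>j\<close> up to the factor \<open>1/k\<^sub>j\<close>;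
  in terms of \<open>s\<^sub>j\<close> this says that \<open>s\<^sub>j T\<^sub>j f - T\<^sub>j f\<close> is proportional to \<open>s\<^sub>j f - f\<close>.\<close>

lemma refl_T: assumes "j \<le> n" shows "sr j (TT j f) - TT j f = - (cst (kk' j) * (sr j f - f))"
proof (rule T_cancel[OF assms])
  let ?z = "zp j 1" and ?z' = "zp j (- 1)" and ?p = "pp j" and ?p' = "sr j (pp j)"
  have 1: "(1 - ?z) * TT j f = cst (kk j) * (1 - ?z) * f + cst (kk' j) * ?p * (sr j f - f)"
    by (rule T_char[OF assms])
  have 2: "(1 - ?z') * sr j (TT j f) = cst (kk j) * (1 - ?z') * sr j f + cst (kk' j) * ?p' * (f - sr j f)"
    using arg_cong[OF 1, of "sr j"] by (simp add: refl_mult refl_simps refl_zp refl_refl assms del: lscale_cst)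
  have 3: "?p - ?z * ?p' = (1 + cst (kk j) * cst (kk j)) * (1 - ?z)"
    using pp_refl[OF assms] by (simp only: cst_add cst_1 cst_mult)
  show "(1 - ?z) * (sr j (TT j f) - TT j f) = (1 - ?z) * (- (cst (kk' j) * (sr j f - f)))"
    using 1 2 3 zp_inv[of j] kk_inv[of j] by algebra
qed

lemma T_quadratic: assumes "j \<le> n" shows "TT j (TT j f) = lscale (hh j) (TT j f) + f"
proof (rule T_cancel[OF assms])
  let ?z = "zp j 1"
  have "(1 - ?z) * TT j (TT j f) = cst (kk j) * (1 - ?z) * TT j f + cst (kk' j) * pp j * (sr j (TT j f) - TT j f)"
    by (rule T_char[OF assms])
  moreover have "(1 - ?z) * TT j f = cst (kk j) * (1 - ?z) * f + cst (kk' j) * pp j * (sr j f - f)"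
    by (rule T_char[OF assms])
  ultimately show "(1 - ?z) * TT j (TT j f) = (1 - ?z) * (lscale (hh j) (TT j f) + f)"
    unfolding lscale_cst[of _ "TT _ _"] cst_diff using refl_T[OF assms, of f] kk_inv[of j] by algebra
qed

end

text \<open>This and the following identities live in an abstract integral domain, where reflected
  polynomials and scalars are plain variables and ring normalization suffices.\<close>

lemma dl_mult_aux:
  fixes Z :: "'a::idom"
  assumes "Z * A = K * Z * (g * f) + K' * p * (sg * sf - g * f)" "Z * B = K * Z * f + K' * p * (sf - f)"
  shows "Z * A = Z * sg * B + (K * Z - K' * p) * (g - sg) * f"
proof -
  have "Z * sg * B = sg * (Z * B)" by (simp add: mult_ac)
  then show ?thesis unfolding assms by (simp add: algebra_simps)
qed

lemma dl_x_aux: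
  fixes z :: "'a::idom"
  assumes "(1 - z) * A = (1 - z) * x' * B + (K * (1 - z) - K' * (1 - K * K * z)) * (x - x') * f"
    "z * x' = x" "K * K' = 1"
  shows "(1 - z) * A = (1 - z) * (x' * (B - (K - K') * f))"
proof -
  have 1: "K * (1 - z) - K' * (1 - K * K * z) = K - K'"
    using assms(3) by algebra
  have 2: "x - x' = - ((1 - z) * x')"
    unfolding assms(2)[symmetric] by (simp add: algebra_simps)
  show ?thesis using assms(1) unfolding 1 2 by (simp add: algebra_simps)
qed

lemma dl_v_aux:
  fixes v :: "'a::idom"
  assumes "(1 - v * v) * A = (1 - v * v) * v' * B + (K * (1 - v * v) - K' * (1 - K * U * v - K * K * (v * v))) * (v - v') * f"
    "v * v' = 1" "K * K' = 1"
  shows "(1 - v * v) * A = (1 - v * v) * (v' * (B - (K - K') * f) - U * f)"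
proof -
  have "K' * (1 - K * U * v - K * K * (v * v)) = K' - (K * K') * (U * v) - (K * K') * K * (v * v)"
    by (simp add: algebra_simps)
  then have 1: "K * (1 - v * v) - K' * (1 - K * U * v - K * K * (v * v)) = K - K' + U * v"
    unfolding assms(3) by (simp add: algebra_simps)
  have "(1 - v * v) * (C * v' + U) = C * v' + U - v * C * (v * v') - v * v * U"
    "(C + U * v) * (v - v') = C * v - C * v' + U * v * v - U * (v * v')" for C
    by (simp_all add: algebra_simps)
  from this[of "K - K'"] have 2: "(K - K' + U * v) * (v - v') = - ((1 - v * v) * ((K - K') * v' + U))"
    unfolding assms(2) by (simp only:) (simp add: algebra_simps)
  show ?thesis using assms(1) unfolding 1 2 by (simp add: algebra_simps)
qed

lemma dl_comm_aux:
  fixes a :: "'a::idom"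
  assumes "a * A = K * a * u + K' * p * (su - u)" "b * B = L * b * w + L' * r * (sw - w)"
    "b * u = L * b * f + L' * r * (fj - f)" "b * su = L * b * fi + L' * r * (fij - fi)"
    "a * w = K * a * f + K' * p * (fi - f)" "a * sw = K * a * fj + K' * p * (fij - fj)"
  shows "b * (a * A) = b * (a * B)"
proof -
  have 1: "b * (a * A) = K * a * (b * u) + K' * p * (b * su - b * u)" unfolding assms(1) by (simp add: algebra_simps)
  have 2: "b * (a * B) = L * b * (a * w) + L' * r * (a * sw - a * w)"
  proof -
    have "b * (a * B) = a * (b * B)" by (simp add: mult_ac)
    then show ?thesis unfolding assms(2) by (simp add: algebra_simps)
  qed
  show ?thesis unfolding 1 2 assms(3-) by (simp add: algebra_simps)
qed

lemma dl_S_aux: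
  fixes z :: "'a::idom"
  assumes "(1 - z) * A = K * (1 - z) * f + K' * (1 - K * K * z) * (sf - f)" "z * y = x" "K * K' = 1"
  shows "(y - x) * A = (K - K') * y * f + (K' * y - K * x) * sf"
proof -
  have 1: "(y - x) * A = y * ((1 - z) * A)" unfolding assms(2)[symmetric] by (simp add: algebra_simps)
  have 2: "K' * (1 - K * K * z) = K' - K * z" using assms(3) by algebra
  show ?thesis unfolding 1 assms(1) 2 unfolding assms(2)[symmetric] by (simp add: algebra_simps)
qed

lemma dl_R_aux:
  fixes v :: "'a::idom"
  assumes "(1 - v * v) * A = K * (1 - v * v) * f + K' * (1 - K * U * v - K * K * (v * v)) * (sf - f)" "K * K' = 1"
  shows "(1 - v * v) * A = (K - K' + U * v) * f + (K' - U * v - K * (v * v)) * sf"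
proof -
  have "K' * (1 - K * U * v - K * K * (v * v)) = K' - (K * K') * (U * v) - (K * K') * K * (v * v)"
    by (simp add: algebra_simps)
  then have 1: "K' * (1 - K * U * v - K * K * (v * v)) = K' - U * v - K * (v * v)"
    unfolding assms(2) by (simp add: algebra_simps)
  show ?thesis unfolding assms(1) 1 by (simp add: algebra_simps)
qed

context daha
begin

section \<open>Relations between the generators\<close>

lemma lin_TI: "j \<le> n \<Longrightarrow> lin (TI j)"
proof -
  assume "j \<le> n"
  moreover have "TI j = (\<lambda>f. TT j f - lscale (hh j) f)" by (simp add: TI_def fun_eq_iff)
  ultimately show ?thesis by (simp add: lin_minus[OF lin_T lin_smult[OF lin_id]])
qed

lemmas T_simps = lin_add[OF lin_T] lin_diff[OF lin_T] lin_scale[OF lin_T] lin_uminus[OF lin_T]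
lemmas TI_simps = lin_add[OF lin_TI] lin_diff[OF lin_TI] lin_scale[OF lin_TI] lin_uminus[OF lin_TI]

lemma T_TI [simp]: "j \<le> n \<Longrightarrow> TT j (TI j f) = f"
  by (simp add: TI_def T_simps T_quadratic)

lemma TI_T [simp]: "j \<le> n \<Longrightarrow> TI j (TT j f) = f"
  by (simp add: TI_def T_quadratic)

text \<open>A twisted Leibniz rule; the cross relations with the variables are its instances for g
  invariant, g = \<open>xpow j 1\<close> and g = \<open>vv j\<close>.\<close>

lemma T_mult: assumes "j \<le> n"
  shows "(1 - zp j 1) * TT j (g * f) =
    (1 - zp j 1) * sr j g * TT j f + (cst (kk j) * (1 - zp j 1) - cst (kk' j) * pp j) * (g - sr j g) * f"
proof (rule dl_mult_aux[where sf = "sr j f"])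
  show "(1 - zp j 1) * TT j (g * f)
    = cst (kk j) * (1 - zp j 1) * (g * f) + cst (kk' j) * pp j * (sr j g * sr j f - g * f)"
    using T_char[OF assms, of "g * f"] by (simp only: refl_mult[OF assms])
qed (rule T_char[OF assms])

lemma T_mult_inv: assumes "j \<le> n" "sr j g = g" shows "TT j (g * f) = g * TT j f"
  using T_mult[OF assms(1), of g f] unfolding assms(2) by - (rule T_cancel[OF assms(1)], simp add: mult.assoc)

lemma refl_xpow_fix: "j \<le> n \<Longrightarrow> p \<noteq> 0 \<Longrightarrow> p \<noteq> j \<Longrightarrow> p \<noteq> j + 1 \<or> j = n \<Longrightarrow> sr j (xpow p m) = xpow p m"
proof -
  assume a: "j \<le> n" "p \<noteq> 0" "p \<noteq> j" "p \<noteq> j + 1 \<or> j = n"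
  then have "rv n j (single p m) = single p m" using n2
    by (intro poly_mapping_eqI) (auto simp: lookup_rv lookup_single when_def)
  then show ?thesis using a n2 by (auto simp: xpow_def refl_monom_x refl_monom_eq lookup_single)
qed

lemma refl_xpow_mid: "0 < j \<Longrightarrow> j < n \<Longrightarrow> sr j (xpow j m) = xpow (j + 1) m" "0 < j \<Longrightarrow> j < n \<Longrightarrow> sr j (xpow (j + 1) m) = xpow j m"
proof -
  assume a: "0 < j" "j < n"
  then have "rv n j (single j m) = single (j + 1) m" "rv n j (single (j + 1) m) = single j m"
    by (intro poly_mapping_eqI; auto simp: lookup_rv lookup_single when_def)+
  then show "sr j (xpow j m) = xpow (j + 1) m" "sr j (xpow (j + 1) m) = xpow j m"
    using a by (auto simp: xpow_def refl_monom_x refl_monom_eq)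
qed

lemma T_xpow_fix: "j \<le> n \<Longrightarrow> p \<noteq> 0 \<Longrightarrow> p \<noteq> j \<Longrightarrow> p \<noteq> j + 1 \<or> j = n \<Longrightarrow> TT j (xpow p m * f) = xpow p m * TT j f"
  by (intro T_mult_inv refl_xpow_fix)

lemma zp_mid: "0 < j \<Longrightarrow> j < n \<Longrightarrow> zp j 1 = xpow j 1 * xpow (j + 1) (- 1)"
  by (simp add: zp_def xpow_def monom_x_mult)

lemma pp_mid: "0 < j \<Longrightarrow> j < n \<Longrightarrow> pp j = 1 - cst (kk j) * cst (kk j) * zp j 1"
  by (simp add: pp_def kp_def hp_2 lscale_cst[of _ "zp _ _"] cst_mult)

lemma xpow_inv: "xpow p 1 * xpow p (- 1) = (1 :: 'k laurent)"
  by (simp add: xpow_mult)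

lemma zp_mid_mult: "0 < j \<Longrightarrow> j < n \<Longrightarrow> zp j 1 * xpow (j + 1) 1 = xpow j 1"
  unfolding zp_mid using xpow_inv[of "j + 1"] by algebra

lemma T_x: assumes "0 < j" "j < n" shows "TT j (xpow j 1 * f) = xpow (j + 1) 1 * TI j f"
proof -
  have j: "j \<le> n" using assms by simp
  show ?thesis
    unfolding TI_def lscale_cst[of _ f] cst_diff
    by (rule T_cancel[OF j], rule dl_x_aux[OF _ zp_mid_mult[OF assms] kk_inv])
      (use T_mult[OF j, of "xpow j 1" f] in \<open>simp only: refl_xpow_mid(1)[OF assms] pp_mid[OF assms]\<close>)
qed

text \<open>Since f \<mapsto> \<open>vi j * TI j f\<close> inverts f \<mapsto>
  \<open>TT j (vv j * f)\<close>, this is a quadratic relation for the latter operator. Through it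
  the parameters u_0 and u_n enter.\<close>

lemma T_v: assumes "j = 0 \<or> j = n"
  shows "TT j (vv j * f) = vi j * TI j f - lscale (uu j) f"
proof -
  have j: "j \<le> n" using assms by auto
  note v = vv_simps[OF assms]
  show ?thesis
    unfolding TI_def lscale_cst[of _ f] cst_diff
    by (rule T_cancel[OF j], unfold v(2), rule dl_v_aux[OF _ v(1) kk_inv])
      (use T_mult[OF j, of "vv j" f] in \<open>simp only: v(2,3,5) cst_mult cst_diff\<close>)
qed

lemma rv_comm: assumes "i + 2 \<le> j" "j \<le> n" shows "rv n i (rv n j \<mu>) = rv n j (rv n i \<mu>)"
  using assms n2 by (intro poly_mapping_eqI) (auto simp: lookup_rv)

lemma refl_comm: assumes "i + 2 \<le> j" "j \<le> n" shows "sr i (sr j f) = sr j (sr i f)"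
proof (rule lin_ext[OF lin_comp[OF lin_refl lin_refl] lin_comp[OF lin_refl lin_refl]])
  fix \<mu> show "sr i (sr j (monom_x \<mu>)) = sr j (sr i (monom_x \<mu>))"
    using assms rv_comm[OF assms, of \<mu>] by (auto simp: refl_monom_x refl_monom_eq refl_simps lookup_rv)
qed

lemma refl_fix_zp: assumes "i + 2 \<le> j \<or> j + 2 \<le> i" "i \<le> n" "j \<le> n" 
  shows "sr i (zp j 1) = zp j 1" "sr i (pp j) = pp j"
proof -
  have x: "sr i (xpow 1 m) = xpow 1 m" if "j = 0" for m
    using assms that n2 by (intro refl_xpow_fix) auto
  have x': "sr i (xpow n m) = xpow n m" if "j = n" for m
    using assms that n2 by (intro refl_xpow_fix) auto
  show z: "sr i (zp j 1) = zp j 1"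
  proof (cases "j = 0 \<or> j = n")
    case True
    then show ?thesis unfolding vv_simps(2)[OF True] refl_mult[OF assms(2)]
      using x x' n2 by (auto simp: vv_def refl_simps)
  next
    case False
    then have "sr i (xpow j 1) = xpow j 1" "sr i (xpow (j+1) (-1)) = xpow (j+1) (-1)"
      using assms by (auto intro!: refl_xpow_fix)
    then show ?thesis using False assms by (simp add: zp_mid refl_mult)
  qed
  show "sr i (pp j) = pp j"
    using x x' z assms n2 by (auto simp: pp_def refl_simps refl_mult)
qed

lemma T_comm: assumes "i + 2 \<le> j" "j \<le> n" shows "TT i (TT j f) = TT j (TT i f)"
proof -
  have ij: "i \<le> n" "j \<le> n" using assms by auto
  have fix_simps: "sr i (zp j 1) = zp j 1" "sr i (pp j) = pp j" "sr j (zp i 1) = zp i 1" "sr j (pp i) = pp i"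
    using refl_fix_zp[of i j] refl_fix_zp[of j i] assms by auto
  note Ti = T_char[OF ij(1)] and Tj = T_char[OF ij(2)]
  have i: "(1 - zp j 1) * sr i (TT j f) = cst (kk j) * (1 - zp j 1) * sr i f + cst (kk' j) * pp j * (sr i (sr j f) - sr i f)"
    using arg_cong[OF Tj[of f], of "sr i"] by (simp only: refl_mult[OF ij(1)] refl_simps refl_cst refl_1 fix_simps)
  have j: "(1 - zp i 1) * sr j (TT i f) = cst (kk i) * (1 - zp i 1) * sr j f + cst (kk' i) * pp i * (sr i (sr j f) - sr j f)"
    using arg_cong[OF Ti[of f], of "sr j"]
    by (simp only: refl_mult[OF ij(2)] refl_simps refl_cst refl_1 fix_simps refl_comm[OF assms])
  have "(1 - zp j 1) * ((1 - zp i 1) * TT i (TT j f)) = (1 - zp j 1) * ((1 - zp i 1) * TT j (TT i f))"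
    by (rule dl_comm_aux[OF Ti[of "TT j f"] Tj[of "TT i f"] Tj[of f] i Ti[of f] j])
  then show ?thesis using T_cancel ij by blast
qed

lemma keys_xpow: "keys (xpow p m :: 'b::zero_neq_one laurent) = {single p m}"
  by (simp add: xpow_def)

lemma single_ne: "p \<noteq> r \<or> a \<noteq> b \<Longrightarrow> a \<noteq> 0 \<Longrightarrow> single p a \<noteq> single r b"
  by (metis lookup_single_eq lookup_single_not_eq)

lemma braid3: assumes "0 < j" "j + 1 < n" shows "TT j (TT (j + 1) (TT j f)) = TT (j + 1) (TT j (TT (j + 1) f))"
proof -
  have j: "j \<le> n" "j + 1 \<le> n" "0 < j" "j < n" "0 < j + 1" "j + 1 < n" "0 \<noteq> j" using assms by auto
  have k: "kp j = Pt" "kp (Suc j) = Pt" using assms by (auto simp: kp_def)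
  have rv: "rv n j (rv n (j + 1) (rv n j \<mu>)) = rv n (j + 1) (rv n j (rv n (j + 1) \<mu>))" for \<mu>
    using assms by (intro poly_mapping_eqI) (auto simp: lookup_rv)
  have ne: "xpow a 1 \<noteq> (xpow b 1 :: 'k laurent)" if "a \<noteq> b" for a b
    using that keys_xpow[of a 1, where 'b = 'k] keys_xpow[of b 1, where 'b = 'k]
    by (metis single_ne singleton_inject one_neq_zero)
  have S: "(xpow (i + 1) 1 - xpow i 1) * TT i f = cst (hh i) * xpow (i + 1) 1 * f + (cst (kk' i) * xpow (i + 1) 1 - cst (kk i) * xpow i 1) * sr i f"
    if "0 < i" "i < n" for i f
    unfolding cst_diff
    by (rule dl_S_aux[OF _ zp_mid_mult[OF that] kk_inv]) (use T_char[of i f] that in \<open>simp only: pp_mid less_imp_le\<close>)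
  show ?thesis
  proof (rule braid3_fract[where s = "sr j" and r = "sr (j + 1)" and X = "xpow j 1" and Y = "xpow (j + 1) 1" and Z = "xpow (j + 2) 1"
      and K = "cst (kk j)" and K' = "cst (kk' j)" and H = "cst (hh j)"])
    show "sr j (sr (j + 1) (sr j f)) = sr (j + 1) (sr j (sr (j + 1) f))" for f
    proof (rule lin_ext[OF lin_comp[OF lin_refl lin_comp[OF lin_refl lin_refl]] lin_comp[OF lin_refl lin_comp[OF lin_refl lin_refl]]])
      fix \<mu> show "sr j (sr (j + 1) (sr j (monom_x \<mu>))) = sr (j + 1) (sr j (sr (j + 1) (monom_x \<mu>)))"
        using j rv[of \<mu>] by (simp add: refl_monom_x refl_monom_eq)
    qed
    show "(xpow (j + 2) 1 - xpow (j + 1) 1) * TT (j + 1) f = cst (hh j) * xpow (j + 2) 1 * f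
        + (cst (kk' j) * xpow (j + 2) 1 - cst (kk j) * xpow (j + 1) 1) * sr (j + 1) f" for f
      using S[of "j + 1" f] assms k by simp
    show "(xpow (j + 1) 1 - xpow j 1) * TT j f = cst (hh j) * xpow (j + 1) 1 * f
        + (cst (kk' j) * xpow (j + 1) 1 - cst (kk j) * xpow j 1) * sr j f" for f
      using S[of j f] assms by simp
    show "cst (hh j) = cst (kk j) - cst (kk' j)" by (rule cst_diff)
    show "cst (kk j) * cst (kk' j) = 1" by (rule kk_inv)
    show "sr j (xpow j 1) = xpow (j + 1) 1" "sr j (xpow (j + 1) 1) = xpow j 1" "sr j (xpow (j + 2) 1) = xpow (j + 2) 1"
      using refl_xpow_mid[of j 1] assms by (auto intro!: refl_xpow_fix)
    show "sr (j + 1) (xpow j 1) = xpow j 1" "sr (j + 1) (xpow (j + 1) 1) = xpow (j + 2) 1" "sr (j + 1) (xpow (j + 2) 1) = xpow (j + 1) 1"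
      using refl_xpow_mid[of "j + 1" 1] assms by (auto intro!: refl_xpow_fix)
  qed (use j in \<open>simp_all add: refl_simps refl_mult refl_refl ne\<close>)
qed

text \<open>Both ends of the affine diagram are treated at once: in the variables \<open>X\<close>
  and \<open>vv j\<close> the reflection \<open>s_i\<close> is the exchange and \<open>s_j\<close>
  inverts the second one.\<close>

lemma braid4: assumes "j = 0 \<and> i = 1 \<or> j = n \<and> i = n - 1"
  shows "TT i (TT j (TT i (TT j f))) = TT j (TT i (TT j (TT i f)))"
proof -
  have i: "0 < i" "i < n" and j: "j = 0 \<or> j = n" and le: "i \<le> n" "j \<le> n" using assms n2 by auto
  define X where "X = (if j = 0 then lscale (hp Pq 1) (xpow 2 (-1)) else xpow (n - 1) 1)"
  define X' where "X' = (if j = 0 then lscale (hp Pq (-1)) (xpow 2 1) else xpow (n - 1) (-1))"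
  note v = vv_simps[OF j]
  have rv: "rv n i (rv n j (rv n i (rv n j \<mu>))) = rv n j (rv n i (rv n j (rv n i \<mu>)))" for \<mu>
  proof (cases "j = 0")
    case True
    then have e: "i = 1" "j = 0" using assms n2 by auto
    show ?thesis unfolding e using n2 by (intro poly_mapping_eqI) (simp add: lookup_rv)
  next
    case False
    then have e: "i = n - 1" "j = n" using assms by auto
    obtain m where m: "n = Suc m" "m > 0" using n2 by (cases n) auto
    show ?thesis unfolding e m(1) using m(2) by (intro poly_mapping_eqI) (simp add: lookup_rv)
  qed
  have XX: "X * X' = 1"
    by (simp add: X_def X'_def lscale_mult_left lscale_mult_right laurent.scale_scale xpow_mult)
  have sX: "sr i X = vv j" "sr i (vv j) = X" "sr i X' = vi j" "sr i (vi j) = X'"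
  proof -
    have "sr 1 (xpow 2 m) = xpow 1 m" "sr 1 (xpow 1 m) = xpow 2 m" if "1 < n" for m
      using refl_xpow_mid[of 1 m] that by (simp_all add: numeral_2_eq_2)
    moreover have "sr (n - 1) (xpow (n - 1) m) = xpow n m" "sr (n - 1) (xpow n m) = xpow (n - 1) m" for m
      using refl_xpow_mid[of "n - 1" m] n2 by simp_all
    ultimately show "sr i X = vv j" "sr i (vv j) = X" "sr i X' = vi j" "sr i (vi j) = X'"
      using assms n2 unfolding X_def X'_def vv_def vi_def by (elim disjE; simp add: refl_simps)+
  qed
  have rX: "sr j X = X" "sr j X' = X'"
    using assms n2 by (auto simp: X_def X'_def refl_simps intro!: refl_xpow_fix)
  have keys: "keys X = {if j = 0 then single 2 (-1) else single (n - 1) 1}" "keys X' = {if j = 0 then single 2 1 else single (n - 1) (-1)}"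
     "keys (vv j) = {if j = 0 then single 1 (-1) else single n 1}" "keys (vi j) = {if j = 0 then single 1 1 else single n (-1)}"
    using j by (auto simp: X_def X'_def vv_def vi_def xpow_def)
  have ne: "X \<noteq> vv j" "X \<noteq> vi j" "X \<noteq> X'" "vv j \<noteq> vi j"
    using keys n2 j single_ne[of "2::nat" "Suc 0" "-1" "-1::int"] single_ne[of "2::nat" "Suc 0" "-1" "1::int"]
      single_ne[of "2::nat" 2 "-1" "1::int"] single_ne[of "Suc 0" "Suc 0" "-1" "1::int"] single_ne[of "n-1" n 1 "1::int"]
      single_ne[of "n-1" n 1 "-1::int"] single_ne[of "n-1" "n-1" 1 "-1::int"] single_ne[of n n 1 "-1::int"]
    by (auto split: if_splits)
  have zX: "zp i 1 * vv j = X"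
  proof (cases "j = 0")
    case True
    then have e: "i = 1" "j = 0" "1 + 1 = (2::nat)" using assms n2 by auto
    have "zp i 1 * vv j = lscale (hp Pq 1) (xpow 1 1 * xpow 1 (- 1) * xpow 2 (- 1))"
      using i(1,2) by (simp only: zp_mid e vv_def simp_thms if_True lscale_mult_right mult_ac)
    also have "\<dots> = X" using e by (simp only: xpow_inv X_def simp_thms if_True mult_1)
    finally show ?thesis .
  next
    case False
    then have e: "i = n - 1" "j = n" "n - 1 + 1 = n" using assms n2 by auto
    show ?thesis using zp_mid_mult[OF i] False by (simp add: e vv_def X_def)
  qed
  show ?thesis
  proof (rule braid4_fract[where s = "sr i" and r = "sr j" and X = X and X' = X' and Y = "vv j" and Y' = "vi j"
      and K = "cst (kk i)" and K' = "cst (kk' i)" and H = "cst (hh i)" and K0 = "cst (kk j)" and K0' = "cst (kk' j)" and H0 = "cst (hh j)"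
      and E = "cst (uu j)"])
    show "sr i (sr j (sr i (sr j f))) = sr j (sr i (sr j (sr i f)))" for f
    proof (rule lin_ext[OF lin_comp[OF lin_refl lin_comp[OF lin_refl lin_comp[OF lin_refl lin_refl]]] lin_comp[OF lin_refl lin_comp[OF lin_refl lin_comp[OF lin_refl lin_refl]]]])
      fix \<mu>
      show "sr i (sr j (sr i (sr j (monom_x \<mu>)))) = sr j (sr i (sr j (sr i (monom_x \<mu>))))"
        using i j rv[of \<mu>] assms n2 by (auto simp: refl_monom_x refl_monom_eq refl_simps lookup_rv laurent.scale_scale mult.commute)
    qed
    show "(vv j - X) * TT i f = cst (hh i) * vv j * f + (cst (kk' i) * vv j - cst (kk i) * X) * sr i f" for f
      unfolding cst_diff
      by (rule dl_S_aux[OF _ zX kk_inv]) (use T_char[OF le(1), of f] in \<open>simp only: pp_mid[OF i]\<close>)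
    show "(1 - vv j * vv j) * TT j f = (cst (hh j) + cst (uu j) * vv j) * f + (cst (kk' j) - cst (uu j) * vv j - cst (kk j) * (vv j * vv j)) * sr j f" for f
      unfolding cst_diff
      by (rule dl_R_aux[OF _ kk_inv]) (use T_char[OF le(2), of f] in \<open>simp only: v(2,5) cst_mult cst_diff\<close>)
    show "cst (hh i) = cst (kk i) - cst (kk' i)" "cst (hh j) = cst (kk j) - cst (kk' j)" by (rule cst_diff)+
    show "cst (kk i) * cst (kk' i) = 1" "cst (kk j) * cst (kk' j) = 1" by (rule kk_inv)+
  qed (use le in \<open>simp_all add: refl_simps refl_mult refl_refl XX sX rX v(1,3,4) ne\<close>)
qed

end

context daha
begin

section \<open>The commuting operators and the affine intertwining element\<close>

abbreviation x1 :: "'k laurent" where "x1 \<equiv> xpow 1 1"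

text \<open>The inverse of f \<mapsto> \<open>vv 0 * TT 0 f\<close>. It commutes with
  \<open>Y_2\<close>, ..., \<open>Y_n\<close>, and its intertwiner changes the first eigenvalue from
  y to 1/(q y).\<close>

definition UU :: "'k laurent \<Rightarrow> 'k laurent" where
  "UU f = lscale (hp Pq (- 1)) (TI 0 (x1 * f))"

definition YY :: "nat \<Rightarrow> 'k laurent \<Rightarrow> 'k laurent" where
  "YY i f = foldr TT ([i..<n] @ [n] @ rev [1..<n] @ [0]) (foldr TI [1..<i] f)"

definition WW :: "nat \<Rightarrow> 'k laurent \<Rightarrow> 'k laurent" where
  "WW i f = foldr TT ([i..<n] @ [n] @ rev [i..<n]) f"

text \<open>The conjugate of \<open>T_0\<close> by \<open>T_(i-1) ... T_1\<close>. As
  \<open>YY n\<close> is \<open>T_n\<close> after \<open>ZZ n\<close>, the sign change of the last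
  coordinate becomes a computation with two quadratic relations.\<close>

definition ZZ :: "nat \<Rightarrow> 'k laurent \<Rightarrow> 'k laurent" where
  "ZZ i f = foldr TT (rev [1..<i] @ [0]) (foldr TI [1..<i] f)"

lemma YY_step: "0 < i \<Longrightarrow> i < n \<Longrightarrow> YY i f = TT i (YY (i + 1) (TT i f))"
  by (simp add: YY_def upt_conv_Cons)

lemma YY_step': "0 < i \<Longrightarrow> i < n \<Longrightarrow> YY (i + 1) f = TI i (YY i (TI i f))"
  using YY_step[of i "TI i f"] by simp

lemma WW_n: "WW n f = TT n f"
  by (simp add: WW_def)

lemma WW_step: "i < n \<Longrightarrow> WW i f = TT i (WW (i + 1) (TT i f))"
  by (simp add: WW_def upt_conv_Cons)

lemma YY_1: "YY 1 f = WW 1 (TT 0 f)"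
  by (simp add: YY_def WW_def)

lemma ZZ_1: "ZZ 1 f = TT 0 f"
  by (simp add: ZZ_def)

lemma ZZ_step: "0 < i \<Longrightarrow> ZZ (i + 1) f = TT i (ZZ i (TI i f))"
  by (simp add: ZZ_def)

lemma YY_n: "YY n f = TT n (ZZ n f)"
  by (simp add: YY_def ZZ_def)

lemma lin_foldr: "(\<And>j. j \<in> set js \<Longrightarrow> lin (F j)) \<Longrightarrow> lin (foldr F js)"
proof (induction js)
  case (Cons j js)
  have "lin (F j)" "lin (foldr F js)" using Cons by simp_all
  from lin_comp[OF this] show ?case by (simp add: comp_def)
next
  case Nil
  show ?case using lin_id by (simp add: id_def)
qed

lemma lin_YY: "i \<le> n \<Longrightarrow> lin (YY i)"
proof -
  assume "i \<le> n"
  then have "lin (foldr TT ([i..<n] @ [n] @ rev [1..<n] @ [0]))" "lin (foldr TI [1..<i])"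
    by (auto intro!: lin_foldr lin_T lin_TI)
  from lin_comp[OF this] show ?thesis by (simp add: YY_def[abs_def])
qed

lemma lin_WW: "lin (WW i)"
proof -
  have "lin (\<lambda>f. foldr TT ([i..<n] @ [n] @ rev [i..<n]) f)"
    by (rule lin_foldr) (auto intro: lin_T)
  then show ?thesis by (simp add: WW_def[abs_def])
qed

lemma lin_UU: "lin UU"
proof -
  have "lin (\<lambda>f. lscale (hp Pq (- 1)) (TI 0 (x1 * f)))"
    by (rule lin_smult[OF lin_comp[OF lin_TI lin_mult[OF lin_id]]]) simp
  then show ?thesis by (simp add: UU_def[abs_def])
qed

lemma lin_ZZ: "i \<le> n \<Longrightarrow> lin (ZZ i)"
proof -
  assume "i \<le> n"
  then have "lin (foldr TT (rev [1..<i] @ [0]))" "lin (foldr TI [1..<i])"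
    by (auto intro!: lin_foldr lin_T lin_TI)
  from lin_comp[OF this] show ?thesis by (simp add: ZZ_def[abs_def])
qed

lemma T_WW_far: "k + 2 \<le> i \<Longrightarrow> i \<le> n \<Longrightarrow> TT k (WW i f) = WW i (TT k f)"
proof (induction "n - i" arbitrary: i f)
  case 0
  then have i: "i = n" by simp
  show ?case unfolding i WW_n using 0 i T_comm[of k n f] by simp
next
  case (Suc m)
  then have "TT k (WW (i + 1) g) = WW (i + 1) (TT k g)" for g by (intro Suc.hyps(1)) auto
  then show ?case using Suc by (simp add: WW_step T_comm)
qed

lemma T_WW: "i < j \<Longrightarrow> j \<le> n \<Longrightarrow> 0 < i \<Longrightarrow> TT j (WW i f) = WW i (TT j f)"
proof (induction "n - i" arbitrary: i f)
  case (Suc m)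
  have i: "i < n" "i \<le> n" using Suc by auto
  show ?case
  proof (cases "j = i + 1")
    case False
    then have "TT j (WW (i + 1) g) = WW (i + 1) (TT j g)" for g using Suc by (intro Suc.hyps(1)) auto
    moreover have "TT j (TT i g) = TT i (TT j g)" for g using Suc False by (intro T_comm[symmetric]) auto
    ultimately show ?thesis using i by (simp add: WW_step)
  next
    case j: True
    show ?thesis
    proof (cases "j = n")
      case True
      then have e: "i = n - 1" "i + 1 = n" using j by auto
      have W: "WW i g = TT i (TT n (TT i g))" for g using WW_step[OF i(1)] unfolding e(2) by (simp add: WW_n)
      show ?thesis unfolding W True using braid4[of n i f] e by simp
    next
      case False
      then have b: "TT i (TT (i + 1) (TT i g)) = TT (i + 1) (TT i (TT (i + 1) g))" for g
        using Suc j by (intro braid3) auto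
      \<comment> \<open>Two layers are exposed: the braid relation turns \<open>T_(i+1)\<close> on
        the left into \<open>T_i\<close> further inside, which commutes with
        \<open>WW (i + 2)\<close>; on the way out it turns back.\<close>
      have W: "WW i g = TT i (TT (i + 1) (WW (i + 2) (TT (i + 1) (TT i g))))" for g
        using WW_step[of i] WW_step[of "i + 1"] i j Suc.prems False by simp
      have c: "TT i (WW (i + 2) g) = WW (i + 2) (TT i g)" for g
        using j Suc.prems False by (intro T_WW_far) auto
      show ?thesis unfolding W j
        by (simp only: b[symmetric] c)
    qed
  qed
qed simp

lemma T_Y1: assumes "2 \<le> j" "j \<le> n" shows "TT j (YY 1 f) = YY 1 (TT j f)"
  using T_WW[of 1 j] T_comm[of 0 j] assms by (simp add: YY_1[unfolded One_nat_def])

lemma TI_comm: "(\<And>f. TT j (F f) = F (TT j f)) \<Longrightarrow> lin F \<Longrightarrow> TI j (F f) = F (TI j f)"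
  by (simp add: TI_def lin_diff lin_scale)

lemma braid3_inv:
  assumes "0 < j" "j + 1 < n"
  shows "TT j (TI (j + 1) (TI j f)) = TI (j + 1) (TI j (TT (j + 1) f))"
    "TT (j + 1) (TI j (TI (j + 1) f)) = TI j (TI (j + 1) (TT j f))"
proof -
  have j: "j \<le> n" "j + 1 \<le> n" using assms by auto
  have "TT j (TT (j + 1) (TT j (TI (j + 1) (TI j f)))) = TT (j + 1) f"
    using braid3[OF assms, of "TI (j + 1) (TI j f)"] j by (simp add: braid3[OF assms])
  from arg_cong[OF this, of "\<lambda>g. TI (j + 1) (TI j g)"]
  show "TT j (TI (j + 1) (TI j f)) = TI (j + 1) (TI j (TT (j + 1) f))" using j by simp
  have "TT (j + 1) (TT j (TT (j + 1) (TI j (TI (j + 1) f)))) = TT j f"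
    using braid3[OF assms, of "TI j (TI (j + 1) f)"] j by simp
  from arg_cong[OF this, of "\<lambda>g. TI j (TI (j + 1) g)"]
  show "TT (j + 1) (TI j (TI (j + 1) f)) = TI j (TI (j + 1) (TT j f))" using j by simp
qed

lemma T_Y: assumes "0 < j" "j \<le> n" "0 < l" "l \<le> n" "l \<noteq> j" "l \<noteq> j + 1 \<or> j = n"
  shows "TT j (YY l f) = YY l (TT j f)"
  using assms
proof (induction l arbitrary: j f rule: less_induct)
  case (less l)
  show ?case
  proof (cases "l = 1")
    case True
    then show ?thesis using less.prems T_Y1[of j f] by simp
  next
    case False
    define m where "m = l - 1"
    have m: "l = m + 1" "0 < m" "m < n" using False less.prems by (auto simp: m_def)
    show ?thesis
    proof (cases "j + 1 = m")
      case False
      have "j + 2 \<le> m \<or> m + 2 \<le> j" using m less.prems False by auto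
      then have c: "TT j (TT m g) = TT m (TT j g)" for g
        using T_comm[of j m g] T_comm[of m j g] m less.prems by auto
      have ci: "TT j (TI m g) = TI m (TT j g)" for g
        using TI_comm[of m "TT j" g] c lin_T less.prems by auto
      have "TT j (YY m g) = YY m (TT j g)" for g
        using less.IH[of m j] less.prems m False by auto
      then show ?thesis using m ci YY_step'[of m] by simp
    next
      case True
      \<comment> \<open>The remaining neighbour of m is j = m - 1, since j = m and j = m + 1 = l are
        excluded. Two steps of the recursion are unrolled and the braid relation is used on both
        sides.\<close>
      have b: "0 < j" "j + 1 < n" using True m less.prems by auto
      have Y: "YY l g = TI (j + 1) (TI j (YY j (TI j (TI (j + 1) g))))" for g
        using YY_step'[of j] YY_step'[of m] m True b by simp
      have "TT (j + 1) (YY j g) = YY j (TT (j + 1) g)" for g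
        using less.IH[of j "j + 1"] b m True by auto
      then show ?thesis unfolding Y braid3_inv(1)[OF b] by (simp only: braid3_inv(2)[OF b])
    qed
  qed
qed

lemma q1_inv: "lscale (hp Pq 1) (lscale (hp Pq (- 1)) f) = f" "lscale (hp Pq (- 1)) (lscale (hp Pq 1) f) = f"
  by (simp_all add: laurent.scale_scale)

text \<open>The operator f \<mapsto> \<open>vv 0 * TT 0 f\<close> is inverse to \<open>UU\<close> by
  definition and equals \<open>UU\<close> minus the scalar \<open>uu 0\<close> by
  \<open>T_v\<close>.\<close>

lemma UU_quadratic: "UU (UU f) = lscale (uu 0) (UU f) + f"
proof -
  have vi: "vi 0 * g = lscale (hp Pq (- 1)) (x1 * g)" and vv: "x1 * (vv 0 * g) = lscale (hp Pq 1) g" for g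
    by (simp_all add: vi_def vv_def lscale_mult_left lscale_mult_right xpow_mult flip: mult.assoc)
  have 1: "vv 0 * TT 0 g = UU g - lscale (uu 0) g" for g
  proof -
    have "TT 0 (vv 0 * TT 0 g) = vi 0 * g - lscale (uu 0) (TT 0 g)"
      using T_v[of 0 "TT 0 g"] by simp
    from arg_cong[OF this, of "TI 0"] show ?thesis
      by (simp add: vi UU_def TI_simps)
  qed
  have *: "UU (vv 0 * TT 0 f) = f"
    using vv[of "TT 0 f"] by (simp add: UU_def TI_simps q1_inv)
  have "UU (UU f) - lscale (uu 0) (UU f) = f"
    using * unfolding 1 by (simp only: lin_diff[OF lin_UU] lin_scale[OF lin_UU])
  then show ?thesis by (simp only: diff_eq_eq add.commute)
qed

text \<open>By \<open>T_x\<close>, the operator f \<mapsto> \<open>WW i (xpow i 1 * f)\<close> is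
  the conjugate by \<open>T_i\<close> of its successor, and for i = n the relation is
  \<open>T_v\<close>.\<close>

lemma WW_x_quadratic:
  "0 < i \<Longrightarrow> i \<le> n \<Longrightarrow> WW i (xpow i 1 * WW i (xpow i 1 * f)) = f - lscale (uu n) (WW i (xpow i 1 * f))"
proof (induction "n - i" arbitrary: i f)
  case 0
  have v: "vv n = xpow n 1" "vi n = xpow n (-1)" "uu n = hp Pun 1 - hp Pun (-1)" using n2 by (auto simp: vv_def vi_def up_def)
  have *: "TT n (xpow n 1 * g) = xpow n (- 1) * TI n g - lscale (uu n) g" for g
    using T_v[of n g] v by simp
  have "TT n (xpow n 1 * TT n (xpow n 1 * f)) = xpow n (- 1) * (xpow n 1 * f) - lscale (uu n) (TT n (xpow n 1 * f))"
    using *[of "TT n (xpow n 1 * f)"] by simp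
  also have "xpow n (- 1) * (xpow n 1 * f) = f" by (simp add: xpow_mult flip: mult.assoc)
  moreover have "i = n" using 0 by simp
  ultimately show ?case by (simp only: WW_n)
next
  case (Suc m)
  then have i: "0 < i" "i < n" "i \<le> n" by auto
  have N: "WW i (xpow i 1 * g) = TT i (WW (i + 1) (xpow (i + 1) 1 * TI i g))" for g
    using WW_step[OF i(2), of "xpow i 1 * g"] T_x[OF i(1,2)] by simp
  have IH: "WW (i + 1) (xpow (i + 1) 1 * WW (i + 1) (xpow (i + 1) 1 * g)) = g - lscale (uu n) (WW (i + 1) (xpow (i + 1) 1 * g))" for g
    using Suc by (intro Suc.hyps(1)) auto
  show ?case unfolding N using i by (simp only: TI_T IH) (simp add: T_simps)
qed

text \<open>\<open>T_0\<close> at the right end of \<open>Y_1\<close> cancels its inverse at the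
  left end of \<open>UU\<close>, so the product is the operator of \<open>WW_x_quadratic\<close> up
  to a power of q.\<close>

lemma UU_Y1_quadratic:
  "YY 1 (UU f) = lscale (hp Pq (- 1)) (WW 1 (x1 * f))"
  "lscale q (YY 1 (UU (YY 1 (UU f)))) = f - lscale (hp Pq 1 * uu n) (YY 1 (UU f))"
proof -
  show 1: "YY 1 (UU f) = lscale (hp Pq (- 1)) (WW 1 (x1 * f))" for f
    by (simp add: YY_1[unfolded One_nat_def] UU_def T_simps TI_simps lin_scale[OF lin_WW])
  have "lscale q (YY 1 (UU (YY 1 (UU f)))) = lscale (q * hp Pq (-1) * hp Pq (-1)) (WW 1 (x1 * WW 1 (x1 * f)))"
    unfolding 1 by (simp add: lscale_mult_right lin_scale[OF lin_WW] laurent.scale_scale mult.assoc)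
  also have "q * hp Pq (-1) * hp Pq (-1) = 1" by (simp add: hp_mult)
  also have "hp Pq 1 * uu n * hp Pq (- 1) = uu n" by (simp add: mult.commute mult.left_commute)
  then have "f - lscale (hp Pq 1 * uu n) (YY 1 (UU f)) = f - lscale (uu n) (WW 1 (x1 * f))"
    unfolding 1 by (simp add: laurent.scale_scale)
  ultimately show "lscale q (YY 1 (UU (YY 1 (UU f)))) = f - lscale (hp Pq 1 * uu n) (YY 1 (UU f))"
    using WW_x_quadratic[of 1 f] n2 by simp
qed

lemma ZZ_quadratic: "0 < i \<Longrightarrow> i \<le> n \<Longrightarrow> ZZ i (ZZ i f) = lscale (hh 0) (ZZ i f) + f"
proof (induction i arbitrary: f)
  case (Suc i)
  show ?case
  proof (cases "i = 0")
    case True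
    then show ?thesis by (simp add: ZZ_1[unfolded One_nat_def] T_quadratic)
  next
    case False
    then have Z: "ZZ (Suc i) g = TT i (ZZ i (TI i g))" for g using ZZ_step[of i g] by simp
    show ?thesis unfolding Z using Suc False by (simp add: T_simps)
  qed
qed simp

lemma UU_T: assumes "2 \<le> j" "j \<le> n" shows "TT j (UU f) = UU (TT j f)"
proof -
  have "TT j (TI 0 g) = TI 0 (TT j g)" for g
    using TI_comm[of 0 "TT j" g] T_comm[of 0 j] lin_T assms by auto
  then show ?thesis using assms T_xpow_fix[of j 1 1 f] by (simp add: UU_def T_simps)
qed

lemma UU_Y: assumes "2 \<le> l" "l \<le> n" shows "UU (YY l f) = YY l (UU f)"
  using assms
proof (induction l arbitrary: f rule: dec_induct)
  case base
  have l1: "1 \<le> n" "1 < n" using n2 by auto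
  have Y: "YY 2 g = WW 2 (TT 1 (TT 0 (TI 1 g)))" for g
    using YY_step'[of 1 g] YY_1 WW_step[of 1] n2 by (simp add: numeral_2_eq_2)
  have x: "TT 1 (x1 * g) = xpow 2 1 * TI 1 g" for g using T_x[of 1 g] l1 by (simp add: numeral_2_eq_2)
  have x': "TI 1 (xpow 2 1 * g) = x1 * TT 1 g" for g
    using x[of "TT 1 g"] l1 by (metis TI_T)
  have x0: "TT 0 (xpow 2 1 * g) = xpow 2 1 * TT 0 g" for g by (rule T_xpow_fix) auto
  have W: "UU (WW 2 g) = WW 2 (UU g)" for g
  proof -
    have s: "set ([2..<n] @ [n] @ rev [2..<n]) \<subseteq> {2..n}" using n2 by auto
    have "UU (foldr TT js g) = foldr TT js (UU g)" if "set js \<subseteq> {2..n}" for js g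
      using that by (induction js arbitrary: g) (auto simp: UU_T[symmetric])
    from this[OF s] show ?thesis by (simp add: WW_def)
  qed
  \<comment> \<open>The core of the base case: \<open>UU\<close> commutes with
    \<open>T_1 T_0 T_1^(-1)\<close>. Writing x_1 as \<open>T_1^(-1) x_2 T_1^(-1)\<close>, with x_2
    commuting with \<open>T_0\<close>, reduces it to the braid relation of length four.\<close>
  have "TI 0 (x1 * TT 1 (TT 0 (TI 1 g))) = TT 1 (TT 0 (TI 1 (TI 0 (x1 * g))))" for g
  proof -
    define h where "h = TI 0 (x1 * g)"
    have "TT 0 (TT 1 (TT 0 (TI 1 h))) = TI 1 (TT 0 (TT 1 (TT 0 h)))"
    proof -
      have "TT 1 (TT 0 (TT 1 (TT 0 (TI 1 h)))) = TT 0 (TT 1 (TT 0 h))"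
        using braid4[of 0 1 "TI 1 h"] l1 by simp
      from arg_cong[OF this, of "TI 1"] show ?thesis using l1 by simp
    qed
    also have "\<dots> = TI 1 (TT 0 (xpow 2 1 * TI 1 g))" by (simp add: h_def x[unfolded One_nat_def])
    also have "\<dots> = x1 * TT 1 (TT 0 (TI 1 g))" by (simp only: x0 x')
    finally have "TI 0 (x1 * TT 1 (TT 0 (TI 1 g))) = TI 0 (TT 0 (TT 1 (TT 0 (TI 1 h))))" by simp
    then show ?thesis by (simp add: h_def)
  qed
  then have "UU (TT 1 (TT 0 (TI 1 g))) = TT 1 (TT 0 (TI 1 (UU g)))" for g
    using l1 by (simp add: UU_def T_simps TI_simps)
  then show ?case unfolding Y W by simp
next
  case (step l)
  have "UU (TI l g) = TI l (UU g)" for g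
    using TI_comm[of l UU g] UU_T[of l] lin_UU step by auto
  then show ?case using step YY_step'[of l] by simp
qed

end

section \<open>A partial order on weights\<close>

text \<open>The number of boxes to the right of column m in the partition formed by the absolute
  values of the coordinates. Comparing these numbers for all m implies dominance of the dominant
  representatives, see \<open>ps_le_dominant\<close>.\<close>

definition ht :: "nat \<Rightarrow> nat \<Rightarrow> (nat \<Rightarrow>\<^sub>0 int) \<Rightarrow> int" where
  "ht n m \<mu> = (\<Sum>p\<in>{1..n}. max (\<bar>lookup \<mu> p\<bar> - int m) 0)"

definition ps :: "nat \<Rightarrow> (nat \<Rightarrow>\<^sub>0 int) \<Rightarrow> int" where
  "ps j \<mu> = (\<Sum>p\<in>{1..j}. lookup \<mu> p)"

definition below :: "nat \<Rightarrow> (nat \<Rightarrow>\<^sub>0 int) \<Rightarrow> (nat \<Rightarrow>\<^sub>0 int) set" where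
  "below n \<mu> = {\<nu>\<in>weights n. \<forall>m. ht n m \<nu> \<le> ht n m \<mu>}"

text \<open>Weights in a strictly smaller orbit of signed permutations. Each single generator
  respects this relation, whereas the order inside an orbit is respected only by the full products
  \<open>Y_i\<close>.\<close>

definition lower :: "nat \<Rightarrow> (nat \<Rightarrow>\<^sub>0 int) \<Rightarrow> (nat \<Rightarrow>\<^sub>0 int) set" where
  "lower n \<mu> = {\<nu>\<in>below n \<mu>. \<exists>m. ht n m \<nu> < ht n m \<mu>}"

text \<open>This order is contained in the order of the definition of the Koornwinder polynomials:
  the numbers \<open>ht n m\<close> control the dominance order of the dominant weights.\<close>

definition lt :: "nat \<Rightarrow> (nat \<Rightarrow>\<^sub>0 int) \<Rightarrow> (nat \<Rightarrow>\<^sub>0 int) set" where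
  "lt n \<mu> = {\<nu>\<in>below n \<mu>. (\<exists>m. ht n m \<nu> < ht n m \<mu>) \<or> (\<forall>j\<le>n. ps j \<nu> \<le> ps j \<mu>) \<and> \<nu> \<noteq> \<mu>}"

lemma weights_0: "\<mu> \<in> weights n \<Longrightarrow> p \<notin> {1..n} \<Longrightarrow> lookup \<mu> p = 0"
  by (auto simp: weights_def in_keys_iff subset_iff)

lemma weightsI: "(\<And>p. p \<notin> {1..n} \<Longrightarrow> lookup \<mu> p = 0) \<Longrightarrow> \<mu> \<in> weights n"
  unfolding weights_def mem_Collect_eq subset_iff by (meson in_keys_iff)

lemma weights_eqI: "\<mu> \<in> weights n \<Longrightarrow> \<nu> \<in> weights n \<Longrightarrow> (\<And>p. p \<in> {1..n} \<Longrightarrow> lookup \<mu> p = lookup \<nu> p) \<Longrightarrow> \<mu> = \<nu>"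
  by (rule poly_mapping_eqI) (metis weights_0)

lemma below_trans: "\<nu> \<in> below n \<mu> \<Longrightarrow> \<mu> \<in> below n \<kappa> \<Longrightarrow> \<nu> \<in> below n \<kappa>"
  by (auto simp: below_def intro: order_trans)

lemma lower_below: "\<nu> \<in> below n \<mu> \<Longrightarrow> \<mu> \<in> lower n \<kappa> \<Longrightarrow> \<nu> \<in> lower n \<kappa>"
  unfolding lower_def using below_trans by (fastforce simp: below_def intro: le_less_trans)

lemma below_lower: "\<nu> \<in> lower n \<mu> \<Longrightarrow> \<mu> \<in> below n \<kappa> \<Longrightarrow> \<nu> \<in> lower n \<kappa>"
  unfolding lower_def using below_trans by (fastforce simp: below_def intro: less_le_trans)

lemma lower_lt: "\<nu> \<in> lower n \<mu> \<Longrightarrow> \<nu> \<in> lt n \<mu>"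
  by (auto simp: lower_def lt_def)

lemma ps_eqD: "\<mu> \<in> weights n \<Longrightarrow> \<nu> \<in> weights n \<Longrightarrow> (\<And>j. j \<le> n \<Longrightarrow> ps j \<nu> = ps j \<mu>) \<Longrightarrow> \<nu> = \<mu>"
proof (rule weights_eqI[where n = n])
  fix p assume a: "p \<in> {1..n}" "\<And>j. j \<le> n \<Longrightarrow> ps j \<nu> = ps j \<mu>"
  have "ps p \<kappa> = ps (p - 1) \<kappa> + lookup \<kappa> p" for \<kappa>
    using a(1) by (cases p) (simp_all add: ps_def)
  moreover have "p - 1 \<le> n" "p \<le> n" using a(1) by auto
  ultimately show "lookup \<nu> p = lookup \<mu> p" using a(2)[of p] a(2)[of "p - 1"] by simp
qed

lemma lt_trans: assumes "\<nu> \<in> lt n \<mu>" "\<mu> \<in> lt n \<kappa>" "\<kappa> \<in> weights n" shows "\<nu> \<in> lt n \<kappa>"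
proof -
  have b: "\<nu> \<in> below n \<mu>" "\<mu> \<in> below n \<kappa>" using assms by (auto simp: lt_def)
  show ?thesis
  proof (cases "\<nu> \<in> lower n \<mu> \<or> \<mu> \<in> lower n \<kappa>")
    case True
    then show ?thesis using b lower_lt lower_below below_lower by blast
  next
    case False
    then have c: "\<forall>j\<le>n. ps j \<nu> \<le> ps j \<mu>" "\<nu> \<noteq> \<mu>" "\<forall>j\<le>n. ps j \<mu> \<le> ps j \<kappa>" using assms by (auto simp: lower_def lt_def)
    then have "\<forall>j\<le>n. ps j \<nu> \<le> ps j \<kappa>" by (meson order_trans)
    moreover have "\<nu> \<noteq> \<kappa>"
      using c ps_eqD[of \<mu> n \<nu>] b by (auto simp: below_def intro: antisym)
    ultimately show ?thesis using below_trans[OF b] by (auto simp: lt_def)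
  qed
qed

lemma lt_irrefl: "\<mu> \<notin> lt n \<mu>"
  by (auto simp: lt_def)

lemma ht_one:
  assumes "p \<in> {1..n}" "\<And>r. r \<noteq> p \<Longrightarrow> lookup \<nu> r = lookup \<mu> r"
  shows "ht n m \<nu> - ht n m \<mu> = max (\<bar>lookup \<nu> p\<bar> - int m) 0 - max (\<bar>lookup \<mu> p\<bar> - int m) 0"
proof -
  have "sum f {1..n} = f p + sum f ({1..n} - {p})" for f :: "nat \<Rightarrow> int"
    using assms(1) by (intro sum.remove) auto
  then show ?thesis unfolding ht_def using assms(2) by simp
qed

lemma ht_two:
  assumes "p \<in> {1..n}" "r \<in> {1..n}" "p \<noteq> r" "\<And>s. s \<noteq> p \<Longrightarrow> s \<noteq> r \<Longrightarrow> lookup \<nu> s = lookup \<mu> s"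
  shows "ht n m \<nu> - ht n m \<mu> = max (\<bar>lookup \<nu> p\<bar> - int m) 0 - max (\<bar>lookup \<mu> p\<bar> - int m) 0
     + (max (\<bar>lookup \<nu> r\<bar> - int m) 0 - max (\<bar>lookup \<mu> r\<bar> - int m) 0)"
proof -
  have "sum f {1..n} = f p + (f r + sum f ({1..n} - {p} - {r}))" for f :: "nat \<Rightarrow> int"
    using assms(1-3) sum.remove[of "{1..n}" p f] sum.remove[of "{1..n} - {p}" r f] by simp
  then show ?thesis unfolding ht_def using assms(4) by simp
qed

lemma lower_one:
  assumes "\<mu> \<in> weights n" "p \<in> {1..n}" "\<And>r. r \<noteq> p \<Longrightarrow> lookup \<nu> r = lookup \<mu> r" "\<bar>lookup \<nu> p\<bar> < \<bar>lookup \<mu> p\<bar>"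
  shows "\<nu> \<in> lower n \<mu>"
proof -
  have "\<nu> \<in> weights n" by (rule weightsI) (metis assms(1-3) weights_0)
  moreover have "ht n m \<nu> \<le> ht n m \<mu>" for m
    using ht_one[OF assms(2,3), of m] assms(4) by (smt (verit))
  moreover have "ht n (nat (\<bar>lookup \<mu> p\<bar> - 1)) \<nu> < ht n (nat (\<bar>lookup \<mu> p\<bar> - 1)) \<mu>"
    using ht_one[OF assms(2,3), of "nat (\<bar>lookup \<mu> p\<bar> - 1)"] assms(4) by (smt (verit) nat_0_le)
  ultimately show ?thesis by (auto simp: lower_def below_def)
qed

lemma lower_two:
  assumes "\<mu> \<in> weights n" "p \<in> {1..n}" "r \<in> {1..n}" "p \<noteq> r" "\<And>s. s \<noteq> p \<Longrightarrow> s \<noteq> r \<Longrightarrow> lookup \<nu> s = lookup \<mu> s"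
    and s: "lookup \<nu> p + lookup \<nu> r = lookup \<mu> p + lookup \<mu> r"
    and b: "min (lookup \<mu> p) (lookup \<mu> r) < lookup \<nu> p" "lookup \<nu> p < max (lookup \<mu> p) (lookup \<mu> r)"
  shows "\<nu> \<in> lower n \<mu>"
proof -
  have "\<nu> \<in> weights n" by (rule weightsI) (metis assms(1-3,5) weights_0)
  \<comment> \<open>Convexity of x \<mapsto> max (|x| - m) 0: moving two numbers towards each other
    at constant sum does not increase the total.\<close>
  moreover have "max (\<bar>a'\<bar> - m) 0 + max (\<bar>b'\<bar> - m) 0 \<le> max (\<bar>a\<bar> - m) 0 + max (\<bar>b\<bar> - m) (0::int)"
    if "a' + b' = a + b" "min a b < a'" "a' < max a b" "m \<ge> 0" for a b a' b' m :: int
    using that by (smt (verit))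
  from this[OF s b] have "ht n m \<nu> \<le> ht n m \<mu>" for m
    using ht_two[OF assms(2-5), of m] by (smt (verit) of_nat_0_le_iff)
  \<comment> \<open>The loss is strict at the threshold just below the larger absolute value: at
    most the outer entry of that size contributed, and it has moved inwards.\<close>
  moreover have "max (\<bar>a'\<bar> - m) 0 + max (\<bar>b'\<bar> - m) 0 < max (\<bar>a\<bar> - m) 0 + max (\<bar>b\<bar> - m) (0::int)"
    if "a' + b' = a + b" "min a b < a'" "a' < max a b" "m = max \<bar>a\<bar> \<bar>b\<bar> - 1" for a b a' b' m :: int
    using that by (smt (verit))
  from this[OF s b] have "ht n (nat (max \<bar>lookup \<mu> p\<bar> \<bar>lookup \<mu> r\<bar> - 1)) \<nu> < ht n (nat (max \<bar>lookup \<mu> p\<bar> \<bar>lookup \<mu> r\<bar> - 1)) \<mu>"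
    using ht_two[OF assms(2-5), of "nat (max \<bar>lookup \<mu> p\<bar> \<bar>lookup \<mu> r\<bar> - 1)"] b by (smt (verit) nat_0_le)
  ultimately show ?thesis by (auto simp: lower_def below_def)
qed

lemma rv_weights: "j \<le> n \<Longrightarrow> n \<ge> 2 \<Longrightarrow> \<mu> \<in> weights n \<Longrightarrow> rv n j \<mu> \<in> weights n"
  by (rule weightsI) (auto simp: lookup_rv weights_0)

lemma ht_rv: assumes "j \<le> n" "n \<ge> 2" shows "ht n m (rv n j \<mu>) = ht n m \<mu>"
proof (cases "j = 0 \<or> j = n")
  case True
  then have "ht n m (rv n j \<mu>) - ht n m \<mu> = 0"
    using assms by (subst ht_one[of "if j = 0 then 1 else n"]) (auto simp: lookup_rv)
  then show ?thesis by simp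
next
  case False
  then have "ht n m (rv n j \<mu>) - ht n m \<mu> = 0"
    using assms by (subst ht_two[of j _ "j + 1"]) (auto simp: lookup_rv)
  then show ?thesis by simp
qed

lemma rv_below: "j \<le> n \<Longrightarrow> n \<ge> 2 \<Longrightarrow> \<mu> \<in> weights n \<Longrightarrow> rv n j \<mu> \<in> below n \<mu>"
  by (simp add: below_def ht_rv rv_weights)

lemma below_refl: "\<mu> \<in> weights n \<Longrightarrow> \<mu> \<in> below n \<mu>"
  by (simp add: below_def)

context daha
begin

section \<open>Triangularity\<close>

definition alpha :: "nat \<Rightarrow> (nat \<Rightarrow>\<^sub>0 int) \<Rightarrow> 'k" where
  "alpha j \<mu> = (if j = 0 then q powi lookup \<mu> 1 else 1) * (if dd j \<mu> > 0 then kk' j else kk j)"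

definition delta :: "nat \<Rightarrow> (nat \<Rightarrow>\<^sub>0 int) \<Rightarrow> 'k" where
  "delta j \<mu> = (if dd j \<mu> < 0 then hh j else 0)"

lemma keys_mult_monom: "keys (monom_x \<mu> * f :: 'k laurent) = (\<lambda>\<nu>. \<mu> + \<nu>) ` keys f"
proof -
  have "\<kappa> \<in> keys (monom_x \<mu> * f) \<longleftrightarrow> \<kappa> - \<mu> \<in> keys f" for \<kappa>
    by (simp add: in_keys_iff monom_x_def lookup_single_mult)
  then show ?thesis by (force simp: image_iff algebra_simps)
qed

lemma keys_zp: "j \<le> n \<Longrightarrow> keys (zp j l) = {if j = 0 then single 1 (- 2 * l) else if j < n then single j l + single (j + 1) (- l) else single n (2 * l)}"
  by (auto simp: zp_def)

lemma keys_vv_zp: assumes "j = 0 \<or> j = n" 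
  shows "keys (vv j * (monom_x \<mu> * zp j l)) = {if j = 0 then \<mu> + single 1 (- 1 - 2 * l) else \<mu> + single n (1 + 2 * l)}"
proof -
  have "vv j * (monom_x \<mu> * zp j l) = lscale (if j = 0 then hp Pq 1 else 1) (monom_x (if j = 0 then single 1 (-1) else single n 1) * (monom_x \<mu> * zp j l))"
    using assms by (simp add: vv_def xpow_def lscale_mult_left)
  also have "keys \<dots> = (+) (if j = 0 then single 1 (-1) else single n 1) ` (+) \<mu> ` keys (zp j l)"
    by (simp add: keys_mult_monom)
  also have "\<dots> = {if j = 0 then \<mu> + single 1 (- 1 - 2 * l) else \<mu> + single n (1 + 2 * l)}"
    using assms n2 by (auto simp: keys_zp intro!: poly_mapping_eqI simp: lookup_add lookup_single when_def)
  finally show ?thesis .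
qed

lemma zp_lower:
  assumes "j \<le> n" "\<mu> \<in> weights n" "0 < l \<and> l < dd j \<mu> \<or> dd j \<mu> < l \<and> l < 0"
  shows "keys (monom_x \<mu> * zp j (- l)) \<subseteq> lower n \<mu>"
proof (cases "j = 0 \<or> j = n")
  case True
  define p where "p = (if j = 0 then 1 else n)"
  have k: "keys (monom_x \<mu> * zp j (- l)) = {\<mu> + single p (if j = 0 then 2 * l else - 2 * l)}"
    using True assms n2 by (auto simp: keys_mult_monom keys_zp p_def)
  have "\<mu> + single p (if j = 0 then 2 * l else - 2 * l) \<in> lower n \<mu>"
    using assms True n2
    by (intro lower_one[of _ _ p]) (auto simp: lookup_add lookup_single when_def dd_def p_def split: if_splits)
  then show ?thesis using k by simp
next
  case False
  then have k: "keys (monom_x \<mu> * zp j (- l)) = {\<mu> + (single j (- l) + single (j + 1) l)}"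
    using assms by (simp add: keys_mult_monom keys_zp)
  have "\<mu> + (single j (- l) + single (j + 1) l) \<in> lower n \<mu>"
    using assms False
    by (intro lower_two[of _ _ j "j + 1"]) (auto simp: lookup_add lookup_single when_def dd_def)
  then show ?thesis using k by simp
qed

lemma vv_zp_lower:
  assumes "j = 0 \<or> j = n" "\<mu> \<in> weights n" "0 < l \<and> l \<le> dd j \<mu> \<or> dd j \<mu> < l \<and> l \<le> 0"
  shows "keys (vv j * (monom_x \<mu> * zp j (- l))) \<subseteq> lower n \<mu>"
proof -
  define p where "p = (if j = 0 then 1 else n)"
  have k: "keys (vv j * (monom_x \<mu> * zp j (- l))) = {\<mu> + single p (if j = 0 then 2 * l - 1 else 1 - 2 * l)}"
    unfolding keys_vv_zp[OF assms(1)] using n2 by (simp add: p_def)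
  have "\<mu> + single p (if j = 0 then 2 * l - 1 else 1 - 2 * l) \<in> lower n \<mu>"
    using assms n2
    by (intro lower_one[of _ _ p]) (auto simp: lookup_add lookup_single when_def dd_def p_def split: if_splits)
  then show ?thesis using k by simp
qed

lemma keys_sum_subset: "(\<And>a. a \<in> A \<Longrightarrow> keys (g a) \<subseteq> S) \<Longrightarrow> keys (sum g A) \<subseteq> S"
  using keys_sum[of g A] by blast

lemma keys_plus_subset: "keys f \<subseteq> S \<Longrightarrow> keys g \<subseteq> S \<Longrightarrow> keys (f + g) \<subseteq> S"
  using keys_add[of f g] by blast

lemma keys_minus_subset: "keys f \<subseteq> S \<Longrightarrow> keys g \<subseteq> S \<Longrightarrow> keys (f - g) \<subseteq> (S :: (nat \<Rightarrow>\<^sub>0 int) set)" for f g :: "'k laurent"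
  by (auto simp: in_keys_iff lookup_minus subset_iff) (metis diff_0_right)

lemma keys_cst_subset: "keys f \<subseteq> S \<Longrightarrow> keys (cst c * f) \<subseteq> S"
  using keys_lscale[of c f] by (simp add: lscale_mult_left)

text \<open>The operator spreads a monomial over the string of exponents from \<mu> to its
  reflection. Interior points lie in smaller orbits, so only the end points count, with coefficients
  \<open>alpha\<close> and \<open>delta\<close>.\<close>

lemma T_monom:
  assumes "j \<le> n" "\<mu> \<in> weights n"
  shows "keys (TT j (monom_x \<mu>) - (lscale (alpha j \<mu>) (monom_x (rv n j \<mu>)) + lscale (delta j \<mu>) (monom_x \<mu>))) \<subseteq> lower n \<mu>"
proof -
  define M where "M = (monom_x \<mu> :: 'k laurent)"
  define K where "K = cst (kk j)" 
  define K' where "K' = cst (kk' j)"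
  define z where "z = zp j 1"
  define D where "D = DDm j \<mu>"
  define U where "U = (if j = 0 \<or> j = n then cst (uu j) * vv j else 0)"
  define d where "d = dd j \<mu>"
  have KK: "K * K' = 1" by (simp add: K_def K'_def kk_inv)
  have D: "D * (1 - z) = M * zp j (- d) - M"
    using DD_eq[OF assms(1), of M] refl_monom_zp[OF assms(1), of \<mu>] by (simp add: D_def M_def z_def d_def DD_monom)
  have pp: "pp j = 1 - K * K * z - K * U"
  proof (cases "j = 0 \<or> j = n")
    case True
    then show ?thesis using vv_simps(2,5)[OF True] by (simp add: K_def z_def U_def cst_mult mult_ac)
  next
    case False
    then show ?thesis using pp_mid[of j] assms by (simp add: K_def z_def U_def)
  qed
  have rvM: "lscale (if j = 0 then q powi lookup \<mu> 1 else 1) (monom_x (rv n j \<mu>)) = M * zp j (- d)"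
    using refl_monom_zp[OF assms(1), of \<mu>] by (simp add: refl_monom_x refl_monom_eq M_def d_def split: if_splits)
  have al: "lscale (alpha j \<mu>) (monom_x (rv n j \<mu>)) = (if d > 0 then K' else K) * (M * zp j (- d))"
  proof -
    have "lscale (alpha j \<mu>) X = lscale (if d > 0 then kk' j else kk j) (lscale (if j = 0 then q powi lookup \<mu> 1 else 1) X)" for X
      by (simp add: alpha_def d_def laurent.scale_scale mult.commute)
    from this[of "monom_x (rv n j \<mu>)"]
    have "lscale (alpha j \<mu>) (monom_x (rv n j \<mu>)) = lscale (if d > 0 then kk' j else kk j) (M * zp j (- d))"
      unfolding rvM .
    then show ?thesis by (simp only: K_def K'_def lscale_mult_left mult_1 split: if_split) auto
  qed
  have de: "lscale (delta j \<mu>) M = (if d < 0 then (K - K') * M else 0)"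
    unfolding K_def K'_def cst_diff[symmetric] lscale_mult_left by (simp add: delta_def d_def)
  have KU: "K' * (K * K * z) = K * z" "K' * (K * U) = U"
    using KK by (metis mult.assoc mult.commute mult_1)+
  have "TT j M = K * M + K' * ((1 - K * K * z - K * U) * D)"
    using T_eq[OF assms(1), of M] pp by (simp add: M_def D_def DD_monom K_def K'_def lscale_mult_left)
  also have "\<dots> = K * M + (K' * D - (K' * (K * K * z)) * D - (K' * (K * U)) * D)" by (simp add: algebra_simps)
  also have "\<dots> = K * M + (K' * D - K * (z * D)) - U * D" unfolding KU by (simp add: algebra_simps)
  finally have T: "TT j M = K * M + (K' * D - K * (z * D)) - U * D" .
  \<comment> \<open>Multiplication by z shifts the string by one step, so \<open>z * D\<close>
    differs from \<open>D\<close> by the two boundary monomials only.\<close>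
  have zD: "z * D = D - (M * zp j (- d) - M)" using D by (simp add: algebra_simps)
  have low: "keys (cst c * (monom_x \<mu> * zp j (- l))) \<subseteq> lower n \<mu>" if "0 < l \<and> l < d \<or> d < l \<and> l < 0" for l c
    using that zp_lower[OF assms] keys_cst_subset by (simp add: d_def)
  \<comment> \<open>Multiplication by \<open>vv j\<close> shifts by half a step, from which every
    monomial lands strictly between the two ends of the string.\<close>
  have UD: "keys (U * D) \<subseteq> lower n \<mu>"
  proof (cases "j = 0 \<or> j = n")
    case True
    have "keys (vv j * D) \<subseteq> lower n \<mu>"
    proof (cases "d \<ge> 0")
      case c: True
      have e: "- 1 - int l = - (1 + int l)" for l by simp
      have "vv j * D = (\<Sum>l<nat d. vv j * (monom_x \<mu> * zp j (- (1 + int l))))"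
        using c by (simp add: D_def DDm_def d_def sum_distrib_left e del: minus_add_distrib)
      moreover have "keys (vv j * (monom_x \<mu> * zp j (- (1 + int l)))) \<subseteq> lower n \<mu>" if "l < nat d" for l
        using that c by (intro vv_zp_lower[OF True assms(2)]) (auto simp: d_def)
      ultimately show ?thesis using keys_sum_subset by (metis (no_types, lifting) lessThan_iff)
    next
      case c: False
      have "vv j * D = - (\<Sum>l<nat (- d). vv j * (monom_x \<mu> * zp j (- (- int l))))"
        using c by (simp add: D_def DDm_def d_def sum_distrib_left)
      moreover have "keys (\<Sum>l<nat (- d). vv j * (monom_x \<mu> * zp j (- (- int l)))) \<subseteq> lower n \<mu>"
        using c by (intro keys_sum_subset vv_zp_lower[OF True assms(2)]) (auto simp: d_def)
      ultimately show ?thesis by (simp add: keys_minus)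
    qed
    then show ?thesis using True keys_cst_subset by (simp add: U_def mult.assoc)
  qed (simp add: U_def)
  consider "d = 0" | "d > 0" | "d < 0" by linarith
  then have "keys (TT j M + U * D - (lscale (alpha j \<mu>) (monom_x (rv n j \<mu>)) + lscale (delta j \<mu>) M)) \<subseteq> lower n \<mu>"
  proof cases
    case 1
    then have "D = 0" by (simp add: D_def DDm_def d_def)
    then show ?thesis unfolding T al de using 1 by simp
  next
    case 2
    define m where "m = nat d - 1"
    have m: "nat d = Suc m" using 2 by (simp add: m_def)
    have D': "D = M * zp j (- d) + (\<Sum>l<m. M * zp j (- (1 + int l)))"
    proof -
      have e: "- 1 - int l = - (1 + int l)" for l by simp
      have "D = (\<Sum>l<Suc m. M * zp j (- (1 + int l)))"
        using 2 by (simp add: D_def DDm_def d_def[symmetric] m M_def e del: sum.lessThan_Suc minus_add_distrib)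
      moreover have "1 + int m = d" using m 2 by simp
      ultimately show ?thesis by (simp del: minus_add_distrib)
    qed
    have "K * M + (K' * D - K * (z * D)) - K' * (M * zp j (- d)) = (K' - K) * (D - M * zp j (- d))"
      unfolding zD by (simp add: algebra_simps)
    also have "\<dots> = (\<Sum>l<m. cst (kk' j - kk j) * (monom_x \<mu> * zp j (- (1 + int l))))"
      unfolding D' by (simp add: sum_distrib_left K_def K'_def M_def cst_diff)
    also have "keys \<dots> \<subseteq> lower n \<mu>"
      using m 2 by (intro keys_sum_subset low) auto
    finally show ?thesis unfolding T al de using 2 by simp
  next
    case 3
    define m where "m = nat (- d) - 1"
    have m: "nat (- d) = Suc m" using 3 by (simp add: m_def)
    have "D = - (\<Sum>l<Suc m. M * zp j (int l))"
      using 3 by (simp add: D_def DDm_def d_def[symmetric] m M_def del: sum.lessThan_Suc)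
    then have D': "D = - M - (\<Sum>l<m. M * zp j (int (Suc l)))"
      unfolding sum.lessThan_Suc_shift by simp
    have "K * M + (K' * D - K * (z * D)) - (K * (M * zp j (- d)) + (K - K') * M) = (K' - K) * (D + M)"
      unfolding zD by (simp add: algebra_simps)
    also have "\<dots> = - (\<Sum>l<m. cst (kk' j - kk j) * (monom_x \<mu> * zp j (- (- int (Suc l)))))"
      unfolding D' by (simp add: sum_distrib_left K_def K'_def M_def cst_diff add.commute)
    also have "keys \<dots> \<subseteq> lower n \<mu>"
      unfolding keys_minus using m 3 by (intro keys_sum_subset low) auto
    finally show ?thesis unfolding T al de using 3 by simp
  qed
  from keys_minus_subset[OF this UD] show ?thesis by (simp add: M_def algebra_simps)
qed

text \<open>The case \<open>dd j \<mu> = 0\<close> now belongs to the first branch: there \<mu> is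
  fixed and the single coefficient is \<open>kk j - hh j = kk' j\<close>. This asymmetry with
  \<open>alpha\<close> is the origin of the strict and weak inequalities in
  \<open>rho'\<close>.\<close>

definition alphai :: "nat \<Rightarrow> (nat \<Rightarrow>\<^sub>0 int) \<Rightarrow> 'k" where
  "alphai j \<mu> = (if dd j \<mu> \<ge> 0 then kk' j else kk j)"

definition deltai :: "nat \<Rightarrow> (nat \<Rightarrow>\<^sub>0 int) \<Rightarrow> 'k" where
  "deltai j \<mu> = (if dd j \<mu> > 0 then - hh j else 0)"

lemma TI_monom:
  assumes "0 < j" "j < n" "\<mu> \<in> weights n"
  shows "keys (TI j (monom_x \<mu>) - (lscale (alphai j \<mu>) (monom_x (rv n j \<mu>)) + lscale (deltai j \<mu>) (monom_x \<mu>))) \<subseteq> lower n \<mu>"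
proof -
  have r: "rv n j \<mu> = \<mu>" if "dd j \<mu> = 0"
    using that assms by (intro poly_mapping_eqI) (auto simp: dd_def lookup_rv)
  have "lscale (alpha j \<mu>) (monom_x (rv n j \<mu>)) + lscale (delta j \<mu>) (monom_x \<mu>) - lscale (hh j) (monom_x \<mu>)
    = lscale (alphai j \<mu>) (monom_x (rv n j \<mu>)) + lscale (deltai j \<mu>) (monom_x \<mu>)"
  proof (cases "dd j \<mu>" "0 :: int" rule: linorder_cases)
    case equal
    then show ?thesis using assms r
      by (simp add: alpha_def delta_def alphai_def deltai_def laurent.scale_left_diff_distrib)
  qed (use assms in \<open>simp_all add: alpha_def delta_def alphai_def deltai_def laurent.scale_left_diff_distrib\<close>)
  then have "TI j (monom_x \<mu>) - (lscale (alphai j \<mu>) (monom_x (rv n j \<mu>)) + lscale (deltai j \<mu>) (monom_x \<mu>))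
   = TT j (monom_x \<mu>) - (lscale (alpha j \<mu>) (monom_x (rv n j \<mu>)) + lscale (delta j \<mu>) (monom_x \<mu>))"
    unfolding TI_def by (simp add: algebra_simps)
  then show ?thesis using T_monom[of j \<mu>] assms by simp
qed

lemma T_below: assumes "j \<le> n" "\<mu> \<in> weights n" shows "keys (TT j (monom_x \<mu>)) \<subseteq> below n \<mu>"
proof -
  let ?r = "lscale (alpha j \<mu>) (monom_x (rv n j \<mu>)) + lscale (delta j \<mu>) (monom_x \<mu>) :: 'k laurent"
  have "keys ?r \<subseteq> below n \<mu>"
    using rv_below[OF assms(1) n2 assms(2)] below_refl[OF assms(2)]
    by (intro keys_plus_subset) (auto dest!: subsetD[OF keys_lscale])
  moreover have "keys (TT j (monom_x \<mu>) - ?r) \<subseteq> below n \<mu>"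
    using T_monom[OF assms] by (auto simp: lower_def)
  ultimately have "keys ((TT j (monom_x \<mu>) - ?r) + ?r) \<subseteq> below n \<mu>"
    using keys_plus_subset by blast
  then show ?thesis by (simp del: diff_add_eq)
qed

lemma TI_below: assumes "j \<le> n" "\<mu> \<in> weights n" shows "keys (TI j (monom_x \<mu>)) \<subseteq> below n \<mu>"
  unfolding TI_def using T_below[OF assms] below_refl[OF assms(2)]
  by (intro keys_minus_subset) (auto dest: subsetD[OF keys_lscale])

end

section \<open>Tracking one entry of a weight through the factors of \<open>Y_i\<close>\<close>

definition wt :: "nat \<Rightarrow> (nat \<Rightarrow> int) \<Rightarrow> (nat \<Rightarrow>\<^sub>0 int)" where
  "wt n f = Abs_poly_mapping (\<lambda>p. if p \<in> {1..n} then f p else 0)"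

lemma lookup_wt: "lookup (wt n f) p = (if p \<in> {1..n} then f p else 0)"
proof -
  have "finite {p. (if p \<in> {1..n} then f p else 0) \<noteq> 0}"
    by (rule finite_subset[of _ "{1..n}"]) auto
  then show ?thesis unfolding wt_def by (subst lookup_Abs_poly_mapping) auto
qed

lemma wt_weights: "wt n f \<in> weights n"
  by (rule weightsI) (simp only: lookup_wt if_False)

text \<open>One entry a travels through the fixed sequence h of the other entries: along the product
  \<open>Y_i\<close> only its position j and its sign change.\<close>

definition ins :: "nat \<Rightarrow> (nat \<Rightarrow> int) \<Rightarrow> nat \<Rightarrow> int \<Rightarrow> (nat \<Rightarrow>\<^sub>0 int)" where
  "ins n h j a = wt n (\<lambda>p. if p < j then h p else if p = j then a else h (p - 1))"

lemma lookup_ins: "1 \<le> p \<Longrightarrow> p \<le> n \<Longrightarrow> lookup (ins n h j a) p = (if p < j then h p else if p = j then a else h (p - 1))"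
  by (simp add: ins_def lookup_wt)

lemma ins_weights: "ins n h j a \<in> weights n"
  by (simp add: ins_def wt_weights)

lemma ins_eqI: "\<mu> \<in> weights n \<Longrightarrow> (\<And>p. 1 \<le> p \<Longrightarrow> p \<le> n \<Longrightarrow> lookup \<mu> p = (if p < j then h p else if p = j then a else h (p - 1))) \<Longrightarrow> \<mu> = ins n h j a"
  by (rule weights_eqI[where n = n]) (auto simp: ins_weights lookup_ins)

lemma ht_ins_sign: "1 \<le> j \<Longrightarrow> j \<le> n \<Longrightarrow> \<bar>a\<bar> = \<bar>b\<bar> \<Longrightarrow> ht n m (ins n h j a) = ht n m (ins n h j b)"
  unfolding ht_def by (rule sum.cong) (auto simp: lookup_ins)

lemma rv_ins: assumes "1 \<le> j" "j < n" shows "rv n j (ins n h (j + 1) a) = ins n h j a" "rv n j (ins n h j a) = ins n h (j + 1) a"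
  using assms by (auto intro!: ins_eqI rv_weights ins_weights simp: lookup_rv lookup_ins)

lemma rv_ins_0: "n \<ge> 2 \<Longrightarrow> rv n 0 (ins n h 1 a) = ins n h 1 (- a)"
  and rv_ins_n: "n \<ge> 2 \<Longrightarrow> rv n n (ins n h n a) = ins n h n (- a)"
  by (auto intro!: ins_eqI rv_weights ins_weights simp: lookup_rv lookup_ins)

lemma ht_ins_pos: "1 \<le> j \<Longrightarrow> j \<le> n \<Longrightarrow> 1 \<le> i \<Longrightarrow> i \<le> n \<Longrightarrow> ht n m (ins n h j a) = ht n m (ins n h i a)"
proof -
  have "ht n m (ins n h j a) = ht n m (ins n h 1 a)" if "1 \<le> j" "j \<le> n" for j
    using that
  proof (induction j rule: dec_induct)
    case (step j)
    then have "rv n j (ins n h (j + 1) a) = ins n h j a" by (intro rv_ins) auto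
    then show ?case using step ht_rv[of j n m "ins n h (j + 1) a"] by simp
  qed simp
  then show "1 \<le> j \<Longrightarrow> j \<le> n \<Longrightarrow> 1 \<le> i \<Longrightarrow> i \<le> n \<Longrightarrow> ht n m (ins n h j a) = ht n m (ins n h i a)" by metis
qed

lemma ht_ins: "1 \<le> j \<Longrightarrow> j \<le> n \<Longrightarrow> 1 \<le> i \<Longrightarrow> i \<le> n \<Longrightarrow> \<bar>a\<bar> = \<bar>b\<bar> \<Longrightarrow> ht n m (ins n h j a) = ht n m (ins n h i b)"
  using ht_ins_pos ht_ins_sign by metis

lemma ps_two:
  assumes "p \<noteq> r" "1 \<le> p" "1 \<le> r" "\<And>s. s \<noteq> p \<Longrightarrow> s \<noteq> r \<Longrightarrow> lookup \<nu> s = lookup \<mu> s"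
  shows "ps j \<nu> - ps j \<mu> = (if p \<le> j then lookup \<nu> p - lookup \<mu> p else 0) + (if r \<le> j then lookup \<nu> r - lookup \<mu> r else 0)"
proof -
  have "ps j \<nu> - ps j \<mu> = (\<Sum>s\<in>{1..j}. lookup \<nu> s - lookup \<mu> s)" by (simp add: ps_def sum_subtractf)
  also have "\<dots> = (\<Sum>s\<in>{1..j}. (if s = p then lookup \<nu> p - lookup \<mu> p else 0) + (if s = r then lookup \<nu> r - lookup \<mu> r else 0))"
    using assms by (intro sum.cong) auto
  also have "\<dots> = (if p \<le> j then lookup \<nu> p - lookup \<mu> p else 0) + (if r \<le> j then lookup \<nu> r - lookup \<mu> r else 0)"
    using assms by (simp add: sum.distrib)
  finally show ?thesis .
qed

lemma lt_two:
  assumes "p \<noteq> r" "1 \<le> p" "1 \<le> r" "\<And>s. s \<noteq> p \<Longrightarrow> s \<noteq> r \<Longrightarrow> lookup \<nu> s = lookup \<mu> s" "\<nu> \<in> weights n"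
    and "\<And>m. ht n m \<nu> = ht n m \<mu>" "lookup \<nu> p < lookup \<mu> p" 
    and "lookup \<nu> r \<le> lookup \<mu> r \<or> p < r \<and> lookup \<nu> p + lookup \<nu> r = lookup \<mu> p + lookup \<mu> r"
  shows "\<nu> \<in> lt n \<mu>"
proof -
  have "ps j \<nu> \<le> ps j \<mu>" for j
    using ps_two[OF assms(1-4), of j] assms(7,8) by (smt (verit) nle_le order.strict_iff_not order.trans)
  moreover have "\<nu> \<noteq> \<mu>" using assms(7) by auto
  ultimately show ?thesis using assms(5,6) by (simp add: lt_def below_def)
qed

lemma lt_neg:
  assumes "1 \<le> i" "i \<le> n" "n \<ge> 2" "a > 0" shows "ins n h i (- a) \<in> lt n (ins n h i a)"
proof -
  \<comment> \<open>A second position where both weights agree, to fit \<open>lt_two\<close>; it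
    exists because n is at least 2.\<close>
  define r where "r = (if i = 1 then 2 else 1 :: nat)"
  have l: "lookup (ins n h i (- a)) s = lookup (ins n h i a) s" if "s \<noteq> i" for s
    using that by (simp add: ins_def lookup_wt)
  have "lookup (ins n h i (- a)) i < lookup (ins n h i a) i" using assms by (simp add: lookup_ins)
  then show ?thesis
    using assms l by (intro lt_two[of i r] ins_weights ht_ins_sign) (auto simp: r_def)
qed

lemma lookup_ins_upd:
  assumes "1 \<le> j" "j < n" "1 \<le> i" "i \<le> n"
  defines "p \<equiv> if j < i then j else j + 1"
  shows "lookup (ins n (h(j := b)) i a) s = (if s = i then a else if s = p then b else lookup (ins n h i c) s)"
  using assms by (auto simp: ins_def lookup_wt p_def)

text \<open>When the travelling entry fails to pass \<open>h j\<close>, the latter becomes the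
  traveller. The weight at which it arrives is smaller precisely under the sign conditions that make
  the diagonal coefficient nonzero.\<close>

lemma lt_swap:
  assumes "1 \<le> j" "j < n" "1 \<le> i" "i \<le> n" "e = 1 \<or> e = (- 1 :: int)"
    and ht: "\<And>m. ht n m (ins n (h(j := e * a)) i (e * h j)) = ht n m (ins n h i a)"
    and c: "e = 1 \<and> (j < i \<and> a < h j \<or> i \<le> j \<and> h j < a) \<or> e = -1 \<and> - a < h j"
  shows "ins n (h(j := e * a)) i (e * h j) \<in> lt n (ins n h i a)"
proof -
  define p where "p = (if j < i then j else j + 1)"
  have p: "p \<noteq> i" "1 \<le> p" "p \<le> n" using assms(1-4) by (auto simp: p_def)
  let ?\<nu> = "ins n (h(j := e * a)) i (e * h j)" and ?\<mu> = "ins n h i a"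
  have l: "lookup ?\<nu> s = (if s = i then e * h j else if s = p then e * a else lookup ?\<mu> s)" for s
    unfolding p_def by (rule lookup_ins_upd[OF assms(1-4)])
  have m: "lookup ?\<mu> p = h j" "lookup ?\<mu> i = a" using assms(1-4) p by (auto simp: lookup_ins p_def)
  show ?thesis
  proof (cases "e = 1 \<and> j < i")
    case True
    then show ?thesis using c p l m assms
      by (intro lt_two[of p i] ins_weights ht) (auto simp: p_def)
  next
    case False
    then show ?thesis using c p l m assms
      by (intro lt_two[of i p] ins_weights ht) (auto simp: p_def)
  qed
qed

context daha
begin

text \<open>\<open>F\<close> is a left part of the product \<open>Y_i\<close>. It brings an entry
  that stands at position j with sign e back to position i with sign +, up to smaller weights and
  with leading coefficient c.\<close>

definition tri :: "nat \<Rightarrow> ('k laurent \<Rightarrow> 'k laurent) \<Rightarrow> nat \<Rightarrow> int \<Rightarrow> ((nat \<Rightarrow> int) \<Rightarrow> int \<Rightarrow> 'k) \<Rightarrow> bool" where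
  "tri i F j e c \<longleftrightarrow> lin F \<and> (\<forall>\<kappa>\<in>weights n. keys (F (monom_x \<kappa>)) \<subseteq> below n \<kappa>) \<and>
    (\<forall>h a. keys (F (monom_x (ins n h j (e * a))) - lscale (c h a) (monom_x (ins n h i a))) \<subseteq> lt n (ins n h i a))"

lemma lin_keys_subset:
  assumes "lin F" "\<And>\<kappa>. \<kappa> \<in> A \<Longrightarrow> keys (F (monom_x \<kappa>)) \<subseteq> S" "keys f \<subseteq> A" shows "keys (F f) \<subseteq> S"
  using lin_keys[OF assms(1), of f] assms(2,3) by blast

text \<open>Appends one factor on the right of the product. If this factor has a diagonal term
  \<delta>, the same weight is reread with another entry as traveller, and the target of that
  traveller must be smaller.\<close>

lemma tri_step:
  assumes F: "tri i F j e c" and Op: "lin Op" "\<And>\<kappa>. \<kappa> \<in> weights n \<Longrightarrow> keys (Op (monom_x \<kappa>)) \<subseteq> below n \<kappa>"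
    and i: "1 \<le> i" "i \<le> n" "1 \<le> j'" "j' \<le> n" and e: "e' = 1 \<or> e' = -1"
    and *: "\<And>h a. \<exists>\<delta>. keys (Op (monom_x (ins n h j' (e' * a))) - (lscale (\<alpha> h a) (monom_x (ins n h j (e * a))) 
        + lscale \<delta> (monom_x (ins n h j' (e' * a))))) \<subseteq> lower n (ins n h j' (e' * a)) \<and>
        (\<delta> \<noteq> 0 \<longrightarrow> (\<exists>h' a'. ins n h j' (e' * a) = ins n h' j (e * a') \<and> ins n h' i a' \<in> lt n (ins n h i a)))"
  shows "tri i (\<lambda>f. F (Op f)) j' e' (\<lambda>h a. \<alpha> h a * c h a)"
  unfolding tri_def
proof (intro conjI ballI allI)
  have F1: "lin F" "\<And>\<kappa>. \<kappa> \<in> weights n \<Longrightarrow> keys (F (monom_x \<kappa>)) \<subseteq> below n \<kappa>"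
    and F2: "\<And>h a. keys (F (monom_x (ins n h j (e * a))) - lscale (c h a) (monom_x (ins n h i a))) \<subseteq> lt n (ins n h i a)"
    using F by (auto simp: tri_def)
  show "lin (\<lambda>f. F (Op f))" by (rule lin_comp[OF F1(1) Op(1)])
  fix \<kappa> assume k: "\<kappa> \<in> weights n"
  show "keys (F (Op (monom_x \<kappa>))) \<subseteq> below n \<kappa>"
  proof (rule lin_keys_subset[OF F1(1) _ Op(2)[OF k]])
    fix \<iota> assume "\<iota> \<in> below n \<kappa>"
    moreover from this have "\<iota> \<in> weights n" by (simp add: below_def)
    ultimately show "keys (F (monom_x \<iota>)) \<subseteq> below n \<kappa>" using F1(2) below_trans by blast
  qed
next
  fix h a
  have F1: "lin F" "\<And>\<kappa>. \<kappa> \<in> weights n \<Longrightarrow> keys (F (monom_x \<kappa>)) \<subseteq> below n \<kappa>"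
    and F2: "\<And>h a. keys (F (monom_x (ins n h j (e * a))) - lscale (c h a) (monom_x (ins n h i a))) \<subseteq> lt n (ins n h i a)"
    using F by (auto simp: tri_def)
  let ?\<nu> = "ins n h j' (e' * a)" and ?\<mu> = "ins n h i a"
  obtain \<delta> where d: "keys (Op (monom_x ?\<nu>) - (lscale (\<alpha> h a) (monom_x (ins n h j (e * a))) + lscale \<delta> (monom_x ?\<nu>))) \<subseteq> lower n ?\<nu>"
    and d2: "\<delta> \<noteq> 0 \<longrightarrow> (\<exists>h' a'. ?\<nu> = ins n h' j (e * a') \<and> ins n h' i a' \<in> lt n ?\<mu>)"
    using *[of h a] by blast
  define R where "R = Op (monom_x ?\<nu>) - (lscale (\<alpha> h a) (monom_x (ins n h j (e * a))) + lscale \<delta> (monom_x ?\<nu>))"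
  have htn: "ht n m ?\<nu> = ht n m ?\<mu>" for m using i e by (intro ht_ins) auto
  have "keys (F R) \<subseteq> lower n ?\<nu>"
  proof (rule lin_keys_subset[OF F1(1)])
    show "keys R \<subseteq> lower n ?\<nu>" using d by (simp add: R_def)
    fix \<kappa> assume k: "\<kappa> \<in> lower n ?\<nu>"
    then have "\<kappa> \<in> weights n" by (auto simp: lower_def below_def)
    then show "keys (F (monom_x \<kappa>)) \<subseteq> lower n ?\<nu>" using F1(2) lower_below k by blast
  qed
  then have 1: "keys (F R) \<subseteq> lt n ?\<mu>" by (auto simp: lower_def lt_def below_def htn)
  have 2: "keys (lscale (\<alpha> h a) (F (monom_x (ins n h j (e * a))) - lscale (c h a) (monom_x ?\<mu>))) \<subseteq> lt n ?\<mu>"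
    using F2[of h a] keys_lscale by blast
  have 3: "keys (lscale \<delta> (F (monom_x ?\<nu>))) \<subseteq> lt n ?\<mu>"
  proof (cases "\<delta> = 0")
    case False
    then obtain h' a' where h': "?\<nu> = ins n h' j (e * a')" "ins n h' i a' \<in> lt n ?\<mu>" using d2 by blast
    let ?\<kappa> = "ins n h' i a'"
    have "keys (F (monom_x ?\<nu>) - lscale (c h' a') (monom_x ?\<kappa>)) \<subseteq> lt n ?\<mu>"
      using F2[of h' a'] lt_trans[OF _ h'(2) ins_weights] unfolding h'(1) by blast
    moreover have "keys (lscale (c h' a') (monom_x ?\<kappa>)) \<subseteq> lt n ?\<mu>" using h'(2) keys_lscale by fastforce
    ultimately have "keys ((F (monom_x ?\<nu>) - lscale (c h' a') (monom_x ?\<kappa>)) + lscale (c h' a') (monom_x ?\<kappa>)) \<subseteq> lt n ?\<mu>"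
      by (rule keys_plus_subset)
    then show ?thesis using keys_lscale by (simp only: diff_add_cancel) blast
  qed simp
  have "F (Op (monom_x ?\<nu>)) = F R + (lscale (\<alpha> h a) (F (monom_x (ins n h j (e * a)))) + lscale \<delta> (F (monom_x ?\<nu>)))"
    unfolding lin_scale[OF F1(1), symmetric] lin_add[OF F1(1), symmetric] by (simp add: R_def)
  then have "F (Op (monom_x ?\<nu>)) - lscale (\<alpha> h a * c h a) (monom_x ?\<mu>)
    = F R + (lscale (\<alpha> h a) (F (monom_x (ins n h j (e * a))) - lscale (c h a) (monom_x ?\<mu>)) + lscale \<delta> (F (monom_x ?\<nu>)))"
    by (simp add: laurent.scale_right_diff_distrib laurent.scale_scale)
  also have "keys \<dots> \<subseteq> lt n ?\<mu>" using 1 2 3 by (intro keys_plus_subset)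
  finally show "keys (F (Op (monom_x ?\<nu>)) - lscale (\<alpha> h a * c h a) (monom_x ?\<mu>)) \<subseteq> lt n ?\<mu>" .
qed

lemma tri_cong: "tri i F j e c \<Longrightarrow> (\<And>f. F f = G f) \<Longrightarrow> (\<And>h a. c h a = c' h a) \<Longrightarrow> tri i G j e c'"
proof -
  assume "tri i F j e c" "\<And>f. F f = G f" "\<And>h a. c h a = c' h a"
  moreover from this have "F = G" "c = c'" by (intro ext; simp)+
  ultimately show ?thesis by simp
qed

definition t1 :: "bool \<Rightarrow> int" where "t1 b = (if b then 1 else - 1)"

lemma kk_mid: "1 \<le> j \<Longrightarrow> j < n \<Longrightarrow> kk j = hp Pt 1 \<and> kk' j = hp Pt (- 1)"
  by (simp add: kp_def)

text \<open>This and the next lemmas assemble \<open>Y_i\<close> from left to right: up to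
  \<open>T_(n-1)\<close>, the sign change by \<open>T_n\<close>, down to \<open>T_1\<close>, the
  sign change by \<open>T_0\<close>, then the inverse factors. Each crossing contributes a factor
  t^(1/2) or t^(-1/2).\<close>

lemma tri_A: assumes "1 \<le> i" "i \<le> j" "j \<le> n"
  shows "tri i (foldr TT [i..<j]) j 1 (\<lambda>h a. hp Pt (\<Sum>p\<in>{i..<j}. t1 (h p \<le> a)))"
  using assms(2,3)
proof (induction j rule: dec_induct)
  case base
  show ?case by (simp add: tri_def lin_id[folded id_def] below_refl flip: id_def)
next
  case (step j)
  have j: "1 \<le> j" "j < n" "j \<le> n" "i \<le> n" using step assms by auto
  note kk = kk_mid[OF j(1,2)]
  have "tri i (\<lambda>f. foldr TT [i..<j] (TT j f)) (Suc j) 1 (\<lambda>h a. (if h j > a then kk' j else kk j) * hp Pt (\<Sum>p\<in>{i..<j}. t1 (h p \<le> a)))"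
  proof (rule tri_step[OF step.IH])
    fix h a
    let ?\<nu> = "ins n h (Suc j) (1 * a)"
    have d: "dd j ?\<nu> = h j - a" using j by (simp add: dd_def lookup_ins)
    have "keys (TT j (monom_x ?\<nu>) - (lscale (if h j > a then kk' j else kk j) (monom_x (ins n h j (1 * a))) + lscale (delta j ?\<nu>) (monom_x ?\<nu>)))
      \<subseteq> lower n ?\<nu>"
      using T_monom[OF j(3) ins_weights[of n h "Suc j" "1 * a"]] rv_ins(1)[OF j(1,2), of h a] d j(1) by (simp add: alpha_def)
    moreover have "\<exists>h' a'. ?\<nu> = ins n h' j (1 * a') \<and> ins n h' i a' \<in> lt n (ins n h i a)" if "delta j ?\<nu> \<noteq> 0"
    proof -
      have n: "h j < a" using that d by (auto simp: delta_def split: if_splits)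
      have e: "ins n h (Suc j) a = ins n (h(j := 1 * a)) j (1 * h j)"
        using j by (intro ins_eqI ins_weights) (auto simp: lookup_ins)
      have "ins n (h(j := 1 * a)) i (1 * h j) \<in> lt n (ins n h i a)"
      proof (rule lt_swap)
        show "ht n m (ins n (h(j := 1 * a)) i (1 * h j)) = ht n m (ins n h i a)" for m
          using ht_ins_pos[of i n j m "h(j := 1 * a)" "1 * h j"] ht_ins_pos[of i n "Suc j" m h a] e j assms by simp
      qed (use j assms step n in auto)
      then show ?thesis using e by auto
    qed
    ultimately show "\<exists>\<delta>. keys (TT j (monom_x ?\<nu>) - (lscale (if h j > a then kk' j else kk j) (monom_x (ins n h j (1 * a))) + lscale \<delta> (monom_x ?\<nu>)))
      \<subseteq> lower n ?\<nu> \<and> (\<delta> \<noteq> 0 \<longrightarrow> (\<exists>h' a'. ?\<nu> = ins n h' j (1 * a') \<and> ins n h' i a' \<in> lt n (ins n h i a)))"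
      by blast
  qed (use j step assms lin_T T_below in auto)
  then show ?case
  proof (rule tri_cong)
    show "(if h j > a then kk' j else kk j) * hp Pt (\<Sum>p\<in>{i..<j}. t1 (h p \<le> a)) = hp Pt (\<Sum>p\<in>{i..<Suc j}. t1 (h p \<le> a))" for h :: "nat \<Rightarrow> int" and a
      using step kk by (cases "h j \<le> a") (auto simp add: sum.atLeastLessThan_Suc t1_def hp_mult add.commute)
  qed (use step in auto)
qed

definition nsgn :: "int \<Rightarrow> int" where "nsgn a = (if a \<ge> 0 then 1 else - 1)"

lemma tri_n: assumes "1 \<le> i" "i \<le> n"
  shows "tri i (foldr TT ([i..<n] @ [n])) n (- 1) (\<lambda>h a. hp Ptn (nsgn a) * hp Pt (\<Sum>p\<in>{i..<n}. t1 (h p \<le> a)))"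
proof -
  have kk: "kk n = hp Ptn 1" "kk' n = hp Ptn (- 1)" using n2 by (auto simp: kp_def)
  have "tri i (\<lambda>f. foldr TT [i..<n] (TT n f)) n (- 1) (\<lambda>h a. (if - a > 0 then kk' n else kk n) * hp Pt (\<Sum>p\<in>{i..<n}. t1 (h p \<le> a)))"
  proof (rule tri_step[OF tri_A])
    fix h a
    let ?\<nu> = "ins n h n (- 1 * a)"
    have d: "dd n ?\<nu> = - a" using n2 by (simp add: dd_def lookup_ins)
    have "keys (TT n (monom_x ?\<nu>) - (lscale (if - a > 0 then kk' n else kk n) (monom_x (ins n h n (1 * a))) + lscale (delta n ?\<nu>) (monom_x ?\<nu>)))
      \<subseteq> lower n ?\<nu>"
      using T_monom[of n ?\<nu>] ins_weights[of n h n "- 1 * a"] rv_ins_n[OF n2, of h "- a"] d n2 by (simp add: alpha_def)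
    moreover have "\<exists>h' a'. ?\<nu> = ins n h' n (1 * a') \<and> ins n h' i a' \<in> lt n (ins n h i a)" if "delta n ?\<nu> \<noteq> 0"
      using that d lt_neg[OF assms n2, of a h] by (auto simp: delta_def split: if_splits intro!: exI[of _ h] exI[of _ "- a"])
    ultimately show "\<exists>\<delta>. keys (TT n (monom_x ?\<nu>) - (lscale (if - a > 0 then kk' n else kk n) (monom_x (ins n h n (1 * a))) + lscale \<delta> (monom_x ?\<nu>)))
      \<subseteq> lower n ?\<nu> \<and> (\<delta> \<noteq> 0 \<longrightarrow> (\<exists>h' a'. ?\<nu> = ins n h' n (1 * a') \<and> ins n h' i a' \<in> lt n (ins n h i a)))"
      by blast
  qed (use assms n2 lin_T T_below in auto)
  then show ?thesis
    by (rule tri_cong) (auto simp: kk nsgn_def)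
qed

lemma tri_B: assumes "1 \<le> i" "i \<le> n" "1 \<le> j" "j \<le> n"
  shows "tri i (foldr TT ([i..<n] @ [n] @ rev [j..<n])) j (- 1)
    (\<lambda>h a. hp Ptn (nsgn a) * hp Pt ((\<Sum>p\<in>{i..<n}. t1 (h p \<le> a)) + (\<Sum>p\<in>{j..<n}. t1 (h p \<ge> - a))))"
  using assms(4,3)
proof (induction j rule: inc_induct)
  case base
  show ?case by (rule tri_cong[OF tri_n[OF assms(1,2)]]) simp_all
next
  case (step j)
  then have j: "1 \<le> j" "j < n" "j \<le> n" by auto
  note kk = kk_mid[OF j(1,2)]
  let ?c = "\<lambda>j h a. hp Ptn (nsgn a) * hp Pt ((\<Sum>p\<in>{i..<n}. t1 (h p \<le> a)) + (\<Sum>p\<in>{j..<n}. t1 (h p \<ge> - a)))"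
  have "tri i (\<lambda>f. foldr TT ([i..<n] @ [n] @ rev [Suc j..<n]) (TT j f)) j (- 1) (\<lambda>h a. (if - a > h j then kk' j else kk j) * ?c (Suc j) h a)"
  proof (rule tri_step[OF step.IH])
    fix h a
    let ?\<nu> = "ins n h j (- 1 * a)"
    have d: "dd j ?\<nu> = - a - h j" using j by (simp add: dd_def lookup_ins)
    have "keys (TT j (monom_x ?\<nu>) - (lscale (if - a > h j then kk' j else kk j) (monom_x (ins n h (Suc j) (- 1 * a))) + lscale (delta j ?\<nu>) (monom_x ?\<nu>)))
      \<subseteq> lower n ?\<nu>"
      using T_monom[OF j(3) ins_weights[of n h j "- 1 * a"]] rv_ins(2)[OF j(1,2), of h "- a"] d j(1) by (simp add: alpha_def)
    moreover have "\<exists>h' a'. ?\<nu> = ins n h' (Suc j) (- 1 * a') \<and> ins n h' i a' \<in> lt n (ins n h i a)" if "delta j ?\<nu> \<noteq> 0"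
    proof -
      have n: "- a < h j" using that d by (auto simp: delta_def split: if_splits)
      have e: "ins n h j (- a) = ins n (h(j := - 1 * a)) (Suc j) (- 1 * (- 1 * h j))"
        using j by (intro ins_eqI ins_weights) (auto simp: lookup_ins)
      have "ins n (h(j := - 1 * a)) i (- 1 * h j) \<in> lt n (ins n h i a)"
      proof (rule lt_swap)
        show "ht n m (ins n (h(j := - 1 * a)) i (- 1 * h j)) = ht n m (ins n h i a)" for m
          using ht_ins[of i n "Suc j" "- 1 * h j" "h j" m "h(j := - 1 * a)"] ht_ins[of i n j a "- a" m h] e j assms by simp
      qed (use j assms step n in auto)
      then show ?thesis using e by (intro exI[of _ "h(j := - 1 * a)"] exI[of _ "- 1 * h j"]) simp
    qed
    ultimately show "\<exists>\<delta>. keys (TT j (monom_x ?\<nu>) - (lscale (if - a > h j then kk' j else kk j) (monom_x (ins n h (Suc j) (- 1 * a))) + lscale \<delta> (monom_x ?\<nu>)))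
      \<subseteq> lower n ?\<nu> \<and> (\<delta> \<noteq> 0 \<longrightarrow> (\<exists>h' a'. ?\<nu> = ins n h' (Suc j) (- 1 * a') \<and> ins n h' i a' \<in> lt n (ins n h i a)))"
      by blast
  qed (use j step assms lin_T T_below in auto)
  then show ?case
  proof (rule tri_cong)
    have "{j..<n} = insert j {Suc j..<n}" using j by auto
    then show "(if - a > h j then kk' j else kk j) * ?c (Suc j) h a = ?c j h a" for h :: "nat \<Rightarrow> int" and a
      using kk by (simp add: t1_def hp_mult[symmetric])
    show "foldr TT ([i..<n] @ [n] @ rev [Suc j..<n]) (TT j f) = foldr TT ([i..<n] @ [n] @ rev [j..<n]) f" for f
      using j by (simp add: upt_conv_Cons)
  qed
qed

lemma tri_0: assumes "1 \<le> i" "i \<le> n"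
  shows "tri i (foldr TT ([i..<n] @ [n] @ rev [1..<n] @ [0])) 1 1
    (\<lambda>h a. q powi a * hp Pt0 (nsgn a) * (hp Ptn (nsgn a) * hp Pt ((\<Sum>p\<in>{i..<n}. t1 (h p \<le> a)) + (\<Sum>p\<in>{1..<n}. t1 (h p \<ge> - a)))))"
proof -
  have kk: "kk 0 = hp Pt0 1" "kk' 0 = hp Pt0 (- 1)" by (auto simp: kp_def)
  let ?c = "\<lambda>h a. hp Ptn (nsgn a) * hp Pt ((\<Sum>p\<in>{i..<n}. t1 (h p \<le> a)) + (\<Sum>p\<in>{1..<n}. t1 (h p \<ge> - a)))"
  have "tri i (\<lambda>f. foldr TT ([i..<n] @ [n] @ rev [1..<n]) (TT 0 f)) 1 1 (\<lambda>h a. q powi a * (if - a > 0 then kk' 0 else kk 0) * ?c h a)"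
  proof (rule tri_step[OF tri_B])
    fix h a
    let ?\<nu> = "ins n h 1 (1 * a)"
    have l: "lookup ?\<nu> 1 = a" using n2 by (simp add: lookup_ins)
    then have d: "dd 0 ?\<nu> = - a" by (simp add: dd_def)
    have "keys (TT 0 (monom_x ?\<nu>) - (lscale (q powi a * (if - a > 0 then kk' 0 else kk 0)) (monom_x (ins n h 1 (- 1 * a))) + lscale (delta 0 ?\<nu>) (monom_x ?\<nu>)))
      \<subseteq> lower n ?\<nu>"
      using T_monom[of 0 ?\<nu>] ins_weights[of n h 1 "1 * a"] rv_ins_0[OF n2, of h a] d l by (simp add: alpha_def)
    moreover have "\<exists>h' a'. ?\<nu> = ins n h' 1 (- 1 * a') \<and> ins n h' i a' \<in> lt n (ins n h i a)" if "delta 0 ?\<nu> \<noteq> 0"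
      using that d lt_neg[OF assms n2, of a h] by (auto simp: delta_def split: if_splits intro!: exI[of _ h] exI[of _ "- a"])
    ultimately show "\<exists>\<delta>. keys (TT 0 (monom_x ?\<nu>) - (lscale (q powi a * (if - a > 0 then kk' 0 else kk 0)) (monom_x (ins n h 1 (- 1 * a))) + lscale \<delta> (monom_x ?\<nu>)))
      \<subseteq> lower n ?\<nu> \<and> (\<delta> \<noteq> 0 \<longrightarrow> (\<exists>h' a'. ?\<nu> = ins n h' 1 (- 1 * a') \<and> ins n h' i a' \<in> lt n (ins n h i a)))"
      by blast
  qed (use assms n2 lin_T T_below in auto)
  then show ?thesis
    by (rule tri_cong) (auto simp: kk nsgn_def)
qed

lemma tri_C: assumes "1 \<le> i" "i \<le> n" "1 \<le> j" "j \<le> i"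
  shows "tri i (\<lambda>f. foldr TT ([i..<n] @ [n] @ rev [1..<n] @ [0]) (foldr TI [1..<j] f)) j 1
    (\<lambda>h a. q powi a * hp Pt0 (nsgn a) * (hp Ptn (nsgn a) * hp Pt ((\<Sum>p\<in>{i..<n}. t1 (h p \<le> a)) + (\<Sum>p\<in>{1..<n}. t1 (h p \<ge> - a))
      + (\<Sum>p\<in>{1..<j}. t1 (h p < a)))))"
  using assms(3,4)
proof (induction j rule: dec_induct)
  case base
  show ?case by (rule tri_cong[OF tri_0[OF assms(1,2)]]) simp_all
next
  case (step j)
  then have j: "1 \<le> j" "j < n" "j \<le> n" "j < i" using assms by auto
  note kk = kk_mid[OF j(1,2)]
  let ?c = "\<lambda>j h a. q powi a * hp Pt0 (nsgn a) * (hp Ptn (nsgn a) * hp Pt ((\<Sum>p\<in>{i..<n}. t1 (h p \<le> a)) + (\<Sum>p\<in>{1..<n}. t1 (h p \<ge> - a))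
      + (\<Sum>p\<in>{1..<j}. t1 (h p < a))))"
  let ?F = "foldr TT ([i..<n] @ [n] @ rev [1..<n] @ [0])"
  have "tri i (\<lambda>f. ?F (foldr TI [1..<j] (TI j f))) (Suc j) 1 (\<lambda>h a. (if h j \<ge> a then kk' j else kk j) * ?c j h a)"
  proof (rule tri_step[of _ "\<lambda>f. ?F (foldr TI [1..<j] f)", OF step.IH])
    fix h a
    let ?\<nu> = "ins n h (Suc j) (1 * a)"
    have d: "dd j ?\<nu> = h j - a" using j by (simp add: dd_def lookup_ins)
    have "keys (TI j (monom_x ?\<nu>) - (lscale (if h j \<ge> a then kk' j else kk j) (monom_x (ins n h j (1 * a))) + lscale (deltai j ?\<nu>) (monom_x ?\<nu>)))
      \<subseteq> lower n ?\<nu>"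
      using TI_monom[of j ?\<nu>] ins_weights[of n h "Suc j" "1 * a"] rv_ins(1)[OF j(1,2), of h a] d j by (simp add: alphai_def)
    moreover have "\<exists>h' a'. ?\<nu> = ins n h' j (1 * a') \<and> ins n h' i a' \<in> lt n (ins n h i a)" if "deltai j ?\<nu> \<noteq> 0"
    proof -
      have n: "a < h j" using that d by (auto simp: deltai_def split: if_splits)
      have e: "ins n h (Suc j) a = ins n (h(j := 1 * a)) j (1 * h j)"
        using j by (intro ins_eqI ins_weights) (auto simp: lookup_ins)
      have "ins n (h(j := 1 * a)) i (1 * h j) \<in> lt n (ins n h i a)"
      proof (rule lt_swap)
        show "ht n m (ins n (h(j := 1 * a)) i (1 * h j)) = ht n m (ins n h i a)" for m
          using ht_ins_pos[of i n j m "h(j := 1 * a)" "1 * h j"] ht_ins_pos[of i n "Suc j" m h a] e j assms by simp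
      qed (use j assms step n in auto)
      then show ?thesis using e by auto
    qed
    ultimately show "\<exists>\<delta>. keys (TI j (monom_x ?\<nu>) - (lscale (if h j \<ge> a then kk' j else kk j) (monom_x (ins n h j (1 * a))) + lscale \<delta> (monom_x ?\<nu>)))
      \<subseteq> lower n ?\<nu> \<and> (\<delta> \<noteq> 0 \<longrightarrow> (\<exists>h' a'. ?\<nu> = ins n h' j (1 * a') \<and> ins n h' i a' \<in> lt n (ins n h i a)))"
      by blast
  qed (use j step assms lin_TI TI_below in auto)
  then show ?case
  proof (rule tri_cong)
    show "(if h j \<ge> a then kk' j else kk j) * ?c j h a = ?c (Suc j) h a" for h :: "nat \<Rightarrow> int" and a
      using step kk by (simp add: sum.atLeastLessThan_Suc t1_def hp_mult[symmetric])
  qed (use step in auto)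
qed

end

text \<open>The exponent of t as the crossings deliver it: every other position contributes -1, 0 or
  1. Agreement with \<open>rho\<close> is shown in \<open>rho_rho'\<close>.\<close>

definition rho' :: "nat \<Rightarrow> (nat \<Rightarrow>\<^sub>0 int) \<Rightarrow> nat \<Rightarrow> int" where
  "rho' n \<mu> i = (\<Sum>p\<in>{1..n} - {i}. of_bool (if p < i then lookup \<mu> p < lookup \<mu> i else lookup \<mu> p \<le> lookup \<mu> i)
     + of_bool (lookup \<mu> p \<ge> - lookup \<mu> i) - 1)"

context daha
begin

definition yev :: "(nat \<Rightarrow>\<^sub>0 int) \<Rightarrow> nat \<Rightarrow> 'k" where
  "yev \<mu> i = q powi lookup \<mu> i * hp Pt 2 powi rho' n \<mu> i * (hp Ptn 1 * hp Pt0 1) powi sigma \<mu> i"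

lemma hp_powi: "hp p a powi m = hp p (a * m)"
proof -
  have nat: "hp p a ^ l = hp p (a * int l)" for a l
    by (induction l) (simp_all add: hp_mult distrib_left mult.commute)
  show ?thesis
  proof (cases "m \<ge> 0")
    case True
    then show ?thesis using nat[of a "nat m"] by (simp add: power_int_def)
  next
    case False
    then show ?thesis using nat[of "- a" "nat (- m)"] by (simp add: power_int_def hp_uminus)
  qed
qed

lemma YY_tri: assumes "\<mu> \<in> weights n" "1 \<le> i" "i \<le> n"
  shows "keys (YY i (monom_x \<mu>) - lscale (yev \<mu> i) (monom_x \<mu>)) \<subseteq> lt n \<mu>" "keys (YY i (monom_x \<mu>)) \<subseteq> below n \<mu>"
proof -
  define h where "h = (\<lambda>p. if p < i then lookup \<mu> p else lookup \<mu> (p + 1))"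
  define a where "a = lookup \<mu> i"
  have m: "\<mu> = ins n h i a" using assms by (intro ins_eqI) (auto simp: h_def a_def)
  let ?e = "(\<Sum>p\<in>{i..<n}. t1 (h p \<le> a)) + (\<Sum>p\<in>{1..<n}. t1 (h p \<ge> - a)) + (\<Sum>p\<in>{1..<i}. t1 (h p < a))"
  have split: "{1..<n} = {1..<i} \<union> {i..<n}" "{1..n} - {i} = {1..<i} \<union> Suc ` {i..<n}"
    using assms by (auto simp: image_iff)
  have dis: "{1..<i} \<inter> {i..<n} = {}" "{1..<i} \<inter> Suc ` {i..<n} = {}" by auto
  \<comment> \<open>Every other entry is crossed twice, each time with half a power of t, hence the
    factor 2.\<close>
  have "2 * rho' n \<mu> i = (\<Sum>p\<in>{1..n} - {i}. t1 (if p < i then lookup \<mu> p < a else lookup \<mu> p \<le> a) + t1 (lookup \<mu> p \<ge> - a))"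
    unfolding rho'_def sum_distrib_left by (intro sum.cong) (auto simp: t1_def a_def)
  also have "\<dots> = (\<Sum>p\<in>{1..<i}. t1 (h p < a) + t1 (h p \<ge> - a)) + (\<Sum>p\<in>{i..<n}. t1 (h p \<le> a) + t1 (h p \<ge> - a))"
  proof -
    have "sum g (Suc ` {i..<n}) = (\<Sum>p\<in>{i..<n}. g (Suc p))" for g :: "nat \<Rightarrow> int"
      by (subst sum.reindex) (simp_all add: comp_def)
    then show ?thesis
      unfolding split(2) by (subst sum.union_disjoint[OF _ _ dis(2)])
        (auto simp: h_def simp del: image_Suc_atLeastLessThan intro!: arg_cong2[of _ _ _ _ "(+)"] sum.cong)
  qed
  also have "\<dots> = ?e"
    unfolding split(1) by (subst sum.union_disjoint[OF _ _ dis(1)]) (auto simp: sum.distrib)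
  finally have e: "?e = 2 * rho' n \<mu> i" ..
  have "yev \<mu> i = q powi a * hp Pt0 (nsgn a) * (hp Ptn (nsgn a) * hp Pt ?e)"
    unfolding e yev_def by (simp add: hp_powi power_int_mult_distrib sigma_def nsgn_def a_def)
  then show "keys (YY i (monom_x \<mu>) - lscale (yev \<mu> i) (monom_x \<mu>)) \<subseteq> lt n \<mu>" "keys (YY i (monom_x \<mu>)) \<subseteq> below n \<mu>"
    using tri_C[OF assms(2,3,2) order_refl] m assms(1) unfolding tri_def YY_def by (metis mult_1)+
qed

end

section \<open>Symmetries of the spectrum\<close>

definition sw :: "nat \<Rightarrow> nat \<Rightarrow> nat" where "sw j i = (if i = j then j + 1 else if i = j + 1 then j else i)"

text \<open>The move on spectral weights made by \<open>UU\<close>. It differs from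
  \<open>rv n 0\<close>, which describes the action of \<open>s_0\<close> on exponents.\<close>

definition s0 :: "(nat \<Rightarrow>\<^sub>0 int) \<Rightarrow> (nat \<Rightarrow>\<^sub>0 int)" where
  "s0 \<mu> = Poly_Mapping.update 1 (- 1 - lookup \<mu> 1) \<mu>"

lemma lookup_s0: "lookup (s0 \<mu>) p = (if p = 1 then - 1 - lookup \<mu> 1 else lookup \<mu> p)"
  by (simp add: s0_def lookup_update)

lemma s0_weights: "n \<ge> 1 \<Longrightarrow> \<mu> \<in> weights n \<Longrightarrow> s0 \<mu> \<in> weights n"
  by (rule weightsI) (auto simp: lookup_s0 weights_0)

lemma rho'_swap:
  assumes "1 \<le> j" "j < n" "lookup \<mu> j \<noteq> lookup \<mu> (j + 1)"
  shows "rho' n (rv n j \<mu>) i = rho' n \<mu> (sw j i)"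
proof -
  have l: "lookup (rv n j \<mu>) p = lookup \<mu> (sw j p)" for p using assms by (auto simp: lookup_rv sw_def)
  show ?thesis unfolding rho'_def l
  proof (rule sum.reindex_bij_witness[of _ "sw j" "sw j"])
    fix p
    assume p: "p \<in> {1..n} - {i}"
    then show "sw j (sw j p) = p" "sw j p \<in> {1..n} - {sw j i}" using assms by (auto simp: sw_def split: if_splits)
    \<comment> \<open>Only the pair j, j + 1 changes its relative order. For this pair weak and
      strict comparison agree, because the two entries differ.\<close>
    have "(p = j \<and> i = j + 1) \<or> (p = j + 1 \<and> i = j) \<or> (sw j p < sw j i) = (p < i)"
      by (cases "p = j"; cases "p = j + 1"; cases "i = j"; cases "i = j + 1") (use p in \<open>auto simp: sw_def\<close>)
    then consider "p = j" "i = j + 1" | "p = j + 1" "i = j" | "(sw j p < sw j i) = (p < i)" by blast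
    then show "of_bool (if sw j p < sw j i then lookup \<mu> (sw j p) < lookup \<mu> (sw j i) else lookup \<mu> (sw j p) \<le> lookup \<mu> (sw j i)) +
         of_bool (- lookup \<mu> (sw j i) \<le> lookup \<mu> (sw j p)) - 1 =
         of_bool (if p < i then lookup \<mu> (sw j p) < lookup \<mu> (sw j i) else lookup \<mu> (sw j p) \<le> lookup \<mu> (sw j i)) +
         of_bool (- lookup \<mu> (sw j i) \<le> lookup \<mu> (sw j p)) - (1::int)"
      by cases (use assms in \<open>auto simp: sw_def\<close>)
  next
    fix p assume "p \<in> {1..n} - {sw j i}"
    then show "sw j (sw j p) = p" "sw j p \<in> {1..n} - {i}" using assms by (auto simp: sw_def split: if_splits)
  qed
qed

lemma rho'_flip:
  assumes "n \<ge> 2" shows "i < n \<Longrightarrow> rho' n (rv n n \<mu>) i = rho' n \<mu> i"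
    "lookup \<mu> n \<noteq> 0 \<Longrightarrow> rho' n (rv n n \<mu>) n = - rho' n \<mu> n"
  unfolding rho'_def sum_negf[symmetric]
  by (rule sum.cong; use assms in \<open>auto simp: lookup_rv of_bool_def cong: if_cong\<close>)+

lemma rho'_s0:
  assumes "n \<ge> 2" shows "1 < i \<Longrightarrow> rho' n (s0 \<mu>) i = rho' n \<mu> i"
    "rho' n (s0 \<mu>) 1 = - rho' n \<mu> 1"
  unfolding rho'_def sum_negf[symmetric]
  by (rule sum.cong; use assms in \<open>auto simp: lookup_s0 of_bool_def cong: if_cong\<close>)+

lemma sigma_swap: "1 \<le> j \<Longrightarrow> j < n \<Longrightarrow> sigma (rv n j \<mu>) i = sigma \<mu> (sw j i)"
  by (auto simp: sigma_def lookup_rv sw_def)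

text \<open>Both sides depend on x only through x + 1/x, and the resulting quadratic polynomial has
  the roots U V + 1/(U V) and -(U/V + V/U).\<close>

lemma quad_factor:
  fixes x U V :: "'f::field"
  assumes "x \<noteq> 0" "U \<noteq> 0" "V \<noteq> 0"
    "(x - 1 / x) ^ 2 = ((V - 1 / V) / x + (U - 1 / U)) * ((V - 1 / V) * x + (U - 1 / U))"
  shows "x = U * V \<or> x = 1 / (U * V) \<or> x = - U / V \<or> x = - V / U"
proof -
  define y U' V' where "y = 1 / x" "U' = 1 / U" "V' = 1 / V"
  have i: "x * y = 1" "U * U' = 1" "V * V' = 1" using assms by (auto simp: y_U'_V'_def)
  have 1: "(x - y) ^ 2 = ((V - V') * y + (U - U')) * ((V - V') * x + (U - U'))"
    using assms(4) by (simp add: y_U'_V'_def)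
  have e1: "(x - y)^2 = (x + y)^2 - 4" using i(1) by (simp add: power2_eq_square algebra_simps)
  have e2: "((V - V') * y + (U - U')) * ((V - V') * x + (U - U')) = (V - V')^2 * (x * y) + (U - U')^2 + (U - U') * (V - V') * (x + y)"
    by (simp add: power2_eq_square algebra_simps)
  have e3: "(V - V')^2 = V^2 + V'^2 - 2" "(U - U')^2 = U^2 + U'^2 - 2" using i by (simp_all add: power2_eq_square algebra_simps)
  have e4: "(U * V + U' * V') * (U * V' + U' * V) = U^2 * (V * V') + V^2 * (U * U') + V'^2 * (U * U') + U'^2 * (V * V')"
    by (simp add: power2_eq_square algebra_simps)
  have "(x + y - (U * V + U' * V')) * (x + y + (U * V' + U' * V))
    = (x + y)^2 - (U - U') * (V - V') * (x + y) - (U * V + U' * V') * (U * V' + U' * V)"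
    by (simp add: power2_eq_square algebra_simps)
  also have "\<dots> = 0" unfolding e4 i using 1[unfolded e1 e2 e3 i] by simp
  finally have "(x + y - (U * V + U' * V')) * (x + y + (U * V' + U' * V)) = 0" .
  then have "x + y - (U * V + U' * V') = 0 \<or> x + y + (U * V' + U' * V) = 0"
    by (simp only: mult_eq_0_iff)
  then have "x + y = U * V + U' * V' \<or> x + y = - (U * V') - U' * V"
    by (metis diff_conv_add_uminus eq_iff_diff_eq_0 eq_neg_iff_add_eq_0 minus_add_distrib)
  then show ?thesis
  proof
    assume "x + y = U * V + U' * V'"
    moreover have "(x - U * V) * (x - U' * V') = x * ((x + y) - (U * V + U' * V')) - (x * y) + (U * U') * (V * V')"
      by (simp add: algebra_simps)
    ultimately have "(x - U * V) * (x - U' * V') = 0" by (simp add: i)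
    then show ?thesis by (auto simp: y_U'_V'_def)
  next
    assume "x + y = - (U * V') - U' * V"
    moreover have "(x + U * V') * (x + U' * V) = x * ((x + y) - (- (U * V') - U' * V)) - (x * y) + (U * U') * (V * V')"
      by (simp add: algebra_simps)
    ultimately have "(x + U * V') * (x + U' * V) = 0" by (simp add: i)
    then show ?thesis by (auto simp: y_U'_V'_def eq_neg_iff_add_eq_0)
  qed
qed

context daha
begin

section \<open>Joint eigenvectors\<close>

abbreviation LP :: "'k laurent set" where "LP \<equiv> laurent_polys n"

lemma LP_iff: "f \<in> LP \<longleftrightarrow> keys f \<subseteq> weights n"
  by (simp add: laurent_polys_def)

lemma LP_add: "f \<in> LP \<Longrightarrow> g \<in> LP \<Longrightarrow> f + g \<in> LP"
  and LP_scale: "f \<in> LP \<Longrightarrow> lscale c f \<in> LP"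
  and LP_diff: "f \<in> LP \<Longrightarrow> g \<in> LP \<Longrightarrow> f - g \<in> LP"
  unfolding LP_iff by (rule keys_plus_subset keys_minus_subset; assumption | use keys_lscale in blast)+

lemma LP_lin: "lin F \<Longrightarrow> (\<And>\<kappa>. \<kappa> \<in> weights n \<Longrightarrow> keys (F (monom_x \<kappa>)) \<subseteq> below n \<kappa>) \<Longrightarrow> f \<in> LP \<Longrightarrow> F f \<in> LP"
  unfolding LP_iff by (rule lin_keys_subset[of F "weights n"]) (auto simp: below_def)

lemma LP_T: "j \<le> n \<Longrightarrow> f \<in> LP \<Longrightarrow> TT j f \<in> LP"
  by (rule LP_lin[OF lin_T]) (auto dest: subsetD[OF T_below])

lemma LP_TI: "j \<le> n \<Longrightarrow> f \<in> LP \<Longrightarrow> TI j f \<in> LP"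
  by (simp add: TI_def LP_diff LP_T LP_scale)

lemma LP_xpow: "1 \<le> p \<Longrightarrow> p \<le> n \<Longrightarrow> f \<in> LP \<Longrightarrow> xpow p m * f \<in> LP"
  unfolding LP_iff xpow_def keys_mult_monom
  by (auto intro!: weightsI simp: lookup_add lookup_single when_def dest!: weights_0 subsetD)

lemma LP_U: "f \<in> LP \<Longrightarrow> UU f \<in> LP"
  using n2 by (simp add: UU_def LP_scale LP_TI LP_xpow del: One_nat_def)

text \<open>Arbitrary eigenvalues w are allowed because the eigenvalues of an intertwined vector are
  known before any weight with this spectrum has been found.\<close>

definition eigw :: "(nat \<Rightarrow> 'k) \<Rightarrow> 'k laurent \<Rightarrow> bool" where
  "eigw w f \<longleftrightarrow> f \<in> LP \<and> (\<forall>i\<in>{1..n}. YY i f = lscale (w i) f)"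

definition eig :: "(nat \<Rightarrow>\<^sub>0 int) \<Rightarrow> 'k laurent \<Rightarrow> bool" where
  "eig \<mu> f \<longleftrightarrow> f \<noteq> 0 \<and> eigw (yev \<mu>) f"

lemma YY_top:
  assumes "1 \<le> i" "i \<le> n" "f \<in> LP" "\<And>\<kappa>. \<kappa> \<in> keys f \<Longrightarrow> \<nu> \<notin> lt n \<kappa>"
  shows "lookup (YY i f) \<nu> = yev \<nu> i * lookup f \<nu>"
proof -
  have l: "lookup (YY i (monom_x \<kappa>)) \<nu> = (if \<kappa> = \<nu> then yev \<nu> i else 0)" if "\<kappa> \<in> keys f" for \<kappa>
  proof -
    have "\<kappa> \<in> weights n" using that assms(3) by (auto simp: LP_iff)
    then have "\<nu> \<notin> keys (YY i (monom_x \<kappa>) - lscale (yev \<kappa> i) (monom_x \<kappa>))"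
      using YY_tri(1)[of \<kappa> i] assms that by blast
    then show ?thesis by (auto simp: in_keys_iff lookup_minus lookup_monom_x)
  qed
  have "lookup (YY i f) \<nu> = (\<Sum>\<kappa>\<in>keys f. lookup f \<kappa> * lookup (YY i (monom_x \<kappa>)) \<nu>)"
    using assms by (subst lin_expand[OF lin_YY]) (auto simp: lookup_sum)
  also have "\<dots> = (\<Sum>\<kappa>\<in>keys f. if \<kappa> = \<nu> then lookup f \<nu> * yev \<nu> i else 0)"
    by (intro sum.cong) (auto simp: l)
  also have "\<dots> = yev \<nu> i * lookup f \<nu>" by (simp add: not_in_keys_iff_lookup_eq_zero mult.commute)
  finally show ?thesis .
qed

lemma ex_maximal:
  assumes "finite A" "\<kappa> \<in> A" "A \<subseteq> weights n"
  obtains \<nu> where "\<nu> \<in> A" "\<kappa> = \<nu> \<or> \<kappa> \<in> lt n \<nu>" "\<And>\<iota>. \<iota> \<in> A \<Longrightarrow> \<nu> \<notin> lt n \<iota>"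
proof -
  have "\<exists>\<nu>\<in>A. (\<kappa> = \<nu> \<or> \<kappa> \<in> lt n \<nu>) \<and> (\<forall>\<iota>\<in>A. \<nu> \<notin> lt n \<iota>)"
    using assms
  proof (induction A arbitrary: \<kappa> rule: finite_psubset_induct)
    case (psubset A)
    show ?case
    proof (cases "\<exists>\<iota>\<in>A. \<kappa> \<in> lt n \<iota>")
      case False
      then show ?thesis using psubset by blast
    next
      case True
      then obtain \<iota> where i: "\<iota> \<in> A" "\<kappa> \<in> lt n \<iota>" by blast
      let ?B = "{\<iota>'\<in>A. \<iota>' = \<iota> \<or> \<iota> \<in> lt n \<iota>'}"
      have k: "\<kappa> \<in> weights n" using psubset.prems by blast
      have "\<kappa> \<noteq> \<iota>" "\<iota> \<notin> lt n \<kappa>" using i(2) lt_irrefl lt_trans[OF i(2) _ k] by auto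
      then have "\<kappa> \<notin> ?B" by blast
      then have B: "?B \<subset> A" using psubset.prems by blast
      then obtain \<nu> where n: "\<nu> \<in> ?B" "\<iota> = \<nu> \<or> \<iota> \<in> lt n \<nu>" "\<forall>\<iota>\<in>?B. \<nu> \<notin> lt n \<iota>"
      proof -
        have "\<iota> \<in> ?B" "?B \<subseteq> weights n" using i psubset.prems by auto
        from psubset.IH[OF B this] show ?thesis using that by blast
      qed
      have "\<nu> \<notin> lt n \<iota>'" if "\<iota>' \<in> A" for \<iota>'
      proof
        assume a: "\<nu> \<in> lt n \<iota>'"
        then have "\<iota> \<in> lt n \<iota>'" using n(2) lt_trans[of \<iota> n \<nu> \<iota>'] that psubset.prems by blast
        then show False using n(3) that a by blast
      qed
      moreover have "\<kappa> \<in> lt n \<nu>" using i(2) n lt_trans[of \<kappa> n \<iota> \<nu>] psubset.prems by blast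
      ultimately show ?thesis using n(1) by blast
    qed
  qed
  then show ?thesis using that by blast
qed

text \<open>At a maximal exponent of the support the triangular operators act by their diagonal
  entry, which must therefore be the eigenvalue.\<close>

lemma eigw_top:
  assumes "eigw w f" "\<kappa> \<in> keys f"
  obtains \<nu> where "\<nu> \<in> keys f" "\<kappa> = \<nu> \<or> \<kappa> \<in> lt n \<nu>" "\<And>i. i \<in> {1..n} \<Longrightarrow> w i = yev \<nu> i"
proof -
  have f: "f \<in> LP" "\<And>i. i \<in> {1..n} \<Longrightarrow> YY i f = lscale (w i) f" using assms by (auto simp: eigw_def)
  obtain \<nu> where n: "\<nu> \<in> keys f" "\<kappa> = \<nu> \<or> \<kappa> \<in> lt n \<nu>" "\<And>\<iota>. \<iota> \<in> keys f \<Longrightarrow> \<nu> \<notin> lt n \<iota>"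
    using ex_maximal[OF finite_keys assms(2)] f(1) unfolding LP_iff by metis
  have "w i = yev \<nu> i" if "i \<in> {1..n}" for i
    using YY_top[of i f \<nu>] f n that by (auto simp: in_keys_iff)
  then show ?thesis using that n by blast
qed

definition ymon :: "int \<Rightarrow> int \<Rightarrow> int \<Rightarrow> 'k" where
  "ymon a b c = q powi a * hp Pt 2 powi b * (hp Ptn 1 * hp Pt0 1) powi c"

lemma yev_ymon: "yev \<mu> i = ymon (lookup \<mu> i) (rho' n \<mu> i) (sigma \<mu> i)"
  by (simp add: yev_def ymon_def)

lemma ymon_nz [simp]: "ymon a b c \<noteq> 0"
  by (simp add: ymon_def)

lemma ymon_mult: "ymon a b c * ymon a' b' c' = ymon (a + a') (b + b') (c + c')"
  by (simp add: ymon_def power_int_add)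

lemma ymon_inv: "1 / ymon a b c = ymon (- a) (- b) (- c)"
  using ymon_mult[of a b c "- a" "- b" "- c"] by (simp add: ymon_def field_simps)

lemma yev_nz [simp]: "yev \<mu> i \<noteq> 0"
  by (simp add: yev_ymon)

text \<open>Used as a criterion: as long as 1 + g g' is nonzero, F + g does not annihilate
  f.\<close>

lemma intertwiner_square:
  assumes "lin F" "\<And>f. F (F f) = lscale h (F f) + f" "g + g' = - h"
  shows "F (F f + lscale g f) + lscale g' (F f + lscale g f) = lscale (1 + g * g') f"
proof -
  have "F (F f + lscale g f) + lscale g' (F f + lscale g f) = lscale (h + (g + g')) (F f) + lscale (1 + g * g') f"
    using assms(1) by (simp add: lin_add lin_scale assms(2) laurent.scale_left_distrib laurent.scale_right_distrib
      laurent.scale_scale algebra_simps)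
  then show ?thesis by (simp add: assms(3))
qed

text \<open>The origin of the constants \<open>gT\<close>, \<open>gN\<close> and \<open>gU\<close>:
  each solves this linear equation for the off-diagonal coefficient c of its operator.\<close>

lemma eig_linear:
  assumes "lin F" "F f = lscale w f" "F f' = lscale w' f' + lscale c f" "c + g * w = w' * g"
  shows "F (f' + lscale g f) = lscale w' (f' + lscale g f)"
proof -
  have "F (f' + lscale g f) = lscale w' f' + lscale (c + g * w) f"
    using assms(1) by (simp add: lin_add lin_scale assms(2,3) laurent.scale_left_distrib laurent.scale_scale)
  then show ?thesis by (simp add: assms(4) laurent.scale_right_distrib laurent.scale_scale)
qed

lemma eig_linear': "lin F \<Longrightarrow> F f = lscale w f \<Longrightarrow> F f' = lscale w f' \<Longrightarrow> F (f' + lscale g f) = lscale w (f' + lscale g f)"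
  by (rule eig_linear[where c = 0]) (auto simp: mult.commute)

definition gT :: "nat \<Rightarrow> (nat \<Rightarrow> 'k) \<Rightarrow> 'k" where
  "gT j w = hh j * w j / (w (j + 1) - w j)"

lemma eigw_swap:
  assumes "eigw w f" "1 \<le> j" "j < n" "w j \<noteq> w (j + 1)"
  shows "eigw (w \<circ> sw j) (TT j f + lscale (gT j w) f)"
    "TT j (TT j f + lscale (gT j w) f) + lscale (gT j (w \<circ> sw j)) (TT j f + lscale (gT j w) f)
       = lscale (1 + gT j w * gT j (w \<circ> sw j)) f"
proof -
  have j: "j \<le> n" "0 < j" using assms by auto
  have f: "f \<in> LP" "\<And>i. i \<in> {1..n} \<Longrightarrow> YY i f = lscale (w i) f" using assms by (auto simp: eigw_def)
  have d: "w (j + 1) - w j \<noteq> 0" using assms by simp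
  have g: "hh j * w j + gT j w * w j = w (j + 1) * gT j w"
    "- (hh j * w j) + gT j w * w (j + 1) = w j * gT j w"
    using d by (simp_all add: gT_def field_simps)
  have Y1: "YY (j + 1) (TT j f) = lscale (w j) (TT j f) + lscale (- (hh j * w j)) f"
  proof -
    have "YY (j + 1) (TT j f) = TI j (YY j f)" using YY_step[of j f] assms by simp
    then show ?thesis using f(2)[of j] assms j by (simp add: TI_def T_simps laurent.scale_right_diff_distrib laurent.scale_scale mult.commute)
  qed
  have Y0: "YY j (TT j f) = lscale (w (j + 1)) (TT j f) + lscale (hh j * w j) f"
  proof -
    have l: "lin (YY (Suc j))" using assms by (intro lin_YY) auto
    have "YY j (TT j f) = TT j (YY (j + 1) (lscale (hh j) (TT j f) + f))"
      using YY_step[of j "TT j f"] assms by (simp add: T_quadratic)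
    also have "\<dots> = lscale (hh j) (TT j (YY (j + 1) (TT j f))) + TT j (YY (j + 1) f)"
      using j by (simp add: lin_add[OF l] lin_scale[OF l] T_simps)
    also have "TT j (YY (j + 1) (TT j f)) = YY j f" using YY_step[of j f] assms by simp
    finally show ?thesis using f(2)[of j] f(2)[of "j + 1"] assms by (simp add: T_simps laurent.scale_scale add.commute)
  qed
  show "eigw (w \<circ> sw j) (TT j f + lscale (gT j w) f)" unfolding eigw_def
  proof (intro conjI ballI)
    show "TT j f + lscale (gT j w) f \<in> LP" using f j by (simp add: LP_add LP_T LP_scale)
    fix i assume i: "i \<in> {1..n}"
    have l: "lin (YY i)" using i by (intro lin_YY) auto
    show "YY i (TT j f + lscale (gT j w) f) = lscale ((w \<circ> sw j) i) (TT j f + lscale (gT j w) f)"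
    proof (cases "i = j \<or> i = j + 1")
      case False
      then have "YY i (TT j f) = TT j (YY i f)" using T_Y[of j i f] i j by simp
      then show ?thesis using f(2)[OF i] False j by (intro eig_linear'[OF l]) (auto simp: sw_def T_simps)
    next
      case True
      then show ?thesis
      proof
        assume "i = j"
        then show ?thesis using eig_linear[OF l f(2)[OF i], of "TT j f" "w (j + 1)" "hh j * w j" "gT j w"] Y0 g(1) by (simp add: sw_def)
      next
        assume e: "i = j + 1"
        then show ?thesis using eig_linear[OF l f(2)[OF i], of "TT j f" "w j" "- (hh j * w j)" "gT j w"] Y1 g(2) by (simp add: sw_def)
      qed
    qed
  qed
  have "gT j w + gT j (w \<circ> sw j) = - hh j"
  proof -
    have "w j - w (j + 1) = - (w (j + 1) - w j)" by simp
    moreover have "gT j (w \<circ> sw j) = hh j * w (j + 1) / (w j - w (j + 1))"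
      by (simp add: gT_def sw_def)
    ultimately have "gT j (w \<circ> sw j) = - (hh j * w (j + 1) / (w (j + 1) - w j))"
      by (simp only: minus_divide_right)
    then have "gT j w + gT j (w \<circ> sw j) = - (hh j * (w (j + 1) - w j) / (w (j + 1) - w j))"
      by (simp only: gT_def right_diff_distrib diff_divide_distrib) simp
    then show ?thesis using d by simp
  qed
  then show "TT j (TT j f + lscale (gT j w) f) + lscale (gT j (w \<circ> sw j)) (TT j f + lscale (gT j w) f)
       = lscale (1 + gT j w * gT j (w \<circ> sw j)) f"
    by (intro intertwiner_square[OF lin_T T_quadratic] j)
qed

definition gN :: "'k \<Rightarrow> 'k" where
  "gN w = (w * hh n + hh 0) / (1 / w - w)"

lemma gN_sum: assumes "w \<noteq> 0" "w * w \<noteq> 1" shows "gN w + gN (1 / w) = - hh n"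
proof -
  have d: "1 / w - w \<noteq> 0" using assms by (simp add: field_simps)
  have "w - 1 / w = - (1 / w - w)" by simp
  moreover have "gN (1 / w) = (1 / w * hh n + hh 0) / (w - 1 / w)" using assms(1) by (simp add: gN_def)
  ultimately have "gN (1 / w) = - ((1 / w * hh n + hh 0) / (1 / w - w))" by (simp only: minus_divide_right)
  then have "gN w + gN (1 / w) = ((w * hh n + hh 0) - (1 / w * hh n + hh 0)) / (1 / w - w)"
    by (simp only: gN_def diff_divide_distrib) simp
  also have "(w * hh n + hh 0) - (1 / w * hh n + hh 0) = - hh n * (1 / w - w)" by (simp add: algebra_simps)
  finally show ?thesis using d by simp
qed

lemma eigw_flip:
  assumes "eigw w f" "w n \<noteq> 0" "w n * w n \<noteq> 1"
  shows "eigw (w(n := 1 / w n)) (TT n f + lscale (gN (w n)) f)"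
    "TT n (TT n f + lscale (gN (w n)) f) + lscale (gN (1 / w n)) (TT n f + lscale (gN (w n)) f)
       = lscale (1 + gN (w n) * gN (1 / w n)) f"
proof -
  have f: "f \<in> LP" "\<And>i. i \<in> {1..n} \<Longrightarrow> YY i f = lscale (w i) f" using assms by (auto simp: eigw_def)
  have l: "lin (ZZ n)" "lin (YY n)" by (auto intro: lin_ZZ lin_YY)
  have d: "1 / w n - w n \<noteq> 0" using assms by (simp add: field_simps)
  have g: "(w n * hh n + hh 0) + gN (w n) * w n = 1 / w n * gN (w n)"
  proof -
    have "gN (w n) * (1 / w n - w n) = w n * hh n + hh 0" using d by (simp add: gN_def)
    then show ?thesis by (simp add: algebra_simps)
  qed
  have Z: "ZZ n f' = TI n (YY n f')" for f' by (simp add: YY_n)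
  \<comment> \<open>On the eigenvector, \<open>ZZ n\<close> is \<open>w n\<close> times the inverse
    of \<open>T_n\<close>. Its quadratic relation therefore determines \<open>Y_n\<close> on
    \<open>TI n f\<close>.\<close>
  have "ZZ n (ZZ n f) = lscale (hh 0) (ZZ n f) + f" using n2 by (intro ZZ_quadratic) auto
  then have "TT n (lscale (w n) (ZZ n (TI n f))) = TT n (lscale (hh 0 * w n) (TI n f) + f)"
    using f(2)[of n] n2 by (simp add: Z[of f] TI_simps lin_scale[OF l(1)] laurent.scale_scale)
  then have e: "lscale (w n) (YY n (TI n f)) = lscale (hh 0 * w n) f + TT n f"
    by (simp add: T_simps YY_n)
  have "YY n (TI n f) = lscale (1 / w n) (lscale (w n) (YY n (TI n f)))"
    using assms by (simp add: laurent.scale_scale)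
  also have "\<dots> = lscale (1 / w n) (TT n f) + lscale (hh 0) f" unfolding e
    using assms by (simp add: laurent.scale_right_distrib laurent.scale_scale add.commute)
  finally have "YY n (TT n f) - lscale (hh n * w n) f = lscale (1 / w n) (TT n f) + lscale (hh 0) f"
    using f(2)[of n] n2 by (simp add: TI_def lin_diff[OF l(2)] lin_scale[OF l(2)] laurent.scale_scale)
  then have Y: "YY n (TT n f) = lscale (1 / w n) (TT n f) + lscale (w n * hh n + hh 0) f"
    by (simp add: laurent.scale_left_distrib diff_eq_eq mult.commute add_ac)
  show "eigw (w(n := 1 / w n)) (TT n f + lscale (gN (w n)) f)" unfolding eigw_def
  proof (intro conjI ballI)
    show "TT n f + lscale (gN (w n)) f \<in> LP" using f by (simp add: LP_add LP_T LP_scale)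
    fix i assume i: "i \<in> {1..n}"
    have l: "lin (YY i)" using i by (intro lin_YY) auto
    show "YY i (TT n f + lscale (gN (w n)) f) = lscale ((w(n := 1 / w n)) i) (TT n f + lscale (gN (w n)) f)"
    proof (cases "i = n")
      case False
      then have "YY i (TT n f) = TT n (YY i f)" using T_Y[of n i f] i n2 by simp
      then show ?thesis using f(2)[OF i] False by (intro eig_linear'[OF l]) (auto simp: T_simps)
    next
      case True
      then show ?thesis using eig_linear[OF l f(2)[OF i], of "TT n f" "1 / w n" "w n * hh n + hh 0"] Y g by simp
    qed
  qed
  show "TT n (TT n f + lscale (gN (w n)) f) + lscale (gN (1 / w n)) (TT n f + lscale (gN (w n)) f)
       = lscale (1 + gN (w n) * gN (1 / w n)) f"
    by (intro intertwiner_square[OF lin_T T_quadratic] gN_sum assms) auto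
qed

definition gU :: "'k \<Rightarrow> 'k" where
  "gU w = (uu 0 / (q * w) + uu n / hp Pq 1) / (w - 1 / (q * w))"

lemma gU_sum: assumes "w \<noteq> 0" "w \<noteq> 1 / (q * w)" shows "gU w + gU (1 / (q * w)) = - uu 0"
proof -
  have d: "w - 1 / (q * w) \<noteq> 0" using assms by simp
  have "1 / (q * w) - w = - (w - 1 / (q * w))" "1 / (q * (1 / (q * w))) = w" using assms by simp_all
  moreover have "gU (1 / (q * w)) = (uu 0 / (q * (1 / (q * w))) + uu n / hp Pq 1) / (1 / (q * w) - 1 / (q * (1 / (q * w))))"
    by (simp only: gU_def)
  moreover have "uu 0 / (q * (1 / (q * w))) = uu 0 * w" using assms by simp
  ultimately have "gU (1 / (q * w)) = - ((uu 0 * w + uu n / hp Pq 1) / (w - 1 / (q * w)))"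
    by (simp only: minus_divide_right)
  then have "gU w + gU (1 / (q * w)) = ((uu 0 / (q * w) + uu n / hp Pq 1) - (uu 0 * w + uu n / hp Pq 1)) / (w - 1 / (q * w))"
    by (simp only: gU_def diff_divide_distrib) simp
  also have "(uu 0 / (q * w) + uu n / hp Pq 1) - (uu 0 * w + uu n / hp Pq 1) = - uu 0 * (w - 1 / (q * w))"
  proof -
    have "(A / Q + X) - (A * w + X) = - A * (w - 1 / Q)" for A Q X
      by (simp add: right_diff_distrib)
    then show ?thesis .
  qed
  finally show ?thesis using d by simp
qed

lemma eigw_affine:
  assumes "eigw w f" "w 1 \<noteq> 0" "w 1 \<noteq> 1 / (q * w 1)"
  shows "eigw (w(1 := 1 / (q * w 1))) (UU f + lscale (gU (w 1)) f)"
    "UU (UU f + lscale (gU (w 1)) f) + lscale (gU (1 / (q * w 1))) (UU f + lscale (gU (w 1)) f)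
       = lscale (1 + gU (w 1) * gU (1 / (q * w 1))) f"
proof -
  have f: "f \<in> LP" "\<And>i. i \<in> {1..n} \<Longrightarrow> YY i f = lscale (w i) f" using assms by (auto simp: eigw_def)
  define w1 where "w1 = w 1"
  define v where "v = 1 / (q * w1)"
  have w1: "w1 \<noteq> 0" "q * w1 * v = 1" using assms by (simp_all add: w1_def v_def)
  have l: "lin UU" "lin (YY 1)" using n2 by (auto intro: lin_UU lin_YY)
  have d: "w1 - v \<noteq> 0" using assms by (simp add: w1_def v_def)
  define c where "c = - (v * uu 0 + uu n / hp Pq 1)"
  have g: "c + gU w1 * w1 = v * gU w1"
  proof -
    have "gU w1 * (w1 - v) = - c" using d by (simp add: gU_def c_def v_def)
    then show ?thesis by (simp add: algebra_simps)
  qed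
  have 1: "lscale q (YY 1 (UU (YY 1 (UU f')))) = f' - lscale (hp Pq 1 * uu n) (YY 1 (UU f'))" for f'
    by (rule UU_Y1_quadratic)
  have Ui: "UU (UU f' - lscale (uu 0) f') = f'" for f'
    by (simp add: lin_diff[OF l(1)] lin_scale[OF l(1)] UU_quadratic)
  \<comment> \<open>The preimage of f under \<open>UU\<close>. Inserted into the relation
    \<open>1\<close>, it yields a formula for \<open>Y_1\<close> on \<open>UU f\<close>.\<close>
  define f'' where "f'' = UU f - lscale (uu 0) f"
  have uf: "UU f'' = f" by (simp add: f''_def Ui)
  have "lscale (q * w1) (YY 1 (UU f)) = f'' - lscale (hp Pq 1 * uu n * w1) f"
    using 1[of f''] f(2)[of 1] n2 unfolding uf by (simp add: w1_def lin_scale[OF l(1)] lin_scale[OF l(2)] laurent.scale_scale del: One_nat_def)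
  then have "lscale v (lscale (q * w1) (YY 1 (UU f))) = lscale v (f'' - lscale (hp Pq 1 * uu n * w1) f)" by simp
  moreover have "v * (q * w1) = 1" using w1(2) by (simp add: mult.commute mult.left_commute)
  moreover have "v * (hp Pq 1 * uu n * w1) = uu n / hp Pq 1"
    using w1 by (simp add: v_def hp_2 field_simps)
  ultimately have Y: "YY 1 (UU f) = lscale v (UU f) + lscale c f"
    by (simp add: laurent.scale_scale laurent.scale_right_diff_distrib laurent.scale_left_distrib laurent.scale_left_diff_distrib f''_def c_def algebra_simps
       del: One_nat_def)
  have "eigw (w(1 := v)) (UU f + lscale (gU w1) f)" unfolding eigw_def
  proof (intro conjI ballI)
    show "UU f + lscale (gU w1) f \<in> LP" using f by (simp add: LP_add LP_U LP_scale)
    fix i assume i: "i \<in> {1..n}"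
    have l: "lin (YY i)" using i by (intro lin_YY) auto
    show "YY i (UU f + lscale (gU w1) f) = lscale ((w(1 := v)) i) (UU f + lscale (gU w1) f)"
    proof (cases "i = 1")
      case False
      then have "YY i (UU f) = UU (YY i f)" using UU_Y[of i f] i by simp
      then show ?thesis using f(2)[OF i] False by (intro eig_linear'[OF l]) (auto simp: lin_scale[OF lin_UU])
    next
      case True
      have "YY 1 (UU f + lscale (gU w1) f) = lscale v (UU f + lscale (gU w1) f)"
        using Y g f(2)[of 1] n2 by (intro eig_linear[where w = w1 and c = c] lin_YY) (auto simp: w1_def)
      then show ?thesis using True by simp
    qed
  qed
  then show "eigw (w(1 := 1 / (q * w 1))) (UU f + lscale (gU (w 1)) f)" by (simp add: v_def w1_def)
  show "UU (UU f + lscale (gU (w 1)) f) + lscale (gU (1 / (q * w 1))) (UU f + lscale (gU (w 1)) f)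
       = lscale (1 + gU (w 1) * gU (1 / (q * w 1))) f"
    by (intro intertwiner_square[OF lin_UU UU_quadratic] gU_sum assms)
qed

end

section \<open>Moves on weights\<close>

text \<open>The affine Weyl group acts on each coordinate by \<open>a \<mapsto> -1 - a\<close> and \<open>a \<mapsto> - a\<close>, which
  moves along the chain \<open>0, -1, 1, -2, 2, \<dots>\<close>; \<open>lev\<close> is the position in this chain.\<close>

definition lev :: "int \<Rightarrow> nat" where
  "lev a = nat (if a \<ge> 0 then 2 * a else - 2 * a - 1)"

definition nlev :: "nat \<Rightarrow> nat \<Rightarrow> (nat \<Rightarrow>\<^sub>0 int) \<Rightarrow> nat" where
  "nlev n L \<mu> = card {p\<in>{1..n}. L \<le> lev (lookup \<mu> p)}"

lemma lev_inj: "lev a = lev b \<Longrightarrow> a = b"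
proof -
  assume "lev a = lev b"
  then have "(if a \<ge> 0 then 2 * a else - 2 * a - 1) = (if b \<ge> 0 then 2 * b else - 2 * b - 1)"
    by (simp add: lev_def split: if_splits)
  then show "a = b" by presburger
qed

lemma lev_aff: "a \<ge> 0 \<Longrightarrow> lev (- 1 - a) = lev a + 1"
  and lev_aff': "a < 0 \<Longrightarrow> lev (- 1 - a) + 1 = lev a"
  and lev_neg: "a < 0 \<Longrightarrow> lev (- a) = lev a + 1"
  and lev_neg': "a > 0 \<Longrightarrow> lev (- a) + 1 = lev a"
  by (auto simp: lev_def)

text \<open>Conjugation by this exchange transports the moves, which act at positions 1 and n only,
  to an arbitrary position p.\<close>

definition exch :: "nat \<Rightarrow> nat \<Rightarrow> (nat \<Rightarrow>\<^sub>0 int) \<Rightarrow> (nat \<Rightarrow>\<^sub>0 int)" where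
  "exch n p \<mu> = wt n (\<lambda>s. lookup \<mu> (transpose 1 p s))"

lemma exch_weights: "exch n p \<mu> \<in> weights n"
  by (simp add: exch_def wt_weights)

lemma lookup_exch:
  assumes "p \<in> {1..n}" "\<mu> \<in> weights n" shows "lookup (exch n p \<mu>) s = lookup \<mu> (transpose 1 p s)"
proof (cases "s \<in> {1..n}")
  case False
  then have "transpose 1 p s = s" using assms by (auto simp: transpose_def)
  then show ?thesis using False assms weights_0[of \<mu> n s] by (simp add: exch_def lookup_wt)
qed (simp add: exch_def lookup_wt)

lemma nlev_exch: assumes "p \<in> {1..n}" "\<mu> \<in> weights n" shows "nlev n L (exch n p \<mu>) = nlev n L \<mu>"
proof -
  have "bij_betw (transpose 1 p) {s\<in>{1..n}. L \<le> lev (lookup (exch n p \<mu>) s)} {s\<in>{1..n}. L \<le> lev (lookup \<mu> s)}"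
    by (rule bij_betwI[of _ _ _ "transpose 1 p"]) (use assms in \<open>auto simp: lookup_exch transpose_def\<close>)
  then show ?thesis unfolding nlev_def by (rule bij_betw_same_card)
qed

lemma nlev_mono: "(\<And>p. p \<in> {1..n} \<Longrightarrow> lev (lookup \<mu> p) \<le> lev (lookup \<kappa> p)) \<Longrightarrow> nlev n L \<mu> \<le> nlev n L \<kappa>"
  unfolding nlev_def by (rule card_mono) (auto intro: order_trans)

lemma update_weights: "p \<in> {1..n} \<Longrightarrow> \<mu> \<in> weights n \<Longrightarrow> Poly_Mapping.update p a \<mu> \<in> weights n"
  by (rule weightsI) (auto simp: lookup_update weights_0)

text \<open>Reachability of weights, separated from the analysis of intertwiners. Q holds along
  permitted moves, and \<open>ok\<close> decides about a sign change from the last entry and the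
  number of entries of level at least L. It serves to construct eigenvectors and to bound
  subrepresentations from below.\<close>

locale moves =
  fixes n :: nat and Q :: "(nat \<Rightarrow>\<^sub>0 int) \<Rightarrow> bool" and L :: nat and ok :: "int \<Rightarrow> nat \<Rightarrow> bool"
  assumes n2: "n \<ge> 2"
    and swap: "\<mu> \<in> weights n \<Longrightarrow> Q \<mu> \<Longrightarrow> 1 \<le> j \<Longrightarrow> j < n \<Longrightarrow> lookup \<mu> j \<noteq> lookup \<mu> (j + 1) \<Longrightarrow> Q (rv n j \<mu>)"
    and aff: "\<mu> \<in> weights n \<Longrightarrow> Q \<mu> \<Longrightarrow> Q (s0 \<mu>)"
    and flip: "\<mu> \<in> weights n \<Longrightarrow> Q \<mu> \<Longrightarrow> lookup \<mu> n \<noteq> 0 \<Longrightarrow> ok (lookup \<mu> n) (nlev n L \<mu>) \<Longrightarrow> Q (rv n n \<mu>)"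
begin

lemma swap': "\<mu> \<in> weights n \<Longrightarrow> Q \<mu> \<Longrightarrow> 1 \<le> j \<Longrightarrow> j < n \<Longrightarrow> Q (rv n j \<mu>)"
proof (cases "lookup \<mu> j = lookup \<mu> (j + 1)")
  case True
  assume a: "\<mu> \<in> weights n" "Q \<mu>" "1 \<le> j" "j < n"
  then have "rv n j \<mu> = \<mu>" using True by (intro poly_mapping_eqI) (auto simp: lookup_rv)
  then show ?thesis using a by simp
qed (rule swap)

lemma exch: "p \<in> {1..n} \<Longrightarrow> \<mu> \<in> weights n \<Longrightarrow> Q \<mu> \<Longrightarrow> Q (exch n p \<mu>)"
proof (induction p arbitrary: \<mu>)
  case (Suc p)
  consider "p = 0" | "p = 1" | "p \<ge> 2" by linarith
  then show ?case
  proof cases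
    case 1
    then have "exch n (Suc p) \<mu> = \<mu>" using Suc.prems by (intro poly_mapping_eqI) (simp add: lookup_exch)
    then show ?thesis using Suc.prems by simp
  next
    case 2
    then have "exch n (Suc p) \<mu> = rv n 1 \<mu>"
      using Suc.prems n2 by (intro poly_mapping_eqI) (auto simp: lookup_exch lookup_rv transpose_def)
    then show ?thesis using Suc.prems swap'[of \<mu> 1] n2 by simp
  next
    case 3
    have p: "p \<in> {1..n}" "1 \<le> p" "p < n" using 3 Suc.prems by auto
    have w: "rv n p \<mu> \<in> weights n" using Suc.prems n2 p by (intro rv_weights) auto
    have "exch n (Suc p) \<mu> = rv n p (exch n p (rv n p \<mu>))"
    proof (rule weights_eqI[where n = n])
      fix s assume "s \<in> {1..n}"
      show "lookup (exch n (Suc p) \<mu>) s = lookup (rv n p (exch n p (rv n p \<mu>))) s"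
        using 3 p w Suc.prems by (simp add: lookup_exch lookup_rv transpose_def)
    qed (use p n2 in \<open>auto intro!: rv_weights exch_weights\<close>)
    then show ?thesis
      using swap'[OF exch_weights Suc.IH[OF p(1) w swap'[OF Suc.prems(2,3) p(2,3)]] p(2,3)] by simp
  qed
qed simp

lemma move_aff: assumes "\<mu> \<in> weights n" "Q \<mu>" "p \<in> {1..n}" shows "Q (Poly_Mapping.update p (- 1 - lookup \<mu> p) \<mu>)"
proof -
  have n1: "1 \<le> n" using n2 by simp
  have "Q (exch n p (s0 (exch n p \<mu>)))"
    using assms n1 by (intro exch aff s0_weights exch_weights)
  moreover have "exch n p (s0 (exch n p \<mu>)) = Poly_Mapping.update p (- 1 - lookup \<mu> p) \<mu>"
    using assms n1 by (intro poly_mapping_eqI) (simp add: lookup_exch s0_weights exch_weights lookup_s0 lookup_update transpose_def)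
  ultimately show ?thesis by simp
qed

lemma move_flip: assumes "\<mu> \<in> weights n" "Q \<mu>" "p \<in> {1..n}" "lookup \<mu> p \<noteq> 0" "ok (lookup \<mu> p) (nlev n L \<mu>)"
  shows "Q (Poly_Mapping.update p (- lookup \<mu> p) \<mu>)"
proof -
  have n1: "n \<in> {1..n}" using n2 by simp
  \<comment> \<open>The entry at p is carried to position 1 and from there to n, where the sign
    change is available.\<close>
  define \<kappa> where "\<kappa> = exch n n (exch n p \<mu>)"
  have k: "\<kappa> \<in> weights n" "Q \<kappa>" using assms n1 by (auto simp: \<kappa>_def intro!: exch exch_weights)
  have l: "lookup \<kappa> n = lookup \<mu> p" using assms n1 by (simp add: \<kappa>_def lookup_exch exch_weights transpose_def)
  have "nlev n L \<kappa> = nlev n L \<mu>" using assms n1 by (simp add: \<kappa>_def nlev_exch exch_weights)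
  then have "Q (rv n n \<kappa>)" using flip[OF k] assms l by simp
  then have "Q (exch n p (exch n n (rv n n \<kappa>)))" using assms n1 k n2 by (intro exch exch_weights rv_weights) auto
  moreover have "exch n p (exch n n (rv n n \<kappa>)) = Poly_Mapping.update p (- lookup \<mu> p) \<mu>"
  proof (rule weights_eqI[where n = n])
    fix s assume s: "s \<in> {1..n}"
    have "lookup (exch n p (exch n n (rv n n \<kappa>))) s = lookup (rv n n \<kappa>) (transpose 1 n (transpose 1 p s))"
      using assms n1 k n2 by (simp add: lookup_exch exch_weights rv_weights)
    also have "\<dots> = (if transpose 1 n (transpose 1 p s) = n then - lookup \<mu> p else lookup \<kappa> (transpose 1 n (transpose 1 p s)))"
      using n2 l by (simp add: lookup_rv)
    also have "transpose 1 n (transpose 1 p s) = n \<longleftrightarrow> s = p" by (auto simp: transpose_def)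
    also have "lookup \<kappa> (transpose 1 n (transpose 1 p s)) = lookup \<mu> s"
      using assms n1 by (simp add: \<kappa>_def lookup_exch exch_weights)
    finally show "lookup (exch n p (exch n n (rv n n \<kappa>))) s = lookup (Poly_Mapping.update p (- lookup \<mu> p) \<mu>) s"
      by (simp add: lookup_update)
  qed (use assms in \<open>auto intro!: exch_weights update_weights\<close>)
  ultimately show ?thesis by simp
qed

lemma climb:
  assumes ok: "\<And>a k. a < 0 \<Longrightarrow> ok a k"
    and "\<mu> \<in> weights n" "Q \<mu>" "\<kappa> \<in> weights n" "\<And>p. p \<in> {1..n} \<Longrightarrow> lev (lookup \<mu> p) \<le> lev (lookup \<kappa> p)"
  shows "Q \<kappa>"
  using assms(2-)
proof (induction "\<Sum>p\<in>{1..n}. lev (lookup \<kappa> p) - lev (lookup \<mu> p)" arbitrary: \<mu> rule: less_induct)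
  case (less \<mu>)
  show ?case
  proof (cases "\<exists>p\<in>{1..n}. lev (lookup \<mu> p) < lev (lookup \<kappa> p)")
    case False
    have "lookup \<mu> p = lookup \<kappa> p" if "p \<in> {1..n}" for p
    proof (rule lev_inj)
      have "\<not> lev (lookup \<mu> p) < lev (lookup \<kappa> p)" using False that by blast
      then show "lev (lookup \<mu> p) = lev (lookup \<kappa> p)" using less.prems(4)[OF that] by linarith
    qed
    then have "\<mu> = \<kappa>" by (rule weights_eqI[OF less.prems(1) less.prems(3)])
    then show ?thesis using less.prems by simp
  next
    case True
    then obtain p where p: "p \<in> {1..n}" "lev (lookup \<mu> p) < lev (lookup \<kappa> p)" by blast
    define b where "b = (if lookup \<mu> p \<ge> 0 then - 1 - lookup \<mu> p else - lookup \<mu> p)"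
    define \<nu> where "\<nu> = Poly_Mapping.update p b \<mu>"
    have b: "lev b = lev (lookup \<mu> p) + 1" by (simp add: b_def lev_aff lev_neg)
    have Q: "Q \<nu>" using move_aff[OF less.prems(1,2) p(1)] move_flip[OF less.prems(1,2) p(1)] ok
      by (auto simp: \<nu>_def b_def)
    have l: "lev (lookup \<nu> s) = (if s = p then lev (lookup \<mu> p) + 1 else lev (lookup \<mu> s))" for s
      by (simp add: \<nu>_def lookup_update b)
    have "(\<Sum>p\<in>{1..n}. lev (lookup \<kappa> p) - lev (lookup \<nu> p)) < (\<Sum>p\<in>{1..n}. lev (lookup \<kappa> p) - lev (lookup \<mu> p))"
      using p by (intro sum_strict_mono_ex1) (auto simp: l intro!: bexI[of _ p])
    moreover have "lev (lookup \<nu> s) \<le> lev (lookup \<kappa> s)" if "s \<in> {1..n}" for s using less.prems(4)[OF that] p by (simp add: l)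
    ultimately show ?thesis
      using less.hyps[OF _ _ Q less.prems(3)] p less.prems(1) by (simp add: \<nu>_def update_weights)
  qed
qed

lemma descend:
  assumes ok: "\<And>a k. a > 0 \<Longrightarrow> \<not> (lev a = L \<and> k = i) \<Longrightarrow> ok a k" "\<And>a k. a < 0 \<Longrightarrow> ok a k"
    and "\<mu> \<in> weights n" "Q \<mu>" "\<kappa> \<in> weights n" "\<And>p. p \<in> {1..n} \<Longrightarrow> lev (lookup \<kappa> p) \<le> lev (lookup \<mu> p)" "nlev n L \<kappa> \<ge> i"
  shows "Q \<kappa>"
  using assms(3-)
proof (induction "\<Sum>p\<in>{1..n}. lev (lookup \<mu> p) - lev (lookup \<kappa> p)" arbitrary: \<mu> rule: less_induct)
  case (less \<mu>)
  show ?case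
  proof (cases "\<exists>p\<in>{1..n}. lev (lookup \<kappa> p) < lev (lookup \<mu> p)")
    case False
    have "lookup \<kappa> p = lookup \<mu> p" if "p \<in> {1..n}" for p
    proof (rule lev_inj)
      have "\<not> lev (lookup \<kappa> p) < lev (lookup \<mu> p)" using False that by blast
      then show "lev (lookup \<kappa> p) = lev (lookup \<mu> p)" using less.prems(4)[OF that] by linarith
    qed
    then have "\<kappa> = \<mu>" by (rule weights_eqI[OF less.prems(3) less.prems(1)])
    then show ?thesis using less.prems by simp
  next
    case True
    then obtain p where p: "p \<in> {1..n}" "lev (lookup \<kappa> p) < lev (lookup \<mu> p)" by blast
    have nz: "lookup \<mu> p \<noteq> 0" using p(2) by (auto simp: lev_def)
    define b where "b = (if lookup \<mu> p < 0 then - 1 - lookup \<mu> p else - lookup \<mu> p)"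
    define \<nu> where "\<nu> = Poly_Mapping.update p b \<mu>"
    have b: "lev b + 1 = lev (lookup \<mu> p)" using nz lev_aff'[of "lookup \<mu> p"] lev_neg'[of "lookup \<mu> p"] by (auto simp: b_def)
    have l: "lev (lookup \<nu> s) = (if s = p then lev b else lev (lookup \<mu> s))" for s
      by (simp add: \<nu>_def lookup_update)
    have le: "lev (lookup \<kappa> s) \<le> lev (lookup \<nu> s)" if "s \<in> {1..n}" for s proof (cases "s = p")
      case True
      then show ?thesis using p(2) b by (simp add: l)
    next
      case False
      then show ?thesis using less.prems(4)[OF that] unfolding l by simp
    qed
    \<comment> \<open>At the blocked sign change p is one of exactly i entries of level at least L
      and would leave this set. But \<nu> still dominates \<kappa>, which has at least i such
      entries.\<close>
    have "\<not> (lev (lookup \<mu> p) = L \<and> nlev n L \<mu> = i)"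
    proof
      assume a: "lev (lookup \<mu> p) = L \<and> nlev n L \<mu> = i"
      have le2: "lev (lookup \<nu> s) \<le> lev (lookup \<mu> s)" for s using b by (cases "s = p") (simp_all add: l)
      have "p \<notin> {s\<in>{1..n}. L \<le> lev (lookup \<nu> s)}" "p \<in> {s\<in>{1..n}. L \<le> lev (lookup \<mu> s)}"
        using a b p(1) by (simp_all add: l)
      moreover have "{s\<in>{1..n}. L \<le> lev (lookup \<nu> s)} \<subseteq> {s\<in>{1..n}. L \<le> lev (lookup \<mu> s)}"
        using le2 order_trans by blast
      ultimately have "nlev n L \<nu> < nlev n L \<mu>" unfolding nlev_def
        by (intro psubset_card_mono) auto
      moreover have "nlev n L \<kappa> \<le> nlev n L \<nu>" using le by (rule nlev_mono)
      ultimately show False using less.prems(5) a by simp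
    qed
    then have "ok (lookup \<mu> p) (nlev n L \<mu>)" if "\<not> lookup \<mu> p < 0" using ok(1) nz that by simp
    then have Q: "Q \<nu>" using move_aff[OF less.prems(1,2) p(1)] move_flip[OF less.prems(1,2) p(1) nz]
      by (simp add: \<nu>_def b_def)
    have "(\<Sum>p\<in>{1..n}. lev (lookup \<nu> p) - lev (lookup \<kappa> p)) < (\<Sum>p\<in>{1..n}. lev (lookup \<mu> p) - lev (lookup \<kappa> p))"
      using p b by (intro sum_strict_mono_ex1) (auto simp: l intro!: bexI[of _ p])
    then show ?thesis
      using less.hyps[OF _ _ Q less.prems(3) le less.prems(5)] p less.prems(1) by (simp add: \<nu>_def update_weights)
  qed
qed

end

section \<open>Generic parameters\<close>

lemma frac_aux: "A \<noteq> 0 \<Longrightarrow> B \<noteq> 0 \<Longrightarrow> A * B * (1 + C / A * (D / B)) = A * B + C * (D :: 'f::field)"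
  by (simp add: field_simps)

text \<open>The converse of \<open>quad_factor\<close> for the two roots -U/V and -V/U, with
  inverses as separate variables.\<close>

lemma crit_aux:
  fixes a a' b b' :: "'f::field"
  assumes "a * a' = 1" "b * b' = 1"
  shows "(- (a * b') - (- (a' * b)))^2 = ((b - b') * (- (a' * b)) + (a - a')) * ((b - b') * (- (a * b')) + (a - a'))"
  using assms by algebra

text \<open>\<open>ind\<close> makes the joint spectrum simple. \<open>indU\<close> keeps x =
  q^(1/2) y(\<mu>)_1 away from the four roots in \<open>quad_factor\<close>, so the affine
  intertwiner never vanishes. For \<open>T_n\<close> zeros are permitted; they are the subject of
  \<open>crit\<close>.\<close>

locale daha_generic = daha +
  assumes ind: "ymon a b c = 1 \<Longrightarrow> a = 0 \<and> b = 0 \<and> c = 0"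
    and indU: "c = 1 \<or> c = - 1 \<Longrightarrow> x = hp Pq 1 * ymon a b c \<Longrightarrow>
      \<not> (x = hp Pun 1 * hp Pu0 1 \<or> x = 1 / (hp Pun 1 * hp Pu0 1) \<or> x = - hp Pun 1 / hp Pu0 1 \<or> x = - hp Pu0 1 / hp Pun 1)"
begin

lemma ymon_eq: "ymon a b c = ymon a' b' c' \<longleftrightarrow> a = a' \<and> b = b' \<and> c = c'"
proof
  assume "ymon a b c = ymon a' b' c'"
  then have "ymon a b c * ymon (- a') (- b') (- c') = ymon a' b' c' * ymon (- a') (- b') (- c')" by simp
  then have "ymon (a - a') (b - b') (c - c') = 1" by (simp add: ymon_mult) (simp add: ymon_def)
  from ind[OF this] show "a = a' \<and> b = b' \<and> c = c'" by simp
qed simp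

lemma sigma_pm: "sigma \<mu> i = 1 \<or> sigma \<mu> i = - 1" "sigma \<mu> i \<noteq> 0"
  by (auto simp: sigma_def)

lemma yev_eqD: "\<nu> \<in> weights n \<Longrightarrow> \<mu> \<in> weights n \<Longrightarrow> (\<And>i. i \<in> {1..n} \<Longrightarrow> yev \<nu> i = yev \<mu> i) \<Longrightarrow> \<nu> = \<mu>"
  by (rule weights_eqI[where n = n]) (auto simp: yev_ymon ymon_eq)

lemma eigw_nonzero: assumes "eigw w f" "f \<noteq> 0"
  obtains \<nu> where "\<nu> \<in> weights n" "\<And>i. i \<in> {1..n} \<Longrightarrow> w i = yev \<nu> i"
proof -
  obtain \<kappa> where "\<kappa> \<in> keys f" using assms(2) by (metis all_not_in_conv keys_eq_empty)
  from eigw_top[OF assms(1) this] that show ?thesis using assms(1) unfolding eigw_def LP_iff by blast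
qed

lemma eigw_cong: "(\<And>i. i \<in> {1..n} \<Longrightarrow> w i = w' i) \<Longrightarrow> eigw w f \<longleftrightarrow> eigw w' f"
  by (auto simp: eigw_def)

text \<open>Each maximal exponent of the support carries the eigenvalues of \<mu>, and by simplicity
  of the spectrum it equals \<mu>.\<close>

lemma eig_top: assumes "eig \<mu> f" "\<mu> \<in> weights n" shows "\<mu> \<in> keys f" "\<And>\<kappa>. \<kappa> \<in> keys f \<Longrightarrow> \<kappa> = \<mu> \<or> \<kappa> \<in> lt n \<mu>"
proof -
  have w: "eigw (yev \<mu>) f" "f \<noteq> 0" "keys f \<subseteq> weights n" using assms by (auto simp: eig_def eigw_def LP_iff)
  have *: "\<mu> \<in> keys f \<and> (\<kappa> = \<mu> \<or> \<kappa> \<in> lt n \<mu>)" if k: "\<kappa> \<in> keys f" for \<kappa>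
  proof -
    obtain \<nu> where n: "\<nu> \<in> keys f" "\<kappa> = \<nu> \<or> \<kappa> \<in> lt n \<nu>" "\<And>i. i \<in> {1..n} \<Longrightarrow> yev \<mu> i = yev \<nu> i"
      using eigw_top[OF w(1) k] by metis
    then have "\<nu> = \<mu>" using yev_eqD[of \<nu> \<mu>] w(3) assms(2) by auto
    then show ?thesis using n by simp
  qed
  show "\<And>\<kappa>. \<kappa> \<in> keys f \<Longrightarrow> \<kappa> = \<mu> \<or> \<kappa> \<in> lt n \<mu>" using * by blast
  show "\<mu> \<in> keys f" using * w(2) by (metis all_not_in_conv keys_eq_empty)
qed

lemma eigw_scale_diff: "eigw w f \<Longrightarrow> eigw w g \<Longrightarrow> eigw w (lscale c f - lscale d g)"
  unfolding eigw_def
proof (elim conjE, intro conjI ballI)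
  fix i assume "i \<in> {1..n}" and *: "\<forall>i\<in>{1..n}. YY i f = lscale (w i) f" "\<forall>i\<in>{1..n}. YY i g = lscale (w i) g"
  then have "lin (YY i)" by (intro lin_YY) auto
  then show "YY i (lscale c f - lscale d g) = lscale (w i) (lscale c f - lscale d g)"
    using * \<open>i \<in> {1..n}\<close> by (simp add: lin_diff lin_scale laurent.scale_right_diff_distrib laurent.scale_scale mult.commute)
qed (auto intro: LP_diff LP_scale)

lemma eig_unique: assumes "eig \<mu> f" "eig \<mu> g" "\<mu> \<in> weights n" shows "lscale (lookup f \<mu>) g = lscale (lookup g \<mu>) f"
proof (rule ccontr)
  assume "lscale (lookup f \<mu>) g \<noteq> lscale (lookup g \<mu>) f"
  then have "eig \<mu> (lscale (lookup f \<mu>) g - lscale (lookup g \<mu>) f)"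
    using assms eigw_scale_diff by (auto simp: eig_def)
  from eig_top(1)[OF this assms(3)] show False by (simp add: in_keys_iff lookup_minus)
qed

lemma eigw_eig: assumes "eigw w f" "f \<noteq> 0" "\<And>i. i \<in> {1..n} \<Longrightarrow> w i = yev \<nu> i" shows "eig \<nu> f"
  using assms eigw_cong[of w "yev \<nu>" f] by (simp add: eig_def)

lemma yev_swap: "1 \<le> j \<Longrightarrow> j < n \<Longrightarrow> lookup \<mu> j \<noteq> lookup \<mu> (j + 1) \<Longrightarrow> yev (rv n j \<mu>) i = (yev \<mu> \<circ> sw j) i"
  by (simp add: yev_ymon rho'_swap sigma_swap) (auto simp: lookup_rv sw_def)

lemma eig_swap:
  assumes "eig \<mu> f" "1 \<le> j" "j < n" "lookup \<mu> j \<noteq> lookup \<mu> (j + 1)"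
  shows "eig (rv n j \<mu>) (TT j f + lscale (gT j (yev \<mu>)) f)"
proof (rule eigw_eig)
  let ?w = "yev \<mu> j" and ?w' = "yev \<mu> (j + 1)"
  have w: "?w \<noteq> ?w'" using assms by (simp add: yev_ymon ymon_eq)
  have e: "eigw (yev \<mu>) f" "f \<noteq> 0" using assms by (auto simp: eig_def)
  show "eigw (yev \<mu> \<circ> sw j) (TT j f + lscale (gT j (yev \<mu>)) f)"
    by (rule eigw_swap(1)[OF e(1) assms(2,3) w])
  show "(yev \<mu> \<circ> sw j) i = yev (rv n j \<mu>) i" for i using yev_swap assms by simp
  have "1 + gT j (yev \<mu>) * gT j (yev \<mu> \<circ> sw j) \<noteq> 0"
  proof
    assume a: "1 + gT j (yev \<mu>) * gT j (yev \<mu> \<circ> sw j) = 0"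
    have d: "?w' - ?w \<noteq> 0" "?w - ?w' \<noteq> 0" using w by auto
    have "(?w' - ?w) * (?w - ?w') * (1 + gT j (yev \<mu>) * gT j (yev \<mu> \<circ> sw j))
      = (?w' - ?w) * (?w - ?w') + (hh j * ?w) * (hh j * ?w')"
    proof -
      have g: "gT j (yev \<mu>) = hh j * ?w / (?w' - ?w)" "gT j (yev \<mu> \<circ> sw j) = hh j * ?w' / (?w - ?w')"
        by (simp_all add: gT_def sw_def)
      show ?thesis unfolding g by (rule frac_aux[OF d])
    qed
    with a have 1: "(?w' - ?w) * (?w - ?w') + (hh j * ?w) * (hh j * ?w') = 0" by simp
    \<comment> \<open>Vanishing of 1 + g g' is a quadratic equation for the quotient of the two
      eigenvalues with roots t and 1/t. Neither occurs, because the two exponents of q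
      differ.\<close>
    have "(?w' - kk j * kk j * ?w) * (?w' - kk' j * kk' j * ?w) = ?w' * ?w' + (kk j * kk' j) * (kk j * kk' j) * (?w * ?w) - (kk j * kk j + kk' j * kk' j) * (?w * ?w')"
      by (simp add: algebra_simps)
    also have "\<dots> = - ((?w' - ?w) * (?w - ?w') + (hh j * ?w) * (hh j * ?w')) + 2 * (1 - kk j * kk' j) * (?w * ?w')
         + ((kk j * kk' j) * (kk j * kk' j) - 1) * (?w * ?w)"
      by (simp add: algebra_simps)
    also have "\<dots> = 0" using 1 by simp
    finally have "?w' - kk j * kk j * ?w = 0 \<or> ?w' - kk' j * kk' j * ?w = 0" by (simp only: mult_eq_0_iff)
    then have "?w' = kk j * kk j * ?w \<or> ?w' = kk' j * kk' j * ?w" by (simp only: right_minus_eq)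
    moreover have "kk j * kk j = ymon 0 1 0" "kk' j * kk' j = ymon 0 (- 1) 0"
      using assms by (simp_all add: kp_def ymon_def hp_powi hp_mult hp_uminus[of Pt 2])
    ultimately show False using assms(4) by (simp add: yev_ymon ymon_mult ymon_eq)
  qed
  then show "TT j f + lscale (gT j (yev \<mu>)) f \<noteq> 0"
    using eigw_swap(2)[OF e(1) assms(2,3) w] e(2) assms(3) lin_zero[OF lin_T, of j] by auto
qed

lemma rho'_adjacent:
  assumes "1 \<le> j" "j < n" "lookup \<mu> j = lookup \<mu> (j + 1)" shows "rho' n \<mu> j = rho' n \<mu> (j + 1) + 1"
proof -
  define g where "g = (\<lambda>i p. of_bool (if p < i then lookup \<mu> p < lookup \<mu> i else lookup \<mu> p \<le> lookup \<mu> i)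
     + of_bool (lookup \<mu> p \<ge> - lookup \<mu> i) - (1::int))"
  define R where "R = {1..n} - {j} - {j + 1}"
  have r: "rho' n \<mu> i = sum (g i) ({1..n} - {i})" for i by (simp add: rho'_def g_def)
  have "sum (g j) ({1..n} - {j}) = g j (j + 1) + sum (g j) R"
    unfolding R_def using assms by (intro sum.remove) auto
  moreover have "{1..n} - {j + 1} - {j} = R" by (auto simp: R_def)
  then have "sum (g (j + 1)) ({1..n} - {j + 1}) = g (j + 1) j + sum (g (j + 1)) R"
    using assms sum.remove[of "{1..n} - {j + 1}" j "g (j + 1)"] by auto
  moreover have "sum (g j) R = sum (g (j + 1)) R"
    using assms by (intro sum.cong) (auto simp: g_def R_def)
  ultimately show ?thesis unfolding r using assms(3) by (simp add: g_def)
qed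

text \<open>The image would have the two eigenvalues exchanged. A weight with that spectrum would
  have the same coordinates as \<mu>, while the exponents of t at j and j + 1 differ by
  \<open>rho'_adjacent\<close>.\<close>

lemma eig_swap_fix:
  assumes "eig \<mu> f" "\<mu> \<in> weights n" "1 \<le> j" "j < n" "lookup \<mu> j = lookup \<mu> (j + 1)"
  shows "TT j f + lscale (gT j (yev \<mu>)) f = 0"
proof (rule ccontr)
  assume nz: "TT j f + lscale (gT j (yev \<mu>)) f \<noteq> 0"
  have w: "yev \<mu> j \<noteq> yev \<mu> (j + 1)" using rho'_adjacent[OF assms(3-5)] by (simp add: yev_ymon ymon_eq)
  have e: "eigw (yev \<mu> \<circ> sw j) (TT j f + lscale (gT j (yev \<mu>)) f)"
    using assms w by (intro eigw_swap(1)) (auto simp: eig_def)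
  obtain \<nu> where n: "\<nu> \<in> weights n" "\<And>i. i \<in> {1..n} \<Longrightarrow> (yev \<mu> \<circ> sw j) i = yev \<nu> i"
    using eigw_nonzero[OF e nz] by metis
  have "\<nu> = \<mu>"
  proof (rule weights_eqI[OF n(1) assms(2)])
    fix p assume "p \<in> {1..n}"
    then have "lookup \<nu> p = lookup \<mu> (sw j p)" using n(2)[of p] by (simp add: yev_ymon ymon_eq)
    then show "lookup \<nu> p = lookup \<mu> p" using assms by (auto simp: sw_def split: if_splits)
  qed
  then show False using n(2)[of j] w assms by (auto simp: sw_def)
qed

lemma eig_affine:
  assumes "eig \<mu> f" shows "eig (s0 \<mu>) (UU f + lscale (gU (yev \<mu> 1)) f)"
proof (rule eigw_eig)
  let ?w = "yev \<mu> 1" and ?v = "1 / (q * yev \<mu> 1)"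
  have n1: "1 \<le> n" using n2 by simp
  have q: "q = ymon 1 0 0" by (simp add: ymon_def)
  have v: "?v = ymon (- 1 - lookup \<mu> 1) (- rho' n \<mu> 1) (- sigma \<mu> 1)"
    unfolding q yev_ymon ymon_mult ymon_inv by simp
  have w: "?w \<noteq> ?v" unfolding v unfolding yev_ymon ymon_eq using sigma_pm[of \<mu> 1] by auto
  have e: "eigw (yev \<mu>) f" "f \<noteq> 0" using assms by (auto simp: eig_def)
  show "eigw ((yev \<mu>)(1 := ?v)) (UU f + lscale (gU ?w) f)"
    by (rule eigw_affine(1)[OF e(1) _ w]) simp
  show "((yev \<mu>)(1 := ?v)) i = yev (s0 \<mu>) i" if "i \<in> {1..n}" for i
  proof (cases "i = 1")
    case True
    have "sigma (s0 \<mu>) 1 = - sigma \<mu> 1" by (auto simp: sigma_def lookup_s0)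
    then show ?thesis unfolding True using rho'_s0(2)[OF n2] v by (simp add: yev_ymon lookup_s0)
  next
    case False
    then have "1 < i" using that by auto
    then show ?thesis using rho'_s0(1)[OF n2 \<open>1 < i\<close>] by (simp add: yev_ymon lookup_s0 sigma_def)
  qed
  have "1 + gU ?w * gU ?v \<noteq> 0"
  proof
    assume a: "1 + gU ?w * gU ?v = 0"
    \<comment> \<open>The factor q^(1/2) symmetrizes: the passage from y to 1/(q y) becomes x
      \<mapsto> 1/x, as required by \<open>quad_factor\<close>.\<close>
    define x where "x = hp Pq 1 * ?w"
    define X where "X = uu n / hp Pq 1"
    have d: "?w - ?v \<noteq> 0" "?v - ?w \<noteq> 0" using w by auto
    have vv: "1 / (q * ?v) = ?w" by simp
    have g: "gU ?w = (uu 0 * ?v + X) / (?w - ?v)" "gU ?v = (uu 0 * ?w + X) / (?v - ?w)"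
      unfolding gU_def X_def vv by simp_all
    have "(?w - ?v) * (?v - ?w) * (1 + gU ?w * gU ?v) = (?w - ?v) * (?v - ?w) + (uu 0 * ?v + X) * (uu 0 * ?w + X)"
      unfolding g by (rule frac_aux[OF d])
    moreover have "(A - B) * (A - B) = Z" if "(A - B) * (B - A) * (1 + G) = (A - B) * (B - A) + Z" "1 + G = 0" for A B Z G :: 'a
    proof -
      have "(A - B) * (B - A) + Z = 0" using that by simp
      moreover have "(A - B) * (B - A) = - ((A - B) * (A - B))" by (simp add: algebra_simps)
      ultimately show ?thesis by simp
    qed
    ultimately have 1: "(?w - ?v) * (?w - ?v) = (uu 0 * ?v + X) * (uu 0 * ?w + X)" using a by blast
    have x1: "1 / x = hp Pq 1 * ?v" by (simp add: x_def hp_2)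
    have hX: "hp Pq 1 * X = uu n" by (simp add: X_def)
    have "(x - 1 / x)^2 = hp Pq 1 * hp Pq 1 * ((?w - ?v) * (?w - ?v))"
      unfolding x1 by (simp add: x_def power2_eq_square algebra_simps)
    also have "\<dots> = (uu 0 * (hp Pq 1 * ?v) + hp Pq 1 * X) * (uu 0 * x + hp Pq 1 * X)"
      unfolding 1 x_def by (simp add: algebra_simps)
    also have "\<dots> = (uu 0 / x + uu n) * (uu 0 * x + uu n)" unfolding hX x1[symmetric] by simp
    finally have "(x - 1 / x)^2 = ((hp Pu0 1 - 1 / hp Pu0 1) / x + (hp Pun 1 - 1 / hp Pun 1)) * ((hp Pu0 1 - 1 / hp Pu0 1) * x + (hp Pun 1 - 1 / hp Pun 1))"
      using n2 by (simp add: up_def hp_uminus inverse_eq_divide)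
    from quad_factor[OF _ _ _ this] show False
      using indU[of "sigma \<mu> 1" x "lookup \<mu> 1" "rho' n \<mu> 1"] sigma_pm[of \<mu> 1] by (auto simp: x_def yev_ymon)
  qed
  moreover have "UU (UU f + lscale (gU ?w) f) + lscale (gU ?v) (UU f + lscale (gU ?w) f) = lscale (1 + gU ?w * gU ?v) f"
    by (rule eigw_affine(2)[OF e(1) _ w]) simp
  ultimately show "UU f + lscale (gU ?w) f \<noteq> 0"
    using e(2) lin_zero[OF lin_UU] by auto
qed

lemma yev_flip: assumes "lookup \<mu> n \<noteq> 0" "i \<in> {1..n}" shows "((yev \<mu>)(n := 1 / yev \<mu> n)) i = yev (rv n n \<mu>) i"
proof (cases "i = n")
  case True
  have "sigma (rv n n \<mu>) n = - sigma \<mu> n" "lookup (rv n n \<mu>) n = - lookup \<mu> n" using assms n2 by (auto simp: sigma_def lookup_rv)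
  then show ?thesis using True rho'_flip(2)[OF n2 assms(1)] by (simp add: yev_ymon ymon_inv)
next
  case False
  then have "sigma (rv n n \<mu>) i = sigma \<mu> i" "lookup (rv n n \<mu>) i = lookup \<mu> i" using n2 by (auto simp: sigma_def lookup_rv)
  then show ?thesis using False rho'_flip(1)[OF n2, of i] assms by (simp add: yev_ymon)
qed

lemma yev_sq: "yev \<mu> n * yev \<mu> n \<noteq> 1"
  using ind[of "2 * lookup \<mu> n" "2 * rho' n \<mu> n" "2 * sigma \<mu> n"] sigma_pm[of \<mu> n] by (auto simp: yev_ymon ymon_mult)

lemma eigw_flip': assumes "eig \<mu> f"
  shows "eigw ((yev \<mu>)(n := 1 / yev \<mu> n)) (TT n f + lscale (gN (yev \<mu> n)) f)"
    "TT n (TT n f + lscale (gN (yev \<mu> n)) f) + lscale (gN (1 / yev \<mu> n)) (TT n f + lscale (gN (yev \<mu> n)) f)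
       = lscale (1 + gN (yev \<mu> n) * gN (1 / yev \<mu> n)) f"
  using assms eigw_flip[of "yev \<mu>" f] yev_sq[of \<mu>] by (simp_all add: eig_def)

text \<open>These values are \<open>par_b_star\<close> and its inverse. The other two roots from
  \<open>quad_factor\<close> are \<open>par_a_star\<close> and its inverse, and they belong to a
  last coordinate 0.\<close>

abbreviation crit :: "'a \<Rightarrow> bool" where
  "crit w \<equiv> w = - hp Pt0 1 / hp Ptn 1 \<or> w = - hp Ptn 1 / hp Pt0 1"

lemma gN_square: assumes "w \<noteq> 0" "w * w \<noteq> 1" shows
  "1 + gN w * gN (1 / w) = 0 \<longleftrightarrow> (w - 1 / w)^2 = ((hp Ptn 1 - 1 / hp Ptn 1) / w + (hp Pt0 1 - 1 / hp Pt0 1)) * ((hp Ptn 1 - 1 / hp Ptn 1) * w + (hp Pt0 1 - 1 / hp Pt0 1))"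
proof -
  have d: "1 / w - w \<noteq> 0" "w - 1 / w \<noteq> 0" using assms by (auto simp: field_simps)
  from frac_aux[OF d] have "(1 / w - w) * (w - 1 / w) * (1 + gN w * gN (1 / w)) = (1 / w - w) * (w - 1 / w) + (w * hh n + hh 0) * (1 / w * hh n + hh 0)"
    using assms(1) by (simp add: gN_def)
  then have "1 + gN w * gN (1 / w) = 0 \<longleftrightarrow> (1 / w - w) * (w - 1 / w) + (w * hh n + hh 0) * (1 / w * hh n + hh 0) = 0"
    using d by (metis mult_eq_0_iff)
  also have "\<dots> \<longleftrightarrow> (w - 1 / w)^2 = (hh n / w + hh 0) * (hh n * w + hh 0)"
  proof -
    have 1: "(1 / w - w) * (w - 1 / w) = - ((w - 1 / w)^2)" by (simp add: power2_eq_square algebra_simps)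
    have 2: "(w * hh n + hh 0) * (1 / w * hh n + hh 0) = (hh n / w + hh 0) * (hh n * w + hh 0)" by (simp add: mult.commute)
    have "- A + B = 0 \<longleftrightarrow> A = B" for A B :: 'a by (auto simp: eq_neg_iff_add_eq_0 add.commute)
    then show ?thesis unfolding 1 2 .
  qed
  finally show ?thesis using n2 by (simp add: kp_def hp_uminus inverse_eq_divide)
qed

lemma eig_flip:
  assumes "eig \<mu> f" "lookup \<mu> n \<noteq> 0" "\<not> crit (yev \<mu> n)"
  shows "eig (rv n n \<mu>) (TT n f + lscale (gN (yev \<mu> n)) f)"
proof (rule eigw_eig[OF eigw_flip'(1)[OF assms(1)] _ yev_flip[OF assms(2)]])
  have "1 + gN (yev \<mu> n) * gN (1 / yev \<mu> n) \<noteq> 0"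
  proof
    assume "1 + gN (yev \<mu> n) * gN (1 / yev \<mu> n) = 0"
    then have "yev \<mu> n = hp Pt0 1 * hp Ptn 1 \<or> yev \<mu> n = 1 / (hp Pt0 1 * hp Ptn 1)"
      using gN_square[OF yev_nz yev_sq, of \<mu>] quad_factor[of "yev \<mu> n" "hp Pt0 1" "hp Ptn 1"] assms(3) by auto
    moreover have "hp Pt0 1 * hp Ptn 1 = ymon 0 0 1" by (simp add: ymon_def mult.commute)
    ultimately show False using assms(2) by (auto simp: yev_ymon ymon_inv ymon_eq)
  qed
  then show "TT n f + lscale (gN (yev \<mu> n)) f \<noteq> 0"
    using eigw_flip'(2)[OF assms(1)] assms(1) lin_zero[OF lin_T, of n] by (auto simp: eig_def)
qed

text \<open>Going up, the leading coefficient shows that the intertwiner does not vanish, even at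
  the critical value.\<close>

lemma eig_flip_up:
  assumes "eig \<mu> f" "\<mu> \<in> weights n" "lookup \<mu> n < 0"
  shows "eig (rv n n \<mu>) (TT n f + lscale (gN (yev \<mu> n)) f)"
proof (rule eigw_eig[OF eigw_flip'(1)[OF assms(1)] _ yev_flip])
  show "lookup \<mu> n \<noteq> 0" using assms by simp
  let ?\<kappa> = "rv n n \<mu>"
  have kw: "?\<kappa> \<in> weights n" using assms n2 by (intro rv_weights) auto
  have "\<mu> = ins n (lookup \<mu>) n (lookup \<mu> n)" using assms by (intro ins_eqI) auto
  then have "?\<kappa> = ins n (lookup \<mu>) n (- lookup \<mu> n)" using rv_ins_n[OF n2] by metis
  then have mk: "\<mu> \<in> lt n ?\<kappa>"
    using lt_neg[of n n "- lookup \<mu> n" "lookup \<mu>"] assms n2 \<open>\<mu> = _\<close> by simp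
  have ne: "?\<kappa> \<noteq> \<mu>" "?\<kappa> \<notin> lt n \<mu>" using mk lt_irrefl lt_trans[OF _ mk kw] by metis+
  then have k0: "lookup f ?\<kappa> = 0" using eig_top(2)[OF assms(1,2)] by (metis in_keys_iff)
  have ht: "ht n m ?\<kappa> = ht n m \<mu>" for m using n2 by (simp add: ht_rv)
  have l: "lookup (TT n (monom_x \<nu>)) ?\<kappa> = (if \<nu> = \<mu> then alpha n \<mu> else 0)" if "\<nu> \<in> keys f" for \<nu>
  proof -
    have nw: "\<nu> \<in> weights n" "\<nu> = \<mu> \<or> \<nu> \<in> lt n \<mu>"
      using that eig_top(2)[OF assms(1,2)] assms by (auto simp: eig_def eigw_def LP_iff)
    then have b: "\<nu> \<in> below n \<mu>" using below_refl assms by (auto simp: lt_def)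
    \<comment> \<open>The weight ?\<kappa> lies in the same orbit as \<mu>, so it cannot come from
      an error term in a smaller orbit.\<close>
    have "?\<kappa> \<notin> lower n \<nu>"
    proof
      assume "?\<kappa> \<in> lower n \<nu>"
      then have "?\<kappa> \<in> lower n \<mu>" using b below_lower by blast
      then show False using ht by (auto simp: lower_def)
    qed
    then have "?\<kappa> \<notin> keys (TT n (monom_x \<nu>) - (lscale (alpha n \<nu>) (monom_x (rv n n \<nu>)) + lscale (delta n \<nu>) (monom_x \<nu>)))"
      using T_monom[of n \<nu>] nw by blast
    then have "lookup (TT n (monom_x \<nu>)) ?\<kappa> = alpha n \<nu> * (if ?\<kappa> = rv n n \<nu> then 1 else 0) + delta n \<nu> * (if ?\<kappa> = \<nu> then 1 else 0)"
      by (simp add: in_keys_iff lookup_minus lookup_add lookup_monom_x)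
    moreover have "?\<kappa> \<noteq> \<nu>" using ne nw by auto
    moreover have "?\<kappa> = rv n n \<nu> \<longleftrightarrow> \<nu> = \<mu>" using rv_rv[of n \<mu>] rv_rv[of n \<nu>] by (metis order_refl)
    ultimately show ?thesis by simp
  qed
  have "lookup (TT n f) ?\<kappa> = (\<Sum>\<nu>\<in>keys f. lookup f \<nu> * lookup (TT n (monom_x \<nu>)) ?\<kappa>)"
    by (subst lin_expand[OF lin_T]) (auto simp: lookup_sum)
  also have "\<dots> = (\<Sum>\<nu>\<in>keys f. if \<nu> = \<mu> then lookup f \<mu> * alpha n \<mu> else 0)" by (intro sum.cong) (auto simp: l)
  also have "\<dots> = lookup f \<mu> * alpha n \<mu>" using eig_top(1)[OF assms(1,2)] by simp
  finally have "lookup (TT n f + lscale (gN (yev \<mu> n)) f) ?\<kappa> = lookup f \<mu> * alpha n \<mu>"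
    by (simp add: lookup_add k0)
  moreover have "alpha n \<mu> \<noteq> 0" by (simp add: alpha_def)
  moreover have "lookup f \<mu> \<noteq> 0" using eig_top(1)[OF assms(1,2)] by (simp add: in_keys_iff)
  ultimately show "TT n f + lscale (gN (yev \<mu> n)) f \<noteq> 0" by auto
qed

text \<open>At a critical value the downward and the upward intertwiner compose to 0. The upward one
  never annihilates an eigenvector, so the downward one must already give 0.\<close>

lemma eig_flip_crit:
  assumes "eig \<mu> f" "\<mu> \<in> weights n" "lookup \<mu> n > 0" "crit (yev \<mu> n)"
  shows "TT n f + lscale (gN (yev \<mu> n)) f = 0"
proof (rule ccontr)
  let ?f = "TT n f + lscale (gN (yev \<mu> n)) f"
  assume nz: "?f \<noteq> 0"
  have e: "eig (rv n n \<mu>) ?f"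
    using assms by (intro eigw_eig[OF eigw_flip'(1)[OF assms(1)] nz yev_flip]) auto
  have y: "yev (rv n n \<mu>) n = 1 / yev \<mu> n" using yev_flip[of \<mu> n] assms n2 by simp
  have "eig (rv n n (rv n n \<mu>)) (TT n ?f + lscale (gN (yev (rv n n \<mu>) n)) ?f)"
    using assms n2 by (intro eig_flip_up[OF e] rv_weights) (auto simp: lookup_rv)
  then have "TT n ?f + lscale (gN (1 / yev \<mu> n)) ?f \<noteq> 0" by (simp add: eig_def y)
  moreover have "1 + gN (yev \<mu> n) * gN (1 / yev \<mu> n) = 0"
  proof -
    have "(x - 1 / x)^2 = ((V - 1 / V) / x + (U - 1 / U)) * ((V - 1 / V) * x + (U - 1 / U))"
      if "x = - U / V \<or> x = - V / U" "U \<noteq> 0" "V \<noteq> 0" for x U V :: 'a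
    proof -
      have "(- (U * (1 / V)) - (- ((1 / U) * V)))^2 = ((V - 1 / V) * (- ((1 / U) * V)) + (U - 1 / U)) * ((V - 1 / V) * (- (U * (1 / V))) + (U - 1 / U))"
        by (rule crit_aux) (use that in simp_all)
      then show ?thesis using that by (auto simp: power2_commute mult.commute)
    qed
    from this[OF assms(4)] show ?thesis using gN_square[OF yev_nz yev_sq] by simp
  qed
  ultimately show False using eigw_flip'(2)[OF assms(1)] by simp
qed

text \<open>The image would belong to last coordinate 0 with the exponent of
  \<open>par_a_star\<close> reversed. The convention that 0 has sign +1 excludes such a
  weight.\<close>

lemma eig_flip_fix:
  assumes "eig \<mu> f" "\<mu> \<in> weights n" "lookup \<mu> n = 0"
  shows "TT n f + lscale (gN (yev \<mu> n)) f = 0"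
proof (rule ccontr)
  assume nz: "TT n f + lscale (gN (yev \<mu> n)) f \<noteq> 0"
  obtain \<nu> where n: "\<nu> \<in> weights n" "\<And>i. i \<in> {1..n} \<Longrightarrow> ((yev \<mu>)(n := 1 / yev \<mu> n)) i = yev \<nu> i"
    using eigw_nonzero[OF eigw_flip'(1)[OF assms(1)] nz] by metis
  have "1 / yev \<mu> n = yev \<nu> n" using n(2)[of n] n2 by simp
  then have "lookup \<nu> n = 0" "sigma \<nu> n = - sigma \<mu> n" using assms(3) by (auto simp: yev_ymon ymon_inv ymon_eq)
  then show False using assms(3) by (simp add: sigma_def)
qed

lemma below_0: "below n 0 = {0}"
proof -
  have "\<nu> = 0" if "\<nu> \<in> below n 0" for \<nu>
  proof (rule poly_mapping_eqI)
    fix p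
    have "ht n 0 \<nu> \<le> ht n 0 0" "\<nu> \<in> weights n" using that by (auto simp: below_def)
    then have "(\<Sum>p\<in>{1..n}. \<bar>lookup \<nu> p\<bar>) \<le> 0" by (simp add: ht_def)
    then have "\<forall>p\<in>{1..n}. \<bar>lookup \<nu> p\<bar> = 0" by (intro sum_nonneg_eq_0_iff[THEN iffD1]) (auto intro: antisym sum_nonneg)
    then show "lookup \<nu> p = lookup 0 p" using weights_0[OF \<open>\<nu> \<in> weights n\<close>, of p] by auto
  qed
  moreover have "0 \<in> below n 0" by (intro below_refl weightsI) simp
  ultimately show ?thesis by blast
qed

lemma eig_0: "eig 0 1"
proof -
  have w: "0 \<in> weights n" by (intro weightsI) simp
  have "lt n 0 = {}" using below_0 lt_irrefl[of 0 n] by (auto simp: lt_def)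
  then have "YY i (monom_x 0) - lscale (yev 0 i) (monom_x 0) = 0" if "i \<in> {1..n}" for i
    using YY_tri(1)[OF w, of i] that by (simp add: keys_eq_empty)
  moreover have "(1 :: 'a laurent) \<in> LP" using w by (simp add: LP_iff)
  ultimately show ?thesis by (auto simp: eig_def eigw_def)
qed

end

section \<open>Signed permutations\<close>

definition sset :: "nat \<Rightarrow> int set" where "sset n = {- int n..int n} - {0}"

lemma sset_iff: "x \<in> sset n \<longleftrightarrow> x \<noteq> 0 \<and> \<bar>x\<bar> \<le> int n"
  by (auto simp: sset_def)

lemma signed_perms_iff: "w \<in> signed_perms n \<longleftrightarrow> w permutes sset n \<and> (\<forall>j. w (- j) = - w j)"
  by (simp add: signed_perms_def sset_def)

lemma signed_perms_inj: "w \<in> signed_perms n \<Longrightarrow> w x = w y \<longleftrightarrow> x = y"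
  by (metis signed_perms_iff permutes_inj injD)

lemma signed_perms_in: "w \<in> signed_perms n \<Longrightarrow> w x \<in> sset n \<longleftrightarrow> x \<in> sset n"
  by (metis signed_perms_iff permutes_in_image)

lemma signed_perms_comp: "v \<in> signed_perms n \<Longrightarrow> w \<in> signed_perms n \<Longrightarrow> v \<circ> w \<in> signed_perms n"
  by (simp add: signed_perms_iff permutes_compose)

lemma signed_perms_inv: assumes "w \<in> signed_perms n" shows "inv w \<in> signed_perms n"
proof -
  have p: "w permutes sset n" "\<And>j. w (- j) = - w j" using assms by (auto simp: signed_perms_iff)
  have "inv w (- j) = - inv w j" for j
    using p(2)[of "inv w j"] permutes_inverses[OF p(1)] by metis
  then show ?thesis using permutes_inv[OF p(1)] by (simp add: signed_perms_iff)
qed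

definition pos :: "(int \<Rightarrow> int) \<Rightarrow> nat \<Rightarrow> nat" where "pos w m = nat \<bar>w (int m)\<bar>"

lemma pos_bij: assumes "w \<in> signed_perms n" shows "bij_betw (pos w) {1..n} {1..n}"
proof -
  have in': "pos w m \<in> {1..n}" if "m \<in> {1..n}" for m
    using signed_perms_in[OF assms, of "int m"] that by (auto simp: pos_def sset_iff)
  have inj: "inj_on (pos w) {1..n}"
  proof (rule inj_onI)
    fix m m' assume m: "m \<in> {1..n}" "m' \<in> {1..n}" "pos w m = pos w m'"
    then have "w (int m) = w (int m') \<or> w (int m) = - w (int m')" by (auto simp: pos_def)
    then have "w (int m) = w (int m') \<or> w (int m) = w (- int m')" using assms by (simp add: signed_perms_iff)
    then show "m = m'" using m signed_perms_inj[OF assms] by auto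
  qed
  moreover have "pos w ` {1..n} = {1..n}"
    using endo_inj_surj[OF _ _ inj] in' by blast
  ultimately show ?thesis by (simp add: bij_betw_def)
qed

lemma pos_in: "w \<in> signed_perms n \<Longrightarrow> m \<in> {1..n} \<Longrightarrow> pos w m \<in> {1..n}"
  using pos_bij bij_betwE by blast

lemma pos_ex: assumes "w \<in> signed_perms n" "p \<in> {1..n}" obtains m where "m \<in> {1..n}" "p = pos w m"
  using pos_bij[OF assms(1)] assms(2) by (metis bij_betw_iff_bijections)

lemma lookup_act:
  assumes "w \<in> signed_perms n" "\<mu> \<in> weights n" "m \<in> {1..n}"
  shows "lookup (act w \<mu>) (pos w m) = sgn (w (int m)) * lookup \<mu> m"
proof -
  have k: "keys \<mu> \<subseteq> {1..n}" using assms by (simp add: weights_def)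
  have "lookup (act w \<mu>) (pos w m) = (\<Sum>i\<in>keys \<mu>. if i = m then sgn (w (int m)) * lookup \<mu> m else 0)"
    unfolding act_def lookup_sum
  proof (rule sum.cong)
    fix i assume "i \<in> keys \<mu>"
    then have "pos w i = pos w m \<longleftrightarrow> i = m" using pos_bij[OF assms(1)] k assms(3)
      by (meson bij_betw_imp_inj_on inj_onD subsetD)
    then show "lookup (single (nat \<bar>w (int i)\<bar>) (sgn (w (int i)) * lookup \<mu> i)) (pos w m) = (if i = m then sgn (w (int m)) * lookup \<mu> m else 0)"
      by (auto simp: lookup_single when_def pos_def[symmetric])
  qed simp
  also have "\<dots> = sgn (w (int m)) * lookup \<mu> m" by (simp add: not_in_keys_iff_lookup_eq_zero)
  finally show ?thesis .
qed

lemma act_weights: assumes "w \<in> signed_perms n" "\<mu> \<in> weights n" shows "act w \<mu> \<in> weights n"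
proof (rule weightsI)
  fix p assume p: "p \<notin> {1..n}"
  have "pos w i \<noteq> p" if "i \<in> keys \<mu>" for i
    using that assms p pos_in[OF assms(1), of i] by (auto simp: weights_def)
  then show "lookup (act w \<mu>) p = 0"
    unfolding act_def lookup_sum by (intro sum.neutral) (auto simp: lookup_single when_def pos_def)
qed

lemma act_eqI:
  assumes "w \<in> signed_perms n" "\<mu> \<in> weights n" "\<nu> \<in> weights n" "\<And>m. m \<in> {1..n} \<Longrightarrow> lookup \<nu> (pos w m) = sgn (w (int m)) * lookup \<mu> m"
  shows "act w \<mu> = \<nu>"
proof (rule weights_eqI[OF act_weights[OF assms(1,2)] assms(3)])
  fix p assume "p \<in> {1..n}"
  then obtain m where "m \<in> {1..n}" "p = pos w m" using pos_ex[OF assms(1)] by blast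
  then show "lookup (act w \<mu>) p = lookup \<nu> p" using lookup_act[OF assms(1,2)] assms(4) by simp
qed

lemma act_comp: assumes "v \<in> signed_perms n" "w \<in> signed_perms n" "\<mu> \<in> weights n" shows "act (v \<circ> w) \<mu> = act v (act w \<mu>)"
proof (rule act_eqI[OF signed_perms_comp[OF assms(1,2)] assms(3)])
  show "act v (act w \<mu>) \<in> weights n" using assms by (intro act_weights)
  fix m assume m: "m \<in> {1..n}"
  define s where "s = w (int m)"
  have s: "s \<noteq> 0" using signed_perms_in[OF assms(2), of "int m"] m by (auto simp: s_def sset_iff)
  have odd: "v (- j) = - v j" for j using assms(1) by (simp add: signed_perms_iff)
  have v: "v (int (pos w m)) = sgn s * v s" using odd[of s] s by (cases "s > 0") (simp_all add: pos_def s_def[symmetric])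
  then have "pos v (pos w m) = pos (v \<circ> w) m" using s by (simp add: pos_def[of v] pos_def[of "v \<circ> w"] s_def[symmetric] abs_mult)
  then have "lookup (act v (act w \<mu>)) (pos (v \<circ> w) m) = sgn (sgn s * v s) * (sgn s * lookup \<mu> m)"
    using lookup_act[OF assms(1) act_weights[OF assms(2,3)] pos_in[OF assms(2) m]] lookup_act[OF assms(2,3) m] v
    by (simp add: s_def)
  also have "\<dots> = sgn (v s) * lookup \<mu> m" using s by (simp add: sgn_mult)
  finally show "lookup (act v (act w \<mu>)) (pos (v \<circ> w) m) = sgn ((v \<circ> w) (int m)) * lookup \<mu> m" by (simp add: s_def)
qed

lemma act_id: "\<mu> \<in> weights n \<Longrightarrow> act id \<mu> = \<mu>"
  by (rule act_eqI[where n = n]) (auto simp: signed_perms_iff permutes_id pos_def sset_iff)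

lemma act_inv: "w \<in> signed_perms n \<Longrightarrow> \<mu> \<in> weights n \<Longrightarrow> act (inv w) (act w \<mu>) = \<mu>"
  using act_comp[OF signed_perms_inv, of w n w \<mu>] act_id[of \<mu> n]
  by (metis signed_perms_iff permutes_inv_o(2))

text \<open>The successor of j in the order 1, ..., n, -n, ..., -1; the j-th simple reflection
  exchanges these two neighbours.\<close>

definition jp :: "nat \<Rightarrow> nat \<Rightarrow> int" where "jp n j = (if j < n then int j + 1 else - int n)"

lemma simple_refl_eq:
  assumes "j \<in> {1..n}"
  shows "simple_refl n j x = (if x = int j then jp n j else if x = jp n j then int j
    else if x = - int j then - jp n j else if x = - jp n j then - int j else x)"
  using assms by (auto simp: simple_refl_def jp_def transpose_def)

lemma simple_refl_signed: assumes "j \<in> {1..n}" shows "simple_refl n j \<in> signed_perms n"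
proof -
  have "simple_refl n j permutes sset n"
    using assms unfolding simple_refl_def
    by (auto intro!: permutes_compose permutes_swap_id simp: sset_iff)
  moreover have "simple_refl n j (- x) = - simple_refl n j x" for x
    using assms unfolding simple_refl_eq[OF assms] by (auto simp: jp_def)
  ultimately show ?thesis by (simp add: signed_perms_iff)
qed

lemma simple_refl_invol: "j \<in> {1..n} \<Longrightarrow> simple_refl n j (simple_refl n j x) = x"
  unfolding simple_refl_eq by (auto simp: jp_def)

lemma act_simple: assumes "j \<in> {1..n}" "n \<ge> 2" "\<mu> \<in> weights n" shows "act (simple_refl n j) \<mu> = rv n j \<mu>"
proof (rule act_eqI[OF simple_refl_signed[OF assms(1)] assms(3)])
  show "rv n j \<mu> \<in> weights n" using assms by (intro rv_weights) auto
  fix m assume m: "m \<in> {1..n}"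
  have "simple_refl n j (int m) = (if j < n then int (sw j m) else if m = n then - int n else int m)"
    using assms m by (auto simp: simple_refl_eq jp_def sw_def)
  then show "lookup (rv n j \<mu>) (pos (simple_refl n j) m) = sgn (simple_refl n j (int m)) * lookup \<mu> m"
    using assms m by (auto simp: pos_def lookup_rv sw_def)
qed

section \<open>The exchange property\<close>

text \<open>The order \<open>1 > \<dots> > n > -n > \<dots> > -1\<close> of \<open>\<plusminus>\<epsilon>\<^sub>1, \<dots>, \<plusminus>\<epsilon>\<^sub>n\<close>.\<close>

definition key :: "nat \<Rightarrow> int \<Rightarrow> int" where "key n a = (if a > 0 then int n + 1 - a else - (int n + 1 + a))"

lemma key_inj: "a \<in> sset n \<Longrightarrow> b \<in> sset n \<Longrightarrow> key n a = key n b \<Longrightarrow> a = b"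
  by (auto simp: key_def sset_iff split: if_splits)

lemma key_minus: "a \<in> sset n \<Longrightarrow> key n (- a) = - key n a"
  by (auto simp: key_def sset_iff)

text \<open>Exchanging neighbours can reverse the order only of this pair and of the pair of its
  negatives.\<close>

lemma key_reversed:
  assumes "i \<in> {1..n}" "a \<in> sset n" "b \<in> sset n" "key n b < key n a" "key n (simple_refl n i a) < key n (simple_refl n i b)"
  shows "a = int i \<and> b = jp n i \<or> a = - jp n i \<and> b = - int i"
proof (cases "i < n")
  case True
  have f: "simple_refl n i x = (if x = int i then int i + 1 else if x = int i + 1 then int i
    else if x = - int i then - (int i + 1) else if x = - (int i + 1) then - int i else x)" for x
    using True assms(1) by (simp add: simple_refl_eq jp_def)
  show ?thesis using assms(1-5) True unfolding f key_def sset_iff jp_def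
    by (simp split: if_splits)
next
  case False
  then have f: "simple_refl n i x = (if x = int n then - int n else if x = - int n then int n else x)" for x
    using assms(1) by (simp add: simple_refl_eq jp_def)
  show ?thesis using assms(1-5) False unfolding f key_def sset_iff jp_def
    by (simp split: if_splits)
qed

abbreviation word :: "nat \<Rightarrow> nat list \<Rightarrow> int \<Rightarrow> int" where "word n is \<equiv> compose_list (map (simple_refl n) is)"

lemma word_Cons: "word n (i # is) = simple_refl n i \<circ> word n is"
  and word_Nil: "word n [] = id"
  by (simp_all add: compose_list_def)

lemma word_append: "word n (is @ js) = word n is \<circ> word n js"
  by (induction "is") (simp_all add: word_Cons word_Nil comp_assoc del: list.map)

lemma word_signed: "set is \<subseteq> {1..n} \<Longrightarrow> word n is \<in> signed_perms n"
proof (induction "is")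
  case Nil
  show ?case unfolding word_Nil signed_perms_iff using permutes_id[of "sset n"] by (simp add: id_def)
next
  case (Cons i "is")
  then show ?case unfolding word_Cons by (intro signed_perms_comp simple_refl_signed) auto
qed

lemma jp_in: "j \<in> {1..n} \<Longrightarrow> jp n j \<in> sset n \<and> int j \<in> sset n"
  by (auto simp: jp_def sset_iff)

lemma simple_refl_vals:
  assumes "j \<in> {1..n}"
  shows "simple_refl n j (int j) = jp n j" "simple_refl n j (jp n j) = int j"
    "simple_refl n j (- int j) = - jp n j" "simple_refl n j (- jp n j) = - int j"
  using assms by (auto simp: simple_refl_eq jp_def)

text \<open>The assumption says that u takes the j-th simple root to the i-th, and conjugation by u
  takes the corresponding reflections to each other.\<close>

lemma commute_simple:
  assumes i: "i \<in> {1..n}" and j: "j \<in> {1..n}" and u: "u \<in> signed_perms n"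
    and e: "u (int j) = int i \<and> u (jp n j) = jp n i \<or> u (int j) = - jp n i \<and> u (jp n j) = - int i"
  shows "simple_refl n i \<circ> u = u \<circ> simple_refl n j"
proof
  fix x
  have odd: "u (- y) = - u y" for y using u by (simp add: signed_perms_iff)
  have inj: "u x = u y \<longleftrightarrow> x = y" for y using signed_perms_inj[OF u] .
  have inj': "u x = - u y \<longleftrightarrow> x = - y" for y using inj[of "- y"] by (simp add: odd)
  note vals = simple_refl_vals[OF i] simple_refl_vals[OF j]
  consider "x = int j" | "x = jp n j" | "x = - int j" | "x = - jp n j"
    | "x \<noteq> int j" "x \<noteq> jp n j" "x \<noteq> - int j" "x \<noteq> - jp n j" by blast
  then show "(simple_refl n i \<circ> u) x = (u \<circ> simple_refl n j) x"
  proof cases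
    case 5
    then have "u x \<noteq> u (int j)" "u x \<noteq> u (jp n j)" "u x \<noteq> - u (int j)" "u x \<noteq> - u (jp n j)"
      unfolding inj inj' by auto
    then have "u x \<noteq> int i" "u x \<noteq> jp n i" "u x \<noteq> - int i" "u x \<noteq> - jp n i" using e by auto
    then show ?thesis using 5 by (simp add: simple_refl_eq[OF i] simple_refl_eq[OF j])
  next
    case 1
    show ?thesis unfolding 1 comp_apply vals using e by (elim disjE conjE) (simp_all only: vals)
  next
    case 2
    show ?thesis unfolding 2 comp_apply vals using e by (elim disjE conjE) (simp_all only: vals)
  next
    case 3
    show ?thesis unfolding 3 comp_apply vals odd using e by (elim disjE conjE) (simp_all only: vals minus_minus)
  next
    case 4
    show ?thesis unfolding 4 comp_apply vals odd using e by (elim disjE conjE) (simp_all only: vals minus_minus)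
  qed
qed

text \<open>The exchange condition. Reading the word from its right end, some letter reverses the
  j-th pair of neighbours; by \<open>commute_simple\<close> this letter cancels against the appended
  reflection.\<close>

lemma exchange:
  assumes "set is \<subseteq> {1..n}" "j \<in> {1..n}" "key n (word n is (int j)) < key n (word n is (jp n j))"
  shows "\<exists>is'. set is' \<subseteq> {1..n} \<and> length is' < length is \<and> word n is \<circ> simple_refl n j = word n is'"
  using assms(1,3)
proof (induction "is")
  case Nil
  then show ?case using assms(2) by (auto simp: word_Nil key_def jp_def simp del: list.map split: if_splits)
next
  case (Cons i "is")
  let ?u = "word n is"
  have i: "i \<in> {1..n}" "set is \<subseteq> {1..n}" using Cons.prems by auto
  have u: "?u \<in> signed_perms n" using word_signed i by blast
  have invol: "simple_refl n j \<circ> simple_refl n j = id" using simple_refl_invol[OF assms(2)] by (simp add: fun_eq_iff)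
  show ?case
  proof (cases "key n (?u (int j)) < key n (?u (jp n j))")
    case True
    from Cons.IH[OF i(2) this] obtain is' where is': "set is' \<subseteq> {1..n}" "length is' < length is" "?u \<circ> simple_refl n j = word n is'" by blast
    then show ?thesis using i by (intro exI[of _ "i # is'"]) (simp only: word_Cons comp_assoc, simp)
  next
    case False
    have "?u (int j) \<in> sset n" "?u (jp n j) \<in> sset n" using signed_perms_in[OF u] jp_in[OF assms(2)] by auto
    moreover have "?u (int j) \<noteq> ?u (jp n j)" using signed_perms_inj[OF u] assms(2) by (auto simp: jp_def)
    ultimately have "key n (?u (jp n j)) < key n (?u (int j))" using False key_inj by force
    then have "?u (int j) = int i \<and> ?u (jp n j) = jp n i \<or> ?u (int j) = - jp n i \<and> ?u (jp n j) = - int i"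
      using Cons.prems(2) key_reversed[OF i(1) \<open>?u (int j) \<in> sset n\<close> \<open>?u (jp n j) \<in> sset n\<close>] by (simp only: word_Cons comp_apply)
    from commute_simple[OF i(1) assms(2) u this]
    have "word n (i # is) \<circ> simple_refl n j = ?u"
      unfolding word_Cons by (simp add: comp_assoc invol)
    then show ?thesis using i(2) by (intro exI[of _ "is"]) simp
  qed
qed

text \<open>A potential for sorting: it is bounded and grows whenever a reversed pair of neighbours
  is put in order.\<close>

definition kmeas :: "nat \<Rightarrow> (int \<Rightarrow> int) \<Rightarrow> int" where
  "kmeas n w = (\<Sum>m\<in>{1..n}. (int n + 1 - int m) * key n (w (int m)))"

lemma signed_perms_eqI:
  assumes "v \<in> signed_perms n" "w \<in> signed_perms n" "\<And>m. m \<in> {1..n} \<Longrightarrow> v (int m) = w (int m)"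
  shows "v = w"
proof
  fix x
  have odd: "v (- y) = - v y" "w (- y) = - w y" for y using assms by (auto simp: signed_perms_iff)
  show "v x = w x"
  proof (cases "x \<in> sset n")
    case False
    then show ?thesis using assms(1,2) unfolding signed_perms_iff permutes_def by metis
  next
    case True
    then have "nat \<bar>x\<bar> \<in> {1..n}" by (auto simp: sset_iff nat_le_iff Suc_le_eq)
    from assms(3)[OF this] True show ?thesis using odd[of x] by (cases "x > 0") (simp_all add: sset_iff)
  qed
qed

lemma signed_perm_word: "n \<ge> 2 \<Longrightarrow> w \<in> signed_perms n \<Longrightarrow> \<exists>is. set is \<subseteq> {1..n} \<and> w = word n is"
proof (induction "nat (int n * ((int n + 1) * (int n + 1)) - kmeas n w)" arbitrary: w rule: less_induct)
  case (less w)
  have wS: "w (int m) \<in> sset n" if "m \<in> {1..n}" for m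
    using signed_perms_in[OF less.prems(2), of "int m"] that by (auto simp: sset_iff)
  have odd: "w (- y) = - w y" for y using less.prems by (auto simp: signed_perms_iff)
  have bound: "kmeas n v \<le> int n * ((int n + 1) * (int n + 1))" if v: "v \<in> signed_perms n" for v
  proof -
    have "key n (v (int m)) \<le> int n + 1" if "m \<in> {1..n}" for m
      using signed_perms_in[OF v, of "int m"] that by (auto simp: key_def sset_iff)
    then have "kmeas n v \<le> (\<Sum>m\<in>{1..n}. (int n + 1) * (int n + 1))" unfolding kmeas_def
      by (intro sum_mono order_trans[OF mult_left_mono mult_right_mono]) auto
    then show ?thesis by simp
  qed
  show ?case
  proof (cases "\<exists>j\<in>{1..n}. key n (w (int j)) < key n (w (jp n j))")
    case True
    then obtain j where j: "j \<in> {1..n}" "key n (w (int j)) < key n (w (jp n j))" by blast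
    let ?v = "w \<circ> simple_refl n j"
    have "kmeas n w < kmeas n ?v"
    proof (cases "j < n")
      case True
      define R where "R = {1..n} - {j} - {j + 1}"
      have "sum f {1..n} = f j + (f (j + 1) + sum f R)" for f :: "nat \<Rightarrow> int"
        using j True sum.remove[of "{1..n}" j f] sum.remove[of "{1..n} - {j}" "j + 1" f] by (simp add: R_def)
      moreover have "(\<Sum>m\<in>R. (int n + 1 - int m) * key n (?v (int m))) = (\<Sum>m\<in>R. (int n + 1 - int m) * key n (w (int m)))"
        using j True by (intro sum.cong) (auto simp: R_def simple_refl_eq jp_def)
      moreover have "?v (int j) = w (int j + 1)" "?v (int (j + 1)) = w (int j)" "jp n j = int j + 1"
        using j True by (auto simp: simple_refl_eq jp_def)
      ultimately show ?thesis unfolding kmeas_def using j(2) by (simp add: algebra_simps)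
    next
      case False
      then have jn: "j = n" using j by auto
      define R where "R = {1..n} - {n}"
      have "sum f {1..n} = f n + sum f R" for f :: "nat \<Rightarrow> int"
        using less.prems(1) sum.remove[of "{1..n}" n f] by (simp add: R_def)
      moreover have "(\<Sum>m\<in>R. (int n + 1 - int m) * key n (?v (int m))) = (\<Sum>m\<in>R. (int n + 1 - int m) * key n (w (int m)))"
        using j jn by (intro sum.cong) (auto simp: R_def simple_refl_eq jp_def)
      moreover have "?v (int n) = w (- int n)" "jp n j = - int n"
        using j jn by (auto simp: simple_refl_eq jp_def)
      ultimately show ?thesis unfolding kmeas_def using j(2) jn by simp
    qed
    then have "nat (int n * ((int n + 1) * (int n + 1)) - kmeas n ?v) < nat (int n * ((int n + 1) * (int n + 1)) - kmeas n w)"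
      using bound[OF signed_perms_comp[OF less.prems(2) simple_refl_signed[OF j(1)]]] by linarith
    from less.hyps[OF this less.prems(1) signed_perms_comp[OF less.prems(2) simple_refl_signed[OF j(1)]]]
    obtain "is" where "is": "set is \<subseteq> {1..n}" "?v = word n is" by blast
    have "w = ?v \<circ> simple_refl n j" using simple_refl_invol[OF j(1)] by (simp add: fun_eq_iff)
    also have "\<dots> = word n (is @ [j])" unfolding "is"(2) word_append word_Cons word_Nil by simp
    finally show ?thesis using "is"(1) j(1) by (intro exI[of _ "is @ [j]"]) auto
  next
    case False
    \<comment> \<open>No pair of neighbours is reversed any more. Comparing n with -n makes w(n)
      positive; then w is positive and increasing on 1, ..., n, hence the identity.\<close>
    have n: "w (int n) > 0"
    proof -
      have "n \<in> {1..n}" using less.prems by simp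
      then have "\<not> key n (w (int n)) < key n (w (jp n n))" "w (int n) \<in> sset n" using False wS by blast+
      moreover have "jp n n = - int n" by (simp add: jp_def)
      ultimately have "\<not> key n (w (int n)) < key n (- w (int n))" "w (int n) \<in> sset n" by (simp_all add: odd)
      then show ?thesis using key_minus[of "w (int n)" n] by (auto simp: key_def sset_iff split: if_splits)
    qed
    have step: "0 < w (int m) \<and> w (int m) < w (int m + 1)" if "m \<in> {1..n}" "m < n" "0 < w (int m + 1)" for m
    proof -
      have "\<not> key n (w (int m)) < key n (w (jp n m))" using False that(1) by blast
      then have "\<not> key n (w (int m)) < key n (w (int m + 1))" using that by (simp add: jp_def)
      moreover have "w (int m) \<in> sset n" "w (int m + 1) \<in> sset n" using wS[of m] wS[of "m + 1"] that by (auto simp: add.commute)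
      moreover have "w (int m) \<noteq> w (int m + 1)" using signed_perms_inj[OF less.prems(2)] by simp
      ultimately show ?thesis using that(3) by (auto simp: key_def sset_iff split: if_splits)
    qed
    have p: "0 < w (int (n - l))" if "l < n" for l
      using that
    proof (induction l)
      case (Suc l)
      then show ?case using step[of "n - Suc l"] by (auto simp: of_nat_diff)
    qed (use n in simp)
    have lt: "w (int m) < w (int m + 1)" if "m \<in> {1..n}" "m < n" for m
      using step[OF that] p[of "n - (m + 1)"] that by (auto simp: of_nat_diff add.commute)
    have ge: "int m \<le> w (int m)" if "1 \<le> m" "m \<le> n" for m
      using that
    proof (induction m rule: dec_induct)
      case base
      then show ?case using p[of "n - 1"] by simp
    next
      case (step m)
      then show ?case using lt[of m] by (auto simp: add.commute)
    qed
    have le: "w (int (n - l)) \<le> int (n - l)" if "l < n" for l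
      using that
    proof (induction l)
      case 0
      show ?case using wS[of n] less.prems by (auto simp: sset_iff)
    next
      case (Suc l)
      have m: "n - Suc l \<in> {1..n}" "n - Suc l < n" "int (n - Suc l) + 1 = int (n - l)" using Suc.prems by auto
      then show ?case using lt[OF m(1,2)] Suc.IH[OF Suc_lessD[OF Suc.prems]] unfolding m(3) by linarith
    qed
    have "w (int m) = int m" if "m \<in> {1..n}" for m
      using ge[of m] le[of "n - m"] that by auto
    then have "w = id" using less.prems by (intro signed_perms_eqI[of _ n]) (auto simp: signed_perms_iff permutes_id)
    then show ?thesis by (intro exI[of _ "[]"]) (simp add: compose_list_def)
  qed
qed

lemma refl_length_le: "set is \<subseteq> {1..n} \<Longrightarrow> refl_length n (word n is) \<le> length is"
  unfolding refl_length_def by (rule Least_le) blast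

lemma refl_length_word:
  assumes "n \<ge> 2" "w \<in> signed_perms n"
  obtains "is" where "set is \<subseteq> {1..n}" "w = word n is" "length is = refl_length n w"
proof -
  have "\<exists>k is. length is = k \<and> set is \<subseteq> {1..n} \<and> w = word n is" using signed_perm_word[OF assms] by blast
  then have "\<exists>is. length is = refl_length n w \<and> set is \<subseteq> {1..n} \<and> w = word n is"
    unfolding refl_length_def by (rule LeastI_ex)
  then show ?thesis using that by blast
qed

lemma refl_length_exchange:
  assumes "n \<ge> 2" "w \<in> signed_perms n" "j \<in> {1..n}" "key n (w (int j)) < key n (w (jp n j))"
  shows "refl_length n (w \<circ> simple_refl n j) < refl_length n w"
proof -
  obtain "is" where i: "set is \<subseteq> {1..n}" "w = word n is" "length is = refl_length n w"
    using refl_length_word[OF assms(1,2)] by blast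
  from exchange[OF i(1) assms(3) assms(4)[unfolded i(2)]]
  obtain is' where "set is' \<subseteq> {1..n}" "length is' < length is" "w \<circ> simple_refl n j = word n is'" unfolding i(2) by blast
  then show ?thesis using refl_length_le[of is' n] i(3) by simp
qed

section \<open>Dominant weights\<close>

lemma ht_act: assumes "w \<in> signed_perms n" "\<mu> \<in> weights n" shows "ht n m (act w \<mu>) = ht n m \<mu>"
proof -
  have "ht n m (act w \<mu>) = (\<Sum>p\<in>{1..n}. max (\<bar>lookup (act w \<mu>) (pos w p)\<bar> - int m) 0)"
    unfolding ht_def by (rule sum.reindex_bij_betw[symmetric, OF pos_bij[OF assms(1)]])
  also have "\<dots> = ht n m \<mu>" unfolding ht_def
  proof (rule sum.cong[OF refl])
    fix p assume p: "p \<in> {1..n}"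
    then have "w (int p) \<noteq> 0" using signed_perms_in[OF assms(1), of "int p"] by (auto simp: sset_iff)
    then show "max (\<bar>lookup (act w \<mu>) (pos w p)\<bar> - int m) 0 = max (\<bar>lookup \<mu> p\<bar> - int m) 0"
      using p assms by (simp add: lookup_act abs_mult sgn_if)
  qed
  finally show ?thesis .
qed

lemma dominant_mono:
  assumes "dominant n \<nu>" "1 \<le> k" "k \<le> m" "m \<le> n" shows "lookup \<nu> m \<le> lookup \<nu> k"
  using assms(3,4)
proof (induction m rule: dec_induct)
  case (step m)
  have "lookup \<nu> (m + 1) \<le> lookup \<nu> m" using assms(1,2) step by (auto simp: dominant_def)
  then show ?case using step by simp
qed simp

lemma dominant_nonneg: "dominant n \<nu> \<Longrightarrow> m \<in> {1..n} \<Longrightarrow> 0 \<le> lookup \<nu> m"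
  using dominant_mono[of n \<nu> m n] by (auto simp: dominant_def)

lemma ps_le_dominant:
  assumes "dominant n a" "\<And>m. ht n m b \<le> ht n m a" "j \<le> n"
  shows "ps j b \<le> ps j a"
proof (cases "j = 0")
  case False
  \<comment> \<open>At the threshold a_j the positions beyond j contribute nothing to
    \<open>ht n m a\<close>, while the entries up to j are not truncated. So \<open>ht n m a\<close>
    plus j m is exactly the partial sum.\<close>
  define m where "m = nat (lookup a j)"
  have j: "j \<in> {1..n}" using False assms(3) by auto
  have m: "int m = lookup a j" using dominant_nonneg[OF assms(1) j] by (simp add: m_def)
  have "ps j b \<le> (\<Sum>p\<in>{1..j}. max (\<bar>lookup b p\<bar> - int m) 0 + int m)"
    unfolding ps_def by (intro sum_mono) linarith
  also have "\<dots> = (\<Sum>p\<in>{1..j}. max (\<bar>lookup b p\<bar> - int m) 0) + int j * int m" by (simp add: sum.distrib)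
  also have "(\<Sum>p\<in>{1..j}. max (\<bar>lookup b p\<bar> - int m) 0) \<le> ht n m b"
    unfolding ht_def using assms(3) by (intro sum_mono2) auto
  also have "ht n m b \<le> ht n m a" by (rule assms(2))
  also have "ht n m a = (\<Sum>p\<in>{1..j}. max (\<bar>lookup a p\<bar> - int m) 0)"
    unfolding ht_def
  proof (rule sum.mono_neutral_right)
    show "\<forall>p\<in>{1..n} - {1..j}. max (\<bar>lookup a p\<bar> - int m) 0 = 0"
    proof
      fix p assume "p \<in> {1..n} - {1..j}"
      then show "max (\<bar>lookup a p\<bar> - int m) 0 = 0"
        using dominant_mono[OF assms(1), of j p] dominant_nonneg[OF assms(1), of p] j m by auto
    qed
  qed (use assms(3) in auto)
  also have "\<dots> = (\<Sum>p\<in>{1..j}. lookup a p - int m)"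
  proof (rule sum.cong[OF refl])
    fix p assume "p \<in> {1..j}"
    then show "max (\<bar>lookup a p\<bar> - int m) 0 = lookup a p - int m"
      using dominant_mono[OF assms(1), of p j] dominant_nonneg[OF assms(1), of p] j m by auto
  qed
  also have "\<dots> + int j * int m = ps j a" by (simp add: sum_subtractf ps_def)
  finally show ?thesis by simp
qed (simp add: ps_def)

lemma dominant_unique:
  assumes "dominant n a" "dominant n b" "\<And>m. ht n m b = ht n m a" shows "a = b"
proof (rule ps_eqD[of b n a])
  show "a \<in> weights n" "b \<in> weights n" using assms by (auto simp: dominant_def)
  show "ps j a = ps j b" if "j \<le> n" for j
    using ps_le_dominant[OF assms(1) _ that, of b] ps_le_dominant[OF assms(2) _ that, of a] assms(3) by force
qed

lemma dominant_ex:
  assumes "n \<ge> 2" "\<mu> \<in> weights n" shows "\<exists>w\<in>signed_perms n. dominant n (act w \<mu>)"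
proof -
  \<comment> \<open>An orbit element maximizing the sum of all partial sums is dominant, since a
    simple reflection would improve any violation.\<close>
  define F where "F w = (\<Sum>j\<in>{1..n}. ps j (act w \<mu>))" for w
  have "finite (signed_perms n)"
    by (rule finite_subset[OF _ finite_permutations[of "sset n"]]) (auto simp: signed_perms_iff sset_def)
  moreover have "id \<in> signed_perms n" by (simp add: signed_perms_iff permutes_id)
  ultimately have "Max (F ` signed_perms n) \<in> F ` signed_perms n" and max: "\<And>v. v \<in> signed_perms n \<Longrightarrow> F v \<le> Max (F ` signed_perms n)"
    by (auto intro!: Max_in)
  then obtain w where w: "w \<in> signed_perms n" "\<And>v. v \<in> signed_perms n \<Longrightarrow> F v \<le> F w" by fastforce
  define \<kappa> where "\<kappa> = act w \<mu>"
  have k: "\<kappa> \<in> weights n" using w assms by (simp add: \<kappa>_def act_weights)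
  have le: "(\<Sum>j\<in>{1..n}. ps j (rv n i \<kappa>)) \<le> (\<Sum>j\<in>{1..n}. ps j \<kappa>)" if i: "i \<in> {1..n}" for i
  proof -
    have "rv n i \<kappa> = act (simple_refl n i \<circ> w) \<mu>"
      using act_comp[OF simple_refl_signed[OF i] w(1) assms(2)] act_simple[of i n \<kappa>] i k assms by (simp add: \<kappa>_def)
    then show ?thesis using w(2)[OF signed_perms_comp[OF simple_refl_signed[OF i] w(1)]] by (simp add: F_def \<kappa>_def)
  qed
  have "lookup \<kappa> (i + 1) \<le> lookup \<kappa> i" if i: "i \<in> {1..<n}" for i
  proof (rule ccontr)
    assume c: "\<not> lookup \<kappa> (i + 1) \<le> lookup \<kappa> i"
    have d: "ps j (rv n i \<kappa>) - ps j \<kappa> = (if i \<le> j then lookup (rv n i \<kappa>) i - lookup \<kappa> i else 0) + (if i + 1 \<le> j then lookup (rv n i \<kappa>) (i + 1) - lookup \<kappa> (i + 1) else 0)" for j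
      using i by (intro ps_two) (auto simp: lookup_rv)
    have "(\<Sum>j\<in>{1..n}. ps j \<kappa>) < (\<Sum>j\<in>{1..n}. ps j (rv n i \<kappa>))"
    proof (rule sum_strict_mono_ex1)
      show "\<forall>j\<in>{1..n}. ps j \<kappa> \<le> ps j (rv n i \<kappa>)"
      proof
        fix j show "ps j \<kappa> \<le> ps j (rv n i \<kappa>)" using d[of j] c i by (simp add: lookup_rv split: if_splits)
      qed
      show "\<exists>j\<in>{1..n}. ps j \<kappa> < ps j (rv n i \<kappa>)" using d[of i] c i by (intro bexI[of _ i]) (simp_all add: lookup_rv)
    qed simp
    then show False using le[of i] i by simp
  qed
  moreover have "0 \<le> lookup \<kappa> n"
  proof (rule ccontr)
    assume c: "\<not> 0 \<le> lookup \<kappa> n"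
    \<comment> \<open>Position 1 is a second position without change, supplied only to fit
      \<open>ps_two\<close>.\<close>
    have d: "ps j (rv n n \<kappa>) - ps j \<kappa> = (if n \<le> j then lookup (rv n n \<kappa>) n - lookup \<kappa> n else 0) + (if 1 \<le> j then lookup (rv n n \<kappa>) 1 - lookup \<kappa> 1 else 0)" for j
      using assms(1) by (intro ps_two) (auto simp: lookup_rv)
    have "(\<Sum>j\<in>{1..n}. ps j \<kappa>) < (\<Sum>j\<in>{1..n}. ps j (rv n n \<kappa>))"
    proof (rule sum_strict_mono_ex1)
      show "\<forall>j\<in>{1..n}. ps j \<kappa> \<le> ps j (rv n n \<kappa>)"
      proof
        fix j show "ps j \<kappa> \<le> ps j (rv n n \<kappa>)" using d[of j] c assms(1) by (simp add: lookup_rv split: if_splits)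
      qed
      show "\<exists>j\<in>{1..n}. ps j \<kappa> < ps j (rv n n \<kappa>)" using d[of n] c assms(1) by (intro bexI[of _ n]) (simp_all add: lookup_rv)
    qed simp
    then show False using le[of n] assms(1) by simp
  qed
  ultimately show ?thesis using k w(1) by (auto simp: dominant_def \<kappa>_def)
qed

lemma dom_wt_props:
  assumes "n \<ge> 2" "\<mu> \<in> weights n"
  shows "dominant n (dom_wt n \<mu>)" "\<exists>w\<in>signed_perms n. dom_wt n \<mu> = act w \<mu>" "\<And>m. ht n m (dom_wt n \<mu>) = ht n m \<mu>"
proof -
  have "\<exists>!\<nu>. dominant n \<nu> \<and> (\<exists>w\<in>signed_perms n. \<nu> = act w \<mu>)"
    using dominant_ex[OF assms] by (auto intro!: dominant_unique[of n] simp: ht_act assms)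
  from theI'[OF this] show 1: "dominant n (dom_wt n \<mu>)" "\<exists>w\<in>signed_perms n. dom_wt n \<mu> = act w \<mu>"
    by (auto simp: dom_wt_def)
  then show "\<And>m. ht n m (dom_wt n \<mu>) = ht n m \<mu>" using ht_act assms by auto
qed

lemma dominatesI:
  assumes "n \<ge> 2" "\<mu> \<in> weights n" "\<nu> \<in> weights n" "\<And>j. j \<le> n \<Longrightarrow> ps j \<nu> \<le> ps j \<mu>"
  shows "dominates n \<mu> \<nu>"
proof -
  define c where "c i = nat (ps i \<mu> - ps i \<nu>)" for i
  have c: "int (c i) = ps i \<mu> - ps i \<nu>" if "i \<le> n" for i using assms(4)[OF that] by (simp add: c_def)
  let ?R = "(\<Sum>i\<in>{1..<n}. single i (int (c i)) - single (i + 1) (int (c i))) + single n (int (c n))"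
  have "\<mu> - \<nu> = ?R"
  proof (rule poly_mapping_eqI)
    fix p
    have 1: "(\<Sum>i\<in>{1..<n}. (int (c i) when i = p)) = (if p \<in> {1..<n} then int (c p) else 0)"
      by (simp add: when_def)
    \<comment> \<open>For p = 0 truncated subtraction gives the index 0, which lies outside the
      range of summation.\<close>
    have "(\<Sum>i\<in>{1..<n}. (int (c i) when i + 1 = p)) = (\<Sum>i\<in>{1..<n}. if i = p - 1 then (if p \<ge> 1 then int (c (p - 1)) else 0) else 0)"
      by (intro sum.cong) (auto simp: when_def)
    also have "\<dots> = (if p - 1 \<in> {1..<n} then int (c (p - 1)) else 0)" by auto
    finally have 2: "(\<Sum>i\<in>{1..<n}. (int (c i) when i + 1 = p)) = (if p - 1 \<in> {1..<n} then int (c (p - 1)) else 0)" .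
    have r: "lookup ?R p = (if p \<in> {1..<n} then int (c p) else 0) - (if p - 1 \<in> {1..<n} then int (c (p - 1)) else 0) + (if n = p then int (c n) else 0)"
      unfolding 1[symmetric] 2[symmetric] by (simp add: lookup_add lookup_sum lookup_minus lookup_single sum_subtractf)
    show "lookup (\<mu> - \<nu>) p = lookup ?R p"
    proof (cases "p \<in> {1..n}")
      case False
      then have "p = 0 \<or> p > n" by auto
      then show ?thesis unfolding r using False assms weights_0[of _ n p] by (auto simp: lookup_minus)
    next
      case True
      have "ps p \<kappa> = ps (p - 1) \<kappa> + lookup \<kappa> p" for \<kappa> using True by (cases p) (simp_all add: ps_def)
      moreover have "ps 0 \<kappa> = 0" for \<kappa> by (simp add: ps_def)
      ultimately show ?thesis unfolding r using True c[of p] c[of "p - 1"] c[of 0]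
        by (cases "p = 1"; cases "p = n") (auto simp: lookup_minus)
    qed
  qed
  then show ?thesis unfolding dominates_def by blast
qed

lemma lt_succ_eq:
  assumes "n \<ge> 2" "\<mu> \<in> weights n" "\<nu> \<in> lt n \<mu>"
  shows "\<nu> \<in> weights n" "succ_eq n \<mu> \<nu>" "\<nu> \<noteq> \<mu>"
proof -
  show n: "\<nu> \<in> weights n" using assms by (auto simp: lt_def below_def)
  show "\<nu> \<noteq> \<mu>" using assms lt_irrefl by metis
  have h: "ht n m \<nu> \<le> ht n m \<mu>" for m using assms by (auto simp: lt_def below_def)
  have "dominates n (dom_wt n \<mu>) (dom_wt n \<nu>)"
  proof (rule dominatesI[OF assms(1)])
    note d = dom_wt_props[OF assms(1,2)] dom_wt_props[OF assms(1) n]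
    show "dom_wt n \<mu> \<in> weights n" "dom_wt n \<nu> \<in> weights n" using d(1,4) by (auto simp: dominant_def)
    show "ps j (dom_wt n \<nu>) \<le> ps j (dom_wt n \<mu>)" if "j \<le> n" for j
      by (rule ps_le_dominant[OF d(1) _ that]) (simp only: d(3,6) h)
  qed
  moreover have "dominates n \<mu> \<nu>" if "dom_wt n \<mu> = dom_wt n \<nu>"
  proof (rule dominatesI[OF assms(1,2) n])
    have "ht n m \<nu> = ht n m \<mu>" for m using that dom_wt_props(3)[OF assms(1,2), of m] dom_wt_props(3)[OF assms(1) n, of m] by simp
    then show "ps j \<nu> \<le> ps j \<mu>" if "j \<le> n" for j using assms(3) that by (auto simp: lt_def)
  qed
  ultimately show "succ_eq n \<mu> \<nu>" unfolding succ_eq_def by blast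
qed

section \<open>Shortest signed permutations\<close>

text \<open>Whether position \<open>k\<close> comes after \<open>p\<close> when the positions of \<open>\<mu>\<close> are listed in the
  order \<open>\<bar>w(1)\<bar>, \<dots>, \<bar>w(n)\<bar>\<close> given by the shortest element \<open>w\<close>.\<close>

definition prec :: "(nat \<Rightarrow>\<^sub>0 int) \<Rightarrow> nat \<Rightarrow> nat \<Rightarrow> bool" where
  "prec \<mu> k p \<longleftrightarrow> lev (lookup \<mu> k) < lev (lookup \<mu> p) \<or>
     lookup \<mu> k = lookup \<mu> p \<and> (if lookup \<mu> p \<ge> 0 then p < k else k < p)"

lemma prec_asym: "prec \<mu> k p \<Longrightarrow> \<not> prec \<mu> p k"
  unfolding prec_def by (smt (verit) less_asym)

lemma lev_abs_less: "\<bar>b\<bar> < \<bar>a\<bar> \<Longrightarrow> lev b < lev a"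
  by (auto simp: lev_def)

lemma prec_aux:
  fixes a b :: int
  shows "of_bool (if c then b < a else b \<le> a) + of_bool (- a \<le> b) - (1 :: int)
    = (if a \<ge> 0 then 1 else - 1) * of_bool ((if a \<ge> 0 then - a \<le> b \<and> b < a else a < b \<and> b < - a) \<or> b = a \<and> (if a \<ge> 0 then \<not> c else c))"
  by (cases c; cases "a \<ge> 0"; cases "b < a"; cases "b = a"; cases "- a \<le> b"; simp)

lemma lev_less_iff: "lev b < lev a \<longleftrightarrow> (if a \<ge> 0 then - a \<le> b \<and> b < a else a < b \<and> b < - a)"
  by (cases "a \<ge> 0"; cases "b \<ge> 0"; auto simp: lev_def)

lemma rho'_prec:
  "rho' n \<mu> p = sigma \<mu> p * int (card {k\<in>{1..n}. prec \<mu> k p})"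
proof -
  have "rho' n \<mu> p = (\<Sum>k\<in>{1..n} - {p}. sigma \<mu> p * of_bool (prec \<mu> k p))"
    unfolding rho'_def
  proof (rule sum.cong[OF refl])
    fix k assume "k \<in> {1..n} - {p}"
    then have "p < k \<longleftrightarrow> \<not> k < p" by auto
    then show "of_bool (if k < p then lookup \<mu> k < lookup \<mu> p else lookup \<mu> k \<le> lookup \<mu> p) + of_bool (- lookup \<mu> p \<le> lookup \<mu> k) - 1
      = sigma \<mu> p * of_bool (prec \<mu> k p)"
      unfolding prec_def sigma_def lev_less_iff by (simp only: prec_aux)
  qed
  also have "\<dots> = sigma \<mu> p * (\<Sum>k\<in>{1..n} - {p}. of_bool (prec \<mu> k p))" by (simp add: sum_distrib_left)
  also have "(\<Sum>k\<in>{1..n} - {p}. of_bool (prec \<mu> k p)) = (\<Sum>k\<in>{1..n}. of_bool (prec \<mu> k p) :: int)"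
    by (rule sum.mono_neutral_left) (simp_all add: prec_def)
  also have "\<dots> = int (card {k\<in>{1..n}. prec \<mu> k p})" by (simp add: sum_of_bool_eq Int_def)
  finally show ?thesis .
qed

text \<open>The property selected by \<open>THE\<close> in \<open>w_plus\<close>, as a predicate, so
  that uniqueness can be derived from properties shared by all such elements.\<close>

definition shortest :: "nat \<Rightarrow> (nat \<Rightarrow>\<^sub>0 int) \<Rightarrow> (int \<Rightarrow> int) \<Rightarrow> bool" where
  "shortest n \<mu> w \<longleftrightarrow> w \<in> signed_perms n \<and> act w (dom_wt n \<mu>) = \<mu> \<and>
     (\<forall>v\<in>signed_perms n. act v (dom_wt n \<mu>) = \<mu> \<longrightarrow> refl_length n w \<le> refl_length n v)"

lemma shortest_ex: assumes "n \<ge> 2" "\<mu> \<in> weights n" shows "\<exists>w. shortest n \<mu> w"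
proof -
  obtain v where v: "v \<in> signed_perms n" "dom_wt n \<mu> = act v \<mu>" using dom_wt_props(2)[OF assms] by blast
  have "inv v \<in> signed_perms n \<and> act (inv v) (dom_wt n \<mu>) = \<mu>" using v assms by (simp add: signed_perms_inv act_inv)
  from ex_has_least_nat[of "\<lambda>w. w \<in> signed_perms n \<and> act w (dom_wt n \<mu>) = \<mu>", OF this, of "refl_length n"]
  show ?thesis unfolding shortest_def by blast
qed

text \<open>By the exchange property a shortest element reverses no pair of neighbours whose
  reflection fixes the dominant weight. So the positions are listed according to
  \<open>prec\<close>, with the prescribed signs, and this determines the element.\<close>

lemma shortest_props:
  assumes "n \<ge> 2" "\<mu> \<in> weights n" "shortest n \<mu> v" "m \<in> {1..n}"
  shows "lookup (dom_wt n \<mu>) m = \<bar>lookup \<mu> (pos v m)\<bar>" "v (int m) = sigma \<mu> (pos v m) * int (pos v m)"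
    "card {k\<in>{1..n}. prec \<mu> k (pos v m)} = n - m"
    "\<And>m'. m' \<in> {1..n} \<Longrightarrow> m < m' \<Longrightarrow> prec \<mu> (pos v m') (pos v m)"
proof -
  define \<nu> where "\<nu> = dom_wt n \<mu>"
  have v: "v \<in> signed_perms n" "act v \<nu> = \<mu>" using assms(3) by (auto simp: shortest_def \<nu>_def)
  have d: "dominant n \<nu>" "\<nu> \<in> weights n" using dom_wt_props[OF assms(1,2)] by (auto simp: \<nu>_def dominant_def)
  have odd: "v (- x) = - v x" for x using v(1) by (simp add: signed_perms_iff)
  have S: "v (int m) \<in> sset n" if "m \<in> {1..n}" for m
    using signed_perms_in[OF v(1), of "int m"] that by (auto simp: sset_iff)
  have simple: "key n (v (jp n j)) \<le> key n (v (int j))" if j: "j \<in> {1..n}" "rv n j \<nu> = \<nu>" for j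
  proof (rule ccontr)
    assume "\<not> key n (v (jp n j)) \<le> key n (v (int j))"
    then have "refl_length n (v \<circ> simple_refl n j) < refl_length n v"
      using refl_length_exchange[OF assms(1) v(1) j(1)] by simp
    moreover have "act (v \<circ> simple_refl n j) \<nu> = \<mu>"
      using act_comp[OF v(1) simple_refl_signed[OF j(1)] d(2)] act_simple[of j n \<nu>] j d v assms(1) by simp
    ultimately show False using assms(3) signed_perms_comp[OF v(1) simple_refl_signed[OF j(1)]]
      unfolding shortest_def \<nu>_def by force
  qed
  have step: "key n (v (int (j + 1))) \<le> key n (v (int j))" if "j \<in> {1..<n}" "lookup \<nu> j = lookup \<nu> (j + 1)" for j
  proof -
    have "rv n j \<nu> = \<nu>" using that by (intro poly_mapping_eqI) (auto simp: lookup_rv)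
    then show ?thesis using simple[of j] that by (simp add: jp_def add.commute)
  qed
  have chain: "key n (v (int l)) \<le> key n (v (int k))" if "1 \<le> k" "k \<le> l" "l \<le> n" "lookup \<nu> k = lookup \<nu> l" for k l
    using that(2-)
  proof (induction l rule: dec_induct)
    case (step l)
    have "lookup \<nu> (Suc l) \<le> lookup \<nu> l" "lookup \<nu> l \<le> lookup \<nu> k"
      using dominant_mono[OF d(1), of l "Suc l"] dominant_mono[OF d(1), of k l] that(1) step by auto
    then have e: "lookup \<nu> k = lookup \<nu> l" "lookup \<nu> l = lookup \<nu> (l + 1)" using step by auto
    have "l \<in> {1..<n}" using that(1) step by auto
    from \<open>\<And>j. j \<in> {1..<n} \<Longrightarrow> lookup \<nu> j = lookup \<nu> (j + 1) \<Longrightarrow> key n (v (int (j + 1))) \<le> key n (v (int j))\<close>[OF this e(2)]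
    show ?case using step e by simp
  qed simp
  have strict: "key n (v (int l)) < key n (v (int k))" if "1 \<le> k" "k < l" "l \<le> n" "lookup \<nu> k = lookup \<nu> l" for k l
  proof -
    have "v (int l) \<noteq> v (int k)" using signed_perms_inj[OF v(1)] that by simp
    then have "key n (v (int l)) \<noteq> key n (v (int k))" using key_inj[OF S S, of l k] that by auto
    then show ?thesis using chain[of k l] that by simp
  qed
  have l: "lookup \<mu> (pos v m) = sgn (v (int m)) * lookup \<nu> m" if "m \<in> {1..n}" for m
    using lookup_act[OF v(1) d(2) that] v(2) by simp
  \<comment> \<open>If one entry vanishes, so does the last. The sign change at n then fixes the
    dominant weight, minimality makes v(n) positive, and \<open>chain\<close> passes positivity on
    to m. This matches the convention that 0 has sign +1.\<close>
  have pos0: "0 < v (int m)" if m: "m \<in> {1..n}" "lookup \<nu> m = 0" for m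
  proof -
    have n0: "lookup \<nu> n = 0" using dominant_mono[OF d(1), of m n] dominant_nonneg[OF d(1), of n] m by simp
    then have "rv n n \<nu> = \<nu>" using assms(1) by (intro poly_mapping_eqI) (auto simp: lookup_rv)
    then have "key n (- v (int n)) \<le> key n (v (int n))" using simple[of n] assms(1) by (simp add: jp_def odd)
    then have "0 < key n (v (int n))" using S[of n] assms(1) key_minus[of "v (int n)" n] by (auto simp: key_def sset_iff split: if_splits)
    then have "0 < key n (v (int m))" using chain[of m n] m n0 by simp
    then show ?thesis using S[OF m(1)] by (auto simp: key_def sset_iff split: if_splits)
  qed
  have nz: "v (int m) \<noteq> 0" if "m \<in> {1..n}" for m using S[OF that] by (simp add: sset_iff)
  have sg: "sgn (v (int m)) = sigma \<mu> (pos v m)" if m: "m \<in> {1..n}" for m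
    using l[OF m] nz[OF m] pos0[OF m] dominant_nonneg[OF d(1) m]
    by (cases "lookup \<nu> m = 0"; cases "v (int m) > 0") (auto simp: sigma_def)
  show val: "lookup (dom_wt n \<mu>) m = \<bar>lookup \<mu> (pos v m)\<bar>"
    using l[OF assms(4)] nz[OF assms(4)] dominant_nonneg[OF d(1) assms(4)] by (simp add: \<nu>_def[symmetric] abs_mult sgn_if)
  have vs: "v (int m) = sigma \<mu> (pos v m) * int (pos v m)" if m: "m \<in> {1..n}" for m
    using sg[OF m] sgn_mult_abs[of "v (int m)"] by (simp add: pos_def)
  then show "v (int m) = sigma \<mu> (pos v m) * int (pos v m)" using assms(4) by simp
  have pr: "prec \<mu> (pos v m') (pos v m)" if m: "m \<in> {1..n}" "m' \<in> {1..n}" "m < m'" for m m'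
  proof (cases "lookup \<nu> m = lookup \<nu> m'")
    case False
    then have "lookup \<nu> m' < lookup \<nu> m" using dominant_mono[OF d(1), of m m'] m by simp
    then have "\<bar>lookup \<mu> (pos v m')\<bar> < \<bar>lookup \<mu> (pos v m)\<bar>"
      using l[OF m(1)] l[OF m(2)] nz[OF m(1)] nz[OF m(2)] dominant_nonneg[OF d(1) m(1)] dominant_nonneg[OF d(1) m(2)]
      by (simp add: abs_mult sgn_if)
    then show ?thesis using lev_abs_less by (simp add: prec_def)
  next
    case True
    define p p' b where "p = pos v m" "p' = pos v m'" "b = lookup \<nu> m"
    have b: "b \<ge> 0" using dominant_nonneg[OF d(1) m(1)] by (simp add: p_p'_b_def)
    have k: "key n (sigma \<mu> p' * int p') < key n (sigma \<mu> p * int p)"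
      using strict[of m m'] m True vs[OF m(1)] vs[OF m(2)] by (simp add: p_p'_b_def)
    have lk: "lookup \<mu> p = sigma \<mu> p * b" "lookup \<mu> p' = sigma \<mu> p' * b"
      using l[OF m(1)] l[OF m(2)] sg[OF m(1)] sg[OF m(2)] True by (simp_all add: p_p'_b_def)
    have pp: "p \<in> {1..n}" "p' \<in> {1..n}" using pos_in[OF v(1)] m by (auto simp: p_p'_b_def)
    have neg: "b > 0" if "sigma \<mu> p = - 1 \<or> sigma \<mu> p' = - 1"
    proof -
      have "lookup \<mu> p < 0 \<or> lookup \<mu> p' < 0" using that by (auto simp: sigma_def split: if_splits)
      then have "b \<noteq> 0" unfolding lk by auto
      then show ?thesis using b by simp
    qed
    have kk: "key n (int x) = int n + 1 - int x" "key n (- int x) = - (int n + 1 - int x)" if "x \<in> {1..n}" for x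
      using that by (auto simp: key_def)
    consider "sigma \<mu> p = 1" "sigma \<mu> p' = 1" | "sigma \<mu> p = 1" "sigma \<mu> p' = - 1"
      | "sigma \<mu> p = - 1" "sigma \<mu> p' = 1" | "sigma \<mu> p = - 1" "sigma \<mu> p' = - 1"
      unfolding sigma_def by (cases "lookup \<mu> p \<ge> 0"; cases "lookup \<mu> p' \<ge> 0") auto
    then show ?thesis unfolding p_p'_b_def(1,2)[symmetric] prec_def lk
    proof cases
      case 1
      then show "lev (sigma \<mu> p' * b) < lev (sigma \<mu> p * b) \<or> sigma \<mu> p' * b = sigma \<mu> p * b \<and> (if 0 \<le> sigma \<mu> p * b then p < p' else p' < p)"
        using k b kk[OF pp(1)] kk[OF pp(2)] by simp
    next
      case 2
      then show "lev (sigma \<mu> p' * b) < lev (sigma \<mu> p * b) \<or> sigma \<mu> p' * b = sigma \<mu> p * b \<and> (if 0 \<le> sigma \<mu> p * b then p < p' else p' < p)"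
        using neg by (simp add: lev_def)
    next
      case 3
      then have "int n + 1 - int p' < - (int n + 1 - int p)" using k kk[OF pp(1)] kk[OF pp(2)] by simp
      then show "lev (sigma \<mu> p' * b) < lev (sigma \<mu> p * b) \<or> sigma \<mu> p' * b = sigma \<mu> p * b \<and> (if 0 \<le> sigma \<mu> p * b then p < p' else p' < p)"
        using pp by simp
    next
      case 4
      then show "lev (sigma \<mu> p' * b) < lev (sigma \<mu> p * b) \<or> sigma \<mu> p' * b = sigma \<mu> p * b \<and> (if 0 \<le> sigma \<mu> p * b then p < p' else p' < p)"
        using k neg kk[OF pp(1)] kk[OF pp(2)] by simp
    qed
  qed
  show "\<And>m'. m' \<in> {1..n} \<Longrightarrow> m < m' \<Longrightarrow> prec \<mu> (pos v m') (pos v m)" using pr assms(4) by blast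
  have "{k\<in>{1..n}. prec \<mu> k (pos v m)} = pos v ` {m<..n}"
  proof (intro equalityI subsetI)
    fix k assume k: "k \<in> {k\<in>{1..n}. prec \<mu> k (pos v m)}"
    then obtain m' where m': "m' \<in> {1..n}" "k = pos v m'" using pos_ex[OF v(1), of k] by blast
    have "\<not> m' < m" using pr[OF m'(1) assms(4)] prec_asym k m' by blast
    moreover have "m' \<noteq> m" using k m' prec_asym by blast
    ultimately show "k \<in> pos v ` {m<..n}" using m' by auto
  next
    fix k assume "k \<in> pos v ` {m<..n}"
    then obtain m' where "m' \<in> {m<..n}" "k = pos v m'" by blast
    then show "k \<in> {k\<in>{1..n}. prec \<mu> k (pos v m)}" using pr[OF assms(4), of m'] pos_in[OF v(1), of m'] assms(4) by auto
  qed
  moreover have "inj_on (pos v) {m<..n}"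
    by (rule inj_on_subset[OF bij_betw_imp_inj_on[OF pos_bij[OF v(1)]]]) auto
  ultimately show "card {k\<in>{1..n}. prec \<mu> k (pos v m)} = n - m" by (simp add: card_image)
qed

lemma shortest_w_plus: assumes "n \<ge> 2" "\<mu> \<in> weights n" shows "shortest n \<mu> (w_plus n \<mu>)"
proof -
  obtain w where w: "shortest n \<mu> w" using shortest_ex[OF assms] by blast
  have "v = w" if v: "shortest n \<mu> v" for v
  proof (rule signed_perms_eqI)
    show s: "v \<in> signed_perms n" "w \<in> signed_perms n" using v w by (auto simp: shortest_def)
    fix m assume m: "m \<in> {1..n}"
    obtain m' where m': "m' \<in> {1..n}" "pos v m = pos w m'" using pos_ex[OF s(2) pos_in[OF s(1) m]] by metis
    have "n - m = n - m'" using shortest_props(3)[OF assms v m] shortest_props(3)[OF assms w m'(1)] m'(2) by simp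
    then have "m = m'" using m m'(1) by auto
    then show "v (int m) = w (int m)"
      using shortest_props(2)[OF assms v m] shortest_props(2)[OF assms w m] m'(2) by simp
  qed
  then have "w_plus n \<mu> = w" unfolding w_plus_def shortest_def[symmetric] using w by blast
  then show ?thesis using w by simp
qed

lemma rho_rho': assumes "n \<ge> 2" "\<mu> \<in> weights n" "p \<in> {1..n}" shows "lookup (rho n \<mu>) p = rho' n \<mu> p"
proof -
  let ?w = "w_plus n \<mu>" and ?\<delta> = "\<Sum>i\<in>{1..n}. single i (int (n - i))"
  note s = shortest_w_plus[OF assms(1,2)]
  have w: "?w \<in> signed_perms n" using s by (simp add: shortest_def)
  obtain m where m: "m \<in> {1..n}" "p = pos ?w m" using pos_ex[OF w assms(3)] by blast
  have l: "lookup ?\<delta> k = (if k \<in> {1..n} then int (n - k) else 0)" for k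
    unfolding lookup_sum lookup_single by (simp add: when_def)
  then have "?\<delta> \<in> weights n" by (intro weightsI) (simp only: if_False)
  from lookup_act[OF w this m(1)] have "lookup (rho n \<mu>) p = sgn (?w (int m)) * int (n - m)"
    unfolding m(2)[symmetric] rho_def[symmetric] l using m(1) by simp
  moreover have "sgn (?w (int m)) = sigma \<mu> p"
    using shortest_props(2)[OF assms(1,2) s m(1)] m pos_in[OF w m(1)] by (simp add: sigma_def sgn_mult)
  ultimately have "lookup (rho n \<mu>) p = sigma \<mu> p * int (n - m)" by simp
  then show ?thesis using shortest_props(3)[OF assms(1,2) s m(1)] unfolding rho'_prec m(2)[symmetric] by simp
qed

lemma prec_lev: "prec \<mu> k p \<Longrightarrow> lev (lookup \<mu> k) \<le> lev (lookup \<mu> p)"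
  by (auto simp: prec_def)

text \<open>Along |w(1)|, ..., |w(n)| the levels do not increase, so the i-th of them reaches a
  bound exactly if at least i coordinates do. The bound 2(r - 1) is the level of r - 1, just above
  that of its negative.\<close>

lemma threshold_iff:
  assumes "n \<ge> 2" "\<mu> \<in> weights n" "i \<in> {1..n}" "r \<ge> 1"
  shows "(lookup (dom_wt n \<mu>) i > int (r - 1) \<or> lookup (dom_wt n \<mu>) i = int (r - 1) \<and> sigma \<mu> (nat \<bar>w_plus n \<mu> (int i)\<bar>) = 1)
    \<longleftrightarrow> i \<le> nlev n (2 * (r - 1)) \<mu>"
proof -
  let ?w = "w_plus n \<mu>" and ?L = "2 * (r - 1)"
  note s = shortest_w_plus[OF assms(1,2)]
  have w: "?w \<in> signed_perms n" using s by (simp add: shortest_def)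
  have inj: "inj_on (pos ?w) A" if "A \<subseteq> {1..n}" for A
    by (rule inj_on_subset[OF bij_betw_imp_inj_on[OF pos_bij[OF w]] that])
  have lev: "lev (lookup \<mu> (pos ?w m')) \<le> lev (lookup \<mu> (pos ?w m))" if "m \<in> {1..n}" "m' \<in> {1..n}" "m \<le> m'" for m m'
    using shortest_props(4)[OF assms(1,2) s that(1,2)] that(3) prec_lev by (cases "m = m'") auto
  have "(lookup (dom_wt n \<mu>) i > int (r - 1) \<or> lookup (dom_wt n \<mu>) i = int (r - 1) \<and> sigma \<mu> (pos ?w i) = 1) \<longleftrightarrow> ?L \<le> lev (lookup \<mu> (pos ?w i))"
    unfolding shortest_props(1)[OF assms(1,2) s assms(3)] sigma_def lev_def by auto
  also have "\<dots> \<longleftrightarrow> i \<le> nlev n ?L \<mu>"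
  proof
    assume a: "?L \<le> lev (lookup \<mu> (pos ?w i))"
    have "pos ?w ` {1..i} \<subseteq> {p\<in>{1..n}. ?L \<le> lev (lookup \<mu> p)}"
    proof
      fix p assume "p \<in> pos ?w ` {1..i}"
      then obtain m where m: "m \<in> {1..i}" "p = pos ?w m" by blast
      then have "m \<in> {1..n}" using assms(3) by auto
      then show "p \<in> {p\<in>{1..n}. ?L \<le> lev (lookup \<mu> p)}"
        using lev[of m i] a m assms(3) pos_in[OF w, of m] by auto
    qed
    from card_mono[OF _ this] show "i \<le> nlev n ?L \<mu>"
      using card_image[OF inj[of "{1..i}"]] assms(3) by (simp add: nlev_def)
  next
    assume a: "i \<le> nlev n ?L \<mu>"
    show "?L \<le> lev (lookup \<mu> (pos ?w i))"
    proof (rule ccontr)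
      assume c: "\<not> ?L \<le> lev (lookup \<mu> (pos ?w i))"
      have "{p\<in>{1..n}. ?L \<le> lev (lookup \<mu> p)} \<subseteq> pos ?w ` {1..<i}"
      proof
        fix p assume p: "p \<in> {p\<in>{1..n}. ?L \<le> lev (lookup \<mu> p)}"
        then obtain m where m: "m \<in> {1..n}" "p = pos ?w m" using pos_ex[OF w] by blast
        have "\<not> i \<le> m" using lev[OF assms(3) m(1)] p c m by auto
        then show "p \<in> pos ?w ` {1..<i}" using m by auto
      qed
      moreover have "{1..<i} \<subseteq> {1..n}" using assms(3) by auto
      then have "card (pos ?w ` {1..<i}) = i - 1" using card_image[OF inj] by simp
      ultimately have "nlev n ?L \<mu> \<le> i - 1" unfolding nlev_def by (metis card_mono finite_atLeastLessThan finite_imageI)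
      then show False using a assms(3) by auto
    qed
  qed
  finally show ?thesis by (simp add: pos_def)
qed

text \<open>For a positive entry at the last position ties do not count, since no position comes
  after n. This turns the exponent of t at a sign change into a value of
  \<open>nlev\<close>.\<close>

lemma rho'_last:
  assumes "lookup \<mu> n > 0" shows "rho' n \<mu> n = int n - int (nlev n (lev (lookup \<mu> n)) \<mu>)"
proof -
  have "{k\<in>{1..n}. prec \<mu> k n} = {1..n} - {p\<in>{1..n}. lev (lookup \<mu> n) \<le> lev (lookup \<mu> p)}"
    using assms by (auto simp: prec_def)
  moreover have "nlev n (lev (lookup \<mu> n)) \<mu> \<le> n"
    unfolding nlev_def by (rule order_trans[OF card_mono[of "{1..n}"]]) auto
  moreover have "{p\<in>{1..n}. lev (lookup \<mu> n) \<le> lev (lookup \<mu> p)} \<subseteq> {1..n}" by blast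
  ultimately show ?thesis using assms unfolding rho'_prec sigma_def nlev_def
    by (simp only: card_Diff_subset[OF finite_subset[OF _ finite_atLeastAtMost]]) (simp add: of_nat_diff)
qed

section \<open>Monomials modulo an irreducible factor of a binomial\<close>

definition filt :: "('a \<Rightarrow> bool) \<Rightarrow> ('a \<Rightarrow>\<^sub>0 'b) \<Rightarrow> ('a \<Rightarrow>\<^sub>0 'b::comm_monoid_add)" where
  "filt P f = (\<Sum>e\<in>{e\<in>keys f. P e}. single e (lookup f e))"

lemma lookup_filt: "lookup (filt P f) e = (if P e then lookup f e else 0)"
  by (auto simp: filt_def lookup_sum lookup_single when_def in_keys_iff)

lemma filt_sum: "filt P (sum h A) = (\<Sum>a\<in>A. filt P (h a))"
  by (rule poly_mapping_eqI) (simp add: lookup_filt lookup_sum)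

lemma filt_single: "filt P (single e c) = single e (if P e then c else 0)"
  by (rule poly_mapping_eqI) (simp add: lookup_filt lookup_single when_def)

lemma filt_mult:
  fixes f g :: "('a::ab_group_add) \<Rightarrow>\<^sub>0 ('b::comm_semiring_1)"
  assumes "\<And>e e'. e \<in> keys f \<Longrightarrow> e' \<in> keys g \<Longrightarrow> R (e + e') \<longleftrightarrow> P e \<and> Q e'"
  shows "filt R (f * g) = filt P f * filt Q g"
proof -
  have s: "filt P h = (\<Sum>e\<in>keys h. single e (if P e then lookup h e else 0))" for h :: "'a \<Rightarrow>\<^sub>0 'b" and P
    unfolding filt_single[symmetric] filt_sum[symmetric] by (simp add: poly_mapping_sum_single[symmetric])
  have "f * g = (\<Sum>e\<in>keys f. single e (lookup f e)) * (\<Sum>e\<in>keys g. single e (lookup g e))"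
    by (simp add: poly_mapping_sum_single[symmetric])
  then have "filt R (f * g) = (\<Sum>e\<in>keys f. \<Sum>e'\<in>keys g. filt R (single (e + e') (lookup f e * lookup g e')))"
    by (simp add: sum_product mult_single filt_sum)
  also have "\<dots> = (\<Sum>e\<in>keys f. \<Sum>e'\<in>keys g. single e (if P e then lookup f e else 0) * single e' (if Q e' then lookup g e' else 0))"
    by (intro sum.cong refl) (simp add: filt_single mult_single assms)
  finally show ?thesis unfolding s sum_product .
qed

text \<open>The parts of s and u of maximal L-degree have a nonzero product in the integral domain,
  so maximal degrees add.\<close>

lemma top_key:
  fixes s u :: param_ring and L :: "(param \<Rightarrow>\<^sub>0 int) \<Rightarrow> int"
  assumes "\<And>x y. L (x + y) = L x + L y" "s \<noteq> 0" "u \<noteq> 0"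
  shows "\<exists>e\<in>keys (s * u). L e = Max (L ` keys s) + Max (L ` keys u)"
proof -
  let ?M = "\<lambda>s::param_ring. Max (L ` keys s)"
  have le: "L e \<le> ?M f" if "e \<in> keys f" for e f using that by simp
  have nz: "filt (\<lambda>e. L e = ?M f) f \<noteq> 0" if f: "f \<noteq> 0" for f
  proof
    assume z: "filt (\<lambda>e. L e = ?M f) f = 0"
    have "?M f \<in> L ` keys f" using f by (intro Max_in) auto
    then obtain e where e: "e \<in> keys f" "L e = ?M f" by (metis imageE)
    then have "lookup (filt (\<lambda>e. L e = ?M f) f) e = lookup f e" by (simp add: lookup_filt)
    then show False using z e(1) by (simp add: in_keys_iff)
  qed
  have "filt (\<lambda>e. L e = ?M s + ?M u) (s * u) = filt (\<lambda>e. L e = ?M s) s * filt (\<lambda>e. L e = ?M u) u"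
  proof (rule filt_mult)
    fix e e' assume "e \<in> keys s" "e' \<in> keys u"
    from le[OF this(1)] le[OF this(2)] show "L (e + e') = ?M s + ?M u \<longleftrightarrow> L e = ?M s \<and> L e' = ?M u"
      unfolding assms(1) by linarith
  qed
  then have "filt (\<lambda>e. L e = ?M s + ?M u) (s * u) \<noteq> 0" using nz assms by simp
  then obtain e where "lookup (filt (\<lambda>e. L e = ?M s + ?M u) (s * u)) e \<noteq> 0"
    by (metis poly_mapping_eqI lookup_zero)
  then show ?thesis by (intro bexI[of _ e]) (auto simp: lookup_filt in_keys_iff split: if_splits)
qed

text \<open>Applied to L and -L, \<open>top_key\<close> shows that widths in direction L add; a
  product of width 0 has factors of width 0.\<close>

lemma factor_homogeneous:
  fixes s u :: param_ring and L :: "(param \<Rightarrow>\<^sub>0 int) \<Rightarrow> int"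
  assumes L: "\<And>x y. L (x + y) = L x + L y" and "s * u \<noteq> 0" "\<And>e. e \<in> keys (s * u) \<Longrightarrow> L e = 0"
  shows "\<exists>l. \<forall>e\<in>keys s. L e = l"
proof -
  let ?N = "\<lambda>e. - L e"
  have nz: "s \<noteq> 0" "u \<noteq> 0" using assms(2) by auto
  have 1: "Max (L ` keys s) + Max (L ` keys u) = 0"
    using top_key[of L, OF L nz] assms(3) by force
  have 2: "Max (?N ` keys s) + Max (?N ` keys u) = 0"
    using top_key[of ?N, OF _ nz] L assms(3) by force
  have le: "L e \<le> Max (L ` keys f)" "- L e \<le> Max (?N ` keys f)" if "e \<in> keys f" for e and f :: param_ring
    using that by (auto intro!: Max_ge)
  obtain e' where "e' \<in> keys u" using nz by (metis all_not_in_conv keys_eq_empty)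
  from le[OF this] have "L e = Max (L ` keys s)" if "e \<in> keys s" for e
    using le[OF that] 1 2 by linarith
  then show ?thesis by blast
qed

text \<open>If L e were nonzero, the part of L-degree 0 of the second binomial would be the constant
  -d. As s is homogeneous for L, it would divide this part too and be a unit.\<close>

lemma dvd_binomial:
  fixes s B :: param_ring and L :: "(param \<Rightarrow>\<^sub>0 int) \<Rightarrow> int"
  assumes L: "\<And>x y. L (x + y) = L x + L y" and s: "s dvd B" "B \<noteq> 0" "\<And>e. e \<in> keys B \<Longrightarrow> L e = 0" "\<not> s dvd 1"
    and d: "s dvd single e c - single 0 d" "d \<noteq> 0"
  shows "L e = 0"
proof (rule ccontr)
  assume e: "L e \<noteq> 0"
  have L0: "L 0 = 0" using L[of 0 0] by simp
  obtain u where "B = s * u" using s(1) by blast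
  then obtain l where l: "\<And>x. x \<in> keys s \<Longrightarrow> L x = l" using factor_homogeneous[of L s u] L s(2,3) by auto
  obtain v where v: "single e c - single 0 d = s * v" using d(1) by blast
  have "filt (\<lambda>x. L x = 0) (s * v) = filt (\<lambda>x. True) s * filt (\<lambda>x. L x = - l) v"
    by (rule filt_mult) (auto simp: L l)
  moreover have "filt (\<lambda>x. L x = 0) (single e c - single 0 d) = - single 0 d"
    by (rule poly_mapping_eqI) (use e L0 in \<open>auto simp: lookup_filt lookup_minus lookup_single when_def\<close>)
  moreover have "filt (\<lambda>x. True) s = s" by (rule poly_mapping_eqI) (simp add: lookup_filt)
  ultimately have "- single 0 d = s * filt (\<lambda>x. L x = - l) v" unfolding v by simp
  then have "s dvd - single 0 d" by (metis dvd_triv_left)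
  then have "s dvd - single 0 d * - single 0 (1 / d)" by (rule dvd_mult2)
  also have "- single 0 d * - single 0 (1 / d) = (1 :: param_ring)" using d(2) by (simp add: mult_single)
  finally show False using s(4) by simp
qed

text \<open>The exponent of \<open>t\<^sup>m q\<^sup>k p\<close>; twice each exponent, because \<open>half_pow\<close> counts half powers.\<close>

definition qtp :: "int \<Rightarrow> int \<Rightarrow> param \<Rightarrow> (param \<Rightarrow>\<^sub>0 int)" where
  "qtp k m p = single Pq (2 * k) + single Pt (2 * m) + single p 2"

text \<open>\<open>sep\<close> says that a monomial becoming constant has an exponent proportional
  to that of the binomial, expressed by additive functions L: independence statements follow by a
  suitable choice of L. For \<open>generic\<close> such an exponent is 0.\<close>

locale daha_sep = daha +
  fixes p0 :: param and k m :: nat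
  assumes p0: "p0 = Ptn \<or> p0 = Pt0" and k1: "k \<ge> 1"
    and sep: "c \<noteq> 0 \<Longrightarrow> d \<noteq> 0 \<Longrightarrow> \<phi> (single e c) = \<phi> (single 0 d) \<Longrightarrow> (\<And>x y. L (x + y) = L x + L y) \<Longrightarrow>
      L (qtp (int k) (int m) p0) = 0 \<Longrightarrow> L e = (0 :: int)"
begin

lemma ymon_single: "ymon a b c = \<phi> (single (single Pq (2 * a) + single Pt (2 * b) + single Ptn c + single Pt0 c) 1)"
proof -
  have "ymon a b c = hp Pq (2 * a) * hp Pt (2 * b) * hp Ptn c * hp Pt0 c"
    by (simp add: ymon_def hp_powi power_int_mult_distrib mult.assoc)
  then show ?thesis by (simp add: half_pow_def mult_single flip: phi_mult)
qed

lemma phi_uminus_1: "- 1 = \<phi> (single 0 (- 1))"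
  by (simp add: single_uminus phi_uminus)

lemma phi_single_mult: "\<phi> (single e c) * \<phi> (single e' c') = \<phi> (single (e + e') (c * c'))"
  by (simp add: mult_single flip: phi_mult)

lemmas look = qtp_def lookup_add lookup_single when_def

lemma daha_generic: "daha_generic \<phi> n"
proof unfold_locales
  fix a b c
  assume a: "ymon a b c = 1"
  define e where "e = single Pq (2 * a) + single Pt (2 * b) + single Ptn c + single Pt0 c"
  have e: "L e = 0" if "\<And>x y. L (x + y) = L x + L y" "L (qtp (int k) (int m) p0) = 0" for L :: "_ \<Rightarrow> int"
    using sep[of 1 1 e L, OF _ _ _ that] a by (simp add: ymon_single e_def)
  \<comment> \<open>The coordinate at whichever of \<open>Ptn\<close> and \<open>Pt0\<close> is not
    \<open>p0\<close> vanishes on the binomial. The functions used next are minors formed with the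
    coordinate at \<open>p0\<close>.\<close>
  have c: "c = 0" using e[of "\<lambda>x. lookup x Pt0"] e[of "\<lambda>x. lookup x Ptn"] p0 by (auto simp: look e_def)
  have "a = 0" using e[of "\<lambda>x. int k * lookup x p0 - lookup x Pq"] p0 c by (auto simp: look e_def algebra_simps)
  moreover have "b = 0" using e[of "\<lambda>x. int m * lookup x p0 - lookup x Pt"] p0 c by (auto simp: look e_def algebra_simps)
  ultimately show "a = 0 \<and> b = 0 \<and> c = 0" using c by simp
next
  fix a b c x
  assume x: "x = hp Pq 1 * ymon a b c"
  have no: False if "x * hp Pun g * hp Pu0 h = \<phi> (single 0 d)" "g \<noteq> 0" "d \<noteq> 0" for g h d
  proof -
    define e where "e = single Pq 1 + (single Pq (2 * a) + single Pt (2 * b) + single Ptn c + single Pt0 c) + single Pun g + single Pu0 h"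
    have "\<phi> (single e 1) = \<phi> (single 0 d)"
      using that(1) unfolding x ymon_single half_pow_def phi_single_mult e_def by simp
    from sep[OF _ that(3) this, of "\<lambda>x. lookup x Pun"] show False using p0 that(2) by (auto simp: look e_def)
  qed
  have [simp]: "\<phi> (single 0 1) = 1" by simp
  show "\<not> (x = hp Pun 1 * hp Pu0 1 \<or> x = 1 / (hp Pun 1 * hp Pu0 1) \<or> x = - hp Pun 1 / hp Pu0 1 \<or> x = - hp Pu0 1 / hp Pun 1)"
  proof (intro notI, elim disjE)
    assume "x = hp Pun 1 * hp Pu0 1"
    then show False using no[of "- 1" "- 1" 1] by (simp add: hp_uminus field_simps)
  next
    assume "x = 1 / (hp Pun 1 * hp Pu0 1)"
    then show False using no[of 1 1 1] by simp
  next
    assume "x = - hp Pun 1 / hp Pu0 1"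
    then show False using no[of "- 1" 1 "- 1"] by (simp add: hp_uminus phi_uminus_1[symmetric])
  next
    assume "x = - hp Pu0 1 / hp Pun 1"
    then show False using no[of 1 "- 1" "- 1"] by (simp add: hp_uminus phi_uminus_1[symmetric])
  qed
qed

end

sublocale daha_sep \<subseteq> daha_generic by (rule daha_generic)

locale daha_res = daha_sep + assumes val: "\<phi> (single (qtp (int k) (int m) p0) 1) = - 1"
begin

lemma crit_single: "crit (ymon a b 1) \<longleftrightarrow> \<phi> (single (qtp a b Ptn) 1) = - 1 \<or> \<phi> (single (qtp a b Pt0) 1) = - 1"
proof -
  have prods: "ymon a b 1 * hp Ptn 1 * hp Pt0 (- 1) = \<phi> (single (qtp a b Ptn) 1)" "ymon a b 1 * hp Ptn (- 1) * hp Pt0 1 = \<phi> (single (qtp a b Pt0) 1)"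
    unfolding ymon_single half_pow_def phi_single_mult
    by (rule arg_cong[of _ _ \<phi>], rule arg_cong2[of _ _ _ _ single], rule poly_mapping_eqI, auto simp: look)+
  have aux: "y = - u / v \<longleftrightarrow> y * v * inverse u = - 1" "y = - v / u \<longleftrightarrow> y * inverse v * u = - 1" if "u \<noteq> 0" "v \<noteq> 0" for y u v :: 'a
    using that by (simp_all add: field_simps)
  show ?thesis unfolding prods[symmetric] hp_uminus
    using aux(1)[OF hp_nonzero hp_nonzero, of "ymon a b 1" Pt0 1 Ptn 1] aux(2)[OF hp_nonzero hp_nonzero, of "ymon a b 1" Ptn 1 Pt0 1] by blast
qed

lemma crit_iff: "crit (ymon a b 1) \<longleftrightarrow> a = int k \<and> b = int m"
proof
  assume "crit (ymon a b 1)"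
  then obtain p where p: "p = Ptn \<or> p = Pt0" "\<phi> (single (qtp a b p) 1) = \<phi> (single 0 (- 1))"
    unfolding crit_single phi_uminus_1 by blast
  note s = sep[OF _ _ p(2)]
  \<comment> \<open>If p differed from \<open>p0\<close>, this function would be the coordinate at
    p, which vanishes on the binomial but not on the exponent under consideration.\<close>
  have "p = p0" using s[of "\<lambda>x. lookup x p - (if p = p0 then lookup x p else 0)"] p(1) p0 by (auto simp: look split: if_splits)
  moreover have "int k * lookup (qtp a b p) p0 - lookup (qtp a b p) Pq = 0"
    using s[of "\<lambda>x. int k * lookup x p0 - lookup x Pq"] p0 by (auto simp: look algebra_simps)
  moreover have "int m * lookup (qtp a b p) p0 - lookup (qtp a b p) Pt = 0"
    using s[of "\<lambda>x. int m * lookup x p0 - lookup x Pt"] p0 by (auto simp: look algebra_simps)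
  ultimately show "a = int k \<and> b = int m" using p0 by (auto simp: look)
next
  assume "a = int k \<and> b = int m"
  then show "crit (ymon a b 1)" unfolding crit_single using val p0 by auto
qed

text \<open>The exponent m of t in the binomial becomes a count of coordinates through
  \<open>rho'_last\<close>; with m = n - i, exactly i of them reach the level of r - 1.\<close>

lemma crit_yev:
  assumes "lookup \<mu> n > 0" "m \<le> n"
  shows "crit (yev \<mu> n) \<longleftrightarrow> lev (lookup \<mu> n) = 2 * k \<and> nlev n (2 * k) \<mu> = n - m"
proof -
  have "sigma \<mu> n = 1" using assms by (simp add: sigma_def)
  then have "crit (yev \<mu> n) \<longleftrightarrow> lookup \<mu> n = int k \<and> rho' n \<mu> n = int m" by (simp only: yev_ymon crit_iff)
  also have "\<dots> \<longleftrightarrow> lev (lookup \<mu> n) = 2 * k \<and> rho' n \<mu> n = int m" using assms(1) by (auto simp: lev_def)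
  finally show ?thesis using assms by (auto simp: rho'_last)
qed

end

lemma generic_inj: "generic x = generic y \<Longrightarrow> x = y"
  by (simp add: generic_def eq_fract)

lemma daha_sep_generic:
  assumes "n \<ge> 2" "p0 = Ptn \<or> p0 = Pt0" "k \<ge> 1" shows "daha_sep generic n p0 k m"
proof unfold_locales
  fix c d e and L :: "(param \<Rightarrow>\<^sub>0 int) \<Rightarrow> int"
  assume "c \<noteq> 0" "generic (single e c) = generic (single 0 d)" and L: "\<And>x y. L (x + y) = L x + L y"
  from generic_inj[OF this(2)] \<open>c \<noteq> 0\<close> have "e = 0" by (metis keys_single singleton_iff insert_not_empty)
  then show "L e = 0" using L[of 0 0] by simp
qed (use assms in \<open>auto simp: generic_def fract_collapse\<close>)

lemma residue_daha_res:
  assumes n: "n \<ge> 2" "i \<le> n" "r \<ge> 2" and sign: "\<beta> = par_b_star \<or> \<beta> * par_b_star = 1"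
    and s: "irreducible s" "s dvd half_pow Pt (2 * int (n - i)) * half_pow Pq (2 * int (r - 1)) * par_a_star * \<beta> - 1"
    and res: "is_residue_field s \<phi>"
  obtains p0 where "daha_res \<phi> n p0 (r - 1) (n - i)"
proof -
  define p0 where "p0 = (if \<beta> = par_b_star then Ptn else Pt0)"
  let ?X = "qtp (int (r - 1)) (int (n - i)) p0"
  have hp: "half_pow p a * half_pow p (- a) = 1" for p a by (simp add: half_pow_mult)
  \<comment> \<open>One of the two half powers cancels and the other doubles. So the two signs of
    the theorem amount to the choice of \<open>p0\<close>, and the monomial itself reduces to
    -1.\<close>
  have "par_a_star * \<beta> = - half_pow p0 2"
  proof (cases "\<beta> = par_b_star")
    case True
    have "half_pow Ptn 1 * half_pow Pt0 1 * (half_pow Ptn 1 * half_pow Pt0 (- 1)) = half_pow Ptn 1 * half_pow Ptn 1 * (half_pow Pt0 1 * half_pow Pt0 (- 1))"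
      by (simp only: ac_simps)
    also have "\<dots> = half_pow Ptn 2" unfolding hp by (simp add: half_pow_mult)
    finally show ?thesis using True by (simp add: p0_def par_a_star_def par_b_star_def)
  next
    case False
    then have b: "\<beta> * par_b_star = 1" using sign by simp
    have "par_b_star * (- (half_pow Ptn (- 1) * half_pow Pt0 1)) = (half_pow Ptn 1 * half_pow Ptn (- 1)) * (half_pow Pt0 1 * half_pow Pt0 (- 1))"
      by (simp add: par_b_star_def ac_simps)
    then have "par_b_star * (- (half_pow Ptn (- 1) * half_pow Pt0 1)) = 1" unfolding hp by simp
    then have "\<beta> * (par_b_star * (- (half_pow Ptn (- 1) * half_pow Pt0 1))) = \<beta>" by simp
    then have "\<beta> = - (half_pow Ptn (- 1) * half_pow Pt0 1)" unfolding mult.assoc[symmetric] b by simp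
    moreover have "half_pow Ptn 1 * half_pow Pt0 1 * (half_pow Ptn (- 1) * half_pow Pt0 1) = (half_pow Ptn 1 * half_pow Ptn (- 1)) * (half_pow Pt0 1 * half_pow Pt0 1)"
      by (simp only: ac_simps)
    ultimately show ?thesis unfolding hp using False by (simp add: p0_def par_a_star_def half_pow_mult)
  qed
  then have B: "half_pow Pt (2 * int (n - i)) * half_pow Pq (2 * int (r - 1)) * par_a_star * \<beta> - 1 = - single ?X 1 - 1"
    by (simp add: mult.assoc) (simp add: half_pow_def mult_single qtp_def ac_simps)
  have X: "?X \<noteq> 0"
  proof
    assume "?X = 0"
    then have "lookup ?X p0 = 0" by simp
    then show False by (auto simp: qtp_def p0_def lookup_add lookup_single when_def split: if_splits)
  qed
  let ?B = "- single ?X 1 - 1 :: param_ring"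
  have B0: "?B \<noteq> 0"
  proof
    assume "?B = 0"
    then have "lookup ?B 0 = 0" by simp
    then show False using X by (simp add: lookup_minus lookup_uminus lookup_single lookup_one when_def)
  qed
  have keysB: "e = 0 \<or> e = ?X" if "e \<in> keys ?B" for e
    using that by (auto simp: in_keys_iff lookup_minus lookup_uminus lookup_single lookup_one when_def split: if_splits)
  have phi: "\<phi> 1 = 1" "\<And>x y. \<phi> (x + y) = \<phi> x + \<phi> y" "\<And>x y. \<phi> (x * y) = \<phi> x * \<phi> y" "\<And>x. \<phi> x = 0 \<longleftrightarrow> s dvd x"
    using res by (auto simp: is_residue_field_def)
  interpret daha \<phi> n by unfold_locales (use phi n in auto)
  have "daha_res \<phi> n p0 (r - 1) (n - i)"
  proof unfold_locales
    fix c d e and L :: "(param \<Rightarrow>\<^sub>0 int) \<Rightarrow> int"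
    assume a: "d \<noteq> 0" "\<phi> (single e c) = \<phi> (single 0 d)" and L: "\<And>x y. L (x + y) = L x + L y" and LX: "L ?X = 0"
    have "s dvd single e c - single 0 d" using a(2) phi(4) by (simp add: phi_diff flip: phi(4))
    moreover have "L 0 = 0" using L[of 0 0] by simp
    then have "L x = 0" if "x \<in> keys ?B" for x using keysB[OF that] LX by auto
    moreover have "\<not> s dvd 1" using s(1) by (simp add: irreducible_def)
    ultimately show "L e = 0" using dvd_binomial[of L s ?B e c d] L B0 a(1) s(2) unfolding B by blast
  next
    have "\<phi> ?B = 0" using s(2) unfolding B phi(4) .
    then have "- \<phi> (single ?X 1) - 1 = 0" by (simp add: phi_diff phi_uminus)
    then show "\<phi> (single ?X 1) = - 1" by (metis eq_iff_diff_eq_0 minus_minus)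
  qed (use n in \<open>auto simp: p0_def\<close>)
  then show ?thesis using that by blast
qed

section \<open>Reduction modulo \<open>s\<close>\<close>

text \<open>Reduction as a relation: a proof of it contains both that the valuation is non-negative
  and what the reduced value is, and it passes through the field operations.\<close>

definition rel :: "(param_ring \<Rightarrow> 'k::field) \<Rightarrow> param_ring fract \<Rightarrow> 'k \<Rightarrow> bool" where
  "rel \<phi> z r \<longleftrightarrow> (\<exists>a b. \<phi> b \<noteq> 0 \<and> z = Fract a b \<and> r = \<phi> a / \<phi> b)"

definition relf :: "(param_ring \<Rightarrow> 'k::field) \<Rightarrow> param_ring fract laurent \<Rightarrow> 'k laurent \<Rightarrow> bool" where
  "relf \<phi> F G \<longleftrightarrow> (\<forall>\<mu>. rel \<phi> (lookup F \<mu>) (lookup G \<mu>))"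

lemma lin_expand': assumes "lin F" "finite K" "keys f \<subseteq> K"
  shows "F f = (\<Sum>\<mu>\<in>K. lscale (lookup f \<mu>) (F (monom_x \<mu>)))"
  by (subst lin_expand[OF assms(1)], rule sum.mono_neutral_left) (use assms in \<open>auto simp: in_keys_iff\<close>)

context daha
begin

lemma relE: assumes "rel \<phi> z r" obtains a b where "b \<noteq> 0" "\<phi> b \<noteq> 0" "z = Fract a b" "r = \<phi> a / \<phi> b"
  using assms phi_0 unfolding rel_def by metis

lemma rel_generic: "rel \<phi> (generic a) (\<phi> a)"
  unfolding rel_def generic_def by (intro exI[of _ a] exI[of _ 1]) simp

lemma rel_add: assumes "rel \<phi> z r" "rel \<phi> z' r'" shows "rel \<phi> (z + z') (r + r')"
proof -
  obtain a b where 1: "b \<noteq> 0" "\<phi> b \<noteq> 0" "z = Fract a b" "r = \<phi> a / \<phi> b" using assms(1) by (rule relE)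
  obtain c d where 2: "d \<noteq> 0" "\<phi> d \<noteq> 0" "z' = Fract c d" "r' = \<phi> c / \<phi> d" using assms(2) by (rule relE)
  show ?thesis unfolding rel_def
    by (intro exI[of _ "a * d + c * b"] exI[of _ "b * d"]) (use 1 2 in \<open>simp add: phi_add phi_mult field_simps\<close>)
qed

lemma rel_mult: assumes "rel \<phi> z r" "rel \<phi> z' r'" shows "rel \<phi> (z * z') (r * r')"
proof -
  obtain a b where 1: "b \<noteq> 0" "\<phi> b \<noteq> 0" "z = Fract a b" "r = \<phi> a / \<phi> b" using assms(1) by (rule relE)
  obtain c d where 2: "d \<noteq> 0" "\<phi> d \<noteq> 0" "z' = Fract c d" "r' = \<phi> c / \<phi> d" using assms(2) by (rule relE)
  show ?thesis unfolding rel_def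
    by (intro exI[of _ "a * c"] exI[of _ "b * d"]) (use 1 2 in \<open>simp add: phi_mult\<close>)
qed

lemma rel_divide: assumes "rel \<phi> z r" "rel \<phi> z' r'" "r' \<noteq> 0" shows "rel \<phi> (z / z') (r / r')"
proof -
  obtain a b where 1: "b \<noteq> 0" "\<phi> b \<noteq> 0" "z = Fract a b" "r = \<phi> a / \<phi> b" using assms(1) by (rule relE)
  obtain c d where 2: "d \<noteq> 0" "\<phi> d \<noteq> 0" "z' = Fract c d" "r' = \<phi> c / \<phi> d" using assms(2) by (rule relE)
  show ?thesis unfolding rel_def
    by (intro exI[of _ "a * d"] exI[of _ "b * c"]) (use 1 2 assms(3) in \<open>simp add: phi_mult\<close>)
qed

lemma rel_0: "rel \<phi> 0 0"
  using rel_generic[of 0] by (simp add: generic_def phi_0 fract_collapse)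

lemma rel_1: "rel \<phi> 1 1"
  using rel_generic[of 1] by (simp add: generic_def fract_collapse)

lemma rel_uminus: assumes "rel \<phi> z r" shows "rel \<phi> (- z) (- r)"
  using rel_mult[OF rel_generic[of "- 1"] assms] by (simp add: generic_def phi_uminus fract_collapse flip: minus_fract)

lemma rel_diff: "rel \<phi> z r \<Longrightarrow> rel \<phi> z' r' \<Longrightarrow> rel \<phi> (z - z') (r - r')"
  using rel_add[OF _ rel_uminus] by fastforce

lemma rel_unique: assumes "rel \<phi> z r" "rel \<phi> z r'" shows "r = r'"
proof -
  obtain a b where 1: "b \<noteq> 0" "\<phi> b \<noteq> 0" "z = Fract a b" "r = \<phi> a / \<phi> b" using assms(1) by (rule relE)
  obtain c d where 2: "d \<noteq> 0" "\<phi> d \<noteq> 0" "z = Fract c d" "r' = \<phi> c / \<phi> d" using assms(2) by (rule relE)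
  have "a * d = c * b" using 1 2 by (simp add: eq_fract)
  then have "\<phi> a * \<phi> d = \<phi> c * \<phi> b" by (metis phi_mult)
  then show ?thesis using 1 2 by (simp add: frac_eq_eq)
qed

lemma relf_add: "relf \<phi> F G \<Longrightarrow> relf \<phi> F' G' \<Longrightarrow> relf \<phi> (F + F') (G + G')"
  and relf_diff: "relf \<phi> F G \<Longrightarrow> relf \<phi> F' G' \<Longrightarrow> relf \<phi> (F - F') (G - G')"
  and relf_scale: "rel \<phi> c d \<Longrightarrow> relf \<phi> F G \<Longrightarrow> relf \<phi> (lscale c F) (lscale d G)"
  by (simp_all add: relf_def lookup_add lookup_minus rel_add rel_diff rel_mult)

lemma relf_uminus: "relf \<phi> F G \<Longrightarrow> relf \<phi> (- F) (- G)"
  by (simp add: relf_def lookup_uminus rel_uminus)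

lemma relf_if: "relf \<phi> a a' \<Longrightarrow> relf \<phi> b b' \<Longrightarrow> relf \<phi> (if c then a else b) (if c then a' else b')"
  by simp

lemma relf_0: "relf \<phi> 0 0"
  by (simp add: relf_def rel_0)

lemma relf_monom: "relf \<phi> (monom_x \<mu>) (monom_x \<mu>)"
  by (simp add: relf_def lookup_monom_x rel_0 rel_1)

lemma relf_1: "relf \<phi> 1 1"
  using relf_monom[of 0] by simp

lemma relf_sum: "(\<And>a. a \<in> A \<Longrightarrow> relf \<phi> (f a) (g a)) \<Longrightarrow> relf \<phi> (sum f A) (sum g A)"
  by (induction A rule: infinite_finite_induct) (auto intro: relf_0 relf_add)

lemma relf_lin:
  assumes "lin F" "lin G" "\<And>\<kappa>. relf \<phi> (F (monom_x \<kappa>)) (G (monom_x \<kappa>))" "relf \<phi> f g"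
  shows "relf \<phi> (F f) (G g)"
proof -
  let ?K = "keys f \<union> keys g"
  have "F f = (\<Sum>\<mu>\<in>?K. lscale (lookup f \<mu>) (F (monom_x \<mu>)))" "G g = (\<Sum>\<mu>\<in>?K. lscale (lookup g \<mu>) (G (monom_x \<mu>)))"
    using assms(1,2) by (auto intro!: lin_expand')
  then show ?thesis using assms(3,4) by (auto intro!: relf_sum relf_scale simp: relf_def[of _ f g])
qed

lemma relf_mult: assumes "relf \<phi> F G" "relf \<phi> F' G'" shows "relf \<phi> (F * F') (G * G')"
proof (rule relf_lin[where F = "\<lambda>f. f * F'" and G = "\<lambda>f. f * G'", OF lin_multr[OF lin_id] lin_multr[OF lin_id] _ assms(1)])
  show "relf \<phi> (monom_x \<kappa> * F') (monom_x \<kappa> * G')" for \<kappa>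
    using assms(2) by (simp add: relf_def monom_x_def lookup_single_mult)
qed

lemma relf_reduce: assumes "relf \<phi> F G" shows "reduce \<phi> F = G"
proof (rule poly_mapping_eqI)
  fix \<mu>
  have r: "rel \<phi> (lookup F \<mu>) (lookup G \<mu>)" using assms by (simp add: relf_def)
  then have "reduce_coeff \<phi> (lookup F \<mu>) = lookup G \<mu>"
    unfolding reduce_coeff_def rel_def[symmetric] using rel_unique by blast
  moreover have "lookup G \<mu> = 0" if "lookup F \<mu> = 0" using r that rel_unique[OF rel_0] by simp
  ultimately show "lookup (reduce \<phi> F) \<mu> = lookup G \<mu>" by (simp add: reduce_def map.rep_eq when_def)
qed

section \<open>Comparison of \<open>Y_hat\<close> with \<open>YY\<close>, and simultaneous reduction
  of operators and eigenvectors\<close>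

lemma compose_list_append: "compose_list (fs @ gs) f = compose_list fs (compose_list gs f)"
  by (induction fs) (simp_all add: compose_list_def)

lemma compose_list_map: "compose_list (map F js) f = foldr F js f"
  by (induction js) (simp_all add: compose_list_def)

lemma T_hat_inv: assumes "j \<le> n" "f \<in> LP" shows "T_hat_inv \<phi> n j f = TI j f"
  unfolding T_hat_inv_def
  by (rule inv_into_f_eq) (use assms in \<open>auto intro!: inj_on_inverseI[of _ "TI j"] LP_TI\<close>)

lemma foldr_T_hat_inv: "(\<And>j. j \<in> set js \<Longrightarrow> j \<le> n) \<Longrightarrow> f \<in> LP \<Longrightarrow> foldr (T_hat_inv \<phi> n) js f = foldr TI js f \<and> foldr TI js f \<in> LP"
  by (induction js) (auto simp: T_hat_inv LP_TI)

lemma Y_hat_YY: assumes "i \<le> n" "f \<in> LP" shows "Y_hat \<phi> n i f = YY i f"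
proof -
  have "foldr (T_hat_inv \<phi> n) [1..<i] f = foldr TI [1..<i] f" using foldr_T_hat_inv[of "[1..<i]" f] assms by auto
  then show ?thesis unfolding Y_hat_def compose_list_append compose_list_map YY_def by simp
qed

end

text \<open>Makes the generic theory available under the prefix \<open>gen\<close> beside that of
  the residue field, so the two can be compared construction by construction.\<close>

sublocale daha_res \<subseteq> gen: daha_sep generic n p0 k m
  by (rule daha_sep_generic[OF n2 p0 k1])

context daha_res
begin

lemma relf_xpow: "relf \<phi> (xpow p a) (xpow p a)"
  unfolding xpow_def by (rule relf_monom)

lemmas relf_intros = relf_add relf_diff relf_uminus relf_scale relf_mult relf_sum relf_1 relf_monom relf_xpow
  rel_add rel_diff rel_mult rel_uminus rel_1 rel_generic

lemma relf_zp: "relf \<phi> (gen.zp j l) (zp j l)"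
  unfolding zp_def gen.zp_def hp_powi gen.hp_powi
  by (intro relf_if relf_intros)

lemma relf_DDm: "relf \<phi> (gen.DDm j \<kappa>) (DDm j \<kappa>)"
  unfolding DDm_def gen.DDm_def by (intro relf_if relf_uminus relf_sum relf_mult relf_monom relf_zp)

lemma relf_DD: assumes "relf \<phi> f g" shows "relf \<phi> (gen.DD j f) (DD j g)"
proof (rule relf_lin[OF gen.lin_DD lin_DD _ assms])
  fix \<kappa> show "relf \<phi> (gen.DD j (monom_x \<kappa>)) (DD j (monom_x \<kappa>))"
    unfolding DD_monom gen.DD_monom by (rule relf_DDm)
qed

lemma relf_pp: "relf \<phi> (gen.pp j) (pp j)"
  unfolding pp_def gen.pp_def
  by (intro relf_if relf_intros relf_zp)

lemma relf_T: "j \<le> n \<Longrightarrow> relf \<phi> f g \<Longrightarrow> relf \<phi> (T_hat generic n j f) (TT j g)"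
  by (simp only: T_eq gen.T_eq) (intro relf_intros relf_pp relf_DD)

lemma relf_TI: "j \<le> n \<Longrightarrow> relf \<phi> f g \<Longrightarrow> relf \<phi> (gen.TI j f) (TI j g)"
  unfolding TI_def gen.TI_def by (intro relf_intros relf_T)

lemma relf_UU: "relf \<phi> f g \<Longrightarrow> relf \<phi> (gen.UU f) (UU g)"
  unfolding UU_def gen.UU_def by (intro relf_intros relf_TI) auto

lemma rel_ymon: "rel \<phi> (gen.ymon a b c) (ymon a b c)"
  unfolding ymon_single gen.ymon_single by (rule rel_generic)

lemma rel_yev: "rel \<phi> (gen.yev \<mu> j) (yev \<mu> j)"
  unfolding yev_ymon gen.yev_ymon by (rule rel_ymon)

lemma rel_gT:
  assumes "1 \<le> j" "j < n" "lookup \<mu> j \<noteq> lookup \<mu> (j + 1)"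
  shows "rel \<phi> (gen.gT j (gen.yev \<mu>)) (gT j (yev \<mu>))"
  unfolding gT_def gen.gT_def
proof (intro rel_divide rel_diff rel_mult rel_generic rel_yev)
  show "yev \<mu> (j + 1) - yev \<mu> j \<noteq> 0" using assms by (simp add: yev_ymon ymon_eq)
qed

lemma rel_gN: "rel \<phi> (gen.gN (gen.yev \<mu> n)) (gN (yev \<mu> n))"
  unfolding gN_def gen.gN_def
proof (intro rel_divide rel_diff rel_mult rel_add rel_generic rel_yev rel_1)
  show "yev \<mu> n \<noteq> 0" by simp
  show "1 / yev \<mu> n - yev \<mu> n \<noteq> 0"
    using sigma_pm[of \<mu> n] by (auto simp: yev_ymon ymon_inv ymon_eq)
qed

lemma rel_gU: "rel \<phi> (gen.gU (gen.yev \<mu> 1)) (gU (yev \<mu> 1))"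
  unfolding gU_def gen.gU_def
proof (intro rel_divide rel_diff rel_mult rel_add rel_generic rel_yev rel_1)
  have q: "q = ymon 1 0 0" by (simp add: ymon_def)
  show "yev \<mu> 1 - 1 / (q * yev \<mu> 1) \<noteq> 0" unfolding q
    using sigma_pm[of \<mu> 1] by (simp add: yev_ymon ymon_mult ymon_inv ymon_eq)
qed simp_all

text \<open>Both vectors arise from 1 by the same sequence of upward moves. Every intertwiner used
  is nonzero over both fields, and the denominators of its constants are nonzero modulo s.\<close>

lemma eig_pair:
  assumes "\<mu> \<in> weights n" shows "\<exists>F G. gen.eig \<mu> F \<and> eig \<mu> G \<and> relf \<phi> F G"
proof -
  interpret moves n "\<lambda>\<mu>. \<exists>F G. gen.eig \<mu> F \<and> eig \<mu> G \<and> relf \<phi> F G" 0 "\<lambda>a k. a < 0"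
  proof (unfold_locales, goal_cases)
    case (2 \<mu> j)
    then obtain F G where fg: "gen.eig \<mu> F" "eig \<mu> G" "relf \<phi> F G" by blast
    have "relf \<phi> (gen.TT j F + lscale (gen.gT j (gen.yev \<mu>)) F) (TT j G + lscale (gT j (yev \<mu>)) G)"
      using fg(3) 2 by (intro relf_add relf_T relf_scale rel_gT) auto
    then show ?case using gen.eig_swap[OF fg(1) 2(3-5)] eig_swap[OF fg(2) 2(3-5)] by blast
  next
    case (3 \<mu>)
    then obtain F G where fg: "gen.eig \<mu> F" "eig \<mu> G" "relf \<phi> F G" by blast
    have "relf \<phi> (gen.UU F + lscale (gen.gU (gen.yev \<mu> 1)) F) (UU G + lscale (gU (yev \<mu> 1)) G)"
      using fg(3) by (intro relf_add relf_UU relf_scale rel_gU)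
    then show ?case using gen.eig_affine[OF fg(1)] eig_affine[OF fg(2)] by blast
  next
    case (4 \<mu>)
    then obtain F G where fg: "gen.eig \<mu> F" "eig \<mu> G" "relf \<phi> F G" by blast
    have "relf \<phi> (gen.TT n F + lscale (gen.gN (gen.yev \<mu> n)) F) (TT n G + lscale (gN (yev \<mu> n)) G)"
      using fg(3) by (intro relf_add relf_T relf_scale rel_gN) auto
    then show ?case using gen.eig_flip_up[OF fg(1) 4(1,4)] eig_flip_up[OF fg(2) 4(1,4)] by blast
  qed (rule n2)
  have "\<exists>F G. gen.eig 0 F \<and> eig 0 G \<and> relf \<phi> F G" using gen.eig_0 eig_0 relf_1 by blast
  then show ?thesis by (intro climb[OF _ _ _ assms, of 0]) (auto simp: lev_def intro: weightsI)
qed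

lemma y_eigenvalue_yev:
  assumes "\<mu> \<in> weights n" "i \<in> {1..n}" shows "y_eigenvalue n \<mu> i = gen.yev \<mu> i"
  using rho_rho'[OF n2 assms] by (simp add: y_eigenvalue_def gen.yev_def par_a_star_def gen.phi_mult)

lemma span_lt:
  assumes "\<mu> \<in> weights n" "keys (f :: 'f::field laurent) \<subseteq> lt n \<mu>"
  shows "f \<in> laurent.span {monom_x \<nu> |\<nu>. \<nu> \<in> weights n \<and> succ_eq n \<mu> \<nu> \<and> \<nu> \<noteq> \<mu>}"
proof -
  have "(\<Sum>\<nu>\<in>keys f. lscale (lookup f \<nu>) (monom_x \<nu>)) \<in> laurent.span {monom_x \<nu> |\<nu>. \<nu> \<in> weights n \<and> succ_eq n \<mu> \<nu> \<and> \<nu> \<noteq> \<mu>}"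
    using assms lt_succ_eq[OF n2 assms(1)] by (intro laurent.span_sum laurent.span_scale laurent.span_base) blast
  then show ?thesis by (simp add: laurent_expand[symmetric])
qed

lemma span_lookup:
  assumes "(f :: 'f::field laurent) \<in> laurent.span {monom_x \<nu> |\<nu>. \<nu> \<in> weights n \<and> succ_eq n \<mu> \<nu> \<and> \<nu> \<noteq> \<mu>}"
  shows "lookup f \<mu> = 0"
  using assms by (rule laurent.span_induct_alt) (auto simp: lookup_add lookup_monom_x)

lemma koornwinder_eig:
  assumes "\<mu> \<in> weights n" shows "eig \<mu> (reduce \<phi> (koornwinder_E n \<mu>))"
proof -
  obtain F G where fg: "gen.eig \<mu> F" "eig \<mu> G" "relf \<phi> F G" using eig_pair[OF assms] by blast
  define c d where "c = lookup F \<mu>" "d = lookup G \<mu>"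
  have nz: "c \<noteq> 0" "d \<noteq> 0" using gen.eig_top(1)[OF fg(1) assms] eig_top(1)[OF fg(2) assms] by (auto simp: c_d_def in_keys_iff)
  define E where "E = lscale (1 / c) F"
  have scale: "eigw (w) (lscale a f)" if "eigw w f" for w a f
    using eigw_scale_diff[OF that that, of a 0] by simp
  have scaleg: "gen.eigw (w) (lscale a f)" if "gen.eigw w f" for w a f
    using gen.eigw_scale_diff[OF that that, of a 0] by simp
  have E: "gen.eigw (gen.yev \<mu>) E" using fg(1) scaleg by (simp add: E_def gen.eig_def)
  have E1: "lookup E \<mu> = 1" using nz by (simp add: E_def c_d_def)
  have "koornwinder_E n \<mu> = E" unfolding koornwinder_E_def
  proof (rule the_equality)
    have "keys (E - monom_x \<mu>) \<subseteq> lt n \<mu>"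
    proof
      fix \<kappa> assume k: "\<kappa> \<in> keys (E - monom_x \<mu>)"
      then have "\<kappa> \<noteq> \<mu>" using E1 by (auto simp: in_keys_iff lookup_minus lookup_monom_x)
      moreover have "\<kappa> \<in> keys F" using k \<open>\<kappa> \<noteq> \<mu>\<close> by (simp add: in_keys_iff lookup_minus lookup_monom_x E_def)
      ultimately show "\<kappa> \<in> lt n \<mu>" using gen.eig_top(2)[OF fg(1) assms] by blast
    qed
    from span_lt[OF assms this] show "E \<in> laurent_polys n \<and> (\<forall>i\<in>{1..n}. Y_hat generic n i E = lscale (y_eigenvalue n \<mu> i) E) \<and>
      E - monom_x \<mu> \<in> laurent.span {monom_x \<nu> |\<nu>. \<nu> \<in> weights n \<and> succ_eq n \<mu> \<nu> \<and> \<nu> \<noteq> \<mu>}"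
      using E by (auto simp: gen.eigw_def gen.Y_hat_YY y_eigenvalue_yev[OF assms])
    fix E'
    assume e: "E' \<in> laurent_polys n \<and> (\<forall>i\<in>{1..n}. Y_hat generic n i E' = lscale (y_eigenvalue n \<mu> i) E') \<and>
      E' - monom_x \<mu> \<in> laurent.span {monom_x \<nu> |\<nu>. \<nu> \<in> weights n \<and> succ_eq n \<mu> \<nu> \<and> \<nu> \<noteq> \<mu>}"
    then have E': "gen.eigw (gen.yev \<mu>) E'" by (auto simp: gen.eigw_def gen.Y_hat_YY y_eigenvalue_yev[OF assms])
    \<comment> \<open>The competitor is triangular only for the larger order \<open>succ_eq\<close>.
      Its coefficient at \<mu> is still 1, which with simplicity of the spectrum suffices for
      uniqueness.\<close>
    have "lookup (E' - monom_x \<mu>) \<mu> = 0" using e span_lookup by blast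
    then have "lookup E' \<mu> = 1" by (simp add: lookup_minus lookup_monom_x)
    show "E' = E"
    proof (rule ccontr)
      assume "E' \<noteq> E"
      then have "gen.eig \<mu> (E' - E)" using gen.eigw_scale_diff[OF E' E, of 1 1] by (simp add: gen.eig_def)
      from gen.eig_top(1)[OF this assms] show False using E1 \<open>lookup E' \<mu> = 1\<close> by (simp add: in_keys_iff lookup_minus)
    qed
  qed
  \<comment> \<open>The leading coefficient of the reduced vector is nonzero, so normalization
    commutes with reduction.\<close>
  moreover have "relf \<phi> E (lscale (1 / d) G)" unfolding E_def c_d_def
    using fg(3) nz(2) by (intro relf_scale rel_divide rel_1) (auto simp: relf_def c_d_def)
  ultimately have "reduce \<phi> (koornwinder_E n \<mu>) = lscale (1 / d) G" by (simp add: relf_reduce)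
  then show ?thesis using fg(2) nz(2) scale by (auto simp: eig_def lscale_eq_0_iff)
qed

end

section \<open>Subrepresentations\<close>

lemma span_lin:
  assumes "lin F" "\<And>g. g \<in> B \<Longrightarrow> F g \<in> laurent.span B" "f \<in> laurent.span B" shows "F f \<in> laurent.span B"
  using assms(3)
proof (rule laurent.span_induct_alt)
  show "F 0 \<in> laurent.span B" using lin_zero[OF assms(1)] laurent.span_zero by simp
  show "F (lscale c x + y) \<in> laurent.span B" if "x \<in> B" "F y \<in> laurent.span B" for c x y
    using that assms(1,2) by (simp add: lin_add lin_scale laurent.span_add laurent.span_scale)
qed

lemma finite_below: "finite (below n \<kappa>)"
proof -
  define b where "b = ht n 0 \<kappa>"
  have "below n \<kappa> \<subseteq> wt n ` (PiE {1..n} (\<lambda>_. {- b..b}))"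
  proof
    fix \<nu> assume "\<nu> \<in> below n \<kappa>"
    then have n: "\<nu> \<in> weights n" "ht n 0 \<nu> \<le> b" by (auto simp: below_def b_def)
    have "\<bar>lookup \<nu> p\<bar> \<le> b" if "p \<in> {1..n}" for p
    proof -
      have "\<bar>lookup \<nu> p\<bar> \<le> (\<Sum>p\<in>{1..n}. \<bar>lookup \<nu> p\<bar>)" by (rule member_le_sum) (use that in auto)
      then show ?thesis using n(2) by (simp add: ht_def)
    qed
    then have "restrict (lookup \<nu>) {1..n} \<in> PiE {1..n} (\<lambda>_. {- b..b})" by (fastforce simp: abs_le_iff)
    moreover have "\<nu> = wt n (restrict (lookup \<nu>) {1..n})"
      by (rule weights_eqI[OF n(1) wt_weights]) (simp add: lookup_wt)
    ultimately show "\<nu> \<in> wt n ` (PiE {1..n} (\<lambda>_. {- b..b}))" by blast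
  qed
  then show ?thesis by (rule finite_subset) (intro finite_imageI finite_PiE; simp)
qed

lemma nlev_swap: assumes "1 \<le> j" "j < n" shows "nlev n L (rv n j \<mu>) = nlev n L \<mu>"
proof -
  have l: "lookup (rv n j \<mu>) p = lookup \<mu> (sw j p)" for p using assms by (auto simp: lookup_rv sw_def)
  have "bij_betw (sw j) {p\<in>{1..n}. L \<le> lev (lookup (rv n j \<mu>) p)} {p\<in>{1..n}. L \<le> lev (lookup \<mu> p)}"
    by (rule bij_betwI[of _ _ _ "sw j"]) (use assms in \<open>auto simp: l sw_def split: if_splits\<close>)
  then show ?thesis unfolding nlev_def by (rule bij_betw_same_card)
qed

text \<open>The move a \<mapsto> -1 - a exchanges the levels 2 j and 2 j + 1, so an even threshold
  is never crossed.\<close>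

lemma nlev_s0: "nlev n (2 * k) \<mu> \<le> nlev n (2 * k) (s0 \<mu>)"
  unfolding nlev_def
proof (rule card_mono)
  have "2 * k \<le> lev (- 1 - a)" if "2 * k \<le> lev a" for a
  proof (cases "a \<ge> 0")
    case False
    then have a: "lev a = 2 * nat (- a) - 1" "a < 0" by (simp_all add: lev_def)
    have "2 * k \<le> x" if "x + 1 = y" "y = 2 * N - 1" "2 * k \<le> y" for x y N :: nat using that by arith
    from this[OF lev_aff'[OF a(2)] a(1) that] show ?thesis .
  qed (use that lev_aff[of a] in simp)
  then show "{p \<in> {1..n}. 2 * k \<le> lev (lookup \<mu> p)} \<subseteq> {p \<in> {1..n}. 2 * k \<le> lev (lookup (s0 \<mu>) p)}"
    by (auto simp: lookup_s0)
qed simp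

lemma nlev_flip_up: "n \<ge> 2 \<Longrightarrow> lookup \<mu> n < 0 \<Longrightarrow> nlev n L \<mu> \<le> nlev n L (rv n n \<mu>)"
  by (rule nlev_mono) (auto simp: lookup_rv lev_neg)

text \<open>A downward sign change lowers one level by one. It therefore crosses the threshold only
  from level L itself, and then the count drops by at most one.\<close>

lemma nlev_flip:
  assumes "n \<ge> 2" "lookup \<mu> n > 0" "\<not> (lev (lookup \<mu> n) = L \<and> nlev n L \<mu> = i)" "i \<le> nlev n L \<mu>"
  shows "i \<le> nlev n L (rv n n \<mu>)"
proof -
  let ?A = "{p\<in>{1..n}. L \<le> lev (lookup \<mu> p)}" and ?B = "{p\<in>{1..n}. L \<le> lev (lookup (rv n n \<mu>) p)}"
  have l: "lookup (rv n n \<mu>) p = (if p = n then - lookup \<mu> n else lookup \<mu> p)" for p using assms(1) by (simp add: lookup_rv)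
  have ln: "lev (- lookup \<mu> n) + 1 = lev (lookup \<mu> n)" using assms(2) by (rule lev_neg')
  show ?thesis
  proof (cases "lev (lookup \<mu> n) = L")
    case False
    have "?A \<subseteq> ?B" using False ln by (auto simp: l)
    then have "nlev n L \<mu> \<le> nlev n L (rv n n \<mu>)" unfolding nlev_def by (intro card_mono) auto
    then show ?thesis using assms(4) by simp
  next
    case True
    have "?A - {n} \<subseteq> ?B" by (auto simp: l)
    then have "card (?A - {n}) \<le> card ?B" by (intro card_mono) auto
    moreover have "card ?A - 1 \<le> card (?A - {n})" by (simp add: card_Diff_singleton_if)
    ultimately show ?thesis using True assms(3,4) unfolding nlev_def by linarith
  qed
qed

context daha
begin

text \<open>These generators act on eigenvectors by intertwiners or scalars. The others are
  recovered: \<open>T_0\<close> from \<open>Y_1\<close>, x_1 as q^(1/2) \<open>T_0\<close>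
  \<open>UU\<close>, its inverse from the inverse of \<open>UU\<close>, and x_(j+1) as
  \<open>T_j\<close> x_j \<open>T_j\<close>.\<close>

lemma subrepI:
  assumes V: "laurent.subspace V" "V \<subseteq> LP"
    and T: "\<And>j f. 1 \<le> j \<Longrightarrow> j \<le> n \<Longrightarrow> f \<in> V \<Longrightarrow> TT j f \<in> V"
    and U: "\<And>f. f \<in> V \<Longrightarrow> UU f \<in> V" and Y: "\<And>f. f \<in> V \<Longrightarrow> YY 1 f \<in> V"
  shows "is_subrep \<phi> n V"
proof -
  note sub = laurent.subspace_add[OF V(1)] laurent.subspace_diff[OF V(1)] laurent.subspace_scale[OF V(1)]
  have TI: "TI j f \<in> V" if "1 \<le> j" "j \<le> n" "f \<in> V" for j f using T[OF that] that by (simp add: TI_def sub)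
  have unwind: "g \<in> V" if "foldr TT js g \<in> V" "set js \<subseteq> {1..n}" for js g
    using that
  proof (induction js)
    case (Cons j js)
    then have "TI j (TT j (foldr TT js g)) \<in> V" by (intro TI) auto
    then show ?case using Cons by simp
  qed simp
  have T0: "TT 0 f \<in> V" if "f \<in> V" for f
  proof (rule unwind)
    show "foldr TT ([1..<n] @ [n] @ rev [1..<n]) (TT 0 f) \<in> V"
      using Y[OF that] unfolding YY_1 WW_def .
  qed (use n2 in auto)
  have TI0: "TI 0 f \<in> V" if "f \<in> V" for f using T0[OF that] that by (simp add: TI_def sub)
  have x1: "xpow 1 1 * f \<in> V" if "f \<in> V" for f
  proof -
    have "lscale (hp Pq 1) (TT 0 (UU f)) = xpow 1 1 * f"
      by (simp add: UU_def T_simps laurent.scale_scale hp_mult)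
    then show ?thesis using sub(3)[OF T0[OF U[OF that]]] by metis
  qed
  have x1': "xpow 1 (- 1) * f \<in> V" if "f \<in> V" for f
  proof -
    have "xpow 1 1 * (xpow 1 (- 1) * f) = f" by (simp only: mult.assoc[symmetric] xpow_inv mult_1)
    then have u: "UU (xpow 1 (- 1) * f) = lscale (hp Pq (- 1)) (TI 0 f)" by (simp only: UU_def)
    then have uV: "UU (xpow 1 (- 1) * f) \<in> V" using TI0[OF that] by (simp add: sub)
    have "xpow 1 (- 1) * f = UU (UU (xpow 1 (- 1) * f)) - lscale (uu 0) (UU (xpow 1 (- 1) * f))"
      unfolding UU_quadratic by simp
    then show ?thesis using sub(2)[OF U[OF uV] sub(3)[OF uV]] by metis
  qed
  have x: "\<forall>f\<in>V. xpow j 1 * f \<in> V \<and> xpow j (- 1) * f \<in> V" if "1 \<le> j" "j \<le> n" for j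
    using that
  proof (induction j rule: dec_induct)
    case base
    show ?case using x1 x1' by blast
  next
    case (step j)
    then have j: "1 \<le> j" "j < n" "0 < j" by auto
    show ?case
    proof
      fix f assume f: "f \<in> V"
      have s: "xpow (Suc j) 1 * g = TT j (xpow j 1 * TT j g)" for g using T_x[OF j(3,2), of "TT j g"] j by simp
      have "TT j (xpow j 1 * TT j f) \<in> V" using step T f j by simp
      moreover have "xpow (Suc j) (- 1) * f = TI j (xpow j (- 1) * TI j f)"
      proof -
        have "xpow (Suc j) 1 * TI j (xpow j (- 1) * TI j f) = f"
          unfolding s using j by (simp add: mult.assoc[symmetric] xpow_inv)
        then have "xpow (Suc j) (- 1) * (xpow (Suc j) 1 * TI j (xpow j (- 1) * TI j f)) = xpow (Suc j) (- 1) * f" by simp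
        moreover have "xpow (Suc j) (- 1) * xpow (Suc j) 1 = (1 :: 'k laurent)" using xpow_inv[of "Suc j"] by (simp add: mult.commute)
        ultimately show ?thesis by (simp add: mult.assoc[symmetric])
      qed
      moreover have "TI j (xpow j (- 1) * TI j f) \<in> V" using step TI f j by simp
      ultimately show "xpow (Suc j) 1 * f \<in> V \<and> xpow (Suc j) (- 1) * f \<in> V" unfolding s by simp
    qed
  qed
  have "TT j f \<in> V" if "j \<le> n" "f \<in> V" for j f using T T0 that by (cases "j = 0") auto
  then show ?thesis using V x by (simp add: is_subrep_def)
qed

lemma subrepD:
  assumes "is_subrep \<phi> n W"
  shows "laurent.subspace W" "W \<subseteq> LP" "\<And>j f. j \<le> n \<Longrightarrow> f \<in> W \<Longrightarrow> TT j f \<in> W" "\<And>f. f \<in> W \<Longrightarrow> UU f \<in> W"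
    "\<And>i f. i \<le> n \<Longrightarrow> f \<in> W \<Longrightarrow> YY i f \<in> W"
proof -
  show V: "laurent.subspace W" "W \<subseteq> LP" and T: "\<And>j f. j \<le> n \<Longrightarrow> f \<in> W \<Longrightarrow> TT j f \<in> W"
    using assms by (auto simp: is_subrep_def)
  note sub = laurent.subspace_add[OF V(1)] laurent.subspace_diff[OF V(1)] laurent.subspace_scale[OF V(1)]
  have TI: "TI j f \<in> W" if "j \<le> n" "f \<in> W" for j f using T[OF that] that by (simp add: TI_def sub)
  have x: "xpow 1 1 * f \<in> W" if "f \<in> W" for f using assms that n2 by (simp add: is_subrep_def)
  show "UU f \<in> W" if "f \<in> W" for f unfolding UU_def using TI x that by (intro sub) auto
  have "foldr TT js f \<in> W" "foldr TI js f \<in> W" if "set js \<subseteq> {..n}" "f \<in> W" for js f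
    using that by (induction js) (auto intro: T TI)
  note closed = this
  show "YY i f \<in> W" if "i \<le> n" "f \<in> W" for i f
    unfolding YY_def by (intro closed) (use that in auto)
qed

end

section \<open>Expansion in eigenvectors, and eigenvectors in subrepresentations\<close>

context daha_generic
begin

lemma span_eig:
  assumes "finite S" "S \<subseteq> weights n" "\<And>\<kappa> \<nu>. \<kappa> \<in> S \<Longrightarrow> \<nu> \<in> lt n \<kappa> \<Longrightarrow> \<nu> \<in> S" "keys f \<subseteq> S"
    and E: "\<And>\<mu>. \<mu> \<in> weights n \<Longrightarrow> eig \<mu> (E \<mu>)"
  shows "\<exists>c. f = (\<Sum>\<mu>\<in>S. lscale (c \<mu>) (E \<mu>))"
  using assms(1-4)
proof (induction "card S" arbitrary: S f)
  case 0
  then have "S = {}" by simp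
  then show ?case using 0 by simp
next
  case (Suc m)
  then have "S \<noteq> {}" by auto
  then obtain \<kappa> where k: "\<kappa> \<in> S" "\<And>\<iota>. \<iota> \<in> S \<Longrightarrow> \<kappa> \<notin> lt n \<iota>"
    using ex_maximal[OF Suc.prems(1) _ Suc.prems(2)] by blast
  have kw: "\<kappa> \<in> weights n" using k Suc.prems by blast
  define d where "d = lookup f \<kappa> / lookup (E \<kappa>) \<kappa>"
  have e: "lookup (E \<kappa>) \<kappa> \<noteq> 0" using eig_top(1)[OF E[OF kw] kw] by (simp add: in_keys_iff)
  let ?g = "f - lscale d (E \<kappa>)"
  have "keys (E \<kappa>) \<subseteq> S" using eig_top(2)[OF E[OF kw] kw] Suc.prems(3)[OF k(1)] k(1) by blast
  then have "keys ?g \<subseteq> S" using Suc.prems(4) keys_lscale[of d "E \<kappa>"] by (intro keys_minus_subset) auto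
  moreover have "lookup ?g \<kappa> = 0" using e by (simp add: d_def lookup_minus)
  ultimately have "keys ?g \<subseteq> S - {\<kappa>}" by (auto simp: in_keys_iff)
  moreover have "m = card (S - {\<kappa>})" using Suc k by simp
  moreover have "\<nu> \<in> S - {\<kappa>}" if "\<iota> \<in> S - {\<kappa>}" "\<nu> \<in> lt n \<iota>" for \<iota> \<nu> using that k(2) Suc.prems(3) by blast
  ultimately obtain c where c: "?g = (\<Sum>\<mu>\<in>S - {\<kappa>}. lscale (c \<mu>) (E \<mu>))"
    using Suc.hyps(1)[of "S - {\<kappa>}" ?g] Suc.prems(1,2) by blast
  have "f = lscale d (E \<kappa>) + (\<Sum>\<mu>\<in>S - {\<kappa>}. lscale (c \<mu>) (E \<mu>))" unfolding c[symmetric] by simp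
  also have "\<dots> = (\<Sum>\<mu>\<in>S. lscale ((c(\<kappa> := d)) \<mu>) (E \<mu>))"
    by (subst sum.remove[OF Suc.prems(1) k(1)]) simp
  finally show ?case by blast
qed

text \<open>Starting from an expansion into eigenvectors, subtracting an eigenvalue of one term from
  some \<open>Y_i\<close> removes this term. This stays in W and is repeated until an eigenvector is
  left.\<close>

lemma subrep_eig:
  assumes W: "is_subrep \<phi> n W" and f: "f \<in> W" "f \<noteq> 0" and E: "\<And>\<mu>. \<mu> \<in> weights n \<Longrightarrow> eig \<mu> (E \<mu>)"
  shows "\<exists>\<mu>\<in>weights n. \<exists>g\<in>W. eig \<mu> g"
proof -
  note W' = subrepD[OF W]
  have *: "\<exists>\<mu>\<in>weights n. \<exists>g\<in>W. eig \<mu> g"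
    if "finite M" "M \<subseteq> weights n" "f \<in> W" "f \<noteq> 0" "f = (\<Sum>\<mu>\<in>M. lscale (c \<mu>) (E \<mu>))" for M f c
    using that
  proof (induction "card M" arbitrary: M f c)
    case 0
    then show ?case by simp
  next
    case (Suc m)
    then obtain \<mu> where m: "\<mu> \<in> M" by fastforce
    show ?case
    proof (cases "\<forall>i\<in>{1..n}. YY i f = lscale (yev \<mu> i) f")
      case True
      then have "eig \<mu> f" using Suc.prems W'(2) by (auto simp: eig_def eigw_def)
      then show ?thesis using Suc.prems m by blast
    next
      case False
      then obtain i where i: "i \<in> {1..n}" "YY i f \<noteq> lscale (yev \<mu> i) f" by blast
      let ?g = "YY i f - lscale (yev \<mu> i) f"
      have l: "lin (YY i)" using i by (intro lin_YY) auto
      have Y: "YY i (E \<nu>) = lscale (yev \<nu> i) (E \<nu>)" if "\<nu> \<in> M" for \<nu>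
        using E[of \<nu>] that Suc.prems(2) i by (auto simp: eig_def eigw_def)
      have "?g = (\<Sum>\<nu>\<in>M. lscale (c \<nu> * (yev \<nu> i - yev \<mu> i)) (E \<nu>))"
      proof -
        have "YY i f = (\<Sum>\<nu>\<in>M. lscale (c \<nu> * yev \<nu> i) (E \<nu>))"
          unfolding Suc.prems(5) lin_sum[OF l]
          by (rule sum.cong[OF refl]) (simp only: lin_scale[OF l] Y laurent.scale_scale)
        moreover have "lscale (yev \<mu> i) f = (\<Sum>\<nu>\<in>M. lscale (c \<nu> * yev \<mu> i) (E \<nu>))"
          unfolding Suc.prems(5) laurent.scale_sum_right by (simp only: laurent.scale_scale mult.commute)
        ultimately show ?thesis
          by (simp only: sum_subtractf[symmetric] laurent.scale_left_diff_distrib[symmetric] right_diff_distrib)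
      qed
      also have "\<dots> = (\<Sum>\<nu>\<in>M - {\<mu>}. lscale (c \<nu> * (yev \<nu> i - yev \<mu> i)) (E \<nu>))"
        by (subst sum.remove[OF Suc.prems(1) m]) simp
      finally have g: "?g = \<dots>" .
      have "?g \<in> W" using W'(5)[of i f] Suc.prems(3) i
        by (auto intro!: laurent.subspace_diff[OF W'(1)] laurent.subspace_scale[OF W'(1)])
      moreover have "m = card (M - {\<mu>})" using Suc m by simp
      moreover have "finite (M - {\<mu>})" "M - {\<mu>} \<subseteq> weights n" "?g \<noteq> 0" using Suc.prems(1,2) i(2) by auto
      ultimately show ?thesis using Suc.hyps(1)[of "M - {\<mu>}" ?g, OF _ _ _ _ _ g] by blast
    qed
  qed
  \<comment> \<open>The smallest set that contains the support and is closed downwards, as demanded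
    by \<open>span_eig\<close>.\<close>
  define S where "S = (\<Union>\<kappa>\<in>keys f. insert \<kappa> (lt n \<kappa>))"
  have kw: "keys f \<subseteq> weights n" using f W'(2) LP_iff[of f] by blast
  have "finite (lt n \<kappa>)" for \<kappa> by (rule finite_subset[OF _ finite_below[of n \<kappa>]]) (auto simp: lt_def)
  then have "finite S" by (simp add: S_def)
  moreover have "S \<subseteq> weights n" using kw by (auto simp: S_def lt_def below_def)
  moreover have "\<nu> \<in> S" if s: "\<kappa> \<in> S" "\<nu> \<in> lt n \<kappa>" for \<kappa> \<nu>
  proof -
    obtain \<iota> where i: "\<iota> \<in> keys f" "\<kappa> = \<iota> \<or> \<kappa> \<in> lt n \<iota>" using s(1) by (auto simp: S_def)
    then have "\<nu> \<in> lt n \<iota>" using s(2) lt_trans[OF s(2)] kw by blast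
    then show ?thesis using i(1) by (auto simp: S_def)
  qed
  moreover have "keys f \<subseteq> S" by (auto simp: S_def)
  ultimately obtain c where "f = (\<Sum>\<mu>\<in>S. lscale (c \<mu>) (E \<mu>))" using span_eig[of S f E] E by blast
  from *[OF \<open>finite S\<close> \<open>S \<subseteq> weights n\<close> f this] show ?thesis .
qed

lemma eig_in:
  assumes "eig \<mu> f" "eig \<mu> g" "\<mu> \<in> weights n" "laurent.subspace W" "f \<in> W" shows "g \<in> W"
proof -
  have "lookup f \<mu> \<noteq> 0" using eig_top(1)[OF assms(1,3)] by (simp add: in_keys_iff)
  then have "lscale (1 / lookup f \<mu>) (lscale (lookup f \<mu>) g) = g" by simp
  then have "g = lscale (lookup g \<mu> / lookup f \<mu>) f"
    unfolding eig_unique[OF assms(1-3)] by simp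
  then show ?thesis using laurent.subspace_scale[OF assms(4,5)] by metis
qed

end

section \<open>The smallest nonzero subrepresentation\<close>

context daha_res
begin

context
  fixes E :: "(nat \<Rightarrow>\<^sub>0 int) \<Rightarrow> 'a laurent" and V :: "'a laurent set"
  assumes E: "\<And>\<mu>. \<mu> \<in> weights n \<Longrightarrow> eig \<mu> (E \<mu>)" and mn: "m \<le> n"
    and V: "V = laurent.span {E \<mu> |\<mu>. \<mu> \<in> weights n \<and> n - m \<le> nlev n (2 * k) \<mu>}"
begin

lemma V_eig: assumes "\<mu> \<in> weights n" "n - m \<le> nlev n (2 * k) \<mu>" "eig \<mu> g" shows "g \<in> V"
proof (rule eig_in[OF E[OF assms(1)] assms(3,1)])
  show "E \<mu> \<in> V" unfolding V by (rule laurent.span_base) (use assms in blast)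
qed (simp add: V)

lemma V_lin:
  assumes "lin F" "\<And>\<mu>. \<mu> \<in> weights n \<Longrightarrow> n - m \<le> nlev n (2 * k) \<mu> \<Longrightarrow> \<exists>c. F (E \<mu>) + lscale c (E \<mu>) \<in> V" "f \<in> V"
  shows "F f \<in> V"
  unfolding V
proof (rule span_lin[OF assms(1) _ assms(3)[unfolded V]])
  fix g assume "g \<in> {E \<mu> |\<mu>. \<mu> \<in> weights n \<and> n - m \<le> nlev n (2 * k) \<mu>}"
  then obtain \<mu> where m: "\<mu> \<in> weights n" "n - m \<le> nlev n (2 * k) \<mu>" "g = E \<mu>" by blast
  obtain c where c: "F g + lscale c g \<in> V" using assms(2)[OF m(1,2)] m(3) by blast
  have "g \<in> V" using V_eig[OF m(1,2) E[OF m(1)]] m(3) by simp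
  then have "(F g + lscale c g) - lscale c g \<in> V" using c unfolding V
    by (intro laurent.span_diff laurent.span_scale) 
  then show "F g \<in> laurent.span {E \<mu> |\<mu>. \<mu> \<in> weights n \<and> n - m \<le> nlev n (2 * k) \<mu>}" by (simp add: V)
qed

lemma V_subrep: "is_subrep \<phi> n V"
proof (rule subrepI)
  show sub: "laurent.subspace V" by (simp add: V)
  have z: "0 \<in> V" using sub by (rule laurent.subspace_0)
  have "laurent.subspace LP" by (intro laurent.subspaceI) (auto simp: LP_add LP_scale, simp add: LP_iff)
  moreover have "E \<mu> \<in> LP" if "\<mu> \<in> weights n" for \<mu> using E[OF that] by (auto simp: eig_def eigw_def)
  ultimately show "V \<subseteq> LP" unfolding V by (intro laurent.span_minimal) auto
  show "UU f \<in> V" if "f \<in> V" for f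
  proof (rule V_lin[OF lin_UU _ that])
    fix \<mu> assume m: "\<mu> \<in> weights n" "n - m \<le> nlev n (2 * k) \<mu>"
    have "UU (E \<mu>) + lscale (gU (yev \<mu> 1)) (E \<mu>) \<in> V"
    proof (rule V_eig[OF _ _ eig_affine[OF E[OF m(1)]]])
      show "s0 \<mu> \<in> weights n" using m n2 by (intro s0_weights) auto
      show "n - m \<le> nlev n (2 * k) (s0 \<mu>)" using m(2) nlev_s0[of n k \<mu>] by simp
    qed
    then show "\<exists>c. UU (E \<mu>) + lscale c (E \<mu>) \<in> V" by blast
  qed
  show "YY 1 f \<in> V" if "f \<in> V" for f
  proof (rule V_lin[OF lin_YY _ that])
    fix \<mu> assume m: "\<mu> \<in> weights n"
    have "YY 1 (E \<mu>) + lscale (- yev \<mu> 1) (E \<mu>) = 0" using E[OF m] n2 by (simp add: eig_def eigw_def)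
    then show "\<exists>c. YY 1 (E \<mu>) + lscale c (E \<mu>) \<in> V" using z by metis
  qed (use n2 in simp)
  show "TT j f \<in> V" if j: "1 \<le> j" "j \<le> n" and f: "f \<in> V" for j f
  proof (rule V_lin[OF lin_T[OF j(2)] _ f])
    fix \<mu> assume m: "\<mu> \<in> weights n" "n - m \<le> nlev n (2 * k) \<mu>"
    note e = E[OF m(1)]
    have w: "rv n j \<mu> \<in> weights n" using j n2 m by (intro rv_weights) auto
    \<comment> \<open>The alternative 0 covers equal neighbours, a last entry 0, and the critical
      sign change, which is the only one that could lead out of the set of weights.\<close>
    have "\<exists>c. TT j (E \<mu>) + lscale c (E \<mu>) = 0 \<or> eig (rv n j \<mu>) (TT j (E \<mu>) + lscale c (E \<mu>)) \<and> n - m \<le> nlev n (2 * k) (rv n j \<mu>)"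
    proof (cases "j < n")
      case True
      show ?thesis
      proof (cases "lookup \<mu> j = lookup \<mu> (j + 1)")
        case eq: True
        show ?thesis using eig_swap_fix[OF e m(1) j(1) True eq] by blast
      next
        case False
        have "n - m \<le> nlev n (2 * k) (rv n j \<mu>)" using nlev_swap[OF j(1) True] m(2) by simp
        then show ?thesis using eig_swap[OF e j(1) True False] by blast
      qed
    next
      case False
      then have jn: "j = n" using j by simp
      consider "lookup \<mu> n = 0" | "lookup \<mu> n < 0" | "lookup \<mu> n > 0" "crit (yev \<mu> n)" | "lookup \<mu> n > 0" "\<not> crit (yev \<mu> n)"
        by linarith
      then show ?thesis unfolding jn
      proof cases
        case 1
        show "\<exists>c. TT n (E \<mu>) + lscale c (E \<mu>) = 0 \<or> eig (rv n n \<mu>) (TT n (E \<mu>) + lscale c (E \<mu>)) \<and> n - m \<le> nlev n (2 * k) (rv n n \<mu>)"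
          using eig_flip_fix[OF e m(1) 1] by blast
      next
        case 2
        have "n - m \<le> nlev n (2 * k) (rv n n \<mu>)" using nlev_flip_up[OF n2 2, of "2 * k"] m(2) by linarith
        then show "\<exists>c. TT n (E \<mu>) + lscale c (E \<mu>) = 0 \<or> eig (rv n n \<mu>) (TT n (E \<mu>) + lscale c (E \<mu>)) \<and> n - m \<le> nlev n (2 * k) (rv n n \<mu>)"
          using eig_flip_up[OF e m(1) 2] by blast
      next
        case 3
        show "\<exists>c. TT n (E \<mu>) + lscale c (E \<mu>) = 0 \<or> eig (rv n n \<mu>) (TT n (E \<mu>) + lscale c (E \<mu>)) \<and> n - m \<le> nlev n (2 * k) (rv n n \<mu>)"
          using eig_flip_crit[OF e m(1) 3] by blast
      next
        case 4
        have "n - m \<le> nlev n (2 * k) (rv n n \<mu>)"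
          by (rule nlev_flip[OF n2 4(1) _ m(2)]) (use 4(2) crit_yev[OF 4(1) mn] in simp)
        moreover have "lookup \<mu> n \<noteq> 0" using 4(1) by simp
        ultimately show "\<exists>c. TT n (E \<mu>) + lscale c (E \<mu>) = 0 \<or> eig (rv n n \<mu>) (TT n (E \<mu>) + lscale c (E \<mu>)) \<and> n - m \<le> nlev n (2 * k) (rv n n \<mu>)"
          using eig_flip[OF e _ 4(2)] by blast
      qed
    qed
    then show "\<exists>c. TT j (E \<mu>) + lscale c (E \<mu>) \<in> V" using z V_eig[OF w] by metis
  qed
qed

text \<open>Starting from any eigenvector one can raise all levels and then descend to every weight
  of \<open>V\<close>; only a flip at the critical level with exactly \<open>n - m\<close> entries above the threshold
  is blocked, and a descent to a weight of \<open>V\<close> never uses it.\<close>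

lemma V_least:
  assumes W: "is_subrep \<phi> n W" and ne: "W \<noteq> {0}" shows "V \<subseteq> W"
proof -
  note W' = subrepD[OF W]
  obtain f where "f \<in> W" "f \<noteq> 0" using ne laurent.subspace_0[OF W'(1)] by blast
  then obtain \<mu> where m: "\<mu> \<in> weights n" "\<exists>g\<in>W. eig \<mu> g" using subrep_eig[OF W _ _ E] by blast
  have c: "F f + lscale c f \<in> W" if "f \<in> W" "F f \<in> W" for F c f
    using that by (intro laurent.subspace_add[OF W'(1)] laurent.subspace_scale[OF W'(1)])
  interpret moves n "\<lambda>\<kappa>. \<exists>g\<in>W. eig \<kappa> g" "2 * k" "\<lambda>a l. a < 0 \<or> \<not> (lev a = 2 * k \<and> l = n - m)"
  proof (unfold_locales, goal_cases)
    case (2 \<mu> j)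
    then obtain g where g: "g \<in> W" "eig \<mu> g" by blast
    have "TT j g + lscale (gT j (yev \<mu>)) g \<in> W" using c[of g "TT j"] W'(3)[of j g] g 2 by simp
    then show ?case using eig_swap[OF g(2) 2(3-5)] by blast
  next
    case (3 \<mu>)
    then obtain g where g: "g \<in> W" "eig \<mu> g" by blast
    have "UU g + lscale (gU (yev \<mu> 1)) g \<in> W" using c[of g UU] W'(4)[of g] g by simp
    then show ?case using eig_affine[OF g(2)] by blast
  next
    case (4 \<mu>)
    then obtain g where g: "g \<in> W" "eig \<mu> g" by blast
    have gW: "TT n g + lscale (gN (yev \<mu> n)) g \<in> W" using c[of g "TT n"] W'(3)[of n g] g by simp
    have "eig (rv n n \<mu>) (TT n g + lscale (gN (yev \<mu> n)) g)"
    proof (cases "lookup \<mu> n < 0")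
      case True
      then show ?thesis by (rule eig_flip_up[OF g(2) 4(1)])
    next
      case False
      then have "lookup \<mu> n > 0" using 4(3) by simp
      then have "\<not> crit (yev \<mu> n)" using crit_yev[OF _ mn, of \<mu>] 4(4) False by blast
      then show ?thesis by (rule eig_flip[OF g(2) 4(3)])
    qed
    then show ?case using gW by blast
  qed (rule n2)
  have "E \<kappa> \<in> W" if k: "\<kappa> \<in> weights n" "n - m \<le> nlev n (2 * k) \<kappa>" for \<kappa>
  proof -
    \<comment> \<open>In each coordinate the entry of higher level, so that \<xi> can be reached
      upwards from \<mu> and \<kappa> downwards from \<xi>.\<close>
    define \<xi> where "\<xi> = wt n (\<lambda>p. if lev (lookup \<mu> p) \<le> lev (lookup \<kappa> p) then lookup \<kappa> p else lookup \<mu> p)"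
    have x: "\<xi> \<in> weights n" by (simp add: \<xi>_def wt_weights)
    have l: "lev (lookup \<mu> p) \<le> lev (lookup \<xi> p)" "lev (lookup \<kappa> p) \<le> lev (lookup \<xi> p)" if "p \<in> {1..n}" for p
      using that by (auto simp: \<xi>_def lookup_wt)
    have "\<exists>g\<in>W. eig \<xi> g" by (rule climb[OF _ m x l(1)]) auto
    from descend[of "n - m", OF _ _ x this k(1) l(2) k(2)] obtain g where "g \<in> W" "eig \<kappa> g" by auto
    then show ?thesis using eig_in[OF _ E[OF k(1)] k(1) W'(1)] by blast
  qed
  then show ?thesis unfolding V by (intro laurent.span_minimal W'(1)) auto
qed

lemma V_nonzero: "V \<noteq> {0}"
proof -
  let ?\<mu> = "wt n (\<lambda>_. int k)"
  have "{p\<in>{1..n}. 2 * k \<le> lev (lookup ?\<mu> p)} = {1..n}" by (auto simp: lookup_wt lev_def)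
  then have "n - m \<le> nlev n (2 * k) ?\<mu>" by (simp add: nlev_def)
  from V_eig[OF wt_weights this E[OF wt_weights]] have "E ?\<mu> \<in> V" .
  moreover have "E ?\<mu> \<noteq> 0" using E[OF wt_weights] by (simp add: eig_def)
  ultimately show ?thesis by blast
qed

text \<open>As V is contained in every nonzero subrepresentation, it has no proper nonzero one, and
  any other irreducible one contains V and hence equals it.\<close>

lemma V_irreducible: "is_irreducible_subrep \<phi> n V \<and> (\<forall>W. is_irreducible_subrep \<phi> n W \<longrightarrow> W = V)"
  unfolding is_irreducible_subrep_def using V_subrep V_nonzero V_least by blast

end

end

theorem theorem4p36:
  fixes n i r :: nat
    and s \<beta> :: param_ring
    and \<phi> :: "param_ring \<Rightarrow> 'k::field"
    and V :: "'k laurent set"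
  assumes "n \<ge> 2" and "n \<ge> i" and "i \<ge> 1" and "r \<ge> 2"
    and sign: "\<beta> = par_b_star \<or> \<beta> * par_b_star = 1"
    and "irreducible s"
    and "s dvd half_pow Pt (2 * int (n - i)) * half_pow Pq (2 * int (r - 1)) * par_a_star * \<beta> - 1"
    and "is_residue_field s \<phi>"
  defines "V \<equiv> laurent.span {reduce \<phi> (koornwinder_E n \<mu>) |\<mu>. \<mu> \<in> weights n \<and>
      (Poly_Mapping.lookup (dom_wt n \<mu>) i > int (r - 1) \<or>
       Poly_Mapping.lookup (dom_wt n \<mu>) i = int (r - 1) \<and>
       sigma \<mu> (nat \<bar>w_plus n \<mu> (int i)\<bar>) = 1)}"
  shows "is_irreducible_subrep \<phi> n V \<and> (\<forall>W. is_irreducible_subrep \<phi> n W \<longrightarrow> W = V)"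
proof -
  obtain p0 where "daha_res \<phi> n p0 (r - 1) (n - i)" using residue_daha_res[OF assms(1,2,4-8)] by blast
  then interpret daha_res \<phi> n p0 "r - 1" "n - i" .
  have "V = laurent.span {reduce \<phi> (koornwinder_E n \<mu>) |\<mu>. \<mu> \<in> weights n \<and> n - (n - i) \<le> nlev n (2 * (r - 1)) \<mu>}"
  proof -
    have "n - (n - i) = i" "i \<in> {1..n}" "r \<ge> 1" using assms(2-4) by auto
    note i = this
    have "{reduce \<phi> (koornwinder_E n \<mu>) |\<mu>. \<mu> \<in> weights n \<and> (Poly_Mapping.lookup (dom_wt n \<mu>) i > int (r - 1) \<or>
        Poly_Mapping.lookup (dom_wt n \<mu>) i = int (r - 1) \<and> sigma \<mu> (nat \<bar>w_plus n \<mu> (int i)\<bar>) = 1)}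
      = {reduce \<phi> (koornwinder_E n \<mu>) |\<mu>. \<mu> \<in> weights n \<and> i \<le> nlev n (2 * (r - 1)) \<mu>}"
      by (rule Collect_cong, rule iff_exI, rule conj_cong[OF refl], rule conj_cong[OF refl], rule threshold_iff[OF assms(1) _ i(2,3)])
    then show ?thesis unfolding V_def i(1) by (rule arg_cong)
  qed
  from V_irreducible[OF koornwinder_eig _ this] show ?thesis by simp
qed

end
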